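(* Let $\Omega\subset\widehat{\mathbb{C}}$ be a hyperbolic plane domain, and let $\pi\colon\mathbb{D}\to\Omega$ be a universal covering, with deck transformation group $\Gamma$. Then the following are equivalent. (a) The non-tangential limit set $\Lambda_{NT}=\Lambda_{NT}(\Gamma)$ has zero Lebesgue measure on $\partial\mathbb{D}$. (b) The set $\partial\Omega$ has positive logarithmic capacity. (c) The radial limits of $\pi$ exist Lebesgue almost everywhere on $\partial\mathbb{D}$.
   Context: $\widehat{\mathbb{C}}$ is the Riemann sphere and $\mathbb{D}$ the open unit disk. A hyperbolic plane domain is a connected open subset $\Omega\subset\widehat{\mathbb{C}}$ omitting at least three points. A universal covering $\pi\colon\mathbb{D}\to\Omega$ is a holomorphic universal covering map; $\Gamma$ is the group of $\gamma\in\mathrm{Aut}(\mathbb{D})$ with $\pi\circ\gamma=\pi$. $\Lambda_{NT}(\Gamma)$ is the set of $e^{i\theta}\in\partial\mathbb{D}$ for which there is a sequence $(\gamma_n)_n\subset\Gamma$ with $\gamma_n(0)\to e^{i\theta}$ and all $\gamma_n(0)$ contained in one Stolz angle at $e^{i\theta}$, where a Stolz angle at $e^{i\theta}$ is a set $\{z\in\mathbb{D}:|\arg(1-e^{-i\theta}z)|<\alpha,\ |z-e^{i\theta}|<\rho\}$ with $0<\alpha<\pi/2$, $\rho>0$. The boundary $\partial\Omega$ and its logarithmic capacity (zero or positive) are understood in $\widehat{\mathbb{C}}$ (positivity is Möbius invariant, so one may move a point of $\Omega$ to $\infty$). The radial limit of $\pi$ at $e^{i\theta}$ is $\lim_{r\to1^-}\pi(re^{i\theta})\in\widehat{\mathbb{C}}$.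 *)

theory Defs
  imports "HOL-Complex_Analysis.Complex_Analysis" "HOL-Probability.Probability"
begin

section \<open>The Riemann sphere\<close>

datatype riemann_sphere = Cpx complex | Infty

fun rs_option :: "riemann_sphere \<Rightarrow> complex option" where
  "rs_option (Cpx z) = Some z"
| "rs_option Infty = None"

lemma inj_rs_option: "inj rs_option"
proof (rule injI)
  fix x y assume "rs_option x = rs_option y"
  then show "x = y" by (cases x; cases y) auto
qed

lemma range_rs_option: "range rs_option = UNIV"
proof -
  have "y \<in> range rs_option" for y
    by (cases y) (metis rangeI rs_option.simps)+
  then show ?thesis by blast
qed

instantiation riemann_sphere :: topological_space
begin

definition open_riemann_sphere :: "riemann_sphere set \<Rightarrow> bool" where
  "open_riemann_sphere U \<longleftrightarrow>
     openin (Alexandroff_compactification euclidean) (rs_option ` U)"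

instance
proof
  show "open (UNIV :: riemann_sphere set)"
    unfolding open_riemann_sphere_def range_rs_option
    by (metis UNIV_option_conv openin_topspace topspace_Alexandroff_compactification
        topspace_euclidean)
  show "open (S \<inter> T)" if "open S" "open T" for S T :: "riemann_sphere set"
    using that unfolding open_riemann_sphere_def
    by (simp add: image_Int[OF inj_rs_option] openin_Int)
  show "open (\<Union>K)" if "\<forall>S\<in>K. open S" for K :: "riemann_sphere set set"
    using that unfolding open_riemann_sphere_def image_Union
    by (auto intro!: openin_Union)
qed

end

lemma open_riemann_sphere_iff:
  "open U \<longleftrightarrow> open (Cpx -` U) \<and> (Infty \<in> U \<longrightarrow> compact (- (Cpx -` U)))"
proof -
  have inj: "Some ` A = Some ` B \<longleftrightarrow> A = B" for A B :: "complex set"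
    by (simp add: inj_image_eq_iff)
  have U: "U = (if Infty \<in> U then insert Infty (Cpx ` (Cpx -` U)) else Cpx ` (Cpx -` U))"
  proof (rule set_eqI)
    fix x show "x \<in> U \<longleftrightarrow>
        x \<in> (if Infty \<in> U then insert Infty (Cpx ` (Cpx -` U)) else Cpx ` (Cpx -` U))"
      by (cases x) auto
  qed
  have eq: "rs_option ` U =
      (if Infty \<in> U then insert None (Some ` (Cpx -` U)) else Some ` (Cpx -` U))"
    by (subst U) (simp add: image_image del: image_vimage_eq)
  show ?thesis
  proof (cases "Infty \<in> U")
    case True
    have "insert None (Some ` A) \<noteq> Some ` B" for A B :: "complex set"
      by blast
    moreover have "insert None (Some ` A) = insert None (Some ` B) \<longleftrightarrow> A = B"
      for A B :: "complex set"
    proof -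
      have "None \<notin> Some ` A" "None \<notin> Some ` B" by auto
      then show ?thesis by (metis insert_ident inj)
    qed
    ultimately have "open U \<longleftrightarrow> (\<exists>C. compact C \<and> closed C \<and> Cpx -` U = - C)"
      using True unfolding open_riemann_sphere_def openin_Alexandroff_compactification eq
      by (simp add: Compl_eq_Diff_UNIV)
    also have "\<dots> \<longleftrightarrow> open (Cpx -` U) \<and> compact (- (Cpx -` U))"
      by (auto simp: compact_imp_closed open_closed intro: exI[of _ "- (Cpx -` U)"])
    finally show ?thesis using True by simp
  next
    case False
    then show ?thesis
      unfolding open_riemann_sphere_def eq by simp
  qed
qed

text \<open>
  The two standard charts \<open>w\<close> and \<open>1/w\<close>. The value of the first at \<open>Infty\<close> and of the
  second at \<open>Cpx 0\<close> (where \<open>inverse 0 = 0\<close>) are dummies: each chart is used below only near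
  points where a continuous map avoids the exceptional value.
\<close>

fun chart0 :: "riemann_sphere \<Rightarrow> complex" where
  "chart0 (Cpx w) = w"
| "chart0 Infty = 0"

fun chart1 :: "riemann_sphere \<Rightarrow> complex" where
  "chart1 (Cpx w) = inverse w"
| "chart1 Infty = 0"

text \<open>Meant for open \<open>S\<close>; the source is the plane, so no charts are needed there.\<close>

definition sphere_holomorphic_on :: "(complex \<Rightarrow> riemann_sphere) \<Rightarrow> complex set \<Rightarrow> bool" where
  "sphere_holomorphic_on f S \<longleftrightarrow>
     continuous_on S f \<and>
     (\<forall>z\<in>S. (f z \<noteq> Infty \<longrightarrow> (\<lambda>w. chart0 (f w)) analytic_on {z}) \<and>
             (f z \<noteq> Cpx 0 \<longrightarrow> (\<lambda>w. chart1 (f w)) analytic_on {z}))"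

section \<open>Hyperbolic domains, universal coverings, deck transformations\<close>

definition hyperbolic_domain :: "riemann_sphere set \<Rightarrow> bool" where
  "hyperbolic_domain \<Omega> \<longleftrightarrow>
     open \<Omega> \<and> connected \<Omega> \<and>
     (\<exists>a b c. a \<notin> \<Omega> \<and> b \<notin> \<Omega> \<and> c \<notin> \<Omega> \<and> a \<noteq> b \<and> a \<noteq> c \<and> b \<noteq> c)"

text \<open>The unit disk is simply connected, so every covering by it is universal.\<close>

definition universal_covering :: "(complex \<Rightarrow> riemann_sphere) \<Rightarrow> riemann_sphere set \<Rightarrow> bool" where
  "universal_covering p \<Omega> \<longleftrightarrow>
     sphere_holomorphic_on p (ball 0 1) \<and> covering_space (ball 0 1) p \<Omega>"

text \<open>
  Automorphisms of the disk are represented by functions on the whole plane, whose values outside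
  the disk are irrelevant.
\<close>

definition disk_automorphisms :: "(complex \<Rightarrow> complex) set" where
  "disk_automorphisms =
     {\<gamma>. \<gamma> holomorphic_on ball 0 1 \<and> bij_betw \<gamma> (ball 0 1) (ball 0 1)}"

definition deck_group :: "(complex \<Rightarrow> riemann_sphere) \<Rightarrow> (complex \<Rightarrow> complex) set" where
  "deck_group p = {\<gamma> \<in> disk_automorphisms. \<forall>z\<in>ball 0 1. p (\<gamma> z) = p z}"

section \<open>The non-tangential limit set and Lebesgue measure on the circle\<close>

text \<open>For \<open>\<zeta> = cis \<theta>\<close> on the unit circle, \<open>cnj \<zeta> = cis (- \<theta>)\<close>.\<close>

definition stolz_angle :: "complex \<Rightarrow> real \<Rightarrow> real \<Rightarrow> complex set" where
  "stolz_angle \<zeta> \<alpha> \<rho> = {z \<in> ball 0 1. \<bar>Arg (1 - cnj \<zeta> * z)\<bar> < \<alpha> \<and> cmod (z - \<zeta>) < \<rho>}"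

definition nontangential_limit_set :: "(complex \<Rightarrow> complex) set \<Rightarrow> complex set" where
  "nontangential_limit_set \<Gamma> =
     {\<zeta> \<in> sphere 0 1. \<exists>(\<gamma> :: nat \<Rightarrow> complex \<Rightarrow> complex) \<alpha> \<rho>.
        (\<forall>n. \<gamma> n \<in> \<Gamma>) \<and> (\<lambda>n. \<gamma> n 0) \<longlonglongrightarrow> \<zeta> \<and>
        0 < \<alpha> \<and> \<alpha> < pi / 2 \<and> 0 < \<rho> \<and> (\<forall>n. \<gamma> n 0 \<in> stolz_angle \<zeta> \<alpha> \<rho>)}"

text \<open>Arc length, with total mass \<open>2 * pi\<close>; completed, so that every subset of a null set is null.\<close>

definition circle_lebesgue :: "complex measure" where
  "circle_lebesgue =
     completion (distr (restrict_space lborel {-pi<..pi}) (restrict_space borel (sphere 0 1)) cis)"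

definition has_radial_limit :: "(complex \<Rightarrow> riemann_sphere) \<Rightarrow> complex \<Rightarrow> bool" where
  "has_radial_limit f \<zeta> \<longleftrightarrow> (\<exists>l. ((\<lambda>r. f (of_real r * \<zeta>)) \<longlongrightarrow> l) (at_left (1::real)))"

section \<open>Logarithmic capacity\<close>

text \<open>
  The kernel \<open>log (1 / |z - w|)\<close> is infinite on the diagonal; this has to be said explicitly because
  \<open>ln 0 = 0\<close> for the real logarithm.
\<close>

definition log_kernel :: "complex \<Rightarrow> complex \<Rightarrow> ereal" where
  "log_kernel z w = (if z = w then \<infinity> else ereal (ln (1 / cmod (z - w))))"

text \<open>
  The energy \<open>\<integral>\<integral> log (1 / |z - w|) d\<mu>(z) d\<mu>(w)\<close>, as the difference of the integrals of the positive
  and the negative part of the kernel (\<^const>\<open>e2ennreal\<close> truncates negative values to 0). If \<open>\<mu>\<close> is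
  a probability measure with bounded support, then the second integral is finite.
\<close>

definition log_energy :: "complex measure \<Rightarrow> ereal" where
  "log_energy \<mu> =
     enn2ereal (\<integral>\<^sup>+ z. (\<integral>\<^sup>+ w. e2ennreal (log_kernel z w) \<partial>\<mu>) \<partial>\<mu>) -
     enn2ereal (\<integral>\<^sup>+ z. (\<integral>\<^sup>+ w. e2ennreal (- log_kernel z w) \<partial>\<mu>) \<partial>\<mu>)"

text \<open>Robin's constant \<open>V\<close> of a compact plane set, and its capacity \<open>exp (- V)\<close>, with \<open>exp (- \<infinity>) = 0\<close>.\<close>

definition robin_constant :: "complex set \<Rightarrow> ereal" where
  "robin_constant K =
     (INF \<mu> \<in> {\<mu>. prob_space \<mu> \<and> sets \<mu> = sets borel \<and> emeasure \<mu> K = 1}. log_energy \<mu>)"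

definition log_capacity :: "complex set \<Rightarrow> real" where
  "log_capacity K =
     (if robin_constant K = \<infinity> then 0 else exp (- real_of_ereal (robin_constant K)))"

text \<open>A Moebius transformation moving the point \<open>a\<close> to infinity.\<close>

fun send_to_infinity :: "riemann_sphere \<Rightarrow> riemann_sphere \<Rightarrow> riemann_sphere" where
  "send_to_infinity Infty x = x"
| "send_to_infinity (Cpx a) Infty = Cpx 0"
| "send_to_infinity (Cpx a) (Cpx w) = (if w = a then Infty else Cpx (1 / (w - a)))"

text \<open>
  For a closed proper subset \<open>E\<close> of the sphere: move a point outside \<open>E\<close> to infinity, so that \<open>E\<close>
  becomes a compact plane set. By Moebius invariance the choice of the point does not matter.
\<close>

definition positive_log_capacity :: "riemann_sphere set \<Rightarrow> bool" where
  "positive_log_capacity E \<longleftrightarrow>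
     (\<exists>a. a \<notin> E \<and> log_capacity (Cpx -` (send_to_infinity a ` E)) > 0)"

end

theory Submission
  imports Defs "HOL-Real_Asymp.Real_Asymp"
begin

text \<open>
  The three conditions are linked through a fourth one, the Blaschke condition
  \<open>\<Sum>(1 - |b|) < \<infinity>\<close> for a fibre \<open>{b. p b = a}\<close> of the covering. It says that the Green function
  of \<open>\<Omega>\<close> with pole \<open>a\<close>, which lifts to \<open>\<Sum> log (1 / d(z, b))\<close> with the pseudo-hyperbolic distance \<open>d\<close>,
  is finite. The cycle of implications is
  positive capacity \<open>\<Longrightarrow>\<close> radial limits \<open>\<Longrightarrow>\<close> null limit set \<open>\<Longrightarrow>\<close> Blaschke condition \<open>\<Longrightarrow>\<close> positive capacity.

  From capacity to radial limits (\<open>capacity_imp_radial_limits\<close>). Move a point off the boundary to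
  infinity. If it lies outside \<open>\<Omega>\<close>, then \<open>p\<close> is a bounded function, and Fatou's theorem applies. If
  it lies in \<open>\<Omega>\<close>, then a measure of finite energy on \<open>\<partial>\<Omega>\<close>, restricted to a set on which its
  potential is bounded, has a potential bounded above off \<open>\<partial>\<Omega>\<close>. Composed with \<open>p\<close> this is a harmonic
  function with value \<open>-\<infinity>\<close> at the poles of \<open>p\<close>, and the maximum principle compares it with the sums
  of Green functions of the disk at finitely many of these poles (\<open>capacity_imp_Blaschke\<close>). Given
  the Blaschke condition for the poles, let \<open>B\<close> be their Blaschke product. The modulus of \<open>B\<close> is
  invariant under deck transformations, and therefore \<open>H = p B\<close> is bounded: where \<open>p\<close> is large, a
  deck transformation moves the point near one fixed pole. So \<open>p = H / B\<close> is a quotient of bounded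
  functions (\<open>quotient_representation\<close>), and \<open>H - w B\<close> is zero-free for \<open>w\<close> outside \<open>\<Omega>\<close>. Fatou's
  theorem for \<open>B\<close> and \<open>H - w B\<close>, together with the fact that the latter has non-zero limits almost
  everywhere, gives the radial limits of \<open>1 / (p - w)\<close> (\<open>Blaschke_imp_radial_limits\<close>).

  From radial limits to a null limit set (\<open>nontangential_no_radial_limit\<close>). A radial limit of a
  covering never lies in \<open>\<Omega>\<close>. At a point of the non-tangential limit set, however, the radius comes
  back infinitely often to within bounded hyperbolic distance of the orbit of 0, and so a radial limit
  would be attained by \<open>p\<close> on a compact part of the disk.

  From a null limit set to the Blaschke condition (\<open>null_nontangential_imp_Blaschke\<close>). The shadows
  on the circle of the orbit points near the circle form an open set that misses a set of positive
  measure. Its harmonic measure \<open>h\<close> is bounded below near the orbit, but not in the whole disk.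
  A truncated Green sum over finitely many orbit points with supremum \<open>M\<close> is at most \<open>M min(1, h / \<delta>)\<close>.
  Its average over a suitable circle is thus smaller than \<open>M\<close> by a fixed proportion, and since every
  orbit point can be moved to 0 by the group, this bounds \<open>M\<close> independently of the finite set
  (\<open>Green_sum_bounded\<close>).

  From the Blaschke condition to capacity (\<open>Blaschke_imp_capacity\<close>). Normalize \<open>p 0 = \<infinity>\<close>, and let
  \<open>\<mu>\<close> be the distribution of the radial limits of \<open>p = H / B\<close> under normalized arc length, that is, harmonic
  measure. For \<open>w \<in> \<partial>\<Omega>\<close> the mean value of \<open>ln |H - w B|\<close> bounds the potential of \<open>\<mu>\<close> at \<open>w\<close> by a constant
  minus \<open>ln |H 0|\<close>, uniformly in \<open>w\<close>. So \<open>\<mu>\<close> has finite energy.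

  Fatou's theorem is proved by a weak-type inequality for the radial maximal function and the
  convergence in mean square of dilations.
\<close>

section \<open>Means over circles and the maximum principle\<close>

text \<open>Normalized arc length: the circle is parametrized by \<open>cis\<close> on
  \<open>{-pi..pi}\<close>, and the doubly covered point \<open>-1\<close> is null.\<close>

definition circ :: "real measure" where
  "circ = density lborel (\<lambda>t. ennreal (indicator {-pi..pi} t / (2 * pi)))"

lemma sets_circ [measurable_cong, simp]: "sets circ = sets borel"
  by (simp add: circ_def)

lemma space_circ [simp]: "space circ = UNIV"
  by (simp add: circ_def)

lemma nn_integral_circ:
  assumes [measurable]: "f \<in> borel_measurable borel"
  shows "(\<integral>\<^sup>+t. f t \<partial>circ) = ennreal (1 / (2 * pi)) * (\<integral>\<^sup>+t. f t * indicator {-pi..pi} t \<partial>lborel)"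
proof -
  have "(\<integral>\<^sup>+t. f t \<partial>circ) = (\<integral>\<^sup>+t. ennreal (1 / (2 * pi)) * (f t * indicator {-pi..pi} t) \<partial>lborel)"
    unfolding circ_def
    by (subst nn_integral_density) (auto intro!: nn_integral_cong simp: indicator_def)
  also have "\<dots> = ennreal (1 / (2 * pi)) * (\<integral>\<^sup>+t. f t * indicator {-pi..pi} t \<partial>lborel)"
    by (rule nn_integral_cmult) simp
  finally show ?thesis .
qed

lemma AE_circ: "(AE t in circ. P t) \<longleftrightarrow> (AE t in lborel. t \<in> {-pi..pi} \<longrightarrow> P t)"
  unfolding circ_def by (subst AE_density) (auto simp: indicator_def)

lemma emeasure_circ:
  assumes "A \<in> sets borel"
  shows "emeasure circ A = ennreal (1 / (2 * pi)) * emeasure lborel (A \<inter> {-pi..pi})"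
proof -
  have "emeasure circ A = (\<integral>\<^sup>+t. indicator A t \<partial>circ)"
    using assms by simp
  also have "\<dots> = ennreal (1 / (2 * pi)) * (\<integral>\<^sup>+t. indicator (A \<inter> {-pi..pi}) t \<partial>lborel)"
    using assms by (subst nn_integral_circ) (auto simp: indicator_inter_arith[symmetric])
  also have "(\<integral>\<^sup>+t. indicator (A \<inter> {-pi..pi}) t \<partial>lborel) = emeasure lborel (A \<inter> {-pi..pi})"
    using assms by (intro nn_integral_indicator) auto
  finally show ?thesis .
qed

lemma prob_space_circ: "prob_space circ"
proof
  have "emeasure circ (space circ) = ennreal (1 / (2 * pi)) * ennreal (2 * pi)"
    by (subst emeasure_circ) auto
  also have "\<dots> = 1"
    by (subst ennreal_mult[symmetric]) auto
  finally show "emeasure circ (space circ) = 1" .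
qed

interpretation circ: prob_space circ
  by (rule prob_space_circ)

lemma integral_circ:
  fixes f :: "real \<Rightarrow> 'a::euclidean_space"
  assumes "continuous_on {-pi..pi} f" and [measurable]: "f \<in> borel_measurable borel"
  shows "(LINT t|circ. f t) = (1 / (2 * pi)) *\<^sub>R integral {-pi..pi} f"
proof -
  have "(LINT t|circ. f t) = (LINT t|lborel. (indicator {-pi..pi} t / (2 * pi)) *\<^sub>R f t)"
    unfolding circ_def by (subst integral_density) auto
  also have "\<dots> = (LINT t|lborel. (1 / (2 * pi)) *\<^sub>R (indicator {-pi..pi} t *\<^sub>R f t))"
    by (intro Bochner_Integration.integral_cong) auto
  also have "\<dots> = (1 / (2 * pi)) *\<^sub>R (LINT t:{-pi..pi}|lborel. f t)"
    using borel_integrable_compact[of "{-pi..pi}" f] assms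
    unfolding set_lebesgue_integral_def by (intro integral_scaleR_right)
  also have "(LINT t:{-pi..pi}|lborel. f t) = integral {-pi..pi} f"
    using borel_integrable_compact[of "{-pi..pi}" f] assms
    by (intro set_borel_integral_eq_integral) (auto simp: set_integrable_def)
  finally show ?thesis .
qed

lemma borel_measurable_cont [intro]:
  "continuous_on UNIV f \<Longrightarrow> f \<in> borel_measurable borel" for f :: "'a::topological_space \<Rightarrow> 'b::topological_space"
  by (rule borel_measurable_continuous_onI)

lemma integrable_circ_bounded:
  fixes f :: "real \<Rightarrow> 'a::{banach,second_countable_topology}"
  assumes "f \<in> borel_measurable borel" "\<And>t. t \<in> {-pi..pi} \<Longrightarrow> norm (f t) \<le> B"
  shows "integrable circ f"
  by (rule circ.integrable_const_bound[of _ B]) (use assms in \<open>auto simp: AE_circ\<close>)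

lemma integrable_circ_cont:
  fixes f :: "real \<Rightarrow> 'a::{banach,second_countable_topology}"
  assumes "continuous_on UNIV f"
  shows "integrable circ f"
proof -
  have "compact (f ` {-pi..pi})"
    by (intro compact_continuous_image continuous_on_subset[OF assms]) auto
  then obtain B where "\<And>t. t \<in> {-pi..pi} \<Longrightarrow> norm (f t) \<le> B"
    using compact_imp_bounded bounded_iff by (metis imageI)
  then show ?thesis
    using assms by (intro integrable_circ_bounded[of f B]) auto
qed

lemma continuous_on_circle [continuous_intros]:
  assumes "continuous_on (sphere z s) f" "s \<ge> 0"
  shows "continuous_on A (\<lambda>t. f (z + of_real s * cis t))"
  by (rule continuous_on_compose2[OF assms(1)])
     (use assms(2) in \<open>auto intro!: continuous_intros simp: dist_norm norm_mult\<close>)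

lemma integral_period_shift:
  fixes F :: "real \<Rightarrow> 'a::euclidean_space"
  assumes F: "continuous_on UNIV F" and per: "\<And>t. F (t + 2 * pi) = F t"
  shows "integral {-pi..pi} F = integral {0..2 * pi} F"
proof -
  have int: "F integrable_on {a..b}" for a b
    by (intro integrable_continuous_interval continuous_on_subset[OF F]) auto
  have "(F \<circ> (+) (2 * pi)) = F"
    using per by (auto simp: fun_eq_iff add.commute)
  then have "(F has_integral integral {-pi..0} F) {-pi + 2 * pi..0 + 2 * pi}"
    using has_integral_shift_Icc_real[of F "2 * pi" "integral {-pi..0} F" "-pi" 0] int[of "-pi" 0]
    by (simp add: integrable_integral)
  then have "integral {pi..2 * pi} F = integral {-pi..0} F"
    by (simp add: integral_unique)
  then show ?thesis
    using Henstock_Kurzweil_Integration.integral_combine[of "-pi" 0 pi F]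
      Henstock_Kurzweil_Integration.integral_combine[of 0 pi "2 * pi" F] int by (simp add: add.commute)
qed

text \<open>On \<open>circlepath z s\<close> the differential \<open>dw\<close> is
  \<open>2 pi i s cis t\<close> times normalized arc length.\<close>

lemma contour_integral_circ:
  assumes f: "continuous_on (sphere z s) f" and s: "s > 0"
    and I: "(f has_contour_integral I) (circlepath z s)"
  shows "I = 2 * pi * \<i> * of_real s * (LINT t|circ. f (z + of_real s * cis t) * cis t)"
proof -
  define F where "F t = f (z + of_real s * cis t) * of_real s * \<i> * cis t" for t
  define G where "G t = f (z + of_real s * cis t) * cis t" for t
  have contG: "continuous_on UNIV G"
    unfolding G_def using s by (intro continuous_intros f) auto
  have FG: "F = (\<lambda>t. (of_real s * \<i>) * G t)"
    by (auto simp: F_def G_def fun_eq_iff)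
  have contF: "continuous_on UNIV F"
    unfolding FG by (intro continuous_intros contG)
  have cis_per: "cis (t + 2 * pi) = cis t" for t
    by (simp flip: cis_mult)
  have "(F has_integral I) {0..2 * pi}"
    using I unfolding circlepath_def F_def
    by (subst (asm) has_contour_integral_part_circlepath_iff) auto
  then have "I = integral {0..2 * pi} F"
    by (simp add: integral_unique)
  also have "\<dots> = integral {-pi..pi} F"
    by (rule integral_period_shift[symmetric, OF contF]) (simp add: F_def cis_per)
  also have "\<dots> = (of_real s * \<i>) * integral {-pi..pi} G"
    unfolding FG by simp
  also have "integral {-pi..pi} G = 2 * pi * (LINT t|circ. G t)"
    using integral_circ[OF continuous_on_subset[OF contG] borel_measurable_cont[OF contG]]
    by (simp add: scaleR_conv_of_real)
  finally show ?thesis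
    by (simp add: G_def)
qed

lemma Cauchy_circ:
  assumes "continuous_on (cball z s) f" "f holomorphic_on ball z s" "norm (w - z) < s"
  shows "f w = (LINT t|circ. f (z + of_real s * cis t) * (of_real s * cis t / (z + of_real s * cis t - w)))"
proof -
  have s: "s > 0"
    using assms(3) norm_ge_zero[of "w - z"] by linarith
  have ne: "u \<noteq> w" if "u \<in> sphere z s" for u
    using that assms(3) by (auto simp: dist_norm norm_minus_commute)
  have "continuous_on (sphere z s) (\<lambda>u. f u / (u - w))"
    using ne by (intro continuous_intros continuous_on_subset[OF assms(1)]) auto
  from contour_integral_circ[OF this s Cauchy_integral_circlepath[OF assms]]
  have "2 * pi * \<i> * f w = 2 * pi * \<i> * (of_real s * (LINT t|circ. f (z + of_real s * cis t) / (z + of_real s * cis t - w) * cis t))"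
    by (simp add: mult_ac)
  then have "f w = of_real s * (LINT t|circ. f (z + of_real s * cis t) / (z + of_real s * cis t - w) * cis t)"
    by simp
  also have "\<dots> = (LINT t|circ. of_real s * (f (z + of_real s * cis t) / (z + of_real s * cis t - w) * cis t))"
    by (rule integral_mult_right_zero[symmetric])
  finally show ?thesis
    by (simp add: mult_ac)
qed

lemma mean_value_holomorphic:
  assumes "continuous_on (cball z s) f" "f holomorphic_on ball z s" "s > 0"
  shows "(LINT t|circ. f (z + of_real s * cis t)) = f z"
  using Cauchy_circ[OF assms(1,2), of z] assms(3) by simp

lemma mean_value_Re:
  assumes "continuous_on (cball z s) f" "f holomorphic_on ball z s" "s > 0"
  shows "(LINT t|circ. Re (f (z + of_real s * cis t))) = Re (f z)"
proof -
  have "continuous_on UNIV (\<lambda>t. f (z + of_real s * cis t))"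
    using assms by (intro continuous_intros continuous_on_subset[OF assms(1)]) auto
  then show ?thesis
    using mean_value_holomorphic[OF assms] integral_Re[OF integrable_circ_cont] by metis
qed

definition poisson :: "complex \<Rightarrow> real \<Rightarrow> real" where
  "poisson z t = (1 - (cmod z)\<^sup>2) / (cmod (cis t - z))\<^sup>2"

lemma cis_minus_nonzero: "cmod z < 1 \<Longrightarrow> cis t - z \<noteq> 0"
  by (metis less_irrefl norm_cis right_minus_eq)

lemma poisson_pos: "cmod z < 1 \<Longrightarrow> poisson z t > 0"
  using cis_minus_nonzero[of z t] by (auto simp: poisson_def power_less_one_iff abs_square_less_1)

lemma poisson_Re:
  assumes "cmod z < 1"
  shows "poisson z t = Re ((cis t + z) / (cis t - z))"
proof -
  have "(cmod (cis t - z))\<^sup>2 = (cos t - Re z)\<^sup>2 + (sin t - Im z)\<^sup>2"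
    by (simp add: cmod_power2)
  moreover have "(cos t)\<^sup>2 = 1 - (sin t)\<^sup>2"
    by (simp add: cos_squared_eq)
  moreover have "Re ((cis t + z) * cnj (cis t - z)) = (cos t)\<^sup>2 + (sin t)\<^sup>2 - (cmod z)\<^sup>2"
    unfolding cmod_power2 by (simp add: algebra_simps power2_eq_square)
  ultimately show ?thesis
    unfolding poisson_def Re_complex_div_eq_0 complex_div_cnj[of "cis t + z"]
    by (simp add: Re_divide_of_real flip: of_real_power)
qed

lemma poisson_le: 
  assumes "cmod z < 1"
  shows "poisson z t \<le> (1 + cmod z) / (1 - cmod z)"
proof -
  have "1 - cmod z \<le> cmod (cis t - z)"
    using norm_triangle_ineq2[of "cis t" z] by simp
  then have "(1 - cmod z)\<^sup>2 \<le> (cmod (cis t - z))\<^sup>2"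
    using assms by (intro power_mono) auto
  then have "poisson z t \<le> (1 - (cmod z)\<^sup>2) / (1 - cmod z)\<^sup>2"
    unfolding poisson_def using assms
    by (intro divide_left_mono mult_pos_pos zero_less_power) (auto simp: power_le_one cis_minus_nonzero)
  also have "1 - (cmod z)\<^sup>2 = (1 + cmod z) * (1 - cmod z)"
    by algebra
  also have "\<dots> / (1 - cmod z)\<^sup>2 = (1 + cmod z) / (1 - cmod z)"
    using assms by (simp add: power2_eq_square)
  finally show ?thesis .
qed

lemma poisson_ge: 
  assumes "cmod z < 1"
  shows "(1 - cmod z) / (1 + cmod z) \<le> poisson z t"
proof -
  have "cmod (cis t - z) \<le> 1 + cmod z"
    using norm_triangle_ineq4[of "cis t" z] by simp
  then have "(cmod (cis t - z))\<^sup>2 \<le> (1 + cmod z)\<^sup>2"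
    using assms by (intro power_mono) auto
  then have "(1 - (cmod z)\<^sup>2) / (1 + cmod z)\<^sup>2 \<le> poisson z t"
    unfolding poisson_def using assms
    by (intro divide_left_mono mult_pos_pos zero_less_power) (auto simp: power_le_one cis_minus_nonzero add_pos_nonneg)
  moreover have "(1 - (cmod z)\<^sup>2) / (1 + cmod z)\<^sup>2 = (1 - cmod z) / (1 + cmod z)"
  proof -
    have "1 + cmod z > 0" by (simp add: add_pos_nonneg)
    moreover have "1 - (cmod z)\<^sup>2 = (1 - cmod z) * (1 + cmod z)"
      by algebra
    ultimately show ?thesis by (simp add: power2_eq_square)
  qed
  ultimately show ?thesis by simp
qed

lemma continuous_on_poisson_gen:
  assumes "continuous_on S f" "continuous_on S g" "\<And>x. x \<in> S \<Longrightarrow> cmod (f x) < 1"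
  shows "continuous_on S (\<lambda>x. poisson (f x) (g x))"
  unfolding poisson_def using assms cis_minus_nonzero[OF assms(3)]
  by (intro continuous_intros) auto

text \<open>To the Cauchy formula at \<open>z\<close> add the mean of the function
  \<open>f u * cnj z u / (1 - cnj z u)\<close>, which is holomorphic in the disk and vanishes at 0;
  the sum of the two kernels is the Poisson kernel.\<close>

lemma poisson_integral:
  assumes f: "continuous_on (cball 0 1) f" "f holomorphic_on ball 0 1" and z: "cmod z < 1"
  shows "f z = (LINT t|circ. poisson z t *\<^sub>R f (cis t))"
proof -
  define g where "g u = f u * (cnj z * u / (1 - cnj z * u))" for u
  have ne: "1 - cnj z * u \<noteq> 0" if "u \<in> cball 0 1" for u
  proof
    assume "1 - cnj z * u = 0"
    then have "cmod (cnj z * u) = 1" by simp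
    then have "cmod z * cmod u = 1" by (simp add: norm_mult)
    moreover have "cmod z * cmod u \<le> cmod z * 1"
      using that by (intro mult_left_mono) auto
    ultimately show False using z by simp
  qed
  have contf: "continuous_on UNIV (\<lambda>t. f (cis t))"
    by (rule continuous_on_compose2[OF f(1)]) (auto intro!: continuous_intros)
  have contg: "continuous_on UNIV (\<lambda>t. g (cis t))"
    unfolding g_def using ne by (intro continuous_intros contf) auto
  have "(LINT t|circ. g (0 + of_real 1 * cis t)) = g 0"
    using ne unfolding g_def
    by (intro mean_value_holomorphic continuous_intros holomorphic_intros f) (auto simp: subset_iff)
  then have g0: "(LINT t|circ. g (cis t)) = 0"
    by (simp add: g_def)
  have "f z = (LINT t|circ. f (cis t) * (cis t / (cis t - z)))"
    using Cauchy_circ[OF f, of z] z by simp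
  also have "\<dots> = (LINT t|circ. f (cis t) * (cis t / (cis t - z))) + (LINT t|circ. g (cis t))"
    using g0 by simp
  also have "\<dots> = (LINT t|circ. f (cis t) * (cis t / (cis t - z)) + g (cis t))"
    using cis_minus_nonzero[OF z]
    by (intro Bochner_Integration.integral_add[symmetric] integrable_circ_cont continuous_intros contf contg) auto
  also have "\<dots> = (LINT t|circ. poisson z t *\<^sub>R f (cis t))"
  proof (intro Bochner_Integration.integral_cong refl)
    fix t
    have n1: "cis t - z \<noteq> 0" by (rule cis_minus_nonzero[OF z])
    have n2: "1 - cnj z * cis t \<noteq> 0" by (rule ne) simp
    have e1: "1 - cnj z * cis t = cis t * cnj (cis t - z)"
      by (simp add: algebra_simps cis_cnj cis_mult)
    have "of_real ((cmod (cis t - z))\<^sup>2) = (cis t - z) * cnj (cis t - z)"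
      by (rule complex_norm_square)
    moreover have "of_real ((cmod z)\<^sup>2) = z * cnj z"
      by (rule complex_norm_square)
    ultimately have p: "of_real (poisson z t) = (1 - z * cnj z) / ((cis t - z) * cnj (cis t - z))"
      by (simp add: poisson_def)
    have n3: "cnj (cis t - z) \<noteq> 0" using n1 by (metis complex_cnj_zero_iff)
    have "cis t / (cis t - z) + cnj z * cis t / (1 - cnj z * cis t)
        = cis t / (cis t - z) + cnj z / cnj (cis t - z)"
      unfolding e1 by simp
    also have "\<dots> = (cis t * cnj (cis t - z) + cnj z * (cis t - z)) / ((cis t - z) * cnj (cis t - z))"
      using n1 n3 by (simp add: add_frac_eq)
    also have "cis t * cnj (cis t - z) + cnj z * (cis t - z) = 1 - z * cnj z"
      by (simp add: algebra_simps cis_cnj cis_mult)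
    finally have "cis t / (cis t - z) + cnj z * cis t / (1 - cnj z * cis t) = of_real (poisson z t)"
      using p by simp
    then show "f (cis t) * (cis t / (cis t - z)) + g (cis t) = poisson z t *\<^sub>R f (cis t)"
      unfolding g_def by (metis distrib_left mult.commute scaleR_conv_of_real)
  qed
  finally show ?thesis .
qed

lemma integrable_poisson:
  assumes "cmod z < 1" "continuous_on UNIV f"
  shows "integrable circ (\<lambda>t. poisson z t * f t)"
  using assms by (intro integrable_circ_cont continuous_intros continuous_on_poisson_gen) auto

lemma integral_poisson: "cmod z < 1 \<Longrightarrow> (LINT t|circ. poisson z t) = 1"
proof -
  assume z: "cmod z < 1"
  have "1 = (LINT t|circ. poisson z t *\<^sub>R (1::complex))"
    using z by (intro poisson_integral[of "\<lambda>_. 1"]) auto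
  also have "\<dots> = (LINT t|circ. complex_of_real (poisson z t))"
    by (simp add: scaleR_conv_of_real)
  also have "\<dots> = of_real (LINT t|circ. poisson z t)"
    using integrable_poisson[OF z, of "\<lambda>_. 1"] by simp
  finally show ?thesis by (metis of_real_eq_1_iff)
qed

text \<open>Harmonicity is used only through the mean value property on small circles, which suffices for the
  maximum principle.\<close>

definition harm_on :: "complex set \<Rightarrow> (complex \<Rightarrow> real) \<Rightarrow> bool" where
  "harm_on U u \<longleftrightarrow> continuous_on U u \<and>
     (\<forall>z\<in>U. \<exists>e>0. \<forall>s. 0 < s \<and> s < e \<longrightarrow> cball z s \<subseteq> U \<and> (LINT t|circ. u (z + of_real s * cis t)) = u z)"

lemma harm_on_add:
  assumes "harm_on U u" "harm_on U v"
  shows "harm_on U (\<lambda>z. u z + v z)"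
  unfolding harm_on_def
proof (intro conjI ballI)
  show "continuous_on U (\<lambda>z. u z + v z)"
    using assms by (auto simp: harm_on_def intro!: continuous_intros)
  fix z assume z: "z \<in> U"
  from assms(1) z obtain e1 where e1: "e1 > 0" "\<And>s. 0 < s \<Longrightarrow> s < e1 \<Longrightarrow> cball z s \<subseteq> U \<and> (LINT t|circ. u (z + of_real s * cis t)) = u z"
    unfolding harm_on_def by meson
  from assms(2) z obtain e2 where e2: "e2 > 0" "\<And>s. 0 < s \<Longrightarrow> s < e2 \<Longrightarrow> cball z s \<subseteq> U \<and> (LINT t|circ. v (z + of_real s * cis t)) = v z"
    unfolding harm_on_def by meson
  show "\<exists>e>0. \<forall>s. 0 < s \<and> s < e \<longrightarrow> cball z s \<subseteq> U \<and> (LINT t|circ. u (z + of_real s * cis t) + v (z + of_real s * cis t)) = u z + v z"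
  proof (intro exI[of _ "min e1 e2"] conjI allI impI)
    fix s assume s: "0 < s \<and> s < min e1 e2"
    then show sub: "cball z s \<subseteq> U" using e1 by auto
    then have "sphere z s \<subseteq> U" by auto
    then have "integrable circ (\<lambda>t. u (z + of_real s * cis t))" "integrable circ (\<lambda>t. v (z + of_real s * cis t))"
      using assms s unfolding harm_on_def
      by (auto intro!: integrable_circ_cont continuous_on_circle intro: continuous_on_subset)
    then show "(LINT t|circ. u (z + of_real s * cis t) + v (z + of_real s * cis t)) = u z + v z"
      using e1(2)[of s] e2(2)[of s] s by simp
  qed (use e1 e2 in auto)
qed

lemma harm_on_cmult:
  assumes "harm_on U u"
  shows "harm_on U (\<lambda>z. c * u z)"
  unfolding harm_on_def
proof (intro conjI ballI)
  show "continuous_on U (\<lambda>z. c * u z)"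
    using assms by (auto simp: harm_on_def intro!: continuous_intros)
  fix z assume "z \<in> U"
  then obtain e where "e > 0" "\<And>s. 0 < s \<and> s < e \<Longrightarrow> cball z s \<subseteq> U \<and> (LINT t|circ. u (z + of_real s * cis t)) = u z"
    using assms unfolding harm_on_def by meson
  then show "\<exists>e>0. \<forall>s. 0 < s \<and> s < e \<longrightarrow> cball z s \<subseteq> U \<and> (LINT t|circ. c * u (z + of_real s * cis t)) = c * u z"
    by (intro exI[of _ e]) auto
qed

lemma harm_on_const:
  assumes "open U"
  shows "harm_on U (\<lambda>z. c)"
  unfolding harm_on_def
proof (intro conjI ballI)
  fix z assume "z \<in> U"
  then obtain e where "e > 0" "cball z e \<subseteq> U"
    using assms open_contains_cball by blast
  then show "\<exists>e>0. \<forall>s. 0 < s \<and> s < e \<longrightarrow> cball z s \<subseteq> U \<and> (LINT t|circ. c) = c"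
    by (intro exI[of _ e]) (auto simp: circ.prob_space[simplified])
qed auto

lemma harm_on_sum:
  assumes "open U" "\<And>i. i \<in> F \<Longrightarrow> harm_on U (u i)"
  shows "harm_on U (\<lambda>z. \<Sum>i\<in>F. u i z)"
  using assms(2)
  by (induction F rule: infinite_finite_induct) (auto intro: harm_on_add harm_on_const assms(1))

lemma harm_on_subset:
  assumes "harm_on U u" "open V" "V \<subseteq> U"
  shows "harm_on V u"
  unfolding harm_on_def
proof (intro conjI ballI)
  show "continuous_on V u" using assms by (auto simp: harm_on_def intro: continuous_on_subset)
  fix z assume z: "z \<in> V"
  then obtain d where d: "d > 0" "cball z d \<subseteq> V"
    using assms open_contains_cball by blast
  from assms z obtain e where e: "e > 0" "\<And>s. 0 < s \<Longrightarrow> s < e \<Longrightarrow> (LINT t|circ. u (z + of_real s * cis t)) = u z"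
    unfolding harm_on_def by (meson subsetD)
  show "\<exists>e>0. \<forall>s. 0 < s \<and> s < e \<longrightarrow> cball z s \<subseteq> V \<and> (LINT t|circ. u (z + of_real s * cis t)) = u z"
    using d e by (intro exI[of _ "min d e"]) auto
qed

lemma mean_value_ln_norm:
  assumes "f holomorphic_on ball z R" "\<And>w. w \<in> ball z R \<Longrightarrow> f w \<noteq> 0" "0 < s" "s < R"
  shows "(LINT t|circ. ln (cmod (f (z + of_real s * cis t)))) = ln (cmod (f z))"
proof -
  have ci: "contractible (ball z R)" by (intro convex_imp_contractible convex_ball)
  obtain g where g: "g holomorphic_on ball z R" "\<And>w. w \<in> ball z R \<Longrightarrow> f w = exp (g w)"
    using contractible_imp_holomorphic_log[OF assms(1) ci assms(2)] by metis
  have Re: "ln (cmod (f w)) = Re (g w)" if "w \<in> ball z R" for w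
    using g(2)[OF that] by simp
  have in_ball: "z + of_real s * cis t \<in> ball z R" for t
    using assms by (simp add: dist_norm norm_mult)
  have "(LINT t|circ. ln (cmod (f (z + of_real s * cis t)))) = (LINT t|circ. Re (g (z + of_real s * cis t)))"
    by (intro Bochner_Integration.integral_cong refl Re in_ball)
  also have "\<dots> = Re (g z)"
    using assms by (intro mean_value_Re continuous_on_subset[OF holomorphic_on_imp_continuous_on[OF g(1)]]
      holomorphic_on_subset[OF g(1)]) auto
  also have "\<dots> = ln (cmod (f z))"
    using assms by (intro Re[symmetric]) auto
  finally show ?thesis .
qed

lemma harm_on_ln_norm:
  assumes "f holomorphic_on U" "open U" "\<And>w. w \<in> U \<Longrightarrow> f w \<noteq> 0"
  shows "harm_on U (\<lambda>z. ln (cmod (f z)))"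
  unfolding harm_on_def
proof (intro conjI ballI)
  show "continuous_on U (\<lambda>z. ln (cmod (f z)))"
    using assms by (intro continuous_intros holomorphic_on_imp_continuous_on) auto
  fix z assume "z \<in> U"
  then obtain e where e: "e > 0" "cball z e \<subseteq> U"
    using assms open_contains_cball by blast
  have "(LINT t|circ. ln (cmod (f (z + of_real s * cis t)))) = ln (cmod (f z))" if "0 < s" "s < e" for s
    using that e by (intro mean_value_ln_norm[of f z e] holomorphic_on_subset[OF assms(1)] assms(3)) auto
  then show "\<exists>e>0. \<forall>s. 0 < s \<and> s < e \<longrightarrow> cball z s \<subseteq> U \<and> (LINT t|circ. ln (cmod (f (z + of_real s * cis t)))) = ln (cmod (f z))"
    using e by (intro exI[of _ e]) auto
qed

lemma mean_square_dist:
  "(LINT t|circ. (cmod (z + of_real s * cis t))\<^sup>2) = (cmod z)\<^sup>2 + s\<^sup>2"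
proof -
  have *: "(cmod (z + of_real s * cis t))\<^sup>2 = ((cmod z)\<^sup>2 + s\<^sup>2) + 2 * s * Re (cnj z * cis t)" for t
  proof -
    have "(cmod (z + of_real s * cis t))\<^sup>2 = (Re z + s * cos t)\<^sup>2 + (Im z + s * sin t)\<^sup>2"
      by (simp add: cmod_power2)
    also have "\<dots> = (Re z)\<^sup>2 + (Im z)\<^sup>2 + s\<^sup>2 * ((cos t)\<^sup>2 + (sin t)\<^sup>2) + 2 * s * (Re z * cos t + Im z * sin t)"
      by algebra
    finally show ?thesis
      unfolding cmod_power2[of z] by simp
  qed
  have "(LINT t|circ. Re (cnj z * (0 + of_real 1 * cis t))) = Re (cnj z * 0)"
    by (rule mean_value_Re) (auto intro!: continuous_intros holomorphic_intros)
  then have 1: "(LINT t|circ. Re (cnj z * cis t)) = 0" by simp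
  have "integrable circ (\<lambda>t. Re (cnj z * cis t))"
    by (intro integrable_circ_cont continuous_intros)
  then have "(LINT t|circ. ((cmod z)\<^sup>2 + s\<^sup>2) + 2 * s * Re (cnj z * cis t)) = (cmod z)\<^sup>2 + s\<^sup>2"
    using 1 by (subst Bochner_Integration.integral_add) (auto simp: circ.prob_space[simplified])
  then show ?thesis unfolding * .
qed

text \<open>The boundary values are controlled through compact exhaustion, so that \<open>U\<close> may be any
  part of the disk. At an interior maximum of \<open>u + \<epsilon> |z|\<^sup>2\<close> the mean value
  property fails, because \<open>|z|\<^sup>2\<close> is strictly subharmonic.\<close>

lemma maximum_principle:
  assumes harm: "harm_on U u" and U: "U \<subseteq> ball 0 1"
    and bd: "\<And>\<eta>. \<eta> > 0 \<Longrightarrow> \<exists>K. compact K \<and> K \<subseteq> U \<and> (\<forall>z\<in>U - K. u z \<le> \<eta>)"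
    and z0: "z0 \<in> U"
  shows "u z0 \<le> 0"
proof (rule ccontr)
  assume "\<not> u z0 \<le> 0"
  then have pos: "u z0 > 0" by simp
  \<comment> \<open>One third for the bound on \<open>u\<close> off \<open>K\<close> and one third for \<open>\<epsilon> |z|\<^sup>2\<close> stay below \<open>u z0\<close>.\<close>
  define \<epsilon> where "\<epsilon> = u z0 / 3"
  define w where "w z = u z + \<epsilon> * (cmod z)\<^sup>2" for z
  have \<epsilon>: "\<epsilon> > 0" using pos by (simp add: \<epsilon>_def)
  obtain K where K: "compact K" "K \<subseteq> U" "\<And>z. z \<in> U - K \<Longrightarrow> u z \<le> \<epsilon>"
    using bd[OF \<epsilon>] by blast
  have off: "w z < u z0" if "z \<in> U - K" for z
  proof -
    have "(cmod z)\<^sup>2 \<le> 1" using that U by (auto simp: power_le_one subset_iff less_imp_le)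
    then have "\<epsilon> * (cmod z)\<^sup>2 \<le> \<epsilon> * 1" using \<epsilon> by (intro mult_left_mono) auto
    then have "w z \<le> \<epsilon> + \<epsilon>" using K(3)[OF that] unfolding w_def by linarith
    then show ?thesis using pos by (simp add: \<epsilon>_def)
  qed
  have w0: "w z0 \<ge> u z0" using \<epsilon> by (simp add: w_def)
  have "z0 \<in> K" using off[of z0] w0 z0 by fastforce
  have contw: "continuous_on U w"
    using harm unfolding w_def harm_on_def by (auto intro!: continuous_intros)
  obtain z1 where z1: "z1 \<in> K" "\<And>z. z \<in> K \<Longrightarrow> w z \<le> w z1"
    using continuous_attains_sup[OF K(1) _ continuous_on_subset[OF contw K(2)]] \<open>z0 \<in> K\<close> by blast
  have max: "w z \<le> w z1" if "z \<in> U" for z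
    using off[of z] w0 z1(2)[OF \<open>z0 \<in> K\<close>] z1(2)[of z] that by fastforce
  obtain e where e: "e > 0" "\<And>s. 0 < s \<and> s < e \<Longrightarrow> cball z1 s \<subseteq> U \<and> (LINT t|circ. u (z1 + of_real s * cis t)) = u z1"
    using harm z1(1) K(2) unfolding harm_on_def by (meson subsetD)
  define s where "s = e / 2"
  have s: "0 < s" "cball z1 s \<subseteq> U" "(LINT t|circ. u (z1 + of_real s * cis t)) = u z1"
    using e(1) e(2)[of s] by (auto simp: s_def)
  have ss: "sphere z1 s \<subseteq> U" using s by auto
  have iu: "integrable circ (\<lambda>t. u (z1 + of_real s * cis t))"
    using s harm unfolding harm_on_def
    by (intro integrable_circ_cont continuous_on_circle) (auto intro: continuous_on_subset[OF _ ss])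
  have iw: "integrable circ (\<lambda>t. w (z1 + of_real s * cis t))"
    using s contw by (intro integrable_circ_cont continuous_on_circle) (auto intro: continuous_on_subset[OF _ ss])
  have "(LINT t|circ. w (z1 + of_real s * cis t)) \<le> (LINT t|circ. w z1)"
  proof (rule integral_mono[OF iw])
    fix t
    have "z1 + of_real s * cis t \<in> U" using s by (auto simp: dist_norm norm_mult subset_iff)
    then show "w (z1 + of_real s * cis t) \<le> w z1" by (rule max)
  qed auto
  moreover have "(LINT t|circ. w z1) = w z1"
    by (simp add: circ.prob_space[simplified])
  moreover have "(LINT t|circ. w (z1 + of_real s * cis t)) = u z1 + \<epsilon> * ((cmod z1)\<^sup>2 + s\<^sup>2)"
  proof -
    have "integrable circ (\<lambda>t. (cmod (z1 + of_real s * cis t))\<^sup>2)"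
      by (intro integrable_circ_cont continuous_intros)
    then show ?thesis
      unfolding w_def using s(3) iu mean_square_dist[of z1 s] by simp
  qed
  ultimately show False
    using \<epsilon> s(1) unfolding w_def by (simp add: distrib_left) (metis linorder_not_less mult_pos_pos zero_less_power)
qed

section \<open>Parseval and the Poisson kernel\<close>

lemma integral_cis_power: "(LINT t|circ. cis t ^ n) = (if n = 0 then 1 else 0)"
proof -
  have "(LINT t|circ. (0 + of_real 1 * cis t) ^ n) = 0 ^ n"
    by (rule mean_value_holomorphic[of 0 1 "\<lambda>u. u ^ n"]) (auto intro!: continuous_intros holomorphic_intros)
  then show ?thesis by (simp add: power_0_left)
qed

lemma integral_cis_orthogonal:
  "(LINT t|circ. cis t ^ k * cnj (cis t) ^ n) = (if k = n then 1 else 0)"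
proof -
  have inv: "cis t ^ m * cnj (cis t) ^ m = 1" for t m
    by (simp add: power_mult_distrib[symmetric] cis_cnj cis_mult)
  show ?thesis
  proof (cases "k \<ge> n")
    case True
    have "cis t ^ k * cnj (cis t) ^ n = cis t ^ (k - n)" for t
    proof -
      have "cis t ^ k * cnj (cis t) ^ n = cis t ^ (k - n) * (cis t ^ n * cnj (cis t) ^ n)"
        using True by (simp flip: power_add mult.assoc)
      then show ?thesis by (simp add: inv)
    qed
    then show ?thesis using True by (simp add: integral_cis_power)
  next
    case False
    have "cis t ^ k * cnj (cis t) ^ n = cnj (cis t ^ (n - k))" for t
    proof -
      have "cis t ^ k * cnj (cis t) ^ n = cnj (cis t) ^ (n - k) * (cis t ^ k * cnj (cis t) ^ k)"
        using False by (simp add: mult_ac flip: power_add)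
      then show ?thesis by (simp add: inv)
    qed
    then have "(LINT t|circ. cis t ^ k * cnj (cis t) ^ n) = cnj (LINT t|circ. cis t ^ (n - k))"
      by (simp only: Bochner_Integration.integral_cnj)
    then show ?thesis using False by (simp add: integral_cis_power)
  qed
qed

lemma parseval_circ:
  fixes a :: "nat \<Rightarrow> complex"
  assumes g: "g holomorphic_on ball 0 1" and sums: "\<And>z. cmod z < 1 \<Longrightarrow> (\<lambda>n. a n * z ^ n) sums g z"
    and r: "0 \<le> r" "r < 1"
  shows "(\<lambda>n. (cmod (a n))\<^sup>2 * r ^ (2 * n)) sums (LINT t|circ. (cmod (g (of_real r * cis t)))\<^sup>2)"
proof -
  define c where "c n = a n * of_real r ^ n" for n
  define G where "G t = g (of_real r * cis t)" for t
  obtain w :: real where w: "r < w" "w < 1" using r dense by blast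
  have "summable (\<lambda>n. a n * of_real w ^ n)"
    using sums[of "of_real w"] w r by (auto simp: sums_iff)
  then have sumc: "summable (\<lambda>n. cmod (c n))"
    unfolding c_def using powser_insidea[of a "of_real w" "of_real r"] w r by simp
  have contG: "continuous_on UNIV G"
    unfolding G_def
    by (rule continuous_on_compose2[OF holomorphic_on_imp_continuous_on[OF g]])
       (use r in \<open>auto intro!: continuous_intros simp: norm_mult\<close>)
  have sumsG: "(\<lambda>k. c k * cis t ^ k) sums G t" for t
    using sums[of "of_real r * cis t"] r unfolding c_def G_def
    by (simp add: norm_mult power_mult_distrib mult_ac)
  have normG: "cmod (G t) \<le> (\<Sum>k. cmod (c k))" for t
  proof -
    have s: "summable (\<lambda>k. norm (c k * cis t ^ k))"
      using sumc by (simp add: norm_mult norm_power)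
    have "cmod (\<Sum>k. c k * cis t ^ k) \<le> (\<Sum>k. norm (c k * cis t ^ k))"
      by (rule summable_norm[OF s])
    then show ?thesis using sumsG[of t] by (simp add: sums_iff norm_mult norm_power)
  qed
  have coeff: "(LINT t|circ. G t * cnj (cis t) ^ n) = c n" for n
  proof -
    have "(\<lambda>k. LINT t|circ. c k * cis t ^ k * cnj (cis t) ^ n) sums
          (LINT t|circ. (\<Sum>k. c k * cis t ^ k * cnj (cis t) ^ n))"
    proof (rule sums_integral)
      show "integrable circ (\<lambda>t. c k * cis t ^ k * cnj (cis t) ^ n)" for k
        by (intro integrable_circ_cont continuous_intros)
    qed (use sumc in \<open>auto simp: norm_mult norm_power circ.prob_space[simplified]\<close>)
    moreover have "(\<Sum>k. c k * cis t ^ k * cnj (cis t) ^ n) = G t * cnj (cis t) ^ n" for t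
      using sums_mult2[OF sumsG[of t]] by (simp add: sums_iff)
    moreover have "(LINT t|circ. c k * cis t ^ k * cnj (cis t) ^ n) = (if k = n then c n else 0)" for k
      using integral_cis_orthogonal[of k n] by (simp add: mult.assoc)
    ultimately have "(\<lambda>k. if k = n then c n else 0) sums (LINT t|circ. G t * cnj (cis t) ^ n)"
      by simp
    then show ?thesis
      using sums_single[of n "\<lambda>_. c n"] sums_unique2 by metis
  qed
  have "(\<lambda>n. LINT t|circ. G t * (cnj (c n) * cnj (cis t) ^ n)) sums
          (LINT t|circ. (\<Sum>n. G t * (cnj (c n) * cnj (cis t) ^ n)))"
  proof (rule sums_integral)
    show int: "integrable circ (\<lambda>t. G t * (cnj (c k) * cnj (cis t) ^ k))" for k
      by (intro integrable_circ_cont continuous_intros contG)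
    show "AE t in circ. summable (\<lambda>k. norm (G t * (cnj (c k) * cnj (cis t) ^ k)))"
      using sumc by (auto simp: norm_mult norm_power intro!: summable_mult)
    have "norm (LINT t|circ. norm (G t * (cnj (c k) * cnj (cis t) ^ k))) \<le> (\<Sum>k. cmod (c k)) * cmod (c k)" for k
    proof -
      have "(LINT t|circ. norm (G t * (cnj (c k) * cnj (cis t) ^ k))) \<le> (LINT t|circ. (\<Sum>k. cmod (c k)) * cmod (c k))"
        using normG int[of k] 
        by (intro integral_mono integrable_norm) (auto simp: norm_mult norm_power intro!: mult_right_mono)
      then show ?thesis by (simp add: circ.prob_space[simplified])
    qed
    then show "summable (\<lambda>k. LINT t|circ. norm (G t * (cnj (c k) * cnj (cis t) ^ k)))"
      by (rule summable_comparison_test'[OF summable_mult[OF sumc], of 0]) 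
  qed
  moreover have "(LINT t|circ. G t * (cnj (c n) * cnj (cis t) ^ n)) = of_real ((cmod (a n))\<^sup>2 * r ^ (2 * n))" for n
  proof -
    have "(LINT t|circ. G t * (cnj (c n) * cnj (cis t) ^ n)) = (LINT t|circ. cnj (c n) * (G t * cnj (cis t) ^ n))"
      by (simp only: mult_ac)
    also have "\<dots> = c n * cnj (c n)"
      using coeff[of n] by simp
    also have "\<dots> = of_real ((cmod (c n))\<^sup>2)"
      by (rule complex_norm_square[symmetric])
    also have "(cmod (c n))\<^sup>2 = (cmod (a n))\<^sup>2 * r ^ (2 * n)"
      using r by (simp add: c_def norm_mult norm_power power_mult_distrib power_mult[symmetric] mult.commute)
    finally show ?thesis .
  qed
  moreover have "(\<Sum>n. G t * (cnj (c n) * cnj (cis t) ^ n)) = of_real ((cmod (G t))\<^sup>2)" for t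
  proof -
    have "(\<lambda>n. cnj (c n * cis t ^ n)) sums cnj (G t)"
      using sumsG[of t] by (subst sums_cnj)
    then have "(\<lambda>n. G t * (cnj (c n) * cnj (cis t) ^ n)) sums (G t * cnj (G t))"
      by (intro sums_mult) simp
    then show ?thesis unfolding complex_norm_square by (simp add: sums_iff)
  qed
  ultimately have "(\<lambda>n. complex_of_real ((cmod (a n))\<^sup>2 * r ^ (2 * n))) sums (LINT t|circ. complex_of_real ((cmod (G t))\<^sup>2))"
    by simp
  moreover have "(LINT t|circ. complex_of_real ((cmod (G t))\<^sup>2)) = of_real (LINT t|circ. (cmod (G t))\<^sup>2)"
    by (rule integral_complex_of_real)
  ultimately show ?thesis
    unfolding G_def by (simp only: sums_of_real_iff)
qed

text \<open>By Parseval the square integral is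
  \<open>\<Sum> |a n|\<^sup>2 R\<^sup>2\<^sup>n (1 - \<rho>\<^sup>n)\<^sup>2\<close>, which is small
  uniformly in \<open>R\<close> for \<open>\<rho>\<close> close to 1, because
  \<open>\<Sum> |a n|\<^sup>2\<close> converges.\<close>

lemma dilation_L2_small:
  assumes f: "f holomorphic_on ball 0 1" and bd: "\<And>z. cmod z < 1 \<Longrightarrow> cmod (f z) \<le> 1" and \<epsilon>: "\<epsilon> > 0"
  shows "\<exists>\<rho>. 0 < \<rho> \<and> \<rho> < 1 \<and> (\<forall>R. 0 < R \<and> R < 1 \<longrightarrow>
     (LINT t|circ. (cmod (f (of_real R * cis t) - f (of_real (\<rho> * R) * cis t)))\<^sup>2) \<le> \<epsilon>)"
proof -
  define a where "a n = (deriv ^^ n) f 0 / fact n" for n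
  have sums: "(\<lambda>n. a n * z ^ n) sums f z" if "cmod z < 1" for z
    using holomorphic_power_series[OF f, of z] that by (simp add: a_def)
  have partial: "(\<Sum>n<N. (cmod (a n))\<^sup>2) \<le> 1" for N
  proof -
    have "(\<Sum>n<N. (cmod (a n))\<^sup>2 * r ^ (2 * n)) \<le> 1" if r: "0 < r" "r < 1" for r
    proof -
      have p: "(\<lambda>n. (cmod (a n))\<^sup>2 * r ^ (2 * n)) sums (LINT t|circ. (cmod (f (of_real r * cis t)))\<^sup>2)"
        using r by (intro parseval_circ f sums) auto
      have cont: "continuous_on UNIV (\<lambda>t. f (of_real r * cis t))"
        by (rule continuous_on_compose2[OF holomorphic_on_imp_continuous_on[OF f]])
           (use r in \<open>auto intro!: continuous_intros simp: norm_mult\<close>)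
      have "(\<Sum>n<N. (cmod (a n))\<^sup>2 * r ^ (2 * n)) \<le> (\<Sum>n. (cmod (a n))\<^sup>2 * r ^ (2 * n))"
        using p r by (intro sum_le_suminf) (auto simp: sums_iff)
      also have "\<dots> = (LINT t|circ. (cmod (f (of_real r * cis t)))\<^sup>2)"
        using p by (simp add: sums_iff)
      also have "\<dots> \<le> (LINT t|circ. 1)"
        using r by (intro integral_mono integrable_circ_cont continuous_intros cont)
          (auto simp: norm_mult intro!: power_le_one[OF norm_ge_zero] bd)
      finally show ?thesis by (simp add: circ.prob_space[simplified])
    qed
    then have "\<forall>\<^sub>F r in at_left 1. (\<Sum>n<N. (cmod (a n))\<^sup>2 * r ^ (2 * n)) \<le> 1"
      unfolding eventually_at_left_field by (intro exI[of _ 0]) auto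
    moreover have "((\<lambda>r. \<Sum>n<N. (cmod (a n))\<^sup>2 * r ^ (2 * n)) \<longlongrightarrow> (\<Sum>n<N. (cmod (a n))\<^sup>2 * 1 ^ (2 * n))) (at_left (1::real))"
      by (intro tendsto_intros)
    ultimately show ?thesis
      using tendsto_upperbound by fastforce
  qed
  then have summ: "summable (\<lambda>n. (cmod (a n))\<^sup>2)"
    by (intro summableI_nonneg_bounded) auto
  obtain N where N: "norm (\<Sum>i. (cmod (a (i + N)))\<^sup>2) < \<epsilon> / 2"
    using suminf_exist_split[OF _ summ, of "\<epsilon> / 2"] \<epsilon> by auto
  have "((\<lambda>\<rho>. \<Sum>n<N. (cmod (a n))\<^sup>2 * (1 - \<rho> ^ n)\<^sup>2) \<longlongrightarrow> (\<Sum>n<N. (cmod (a n))\<^sup>2 * (1 - 1 ^ n)\<^sup>2)) (at_left (1::real))"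
    by (intro tendsto_intros)
  then have "\<forall>\<^sub>F \<rho> in at_left (1::real). (\<Sum>n<N. (cmod (a n))\<^sup>2 * (1 - \<rho> ^ n)\<^sup>2) < \<epsilon> / 2"
    by (rule order_tendstoD) (use \<epsilon> in auto)
  moreover have "\<forall>\<^sub>F \<rho> in at_left (1::real). 0 < \<rho> \<and> \<rho> < 1"
    unfolding eventually_at_left_field by (intro exI[of _ 0]) auto
  ultimately obtain \<rho> where \<rho>: "0 < \<rho>" "\<rho> < 1" "(\<Sum>n<N. (cmod (a n))\<^sup>2 * (1 - \<rho> ^ n)\<^sup>2) < \<epsilon> / 2"
    using eventually_happens'[OF trivial_limit_at_left_real eventually_conj] by (metis (no_types, lifting))
  have pow1: "(1 - \<rho> ^ n)\<^sup>2 \<le> 1" for n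
    using \<rho> by (intro power_le_one) (auto simp: power_le_one)
  show ?thesis
  proof (intro exI[of _ \<rho>] conjI allI impI \<rho>(1,2))
    fix R :: real assume R: "0 < R \<and> R < 1"
    define h where "h z = f z - f (of_real \<rho> * z)" for z
    define b where "b n = a n * (1 - of_real \<rho> ^ n)" for n
    have dil: "cmod (of_real \<rho> * z) < 1" if "cmod z < 1" for z
    proof -
      have "\<rho> * cmod z \<le> 1 * cmod z" using \<rho> by (intro mult_right_mono) auto
      then show ?thesis using that \<rho> by (simp add: norm_mult)
    qed
    have h: "h holomorphic_on ball 0 1"
      unfolding h_def using dil
      by (intro holomorphic_intros f holomorphic_on_compose_gen[OF _ f, unfolded o_def]) auto
    have "(\<lambda>n. b n * z ^ n) sums h z" if "cmod z < 1" for z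
      using sums_diff[OF sums[OF that] sums[OF dil[OF that]]]
      by (simp add: h_def b_def power_mult_distrib algebra_simps)
    then have p: "(\<lambda>n. (cmod (b n))\<^sup>2 * R ^ (2 * n)) sums (LINT t|circ. (cmod (h (of_real R * cis t)))\<^sup>2)"
      using R by (intro parseval_circ h) auto
    have bn: "(cmod (b n))\<^sup>2 = (cmod (a n))\<^sup>2 * (1 - \<rho> ^ n)\<^sup>2" for n
    proof -
      have "cmod (1 - of_real \<rho> ^ n) = \<bar>1 - \<rho> ^ n\<bar>"
        by (metis norm_of_real of_real_1 of_real_diff of_real_power)
      then show ?thesis by (simp add: b_def norm_mult power_mult_distrib)
    qed
    have b_le: "(cmod (b n))\<^sup>2 \<le> (cmod (a n))\<^sup>2" for n
      unfolding bn using pow1[of n] mult_left_mono[OF pow1[of n], of "(cmod (a n))\<^sup>2"] by simp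
    have summb: "summable (\<lambda>n. (cmod (b n))\<^sup>2)"
      by (rule summable_comparison_test'[OF summ, of 0]) (use b_le in auto)
    have "(LINT t|circ. (cmod (h (of_real R * cis t)))\<^sup>2) = (\<Sum>n. (cmod (b n))\<^sup>2 * R ^ (2 * n))"
      using p by (simp add: sums_iff)
    also have "\<dots> \<le> (\<Sum>n. (cmod (b n))\<^sup>2)"
      using p R by (intro suminf_le summb) (auto simp: sums_iff intro!: mult_left_le power_le_one)
    also have "\<dots> = (\<Sum>n. (cmod (b (n + N)))\<^sup>2) + (\<Sum>n<N. (cmod (b n))\<^sup>2)"
      by (rule suminf_split_initial_segment[OF summb])
    also have "(\<Sum>n. (cmod (b (n + N)))\<^sup>2) \<le> (\<Sum>n. (cmod (a (n + N)))\<^sup>2)"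
      using summ b_le by (intro suminf_le summable_ignore_initial_segment summb summ) auto
    also have "\<dots> \<le> \<epsilon> / 2"
      using N by simp
    also have "(\<Sum>n<N. (cmod (b n))\<^sup>2) \<le> \<epsilon> / 2"
      using \<rho>(3) by (simp add: bn)
    finally show "(LINT t|circ. (cmod (f (of_real R * cis t) - f (of_real (\<rho> * R) * cis t)))\<^sup>2) \<le> \<epsilon>"
      by (simp add: h_def mult.assoc)
  qed
qed

lemma integral_symmetrize:
  fixes H :: "real \<Rightarrow> real"
  assumes H: "continuous_on UNIV H" and s: "s \<ge> 0"
  shows "integral {-s..s} H = integral {0..s} (\<lambda>t. H t + H (-t))"
proof -
  have int: "H integrable_on {a..b}" for a b
    by (intro integrable_continuous_interval continuous_on_subset[OF H]) auto
  have H': "continuous_on UNIV (\<lambda>t. H (- t))"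
    by (rule continuous_on_compose2[OF H]) (auto intro!: continuous_intros)
  have int': "(\<lambda>t. H (-t)) integrable_on {a..b}" for a b
    by (intro integrable_continuous_interval continuous_on_subset[OF H']) auto
  have "integral {-s..s} H = integral {-s..0} H + integral {0..s} H"
    using s int by (intro Henstock_Kurzweil_Integration.integral_combine[symmetric]) auto
  also have "integral {-s..0} H = integral {0..s} (\<lambda>t. H (-t))"
    using Henstock_Kurzweil_Integration.integral_reflect_real[of s 0 "\<lambda>t. H (-t)"] by simp
  also have "integral {0..s} (\<lambda>t. H (-t)) + integral {0..s} H = integral {0..s} (\<lambda>t. H t + H (-t))"
    using int int' by (subst Henstock_Kurzweil_Integration.integral_add) auto
  finally show ?thesis .
qed

lemma poisson_real:
  assumes "0 \<le> r" "r < 1"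
  shows "poisson (of_real r) t = (1 - r\<^sup>2) / (1 - 2 * r * cos t + r\<^sup>2)"
proof -
  have "(cmod (cis t - of_real r))\<^sup>2 = ((cos t)\<^sup>2 + (sin t)\<^sup>2) - 2 * r * cos t + r\<^sup>2"
    unfolding cmod_power2 by (simp add: power2_eq_square algebra_simps)
  then show ?thesis using assms by (simp add: poisson_def)
qed

text \<open>The Poisson kernel is even and decreasing on \<open>{0..pi}\<close>, hence a superposition of
  symmetric box kernels. The proof is an integration by parts against the primitive of the symmetrized
  \<open>G\<close>.\<close>

lemma poisson_le_box_averages:
  fixes G :: "real \<Rightarrow> real"
  assumes G: "continuous_on UNIV G" and r: "0 \<le> r" "r < 1"
    and box: "\<And>s. 0 < s \<Longrightarrow> s \<le> pi \<Longrightarrow> integral {-s..s} G \<le> 2 * s * l"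
  shows "(LINT t|circ. poisson (of_real r) t * G t) \<le> l"
proof -
  define g where "g t = G t + G (-t)" for t
  define q where "q t = (1 - r\<^sup>2) / (1 - 2 * r * cos t + r\<^sup>2)" for t
  define q' where "q' t = - ((1 - r\<^sup>2) * (2 * r * sin t)) / (1 - 2 * r * cos t + r\<^sup>2)\<^sup>2" for t
  define K where "K s = 2 * l * s - integral {0..s} g" for s
  have G': "continuous_on UNIV (\<lambda>t. G (- t))"
    by (rule continuous_on_compose2[OF G]) (auto intro!: continuous_intros)
  have contg: "continuous_on A g" for A
    unfolding g_def by (rule continuous_on_subset[of UNIV]) (auto intro!: continuous_intros G G')
  have den: "1 - 2 * r * cos t + r\<^sup>2 > 0" for t
  proof -
    have "r * cos t \<le> r * 1" using r by (intro mult_left_mono) auto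
    moreover have "(1 - r)\<^sup>2 > 0" using r by simp
    ultimately show ?thesis by (simp add: power2_eq_square algebra_simps)
  qed
  have q0: "q t \<ge> 0" for t
    unfolding q_def using r den[of t] by (intro divide_nonneg_pos) (auto simp: power_le_one)
  have contq: "continuous_on A q" for A
    unfolding q_def using den by (intro continuous_intros) (auto simp: less_imp_neq[THEN not_sym])
  have contq': "continuous_on A q'" for A
    unfolding q'_def using den by (intro continuous_intros) (auto simp: less_imp_neq[THEN not_sym])
  have K0: "K s \<ge> 0" if "s \<in> {0..pi}" for s
  proof (cases "s = 0")
    case False
    then have "integral {-s..s} G \<le> 2 * s * l" using that by (intro box) auto
    then show ?thesis
      using integral_symmetrize[OF G, of s] that by (simp add: K_def g_def[abs_def] mult_ac)
  qed (simp add: K_def)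
  have contK: "continuous_on {0..pi} K"
    unfolding K_def by (intro continuous_intros indefinite_integral_continuous_1 integrable_continuous_interval contg)
  have "((\<lambda>t. q' t * K t + q t * (2 * l - g t)) has_integral q pi * K pi - q 0 * K 0) {0..pi}"
  proof (rule fundamental_theorem_of_calculus)
    fix x :: real assume x: "x \<in> {0..pi}"
    have "((\<lambda>u. integral {0..u} g) has_real_derivative g x) (at x within {0..pi})"
      using integral_has_real_derivative[OF contg x] .
    then have "(K has_real_derivative 2 * l - g x) (at x within {0..pi})"
      unfolding K_def by (auto intro!: derivative_eq_intros)
    moreover have "(q has_real_derivative q' x) (at x within {0..pi})"
      unfolding q_def q'_def using den[of x]
      by (auto intro!: derivative_eq_intros simp: power2_eq_square divide_simps)
    ultimately have "((\<lambda>t. q t * K t) has_real_derivative q' x * K x + q x * (2 * l - g x)) (at x within {0..pi})"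
      by (auto intro!: derivative_eq_intros)
    then show "((\<lambda>t. q t * K t) has_vector_derivative q' x * K x + q x * (2 * l - g x)) (at x within {0..pi})"
      by (simp add: has_real_derivative_iff_has_vector_derivative)
  qed auto
  then have I: "integral {0..pi} (\<lambda>t. q' t * K t + q t * (2 * l - g t)) = q pi * K pi"
    by (simp add: integral_unique K_def)
  have "q' t * K t \<le> 0" if "t \<in> {0..pi}" for t
    unfolding q'_def using K0[OF that] r that
    by (intro mult_nonpos_nonneg divide_nonpos_nonneg)
       (auto intro!: mult_nonneg_nonneg sin_ge_zero simp: power_le_one)
  then have "integral {0..pi} (\<lambda>t. q' t * K t + q t * (2 * l - g t)) \<le> integral {0..pi} (\<lambda>t. q t * (2 * l - g t))"
    by (intro integral_le integrable_continuous_interval continuous_intros contq contq' contK contg) auto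
  moreover have "q pi * K pi \<ge> 0" using q0 K0 by auto
  ultimately have "0 \<le> integral {0..pi} (\<lambda>t. q t * (2 * l - g t))" using I by linarith
  also have "(\<lambda>t. q t * (2 * l - g t)) = (\<lambda>t. q t * (l - G t) + q (-t) * (l - G (-t)))"
  proof
    fix t
    have "q (-t) = q t" by (simp add: q_def)
    then show "q t * (2 * l - g t) = q t * (l - G t) + q (-t) * (l - G (-t))"
      unfolding g_def by (simp add: algebra_simps)
  qed
  also have "integral {0..pi} \<dots> = integral {-pi..pi} (\<lambda>t. q t * (l - G t))"
    by (subst integral_symmetrize) (auto intro!: continuous_intros contq G)
  finally have "0 \<le> (1 / (2 * pi)) *\<^sub>R integral {-pi..pi} (\<lambda>t. q t * (l - G t))"
    by simp
  also have "\<dots> = (LINT t|circ. q t * (l - G t))"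
    by (rule integral_circ[symmetric])
       (auto intro!: continuous_intros contq continuous_on_subset[OF G])
  also have "\<dots> = (LINT t|circ. l * q t - q t * G t)"
    by (simp add: algebra_simps)
  also have "\<dots> = l * (LINT t|circ. q t) - (LINT t|circ. q t * G t)"
    by (subst Bochner_Integration.integral_diff)
       (auto intro!: integrable_circ_cont continuous_intros contq G)
  finally show ?thesis
    using integral_poisson[of "of_real r"] r by (simp add: poisson_real q_def)
qed

section \<open>Radial limits of bounded holomorphic functions\<close>

lemma nn_integral_periodic:
  fixes G :: "real \<Rightarrow> real"
  assumes [measurable]: "G \<in> borel_measurable borel" and per: "\<And>t. G (t + 2 * pi) = G t"
  shows "(\<integral>\<^sup>+t\<in>{-2*pi..2*pi}. ennreal (G t) \<partial>lborel) \<le> 6 * ennreal pi * (\<integral>\<^sup>+t. ennreal (G t) \<partial>circ)"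
proof -
  let ?I = "\<lambda>a b. (\<integral>\<^sup>+t\<in>{a..b}. ennreal (G t) \<partial>lborel)"
  have per': "G (t - 2 * pi) = G t" for t using per[of "t - 2 * pi"] by simp
  have s1: "?I (-3*pi) (-pi) = ?I (-pi) pi"
  proof -
    have "?I (-3*pi) (-pi) = ennreal \<bar>1\<bar> * (\<integral>\<^sup>+t. ennreal (G (-2*pi + 1 * t)) * indicator {-3*pi..-pi} (-2*pi + 1 * t) \<partial>lborel)"
      by (rule nn_integral_real_affine) auto
    also have "\<dots> = ?I (-pi) pi"
      using per' by (auto intro!: nn_integral_cong simp: indicator_def algebra_simps)
    finally show ?thesis .
  qed
  have s2: "?I pi (3*pi) = ?I (-pi) pi"
  proof -
    have "?I pi (3*pi) = ennreal \<bar>1\<bar> * (\<integral>\<^sup>+t. ennreal (G (2*pi + 1 * t)) * indicator {pi..3*pi} (2*pi + 1 * t) \<partial>lborel)"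
      by (rule nn_integral_real_affine) auto
    also have "\<dots> = ?I (-pi) pi"
      using per by (auto intro!: nn_integral_cong simp: indicator_def algebra_simps)
    finally show ?thesis .
  qed
  have "?I (-2*pi) (2*pi) \<le> (\<integral>\<^sup>+t. ennreal (G t) * indicator {-3*pi..-pi} t + (ennreal (G t) * indicator {-pi..pi} t + ennreal (G t) * indicator {pi..3*pi} t) \<partial>lborel)"
    by (intro nn_integral_mono) (auto simp: indicator_def)
  also have "\<dots> = ?I (-3*pi) (-pi) + (?I (-pi) pi + ?I pi (3*pi))"
    by (simp add: nn_integral_add)
  also have "\<dots> = 3 * ?I (-pi) pi"
  proof -
    have "(3::ennreal) = 1 + (1 + 1)" by simp
    then show ?thesis unfolding s1 s2 by (simp only: distrib_right mult_1)
  qed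
  also have "?I (-pi) pi = ennreal (2 * pi) * (\<integral>\<^sup>+t. ennreal (G t) \<partial>circ)"
    by (subst nn_integral_circ) (auto simp: mult.assoc[symmetric] simp flip: ennreal_mult)
  also have "3 * (ennreal (2 * pi) * (\<integral>\<^sup>+t. ennreal (G t) \<partial>circ)) = 6 * ennreal pi * (\<integral>\<^sup>+t. ennreal (G t) \<partial>circ)"
    by (simp add: ennreal_mult' mult.assoc[symmetric])
  finally show ?thesis .
qed

lemma nn_integral_ball:
  fixes G :: "real \<Rightarrow> real"
  assumes "continuous_on UNIV G" "\<And>t. G t \<ge> 0"
  shows "(\<integral>\<^sup>+x\<in>ball t s. ennreal (G x) \<partial>lborel) = ennreal (integral {t-s..t+s} G)"
proof (rule nn_integral_has_integral_lebesgue')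
  have "G integrable_on {t-s..t+s}"
    by (intro integrable_continuous_interval continuous_on_subset[OF assms(1)]) auto
  then have "(G has_integral (integral {t-s..t+s} G)) {t-s..t+s}"
    by (rule integrable_integral)
  then show "(G has_integral (integral {t-s..t+s} G)) (ball t s)"
    unfolding ball_eq_greaterThanLessThan has_integral_Icc_iff_Ioo .
qed (use assms in auto)

text \<open>The Poisson formula bounds the radial maximal function by averages over symmetric arcs, and the
  Vitali covering lemma bounds the measure of the set where one of these averages exceeds \<open>l\<close>.
  The constant is \<open>5 * 3\<close>: the dilation factor of the covering lemma times the number of
  periods that cover \<open>{-2*pi..2*pi}\<close>.\<close>

lemma radial_maximal_inequality:
  assumes g: "continuous_on (cball 0 1) g" "g holomorphic_on ball 0 1" and l: "l > 0"
  shows "emeasure circ {t. \<exists>r. 0 \<le> r \<and> r < 1 \<and> cmod (g (of_real r * cis t)) > l}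
      \<le> ennreal (15 / l) * (\<integral>\<^sup>+t. ennreal (cmod (g (cis t))) \<partial>circ)"
    and "open {t. \<exists>r. 0 \<le> r \<and> r < 1 \<and> cmod (g (of_real r * cis t)) > l}"
proof -
  define G where "G t = cmod (g (cis t))" for t
  define E where "E = {t. \<exists>r. 0 \<le> r \<and> r < 1 \<and> cmod (g (of_real r * cis t)) > l}"
  have contG: "continuous_on UNIV G"
    unfolding G_def by (intro continuous_intros continuous_on_compose2[OF g(1)]) auto
  then have [measurable]: "G \<in> borel_measurable borel" by auto
  have G0: "G t \<ge> 0" for t by (simp add: G_def)
  have per: "G (t + 2 * pi) = G t" for t by (simp add: G_def flip: cis_mult)
  have E_eq: "E = (\<Union>r\<in>{0..<1}. {t. cmod (g (of_real r * cis t)) > l})"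
    by (auto simp: E_def)
  show openE: "open {t. \<exists>r. 0 \<le> r \<and> r < 1 \<and> cmod (g (of_real r * cis t)) > l}"
    unfolding E_def[symmetric] E_eq
    by (intro open_UN ballI open_Collect_less continuous_intros continuous_on_compose2[OF g(1)])
       (auto simp: norm_mult)
  then have E_sets: "E \<in> sets borel" by (simp add: E_def)
  \<comment> \<open>Were no average too large, the Poisson formula would bound \<open>g\<close> by \<open>l\<close> on the whole radius.\<close>
  have ex: "\<exists>s. 0 < s \<and> s \<le> pi \<and> integral {t-s..t+s} G > 2 * s * l" if t: "t \<in> E" for t
  proof (rule ccontr)
    assume "\<not> ?thesis"
    then have le: "integral {t-s..t+s} G \<le> 2 * s * l" if "0 < s" "s \<le> pi" for s
      using that by (meson not_less)
    obtain r where r: "0 \<le> r" "r < 1" "cmod (g (of_real r * cis t)) > l"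
      using t by (auto simp: E_def)
    have contGt: "continuous_on UNIV (\<lambda>s. G (t + s))"
      by (rule continuous_on_compose2[OF contG]) (auto intro!: continuous_intros)
    have box: "integral {-s..s} (\<lambda>s. G (t + s)) \<le> 2 * s * l" if "0 < s" "s \<le> pi" for s
    proof -
      have "(G has_integral integral {t-s..t+s} G) {-s+t..s+t}"
        using integrable_integral[OF integrable_continuous_interval[OF continuous_on_subset[OF contG]], of "-s+t" "s+t"]
        by (simp add: add.commute)
      then have "((G \<circ> (+) t) has_integral integral {t-s..t+s} G) {-s..s}"
        by (subst has_integral_shift_Icc_real)
      then show ?thesis using le[OF that] by (simp add: o_def integral_unique)
    qed
    define k where "k u = g (cis t * u)" for u
    have "k (of_real r) = (LINT s|circ. poisson (of_real r) s *\<^sub>R k (cis s))"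
      using r unfolding k_def
      by (intro poisson_integral continuous_on_compose2[OF g(1)] holomorphic_on_compose_gen[OF _ g(2), unfolded o_def])
         (auto intro!: continuous_intros holomorphic_intros simp: norm_mult)
    then have "cmod (k (of_real r)) \<le> (LINT s|circ. cmod (poisson (of_real r) s *\<^sub>R k (cis s)))"
      by (simp only: integral_norm_bound)
    also have "\<dots> = (LINT s|circ. poisson (of_real r) s * G (t + s))"
      using poisson_pos[of "of_real r"] r
      by (intro Bochner_Integration.integral_cong) (auto simp: k_def G_def cis_mult less_imp_le)
    also have "\<dots> \<le> l"
      by (rule poisson_le_box_averages[OF contGt r(1,2) box])
    finally show False using r(3) by (simp add: k_def mult.commute)
  qed
  define s where "s t = (SOME s. 0 < s \<and> s \<le> pi \<and> integral {t-s..t+s} G > 2 * s * l)" for t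
  have s: "0 < s t \<and> s t \<le> pi \<and> integral {t-s t..t+s t} G > 2 * s t * l" if "t \<in> E" for t
    unfolding s_def by (rule someI_ex[OF ex[OF that]])
  define K where "K = E \<inter> {-pi..pi}"
  obtain C where C: "countable C" "C \<subseteq> K" 
      "pairwise (\<lambda>i j. disjnt (ball i (s i)) (ball j (s j))) C"
      "K \<subseteq> (\<Union>i\<in>C. ball i (5 * s i))"
  proof (rule Vitali_covering_lemma_balls[where S = K and K = K and a = "\<lambda>i. i" and r = s and B = pi])
    show "K \<subseteq> (\<Union>i\<in>K. ball i (s i))" "\<And>i. i \<in> K \<Longrightarrow> 0 < s i \<and> s i \<le> pi"
      using s by (auto simp: K_def)
  qed (use that in blast)
  define N where "N = to_nat_on C ` C"
  define x where "x = inv_into C (to_nat_on C)"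
  have x: "x n \<in> C" if "n \<in> N" for n
    using that unfolding N_def x_def by (rule inv_into_into)
  have xx: "x (to_nat_on C t) = t" if "t \<in> C" for t
    using that inj_on_to_nat_on[OF C(1)] by (simp add: x_def inv_into_f_f)
  have x_inj: "n = m" if "n \<in> N" "m \<in> N" "x n = x m" for n m
    using that unfolding N_def x_def by (metis f_inv_into_f)
  define A where "A n = (if n \<in> N then ball (x n) (s (x n)) else {})" for n
  define A5 where "A5 n = (if n \<in> N then ball (x n) (5 * s (x n)) else {})" for n
  define M where "M = density lborel (\<lambda>t. ennreal (G t))"
  have setsM: "sets M = sets borel" by (simp add: M_def)
  have disj: "disjoint_family A"
    unfolding disjoint_family_on_def
  proof (intro ballI impI)
    fix m n :: nat assume mn: "m \<noteq> n"
    show "A m \<inter> A n = {}"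
    proof (cases "m \<in> N \<and> n \<in> N")
      case True
      then have "x m \<noteq> x n" using mn x_inj by blast
      then have "disjnt (ball (x m) (s (x m))) (ball (x n) (s (x n)))"
        using C(3) x True by (auto intro: pairwiseD)
      then show ?thesis using True by (simp add: A_def disjnt_def)
    qed (auto simp: A_def)
  qed
  have bound: "emeasure lborel (A5 n) \<le> ennreal (5 / l) * emeasure M (A n)" for n
  proof (cases "n \<in> N")
    case True
    define t where "t = x n"
    have t: "t \<in> E" using x[OF True] C(2) by (auto simp: t_def K_def)
    have "s t > 0" using s[OF t] by blast
    then have "emeasure lborel {t - 5 * s t<..<t + 5 * s t} = ennreal (10 * s t)"
      by simp
    then have "emeasure lborel (A5 n) = ennreal (10 * s t)"
      using True by (simp only: A5_def t_def[symmetric] ball_eq_greaterThanLessThan if_True)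
    also have "\<dots> \<le> ennreal ((5 / l) * integral {t-s t..t+s t} G)"
    proof (rule ennreal_leI)
      have "(5 / l) * (2 * s t * l) \<le> (5 / l) * integral {t-s t..t+s t} G"
        using s[OF t] l by (intro mult_left_mono) auto
      then show "10 * s t \<le> (5 / l) * integral {t-s t..t+s t} G"
        using l by simp
    qed
    also have "\<dots> = ennreal (5 / l) * emeasure M (A n)"
      using True l nn_integral_ball[OF contG G0, of t "s t"]
      by (simp only: A_def M_def t_def emeasure_density ennreal_mult' divide_nonneg_pos if_True)
         (simp add: emeasure_density ennreal_mult'[symmetric])
    finally show ?thesis .
  qed (auto simp: A5_def)
  have ball_sub: "ball t (s t) \<subseteq> {-2*pi..2*pi}" if "t \<in> K" for t
    using that s[of t] by (auto simp: K_def ball_eq_greaterThanLessThan)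
  have "emeasure lborel K \<le> emeasure lborel (\<Union>n. A5 n)"
  proof (rule emeasure_mono)
    show "K \<subseteq> (\<Union>n. A5 n)"
    proof
      fix t assume "t \<in> K"
      then obtain i where i: "i \<in> C" "t \<in> ball i (5 * s i)" using C(4) by blast
      then have "t \<in> A5 (to_nat_on C i)" by (simp add: A5_def N_def xx)
      then show "t \<in> (\<Union>n. A5 n)" by blast
    qed
  qed (auto simp: A5_def)
  also have "\<dots> \<le> (\<Sum>n. emeasure lborel (A5 n))"
    by (rule emeasure_subadditive_countably) (auto simp: A5_def)
  also have "\<dots> \<le> (\<Sum>n. ennreal (5 / l) * emeasure M (A n))"
    by (intro suminf_le bound) auto
  also have "\<dots> = ennreal (5 / l) * (\<Sum>n. emeasure M (A n))"
    by simp
  also have "(\<Sum>n. emeasure M (A n)) = emeasure M (\<Union>n. A n)"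
    by (rule suminf_emeasure[OF _ disj]) (auto simp: A_def setsM)
  also have "\<dots> \<le> emeasure M {-2*pi..2*pi}"
    using ball_sub x C(2) by (intro emeasure_mono) (auto simp: A_def setsM split: if_splits)
  also have "\<dots> \<le> 6 * ennreal pi * (\<integral>\<^sup>+t. ennreal (G t) \<partial>circ)"
    using nn_integral_periodic[OF \<open>G \<in> borel_measurable borel\<close> per]
    unfolding M_def by (subst emeasure_density) auto
  finally have "emeasure lborel K \<le> ennreal (5 / l) * (6 * ennreal pi * (\<integral>\<^sup>+t. ennreal (G t) \<partial>circ))"
    by (simp add: mult_left_mono)
  then have "ennreal (1 / (2 * pi)) * emeasure lborel K \<le> ennreal (1 / (2 * pi)) * (ennreal (5 / l) * (6 * ennreal pi * (\<integral>\<^sup>+t. ennreal (G t) \<partial>circ)))"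
    by (rule mult_left_mono) auto
  also have "\<dots> = (ennreal (1 / (2 * pi)) * (ennreal (5 / l) * (ennreal 6 * ennreal pi))) * (\<integral>\<^sup>+t. ennreal (G t) \<partial>circ)"
    by (simp add: mult.assoc)
  also have "ennreal (1 / (2 * pi)) * (ennreal (5 / l) * (ennreal 6 * ennreal pi)) = ennreal (15 / l)"
  proof -
    have 1: "ennreal 6 * ennreal pi = ennreal (6 * pi)"
      by (rule ennreal_mult'[symmetric]) simp
    have 2: "ennreal (5 / l) * ennreal (6 * pi) = ennreal (5 / l * (6 * pi))"
      by (rule ennreal_mult'[symmetric]) (use l in simp)
    have 3: "ennreal (1 / (2 * pi)) * ennreal (5 / l * (6 * pi)) = ennreal (1 / (2 * pi) * (5 / l * (6 * pi)))"
      by (rule ennreal_mult'[symmetric]) simp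
    show ?thesis unfolding 1 2 3 using l by simp
  qed
  finally show "emeasure circ {t. \<exists>r. 0 \<le> r \<and> r < 1 \<and> cmod (g (of_real r * cis t)) > l}
      \<le> ennreal (15 / l) * (\<integral>\<^sup>+t. ennreal (cmod (g (cis t))) \<partial>circ)"
    using E_sets by (simp add: emeasure_circ K_def E_def[symmetric] G_def)
qed

text \<open>The maximal inequality for \<open>f(z) - f(\<rho> z)\<close>, whose mean square is small. It is
  applied on the circles of radius \<open>R m < 1\<close>; the exceptional sets increase with
  \<open>m\<close>.\<close>

lemma dilation_maximal_small:
  assumes f: "f holomorphic_on ball 0 1" and bd: "\<And>z. cmod z < 1 \<Longrightarrow> cmod (f z) \<le> 1"
    and l: "l > 0" and \<eta>: "\<eta> > 0"
  shows "\<exists>\<rho> U. 0 < \<rho> \<and> \<rho> < 1 \<and> open U \<and> emeasure circ U \<le> ennreal \<eta> \<and>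
     (\<forall>t r. t \<notin> U \<longrightarrow> 0 \<le> r \<longrightarrow> r < 1 \<longrightarrow> cmod (f (of_real r * cis t) - f (of_real (\<rho> * r) * cis t)) \<le> l)"
proof -
  define \<delta> where "\<delta> = \<eta> * l / 30"
  have \<delta>: "\<delta> > 0" using l \<eta> by (simp add: \<delta>_def)
  obtain \<rho> where \<rho>: "0 < \<rho>" "\<rho> < 1" and L2: "\<And>R. 0 < R \<Longrightarrow> R < 1 \<Longrightarrow>
     (LINT t|circ. (cmod (f (of_real R * cis t) - f (of_real (\<rho> * R) * cis t)))\<^sup>2) \<le> \<delta>\<^sup>2"
    using dilation_L2_small[OF f bd, of "\<delta>\<^sup>2"] \<delta> by auto
  define h where "h z = f z - f (of_real \<rho> * z)" for z
  have dil: "cmod (of_real c * z) < 1" if "cmod z \<le> 1" "0 < c" "c < 1" for z c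
  proof -
    have "c * cmod z \<le> c * 1" using that by (intro mult_left_mono) auto
    then have "c * cmod z < 1" using that by linarith
    then show ?thesis using that by (simp add: norm_mult)
  qed
  have h: "h holomorphic_on ball 0 1"
    unfolding h_def using dil[OF _ \<rho>]
    by (intro holomorphic_intros f holomorphic_on_compose_gen[OF _ f, unfolded o_def]) auto
  define R where "R m = 1 - 1 / (real m + 2)" for m
  have R: "0 < R m" "R m < 1" for m by (auto simp: R_def divide_simps)
  define U where "U m = {t. \<exists>r. 0 \<le> r \<and> r < 1 \<and> cmod (h (of_real (R m) * (of_real r * cis t))) > l}" for m
  have U: "open (U m) \<and> emeasure circ (U m) \<le> ennreal \<eta>" for m
  proof -
    define g where "g z = h (of_real (R m) * z)" for z
    have g: "continuous_on (cball 0 1) g" "g holomorphic_on ball 0 1"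
      unfolding g_def using dil[OF _ R]
      by (auto intro!: continuous_on_compose2[OF holomorphic_on_imp_continuous_on[OF h]] continuous_intros
            holomorphic_on_compose_gen[OF _ h, unfolded o_def] holomorphic_intros)
    have contg: "continuous_on UNIV (\<lambda>t. g (cis t))"
      by (rule continuous_on_compose2[OF g(1)]) (auto intro!: continuous_intros)
    have int2: "(LINT t|circ. (cmod (g (cis t)))\<^sup>2) \<le> \<delta>\<^sup>2"
      using L2[OF R] by (simp add: g_def h_def mult.assoc)
    have "cmod (g (cis t)) \<le> \<delta> + (cmod (g (cis t)))\<^sup>2 / \<delta>" for t
    proof (cases "cmod (g (cis t)) \<le> \<delta>")
      case True then show ?thesis using \<delta> by (simp add: add_increasing2)
    next
      case False
      then have "cmod (g (cis t)) * \<delta> \<le> cmod (g (cis t)) * cmod (g (cis t))"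
        by (intro mult_left_mono) auto
      then have "cmod (g (cis t)) \<le> (cmod (g (cis t)))\<^sup>2 / \<delta>"
        using \<delta> by (simp add: power2_eq_square pos_le_divide_eq)
      then show ?thesis using \<delta> by linarith
    qed
    then have "(LINT t|circ. cmod (g (cis t))) \<le> (LINT t|circ. \<delta> + (cmod (g (cis t)))\<^sup>2 / \<delta>)"
      using \<delta> by (intro integral_mono integrable_circ_cont continuous_intros contg) auto
    also have "\<dots> = \<delta> + (LINT t|circ. (cmod (g (cis t)))\<^sup>2) / \<delta>"
      using integrable_circ_cont[of "\<lambda>t. (cmod (g (cis t)))\<^sup>2"] contg
      by (subst Bochner_Integration.integral_add)
         (use \<delta> in \<open>auto intro!: integrable_circ_cont continuous_intros simp: circ.prob_space[simplified]\<close>)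
    also have "\<dots> \<le> \<delta> + \<delta>\<^sup>2 / \<delta>"
      using int2 \<delta> by (intro add_left_mono divide_right_mono) auto
    also have "\<dots> = 2 * \<delta>" using \<delta> by (simp add: power2_eq_square)
    finally have L1: "(LINT t|circ. cmod (g (cis t))) \<le> 2 * \<delta>" .
    have "(\<integral>\<^sup>+t. ennreal (cmod (g (cis t))) \<partial>circ) = ennreal (LINT t|circ. cmod (g (cis t)))"
      by (intro nn_integral_eq_integral integrable_circ_cont continuous_intros contg) auto
    then have "ennreal (15 / l) * (\<integral>\<^sup>+t. ennreal (cmod (g (cis t))) \<partial>circ) = ennreal (15 / l * (LINT t|circ. cmod (g (cis t))))"
      using l by (simp only: ennreal_mult'[symmetric] divide_nonneg_pos)
    also have "\<dots> \<le> ennreal (15 / l * (2 * \<delta>))"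
      using L1 l by (intro ennreal_leI mult_left_mono) auto
    also have "15 / l * (2 * \<delta>) = \<eta>" using l by (simp add: \<delta>_def)
    finally show ?thesis
      using radial_maximal_inequality[OF g l] by (auto simp: U_def g_def)
  qed
  have Rmono: "R m \<le> R n" if "m \<le> n" for m n
    using that by (auto simp: R_def frac_le)
  have "incseq U"
  proof (rule incseq_SucI)
    fix m
    show "U m \<subseteq> U (Suc m)"
    proof
      fix t assume "t \<in> U m"
      then obtain r where r: "0 \<le> r" "r < 1" "cmod (h (of_real (R m) * (of_real r * cis t))) > l"
        by (auto simp: U_def)
      define r' where "r' = R m * r / R (Suc m)"
      have "R m * r / R (Suc m) \<le> 1 * r"
      proof -
        have "R m * r \<le> R (Suc m) * r" using Rmono[of m "Suc m"] r by (intro mult_right_mono) auto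
        then show ?thesis using R[of "Suc m"] by (simp add: pos_divide_le_eq mult.commute)
      qed
      then have "r' < 1" using r(2) unfolding r'_def by linarith
      moreover have "0 \<le> r'" using r R[of m] R[of "Suc m"] by (simp add: r'_def)
      moreover have "R (Suc m) * r' = R m * r" using R[of "Suc m"] by (simp add: r'_def)
      then have eqR: "complex_of_real (R (Suc m)) * (of_real r' * cis t) = of_real (R m) * (of_real r * cis t)"
        by (metis mult.assoc of_real_mult)
      ultimately show "t \<in> U (Suc m)"
        unfolding U_def mem_Collect_eq using r(3) by (intro exI[of _ r'] conjI) (simp_all only: eqR)
    qed
  qed
  have "emeasure circ (\<Union>m. U m) = (SUP m. emeasure circ (U m))"
    using U by (intro SUP_emeasure_incseq[symmetric] \<open>incseq U\<close>) auto
  also have "\<dots> \<le> ennreal \<eta>"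
    using U by (intro SUP_least) auto
  finally have "emeasure circ (\<Union>m. U m) \<le> ennreal \<eta>" .
  moreover have "cmod (f (of_real r * cis t) - f (of_real (\<rho> * r) * cis t)) \<le> l"
    if "t \<notin> (\<Union>m. U m)" "0 \<le> r" "r < 1" for t r
  proof -
    have "R \<longlonglongrightarrow> 1"
      unfolding R_def by real_asymp
    then have "\<forall>\<^sub>F m in sequentially. R m > r"
      using that(3) by (rule order_tendstoD)
    then obtain m where m: "R m > r" by (auto simp: eventually_sequentially)
    have "t \<notin> U m" "0 \<le> r / R m" "r / R m < 1" using that(1,2) m R[of m] by auto
    then have "\<not> cmod (h (of_real (R m) * (of_real (r / R m) * cis t))) > l"
      unfolding U_def mem_Collect_eq by blast
    moreover have "complex_of_real (R m) * (of_real (r / R m) * cis t) = of_real r * cis t"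
      using R[of m] by simp
    ultimately show ?thesis by (simp add: h_def mult.assoc)
  qed
  ultimately show ?thesis
    using \<rho> U by (intro exI[of _ \<rho>] exI[of _ "\<Union>m. U m"]) auto
qed

text \<open>Off a set of small measure the oscillation of \<open>f\<close> at the end of a radius is at most
  that of \<open>f(\<rho> z)\<close>, which is continuous across the circle, plus a small error.\<close>

theorem Fatou_radial_limit:
  assumes f: "f holomorphic_on ball 0 1" and bd: "\<And>z. cmod z < 1 \<Longrightarrow> cmod (f z) \<le> B"
  shows "AE t in circ. \<exists>l. ((\<lambda>r. f (of_real r * cis t)) \<longlongrightarrow> l) (at_left (1::real))"
proof -
  define B' where "B' = max B 1"
  have B': "B' > 0" by (simp add: B'_def)
  define F where "F z = f z / of_real B'" for z
  have F: "F holomorphic_on ball 0 1" unfolding F_def using B' by (intro holomorphic_intros f) auto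
  have F1: "cmod (F z) \<le> 1" if "cmod z < 1" for z
    using bd[OF that] B' by (simp add: F_def norm_divide divide_le_eq B'_def le_max_iff_disj)
  define good where "good l t \<longleftrightarrow> (\<exists>r0<1. \<forall>r s. r0 < r \<and> r < 1 \<and> r0 < s \<and> s < 1 \<longrightarrow>
       cmod (F (of_real r * cis t) - F (of_real s * cis t)) \<le> 3 * l)" for l t
  have AE_good: "AE t in circ. good l t" if l: "l > 0" for l :: real
  proof -
    have "\<exists>U. open U \<and> emeasure circ U \<le> ennreal (1 / real (Suc n)) \<and> (\<forall>t. t \<notin> U \<longrightarrow> good l t)" for n
    proof -
      obtain \<rho> U where \<rho>: "0 < \<rho>" "\<rho> < 1" "open U" "emeasure circ U \<le> ennreal (1 / real (Suc n))"
        and U: "\<And>t r. t \<notin> U \<Longrightarrow> 0 \<le> r \<Longrightarrow> r < 1 \<Longrightarrow> cmod (F (of_real r * cis t) - F (of_real (\<rho> * r) * cis t)) \<le> l"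
        using dilation_maximal_small[OF F F1 l, of "1 / real (Suc n)"] by auto
      have "good l t" if t: "t \<notin> U" for t
      proof -
        have "isCont F (of_real \<rho> * cis t)"
          using \<rho> by (intro continuous_on_interior[OF holomorphic_on_imp_continuous_on[OF F]])
            (auto simp: norm_mult interior_open)
        then have "((\<lambda>r. F (of_real (\<rho> * r) * cis t)) \<longlongrightarrow> F (of_real (\<rho> * 1) * cis t)) (at_left 1)"
          by (intro isCont_tendsto_compose[where g = F] tendsto_intros) auto
        then have "\<forall>\<^sub>F r in at_left 1. dist (F (of_real (\<rho> * r) * cis t)) (F (of_real (\<rho> * 1) * cis t)) < l / 2"
          using l by (intro tendstoD) auto
        then obtain r1 where r1: "r1 < 1" "\<And>r. r1 < r \<Longrightarrow> r < 1 \<Longrightarrow> dist (F (of_real (\<rho> * r) * cis t)) (F (of_real (\<rho> * 1) * cis t)) < l / 2"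
          unfolding eventually_at_left_field by blast
        show ?thesis unfolding good_def
        proof (intro exI[of _ "max r1 0"] conjI allI impI)
          fix r s assume rs: "max r1 0 < r \<and> r < 1 \<and> max r1 0 < s \<and> s < 1"
          have "dist (F (of_real (\<rho> * r) * cis t)) (F (of_real (\<rho> * s) * cis t)) < l"
            by (rule dist_triangle_half_l[OF r1(2) r1(2)]) (use rs in auto)
          then have "cmod (F (of_real (\<rho> * r) * cis t) - F (of_real (\<rho> * s) * cis t)) < l"
            by (simp add: dist_norm)
          moreover have "cmod (F (of_real r * cis t) - F (of_real (\<rho> * r) * cis t)) \<le> l"
            "cmod (F (of_real s * cis t) - F (of_real (\<rho> * s) * cis t)) \<le> l"
            using U[OF t] rs by auto
          moreover have "cmod (A + B - C) \<le> cmod A + cmod B + cmod C" for A B C :: complex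
            using norm_triangle_ineq4[of "A + B" C] norm_triangle_ineq[of A B] by linarith
          from this[of "F (of_real r * cis t) - F (of_real (\<rho> * r) * cis t)"
              "F (of_real (\<rho> * r) * cis t) - F (of_real (\<rho> * s) * cis t)"
              "F (of_real s * cis t) - F (of_real (\<rho> * s) * cis t)"]
          have "cmod (F (of_real r * cis t) - F (of_real s * cis t)) \<le>
              cmod (F (of_real r * cis t) - F (of_real (\<rho> * r) * cis t)) +
              cmod (F (of_real (\<rho> * r) * cis t) - F (of_real (\<rho> * s) * cis t)) +
              cmod (F (of_real s * cis t) - F (of_real (\<rho> * s) * cis t))"
            by (simp add: algebra_simps)
          ultimately show "cmod (F (of_real r * cis t) - F (of_real s * cis t)) \<le> 3 * l"
            by linarith
        qed (use r1 in auto)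
      qed
      then show ?thesis using \<rho> by auto
    qed
    then obtain U where U: "\<And>n. open (U n)" "\<And>n. emeasure circ (U n) \<le> ennreal (1 / real (Suc n))"
      "\<And>n t. t \<notin> U n \<Longrightarrow> good l t" by metis
    have "emeasure circ (\<Inter>n. U n) \<le> 0"
    proof (rule ccontr)
      assume "\<not> ?thesis"
      then have pos: "emeasure circ (\<Inter>n. U n) > 0" by (simp only: not_le)
      have fin: "emeasure circ (\<Inter>n. U n) = ennreal (measure circ (\<Inter>n. U n))"
        by (rule circ.emeasure_eq_measure)
      have "(\<lambda>n. 1 / real (Suc n)) \<longlonglongrightarrow> 0" by real_asymp
      moreover have "measure circ (\<Inter>n. U n) > 0" using pos fin by simp
      ultimately have "\<forall>\<^sub>F n in sequentially. 1 / real (Suc n) < measure circ (\<Inter>n. U n)"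
        by (rule order_tendstoD)
      then obtain n where n: "1 / real (Suc n) < measure circ (\<Inter>n. U n)"
        by (auto simp: eventually_sequentially)
      have "emeasure circ (\<Inter>n. U n) \<le> emeasure circ (U n)"
        using U(1) by (intro emeasure_mono) auto
      also have "\<dots> \<le> ennreal (1 / real (Suc n))" by (rule U(2))
      finally show False using n by (simp add: fin)
    qed
    then have "(\<Inter>n. U n) \<in> null_sets circ"
      using U(1) by (intro null_setsI) auto
    then show ?thesis
      by (rule AE_I') (use U(3) in auto)
  qed
  have "AE t in circ. \<forall>n. good (1 / real (Suc n)) t"
    by (subst AE_all_countable) (auto intro!: AE_good)
  then show ?thesis
  proof (rule AE_mp, intro AE_I2 impI)
    fix t assume gd: "\<forall>n. good (1 / real (Suc n)) t"
    define X where "X n = F (of_real (1 - 1 / real (Suc n)) * cis t)" for n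
    have small: "\<exists>r0<1. \<forall>r s. r0 < r \<and> r < 1 \<and> r0 < s \<and> s < 1 \<longrightarrow>
       cmod (F (of_real r * cis t) - F (of_real s * cis t)) < e" if "e > 0" for e
    proof -
      obtain n where n: "3 / real (Suc n) < e"
      proof -
        have "(\<lambda>n. 3 / real (Suc n)) \<longlonglongrightarrow> 0" by real_asymp
        then have "\<forall>\<^sub>F n in sequentially. 3 / real (Suc n) < e" using \<open>e > 0\<close> by (rule order_tendstoD)
        then show ?thesis using that by (auto simp: eventually_sequentially)
      qed
      from gd obtain r0 where "r0 < 1" "\<And>r s. r0 < r \<and> r < 1 \<and> r0 < s \<and> s < 1 \<Longrightarrow>
         cmod (F (of_real r * cis t) - F (of_real s * cis t)) \<le> 3 * (1 / real (Suc n))"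
        unfolding good_def by meson
      then show ?thesis using n by (intro exI[of _ r0]) fastforce
    qed
    have to1: "(\<lambda>n. 1 - 1 / real (Suc n)) \<longlonglongrightarrow> 1" by real_asymp
    have near: "\<forall>\<^sub>F n in sequentially. 1 - 1 / real (Suc n) > r0" if "r0 < 1" for r0
      using to1 that by (rule order_tendstoD)
    have "Cauchy X"
    proof (rule metric_CauchyI)
      fix e :: real assume "e > 0"
      from small[OF this] obtain r0 where r0: "r0 < 1" "\<And>r s. r0 < r \<and> r < 1 \<and> r0 < s \<and> s < 1 \<Longrightarrow>
         cmod (F (of_real r * cis t) - F (of_real s * cis t)) < e" by blast
      from near[OF r0(1)] obtain N where "\<And>n. n \<ge> N \<Longrightarrow> 1 - 1 / real (Suc n) > r0"
        by (auto simp: eventually_sequentially)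
      then show "\<exists>M. \<forall>m\<ge>M. \<forall>n\<ge>M. dist (X m) (X n) < e"
        unfolding X_def dist_norm by (intro exI[of _ N] allI impI r0(2)) simp
    qed
    then obtain L where L: "X \<longlonglongrightarrow> L" using Cauchy_convergent_iff convergent_def by blast
    have "((\<lambda>r. F (of_real r * cis t)) \<longlongrightarrow> L) (at_left 1)"
    proof (rule tendstoI)
      fix e :: real assume e: "e > 0"
      from small[of "e/2"] e obtain r0 where r0: "r0 < 1" "\<And>r s. r0 < r \<and> r < 1 \<and> r0 < s \<and> s < 1 \<Longrightarrow>
         cmod (F (of_real r * cis t) - F (of_real s * cis t)) < e/2" by (meson half_gt_zero)
      have "\<forall>\<^sub>F n in sequentially. dist (X n) L < e / 2"
        using L e by (intro tendstoD) auto
      from eventually_conj[OF this near[OF r0(1)]] obtain n where n: "dist (X n) L < e/2" "1 - 1 / real (Suc n) > r0"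
        by (auto simp: eventually_sequentially)
      have "dist (F (of_real r * cis t)) L < e" if "r0 < r" "r < 1" for r
      proof (rule dist_triangle_half_r[OF _ n(1)])
        show "dist (X n) (F (of_real r * cis t)) < e / 2"
          using r0(2)[of "1 - 1 / real (Suc n)" r] n(2) that by (simp add: X_def dist_norm)
      qed
      then show "\<forall>\<^sub>F r in at_left 1. dist (F (of_real r * cis t)) L < e"
        unfolding eventually_at_left_field using r0(1) by blast
    qed
    then have "((\<lambda>r. of_real B' * F (of_real r * cis t)) \<longlongrightarrow> of_real B' * L) (at_left 1)"
      by (intro tendsto_intros)
    then show "\<exists>l. ((\<lambda>r. f (of_real r * cis t)) \<longlongrightarrow> l) (at_left (1::real))"
      using B' by (auto simp: F_def)
  qed
qed

section \<open>Moebius transformations of the sphere\<close>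

text \<open>The parametrization of the sphere near infinity. Together with \<open>Cpx\<close> it describes the
  topology by plane sets only.\<close>

definition Rcp :: "complex \<Rightarrow> riemann_sphere" where
  "Rcp z = (if z = 0 then Infty else Cpx (1 / z))"

text \<open>A neighbourhood of infinity is the complement of a compact set, which the inversion maps to a
  neighbourhood of 0.\<close>

lemma open_sphere_charts: "open U \<longleftrightarrow> open (Cpx -` U) \<and> open (Rcp -` U)"
proof
  assume U: "open U"
  then have o: "open (Cpx -` U)" and c: "Infty \<in> U \<Longrightarrow> compact (- (Cpx -` U))"
    by (auto simp: open_riemann_sphere_iff)
  have "open (- {0 :: complex} \<inter> (\<lambda>z. 1 / z) -` (Cpx -` U))"
    by (rule continuous_open_preimage) (auto intro!: continuous_intros o)
  then have punct: "open ((\<lambda>z. 1 / z) -` (Cpx -` U) \<inter> - {0 :: complex})"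
    by (simp only: Int_commute)
  have "\<exists>e>0. ball z e \<subseteq> Rcp -` U" if z: "z \<in> Rcp -` U" for z
  proof (cases "z = 0")
    case True
    then have "compact (- (Cpx -` U))" using z c by (simp add: Rcp_def)
    then obtain B where B: "B > 0" "\<And>w. w \<in> - (Cpx -` U) \<Longrightarrow> cmod w \<le> B"
      using compact_imp_bounded bounded_pos by metis
    have "w \<in> Rcp -` U" if w: "cmod w < 1 / B" for w
    proof (cases "w = 0")
      case False
      then have "cmod (1 / w) > B" using w B(1) by (simp add: norm_divide field_simps)
      then show ?thesis using B(2)[of "1 / w"] False by (auto simp: Rcp_def)
    qed (use z True in auto)
    then show ?thesis using True B(1) by (intro exI[of _ "1 / B"]) auto
  next
    case False
    then have "z \<in> (\<lambda>z. 1 / z) -` (Cpx -` U) \<inter> - {0}" using z by (simp add: Rcp_def)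
    then obtain e where "e > 0" "ball z e \<subseteq> (\<lambda>z. 1 / z) -` (Cpx -` U) \<inter> - {0}"
      using punct open_contains_ball by meson
    moreover have "w \<in> Rcp -` U" if "w \<in> (\<lambda>z. 1 / z) -` (Cpx -` U) \<inter> - {0}" for w
      using that by (simp add: Rcp_def)
    ultimately show ?thesis by blast
  qed
  then have "open (Rcp -` U)" by (simp add: open_contains_ball)
  then show "open (Cpx -` U) \<and> open (Rcp -` U)" using o by simp
next
  assume U: "open (Cpx -` U) \<and> open (Rcp -` U)"
  have "compact (- (Cpx -` U))" if "Infty \<in> U"
  proof -
    have "0 \<in> Rcp -` U" using that by (simp add: Rcp_def)
    then obtain e where e: "e > 0" "ball 0 e \<subseteq> Rcp -` U"
      using U open_contains_ball by meson
    have "cmod z \<le> 1 / e" if z: "Cpx z \<notin> U" for z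
    proof (rule ccontr)
      assume "\<not> cmod z \<le> 1 / e"
      then have "cmod z > 1 / e" by simp
      moreover have "1 / e > 0" using e(1) by simp
      ultimately have "cmod z > 0" by linarith
      then have "z \<noteq> 0" "cmod (1 / z) < e"
        using e(1) \<open>cmod z > 1 / e\<close> by (auto simp: norm_divide field_simps)
      then have "Rcp (1 / z) \<in> U" using e(2) by (auto simp: subset_iff)
      then show False using z \<open>z \<noteq> 0\<close> by (simp add: Rcp_def)
    qed
    then have "bounded (- (Cpx -` U))" by (intro boundedI[of _ "1 / e"]) auto
    moreover have "closed (- (Cpx -` U))" using U by (simp add: closed_Compl)
    ultimately show ?thesis by (simp add: compact_eq_bounded_closed)
  qed
  then show "open U" using U by (simp add: open_riemann_sphere_iff)
qed

lemma continuous_Cpx: "continuous_on A Cpx"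
  by (rule continuous_on_subset[of UNIV])
     (auto simp: continuous_on_open_vimage open_sphere_charts)

lemma continuous_Rcp: "continuous_on A Rcp"
  by (rule continuous_on_subset[of UNIV])
     (auto simp: continuous_on_open_vimage open_sphere_charts)

lemma continuous_from_sphereI:
  assumes "continuous_on UNIV (\<lambda>z. g (Cpx z))" "continuous_on UNIV (\<lambda>z. g (Rcp z))"
  shows "continuous_on A g"
proof (rule continuous_on_subset[of UNIV])
  show "continuous_on UNIV g"
    using assms by (auto simp: continuous_on_open_vimage open_sphere_charts vimage_def)
qed auto

lemma open_Cpx_image: "open (Cpx ` V) \<longleftrightarrow> open V"
proof -
  have "Cpx -` (Cpx ` V) = V" "Infty \<notin> Cpx ` V" by auto
  then show ?thesis by (simp add: open_riemann_sphere_iff)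
qed

instance riemann_sphere :: t2_space
proof
  have fin_inf: "\<exists>U V. open U \<and> open V \<and> Cpx a \<in> U \<and> Infty \<in> V \<and> U \<inter> V = {}" for a
  proof (intro exI conjI)
    show "open (Cpx ` ball a 1)" by (simp add: open_Cpx_image)
    have "Cpx -` (- (Cpx ` cball a 1)) = - cball a 1" by auto
    then show "open (- (Cpx ` cball a 1))"
      by (auto simp: open_riemann_sphere_iff)
  qed auto
  fix x y :: riemann_sphere assume "x \<noteq> y"
  then show "\<exists>U V. open U \<and> open V \<and> x \<in> U \<and> y \<in> V \<and> U \<inter> V = {}"
  proof (cases x; cases y)
    fix a b assume xy: "x = Cpx a" "y = Cpx b"
    then have "a \<noteq> b" using \<open>x \<noteq> y\<close> by simp
    then obtain U V where "open U" "open V" "a \<in> U" "b \<in> V" "U \<inter> V = {}"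
      using hausdorff by metis
    then show ?thesis using xy
      by (intro exI[of _ "Cpx ` U"] exI[of _ "Cpx ` V"]) (auto simp: open_Cpx_image)
  next
    fix a assume "x = Cpx a" "y = Infty"
    then show ?thesis using fin_inf[of a] by simp
  next
    fix b assume "x = Infty" "y = Cpx b"
    then show ?thesis using fin_inf[of b] by (metis Int_commute)
  qed simp
qed

lemma continuous_chart0: "continuous_on (range Cpx) chart0"
proof -
  have "open (range Cpx)" by (simp add: open_Cpx_image)
  moreover have "open (chart0 -` B \<inter> range Cpx)" if "open B" for B
  proof -
    have "chart0 -` B \<inter> range Cpx = Cpx ` B" by auto
    then show ?thesis using that by (simp add: open_Cpx_image)
  qed
  ultimately show ?thesis by (simp add: continuous_on_open_vimage)
qed

fun recip :: "riemann_sphere \<Rightarrow> riemann_sphere" where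
  "recip Infty = Cpx 0"
| "recip (Cpx z) = Rcp z"

fun translate :: "complex \<Rightarrow> riemann_sphere \<Rightarrow> riemann_sphere" where
  "translate b Infty = Infty"
| "translate b (Cpx z) = Cpx (z + b)"

lemma recip_Rcp [simp]: "recip (Rcp z) = Cpx z"
  by (simp add: Rcp_def)

lemma recip_recip [simp]: "recip (recip x) = x"
  by (cases x) (auto simp: Rcp_def)

lemma continuous_recip: "continuous_on A recip"
  by (rule continuous_from_sphereI) (auto intro: continuous_Rcp continuous_Cpx)

lemma continuous_translate: "continuous_on A (translate b)"
proof (rule continuous_from_sphereI)
  show "continuous_on UNIV (\<lambda>z. translate b (Cpx z))"
    by (auto intro!: continuous_on_compose2[OF continuous_Cpx] continuous_intros)
  define V where "V = {z. 1 + b * z \<noteq> 0}"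
  have "open V" unfolding V_def by (intro open_Collect_neq continuous_intros)
  have 1: "continuous_on V (\<lambda>z. translate b (Rcp z))"
  proof (rule continuous_on_eq)
    show "continuous_on V (\<lambda>z. Rcp (z / (1 + b * z)))"
      by (auto intro!: continuous_on_compose2[OF continuous_Rcp[of UNIV]] continuous_intros simp: V_def)
    fix z assume "z \<in> V"
    then show "Rcp (z / (1 + b * z)) = translate b (Rcp z)"
      by (auto simp: Rcp_def V_def field_simps)
  qed
  have 2: "continuous_on (-{0}) (\<lambda>z. translate b (Rcp z))"
  proof (rule continuous_on_eq)
    show "continuous_on (-{0}) (\<lambda>z. Cpx (1 / z + b))"
      by (auto intro!: continuous_on_compose2[OF continuous_Cpx[of UNIV]] continuous_intros)
  qed (auto simp: Rcp_def)
  have "continuous_on (V \<union> -{0}) (\<lambda>z. translate b (Rcp z))"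
    by (rule continuous_on_open_Un[OF \<open>open V\<close> _ 1 2]) auto
  moreover have "V \<union> -{0} = UNIV" by (auto simp: V_def)
  ultimately show "continuous_on UNIV (\<lambda>z. translate b (Rcp z))" by simp
qed

lemma send_Cpx: "send_to_infinity (Cpx a) x = recip (translate (-a) x)"
  by (cases x) (auto simp: Rcp_def)

text \<open>The inverse of \<open>send_to_infinity a\<close>.\<close>

fun unsend :: "riemann_sphere \<Rightarrow> riemann_sphere \<Rightarrow> riemann_sphere" where
  "unsend Infty x = x"
| "unsend (Cpx a) x = translate a (recip x)"

lemma translate_translate [simp]: "translate a (translate b x) = translate (a + b) x"
  by (cases x) (auto simp: add_ac)

lemma translate_0 [simp]: "translate 0 x = x"
  by (cases x) auto

lemma unsend_send [simp]: "unsend a (send_to_infinity a x) = x"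
  by (cases a) (auto simp: send_Cpx)

lemma send_unsend [simp]: "send_to_infinity a (unsend a x) = x"
  by (cases a) (auto simp: send_Cpx)

lemma send_self [simp]: "send_to_infinity a a = Infty"
  by (cases a) auto

lemma send_eq_Infty_iff [simp]: "send_to_infinity a x = Infty \<longleftrightarrow> x = a"
  by (metis send_self unsend_send)

lemma continuous_send: "continuous_on A (send_to_infinity a)"
proof (cases a)
  case (Cpx z)
  have "send_to_infinity a = (\<lambda>x. recip (translate (-z) x))" using Cpx by (auto simp: send_Cpx)
  then show ?thesis
    by (auto intro!: continuous_on_compose2[OF continuous_recip[of UNIV]] continuous_translate)
next
  case Infty
  have "send_to_infinity a = (\<lambda>x. x)" using Infty by (auto)
  then show ?thesis by simp
qed

lemma continuous_unsend: "continuous_on A (unsend a)"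
proof (cases a)
  case (Cpx z)
  have "unsend a = (\<lambda>x. translate z (recip x))" using Cpx by auto
  then show ?thesis
    by (auto intro!: continuous_on_compose2[OF continuous_translate[of UNIV]] continuous_recip)
next
  case Infty
  have "unsend a = (\<lambda>x. x)" using Infty by (auto)
  then show ?thesis by simp
qed

lemma homeomorphism_send: "homeomorphism UNIV UNIV (send_to_infinity a) (unsend a)"
  by (rule homeomorphismI) (auto intro: continuous_send continuous_unsend)

lemma inj_send: "inj (send_to_infinity a)"
  by (metis injI unsend_send)

lemma send_image_eq: "send_to_infinity a ` S = unsend a -` S"
  by (force simp: image_iff)

lemma open_send_image: "open S \<Longrightarrow> open (send_to_infinity a ` S)"
  unfolding send_image_eq using continuous_unsend[of UNIV a]
  by (auto simp: continuous_on_open_vimage)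

lemma closure_send_image: "closure (send_to_infinity a ` S) = send_to_infinity a ` closure S"
proof
  show "send_to_infinity a ` closure S \<subseteq> closure (send_to_infinity a ` S)"
    by (rule image_closure_subset[OF continuous_send]) (auto simp: closure_subset)
  have "closed (send_to_infinity a ` closure S)"
    unfolding send_image_eq
    using continuous_closed_vimage[of "closure S" "unsend a"] continuous_unsend[of UNIV a]
    by (auto simp: continuous_on_eq_continuous_at)
  then show "closure (send_to_infinity a ` S) \<subseteq> send_to_infinity a ` closure S"
    by (intro closure_minimal image_mono closure_subset)
qed

lemma frontier_send_image: "frontier (send_to_infinity a ` S) = send_to_infinity a ` frontier S"
proof -
  have "- (send_to_infinity a ` S) = send_to_infinity a ` (- S)"
    by (auto simp: send_image_eq)
  then show ?thesis
    by (simp add: frontier_closures closure_send_image image_Int[OF inj_send])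
qed

lemma has_radial_limit_send:
  "has_radial_limit (\<lambda>z. send_to_infinity a (p z)) \<zeta> \<longleftrightarrow> has_radial_limit p \<zeta>"
proof
  assume "has_radial_limit p \<zeta>"
  then obtain l where "((\<lambda>r. p (of_real r * \<zeta>)) \<longlongrightarrow> l) (at_left (1::real))"
    by (auto simp: has_radial_limit_def)
  moreover have "isCont (send_to_infinity a) l"
    using continuous_send[of UNIV a] by (simp add: continuous_on_eq_continuous_at)
  ultimately have "((\<lambda>r. send_to_infinity a (p (of_real r * \<zeta>))) \<longlongrightarrow> send_to_infinity a l) (at_left (1::real))"
    by (metis isCont_tendsto_compose)
  then show "has_radial_limit (\<lambda>z. send_to_infinity a (p z)) \<zeta>"
    unfolding has_radial_limit_def by blast
next
  assume "has_radial_limit (\<lambda>z. send_to_infinity a (p z)) \<zeta>"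
  then obtain l where "((\<lambda>r. send_to_infinity a (p (of_real r * \<zeta>))) \<longlongrightarrow> l) (at_left (1::real))"
    by (auto simp: has_radial_limit_def)
  moreover have "isCont (unsend a) l"
    using continuous_unsend[of UNIV a] by (simp add: continuous_on_eq_continuous_at)
  ultimately have "((\<lambda>r. unsend a (send_to_infinity a (p (of_real r * \<zeta>)))) \<longlongrightarrow> unsend a l) (at_left (1::real))"
    by (metis isCont_tendsto_compose)
  then show "has_radial_limit p \<zeta>"
    by (auto simp: has_radial_limit_def)
qed

lemma covering_space_homeomorphism_compose:
  assumes cov: "covering_space c p S" and h: "homeomorphism S S' h h'"
  shows "covering_space c (\<lambda>z. h (p z)) S'"
proof
  have pim: "p ` c = S" by (rule covering_space_imp_surjective[OF cov])
  show "continuous_on c (\<lambda>z. h (p z))"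
    by (rule continuous_on_compose2[OF homeomorphism_cont1[OF h] covering_space_imp_continuous[OF cov]])
       (use pim in auto)
  show "(\<lambda>z. h (p z)) ` c = S'"
    using pim homeomorphism_image1[OF h] by (auto simp: image_image[symmetric])
  fix y assume "y \<in> S'"
  then obtain x where x: "x \<in> S" "y = h x" using homeomorphism_image1[OF h] by auto
  with cov obtain T v where T: "x \<in> T" "openin (top_of_set S) T" "\<Union>v = c \<inter> p -` T"
    "\<forall>u \<in> v. openin (top_of_set c) u" "pairwise disjnt v" "\<forall>u \<in> v. \<exists>q. homeomorphism u T p q"
    unfolding covering_space_def by meson
  have TS: "T \<subseteq> S" using T(2) openin_imp_subset by blast
  show "\<exists>T. y \<in> T \<and> openin (top_of_set S') T \<and>
          (\<exists>v. \<Union>v = c \<inter> (\<lambda>z. h (p z)) -` T \<and> (\<forall>u \<in> v. openin (top_of_set c) u) \<and>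
            pairwise disjnt v \<and> (\<forall>u \<in> v. \<exists>q. homeomorphism u T (\<lambda>z. h (p z)) q))"
  proof (intro exI[of _ "h ` T"] conjI exI[of _ v])
    show "openin (top_of_set S') (h ` T)" by (rule homeomorphism_imp_open_map[OF h T(2)])
    have "h (p z) \<in> h ` T \<longleftrightarrow> p z \<in> T" if "z \<in> c" for z
    proof
      assume "h (p z) \<in> h ` T"
      then obtain t where t: "t \<in> T" "h (p z) = h t" by auto
      have "p z = h' (h (p z))" using that pim by (intro homeomorphism_apply1[OF h, symmetric]) auto
      also have "\<dots> = t" unfolding t(2) using t(1) TS by (intro homeomorphism_apply1[OF h]) auto
      finally show "p z \<in> T" using t(1) by simp
    qed auto
    then show "\<Union>v = c \<inter> (\<lambda>z. h (p z)) -` (h ` T)"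
      using T(3) by auto
    have "homeomorphism T (h ` T) h h'"
      by (rule homeomorphism_of_subsets[OF h TS empty_subsetI refl])
    then show "\<forall>u \<in> v. \<exists>q. homeomorphism u (h ` T) (\<lambda>z. h (p z)) q"
    proof (intro ballI)
      fix u assume "u \<in> v"
      then obtain q where "homeomorphism u T p q" using T(6) by auto
      from homeomorphism_compose[OF this \<open>homeomorphism T (h ` T) h h'\<close>]
      show "\<exists>q. homeomorphism u (h ` T) (\<lambda>z. h (p z)) q"
        by (auto simp: o_def)
    qed
  qed (use x T in auto)
qed

lemma covering_space_send:
  assumes "covering_space c p S"
  shows "covering_space c (\<lambda>z. send_to_infinity a (p z)) (send_to_infinity a ` S)"
  by (rule covering_space_homeomorphism_compose[OF assms
        homeomorphism_of_subsets[OF homeomorphism_send subset_UNIV subset_UNIV refl]])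

lemma sphere_holomorphic_on_send:
  assumes p: "sphere_holomorphic_on p S" and S: "open S"
  shows "sphere_holomorphic_on (\<lambda>z. send_to_infinity a (p z)) S"
proof (cases a)
  case Infty
  then have "(\<lambda>z. send_to_infinity a (p z)) = p" by auto
  then show ?thesis using p by simp
next
  case (Cpx b)
  have cont: "continuous_on S p" using p by (simp add: sphere_holomorphic_on_def)
  have near: "\<forall>\<^sub>F w in nhds z. p w \<noteq> y" if "z \<in> S" "p z \<noteq> y" for z y
  proof -
    have "open (p -` (-{y}) \<inter> S)"
      using cont S by (auto simp: continuous_on_open_vimage)
    moreover have "z \<in> p -` (-{y}) \<inter> S" using that by auto
    ultimately have "\<forall>\<^sub>F w in nhds z. w \<in> p -` (-{y}) \<inter> S" by (rule eventually_nhds_in_open)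
    then show ?thesis by eventually_elim auto
  qed
  show ?thesis unfolding sphere_holomorphic_on_def
  proof (intro conjI ballI impI)
    show "continuous_on S (\<lambda>z. send_to_infinity a (p z))"
      by (auto intro!: continuous_on_compose2[OF continuous_send[of UNIV]] cont)
    fix z assume z: "z \<in> S"
    {
      assume "send_to_infinity a (p z) \<noteq> Infty"
      then have pa: "p z \<noteq> Cpx b" using Cpx by simp
      show "(\<lambda>w. chart0 (send_to_infinity a (p w))) analytic_on {z}"
      proof (cases "p z = Infty")
        case True
        then have "(\<lambda>w. chart1 (p w)) analytic_on {z}"
          using p z by (auto simp: sphere_holomorphic_on_def)
        then have "(\<lambda>w. chart1 (p w) / (1 - b * chart1 (p w))) analytic_on {z}"
          using True by (intro analytic_intros) auto
        moreover have "\<forall>\<^sub>F w in nhds z. chart1 (p w) / (1 - b * chart1 (p w)) = chart0 (send_to_infinity a (p w))"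
        proof -
          have "p z \<noteq> Cpx 0" using True by simp
          from near[OF z this] near[OF z pa] show ?thesis
          proof eventually_elim
            case (elim w)
            then show ?case using Cpx by (cases "p w") (auto simp: field_simps)
          qed
        qed
        ultimately show ?thesis by (metis analytic_at_cong)
      next
        case False
        then have an: "(\<lambda>w. chart0 (p w)) analytic_on {z}"
          using p z by (auto simp: sphere_holomorphic_on_def)
        have "chart0 (p z) \<noteq> b" using pa False by (cases "p z") auto
        then have "(\<lambda>w. 1 / (chart0 (p w) - b)) analytic_on {z}"
          by (intro analytic_intros an) auto
        moreover have "\<forall>\<^sub>F w in nhds z. 1 / (chart0 (p w) - b) = chart0 (send_to_infinity a (p w))"
          using near[OF z False] near[OF z pa]
        proof eventually_elim
          case (elim w)
          then show ?case using Cpx by (cases "p w") auto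
        qed
        ultimately show ?thesis by (metis analytic_at_cong)
      qed
    }
    {
      assume "send_to_infinity a (p z) \<noteq> Cpx 0"
      then have pI: "p z \<noteq> Infty" using Cpx by auto
      then have an: "(\<lambda>w. chart0 (p w)) analytic_on {z}"
        using p z by (auto simp: sphere_holomorphic_on_def)
      then have "(\<lambda>w. chart0 (p w) - b) analytic_on {z}"
        by (intro analytic_intros an)
      moreover have "\<forall>\<^sub>F w in nhds z. chart0 (p w) - b = chart1 (send_to_infinity a (p w))"
        using near[OF z pI]
      proof eventually_elim
        case (elim w)
        then show ?case using Cpx by (cases "p w") auto
      qed
      ultimately show "(\<lambda>w. chart1 (send_to_infinity a (p w))) analytic_on {z}"
        by (metis analytic_at_cong)
    }
  qed
qed

lemma universal_covering_send:
  assumes "universal_covering p \<Omega>"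
  shows "universal_covering (\<lambda>z. send_to_infinity a (p z)) (send_to_infinity a ` \<Omega>)"
  using assms sphere_holomorphic_on_send covering_space_send
  unfolding universal_covering_def by blast

text \<open>If the limit lay in \<open>\<Omega>\<close>, the tail of the radius would, being connected, lie in
  a single sheet over an evenly covered neighbourhood, and would converge inside that sheet.\<close>

lemma radial_limit_not_in_base:
  fixes p :: "complex \<Rightarrow> 'b::t2_space"
  assumes cov: "covering_space (ball 0 1) p \<Omega>" and \<Omega>: "open \<Omega>"
    and \<zeta>: "cmod \<zeta> = 1" and lim: "((\<lambda>r. p (of_real r * \<zeta>)) \<longlongrightarrow> l) (at_left (1::real))"
  shows "l \<notin> \<Omega>"
proof
  assume l: "l \<in> \<Omega>"
  with cov obtain T v where T: "l \<in> T" "openin (top_of_set \<Omega>) T" "\<Union>v = ball 0 1 \<inter> p -` T"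
    "\<And>u. u \<in> v \<Longrightarrow> openin (top_of_set (ball 0 1)) u" "pairwise disjnt v"
    "\<And>u. u \<in> v \<Longrightarrow> \<exists>q. homeomorphism u T p q"
    unfolding covering_space_def by meson
  have openT: "open T" using T(2) \<Omega> by (simp add: openin_open_eq)
  have openv: "open u" if "u \<in> v" for u using T(4)[OF that] by (simp add: openin_open_eq)
  have "\<forall>\<^sub>F r in at_left (1::real). p (of_real r * \<zeta>) \<in> T"
    using lim openT T(1) by (rule topological_tendstoD)
  then obtain r1 where r1: "r1 < 1" "\<And>r. r1 < r \<Longrightarrow> r < 1 \<Longrightarrow> p (of_real r * \<zeta>) \<in> T"
    unfolding eventually_at_left_field by blast
  define r0 where "r0 = max r1 0"
  define I where "I = (\<lambda>r. of_real r * \<zeta>) ` {r0<..<1}"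
  have r0: "0 \<le> r0" "r0 < 1" using r1 by (auto simp: r0_def)
  have "connected I"
    unfolding I_def by (intro connected_continuous_image continuous_intros) auto
  have I: "I \<subseteq> \<Union>v"
    unfolding I_def T(3) using r1 \<zeta> by (auto simp: r0_def norm_mult)
  obtain r2 where r2: "r0 < r2" "r2 < 1" using dense r0 by blast
  then have r2I: "of_real r2 * \<zeta> \<in> I" by (auto simp: I_def)
  then obtain u where u: "u \<in> v" "of_real r2 * \<zeta> \<in> u"
    using I by blast
  have "I \<subseteq> u"
  proof (rule ccontr)
    assume n: "\<not> I \<subseteq> u"
    have "open (\<Union>(v - {u}))" using openv by auto
    moreover have "u \<inter> \<Union>(v - {u}) \<inter> I = {}"
      using T(5) u(1) by (auto simp: pairwise_def disjnt_def)
    moreover have "I \<subseteq> u \<union> \<Union>(v - {u})" using I by auto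
    moreover have "u \<inter> I \<noteq> {}" using u r2I by blast
    moreover have "\<Union>(v - {u}) \<inter> I \<noteq> {}" using n I by auto
    ultimately show False
      using \<open>connected I\<close> openv[OF u(1)] unfolding connected_def by blast
  qed
  obtain q where q: "homeomorphism u T p q" using T(6)[OF u(1)] by auto
  then have "continuous_on T q" by (rule homeomorphism_cont2)
  then have "isCont q l" using openT T(1) by (simp add: continuous_on_eq_continuous_at)
  then have "((\<lambda>r. q (p (of_real r * \<zeta>))) \<longlongrightarrow> q l) (at_left (1::real))"
    using lim by (rule isCont_tendsto_compose)
  moreover have "\<forall>\<^sub>F r in at_left (1::real). q (p (of_real r * \<zeta>)) = of_real r * \<zeta>"
    unfolding eventually_at_left_field
  proof (intro exI[of _ r0] conjI allI impI r0)
    fix r :: real assume "r0 < r" "r < 1"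
    then have "of_real r * \<zeta> \<in> I" by (auto simp: I_def)
    then have "of_real r * \<zeta> \<in> u" using \<open>I \<subseteq> u\<close> by blast
    then show "q (p (of_real r * \<zeta>)) = of_real r * \<zeta>" using q by (simp add: homeomorphism_apply1)
  qed
  ultimately have "((\<lambda>r. of_real r * \<zeta>) \<longlongrightarrow> q l) (at_left (1::real))"
    by (rule Lim_transform_eventually)
  moreover have "((\<lambda>r. of_real r * \<zeta>) \<longlongrightarrow> of_real 1 * \<zeta>) (at_left (1::real))"
    by (intro tendsto_intros)
  ultimately have "q l = \<zeta>"
    using tendsto_unique[OF trivial_limit_at_left_real] by fastforce
  moreover have "q l \<in> u" using q T(1) by (metis homeomorphism_image2 imageI)
  moreover have "u \<subseteq> ball 0 1" using T(3) u(1) by auto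
  ultimately show False using \<zeta> by auto
qed

section \<open>Pseudo-hyperbolic distance and deck transformations\<close>

text \<open>The pseudo-hyperbolic distance, so that \<open>- ln (phd z w)\<close> is the Green function of
  the disk.\<close>

definition phd :: "complex \<Rightarrow> complex \<Rightarrow> real" where
  "phd z w = cmod (Moebius_function 0 w z)"

lemma phd_eq: "phd z w = cmod (z - w) / cmod (1 - cnj w * z)"
  by (simp add: phd_def Moebius_function_simple norm_divide)

lemma moebius_denom: "cmod w < 1 \<Longrightarrow> cmod z \<le> 1 \<Longrightarrow> 1 - cnj w * z \<noteq> 0"
proof
  assume *: "cmod w < 1" "cmod z \<le> 1" "1 - cnj w * z = 0"
  then have "cmod (cnj w * z) = 1" by simp
  then have "cmod w * cmod z = 1" by (simp add: norm_mult)
  moreover have "cmod w * cmod z \<le> cmod w * 1" using * by (intro mult_left_mono) auto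
  ultimately show False using * by simp
qed

lemma moebius_identity:
  "(cmod (1 - cnj w * z))\<^sup>2 - (cmod (z - w))\<^sup>2 = (1 - (cmod z)\<^sup>2) * (1 - (cmod w)\<^sup>2)"
  unfolding cmod_power2 by (simp add: algebra_simps power2_eq_square)

lemma one_minus_phd_sq:
  assumes "cmod w < 1" "cmod z \<le> 1"
  shows "1 - (phd z w)\<^sup>2 = (1 - (cmod z)\<^sup>2) * (1 - (cmod w)\<^sup>2) / (cmod (1 - cnj w * z))\<^sup>2"
  using moebius_denom[OF assms] moebius_identity[of w z]
  by (simp add: phd_eq power_divide field_simps)

lemma phd_nonneg: "0 \<le> phd z w"
  by (simp add: phd_def)

lemma phd_sym: "phd z w = phd w z"
proof -
  have "cmod (1 - cnj w * z) = cmod (cnj (1 - cnj w * z))" by (rule complex_mod_cnj[symmetric])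
  then show ?thesis by (simp add: phd_eq norm_minus_commute mult.commute)
qed

lemma phd_lt_1: "cmod w < 1 \<Longrightarrow> cmod z < 1 \<Longrightarrow> phd z w < 1"
  unfolding phd_def by (rule Moebius_function_norm_lt_1)

lemma phd_0 [simp]: "phd z 0 = cmod z"
  by (simp add: phd_eq)

lemma phd_pos: "cmod w < 1 \<Longrightarrow> cmod z < 1 \<Longrightarrow> z \<noteq> w \<Longrightarrow> phd z w > 0"
  using moebius_denom[of w z] by (simp add: phd_eq)

text \<open>The Schwarz lemma for \<open>f\<close> composed with the automorphisms that move \<open>w\<close>
  and \<open>f w\<close> to 0.\<close>

lemma Schwarz_Pick:
  assumes f: "f holomorphic_on ball 0 1" and im: "\<And>z. cmod z < 1 \<Longrightarrow> cmod (f z) < 1"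
    and zw: "cmod z < 1" "cmod w < 1"
  shows "phd (f z) (f w) \<le> phd z w"
proof -
  let ?M = "Moebius_function 0"
  define F where "F = ?M (f w) \<circ> (f \<circ> ?M (-w))"
  have w': "cmod (-w) < 1" using zw by simp
  have M1: "cmod (?M (-w) u) < 1" if "cmod u < 1" for u
    using Moebius_function_norm_lt_1[OF w' that] .
  have hol: "F holomorphic_on ball 0 1"
    unfolding F_def
  proof (intro holomorphic_on_compose)
    show "?M (- w) holomorphic_on ball 0 1" by (rule Moebius_function_holomorphic[OF w'])
    show "f holomorphic_on ?M (- w) ` ball 0 1"
      using M1 by (intro holomorphic_on_subset[OF f]) auto
    show "?M (f w) holomorphic_on (f \<circ> ?M (- w)) ` ball 0 1"
      by (rule holomorphic_on_subset[OF Moebius_function_holomorphic]) (use M1 im zw in auto)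
  qed
  have F0: "F 0 = 0" by (simp add: F_def Moebius_function_of_zero Moebius_function_eq_zero)
  have F1: "cmod (F u) < 1" if "cmod u < 1" for u
    unfolding F_def o_def using M1[OF that] im zw by (intro Moebius_function_norm_lt_1) auto
  have "cmod (?M w z) < 1" using zw by (intro Moebius_function_norm_lt_1)
  then have "cmod (F (?M w z)) \<le> cmod (?M w z)"
    using Schwarz_Lemma(1)[OF hol F0, of "?M w z"] F1 by blast
  moreover have "?M (-w) (?M w z) = z" using zw by (intro Moebius_function_compose) auto
  ultimately show ?thesis by (simp add: F_def phd_def)
qed

lemma disk_automorphism_inverse:
  assumes "g \<in> disk_automorphisms"
  obtains h where "h \<in> disk_automorphisms" "\<And>z. cmod z < 1 \<Longrightarrow> h (g z) = z" "\<And>z. cmod z < 1 \<Longrightarrow> g (h z) = z"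
proof -
  have g: "g holomorphic_on ball 0 1" "bij_betw g (ball 0 1) (ball 0 1)"
    using assms by (auto simp: disk_automorphisms_def)
  then have inj: "inj_on g (ball 0 1)" and im: "g ` ball 0 1 = ball 0 1"
    by (auto simp: bij_betw_def)
  obtain h where h: "h holomorphic_on (g ` ball 0 1)" "\<And>z. z \<in> ball 0 1 \<Longrightarrow> h (g z) = z"
    using holomorphic_has_inverse[OF g(1) open_ball inj] by metis
  have gh: "g (h z) = z" if "cmod z < 1" for z
  proof -
    have "z \<in> g ` ball 0 1" using that im by simp
    then show ?thesis using h(2) by auto
  qed
  have "bij_betw h (ball 0 1) (ball 0 1)"
  proof (rule bij_betw_byWitness[where f' = g])
    show "h ` ball 0 1 \<subseteq> ball 0 1"
    proof safe
      fix z :: complex assume "z \<in> ball 0 1"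
      then obtain u where "u \<in> ball 0 1" "z = g u" using im by blast
      then show "h z \<in> ball 0 1" using h(2) by simp
    qed
  qed (use h(2) gh im in auto)
  then have "h \<in> disk_automorphisms" using h(1) im by (simp add: disk_automorphisms_def)
  then show thesis using that h(2) gh by simp
qed

lemma disk_automorphism_norm: "g \<in> disk_automorphisms \<Longrightarrow> cmod z < 1 \<Longrightarrow> cmod (g z) < 1"
  by (auto simp: disk_automorphisms_def bij_betw_def)

lemma phd_automorphism:
  assumes g: "g \<in> disk_automorphisms" and zw: "cmod z < 1" "cmod w < 1"
  shows "phd (g z) (g w) = phd z w"
proof -
  obtain h where h: "h \<in> disk_automorphisms" "\<And>z. cmod z < 1 \<Longrightarrow> h (g z) = z"
    using disk_automorphism_inverse[OF g] by metis
  have hol: "g holomorphic_on ball 0 1" "h holomorphic_on ball 0 1"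
    using g h(1) by (auto simp: disk_automorphisms_def)
  have "phd (g z) (g w) \<le> phd z w"
    by (rule Schwarz_Pick[OF hol(1) disk_automorphism_norm[OF g] zw])
  moreover have "phd (h (g z)) (h (g w)) \<le> phd (g z) (g w)"
    by (rule Schwarz_Pick[OF hol(2) disk_automorphism_norm[OF h(1)]
          disk_automorphism_norm[OF g zw(1)] disk_automorphism_norm[OF g zw(2)]])
  ultimately show ?thesis using h(2) zw by simp
qed

lemma deck_automorphism: "g \<in> deck_group p \<Longrightarrow> g \<in> disk_automorphisms"
  by (simp add: deck_group_def)

lemma deck_invariant: "g \<in> deck_group p \<Longrightarrow> cmod z < 1 \<Longrightarrow> p (g z) = p z"
  by (simp add: deck_group_def)

lemma deck_inverse:
  assumes "g \<in> deck_group p"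
  obtains h where "h \<in> deck_group p" "\<And>z. cmod z < 1 \<Longrightarrow> h (g z) = z" "\<And>z. cmod z < 1 \<Longrightarrow> g (h z) = z"
proof -
  obtain h where h: "h \<in> disk_automorphisms" "\<And>z. cmod z < 1 \<Longrightarrow> h (g z) = z" "\<And>z. cmod z < 1 \<Longrightarrow> g (h z) = z"
    using disk_automorphism_inverse[OF deck_automorphism[OF assms]] by metis
  have "p (h z) = p z" if "cmod z < 1" for z
    using deck_invariant[OF assms, of "h z"] h(3)[OF that] disk_automorphism_norm[OF h(1) that] by simp
  then have "h \<in> deck_group p" using h(1) by (simp add: deck_group_def)
  then show thesis using that h by metis
qed

lemma covering_locally_injective:
  fixes p :: "complex \<Rightarrow> 'b::topological_space"
  assumes "covering_space (ball 0 1) p \<Omega>" "cmod z < 1"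
  obtains e where "e > 0" "ball z e \<subseteq> ball 0 1" "inj_on p (ball z e)"
proof -
  obtain T u q where T: "z \<in> T" "openin (top_of_set (ball 0 1)) T" "homeomorphism T u p q"
    by (rule covering_space_local_homeomorphism[OF assms(1), of z]) (use assms(2) in auto)
  then have "open T" "T \<subseteq> ball 0 1" by (auto simp: openin_open_eq)
  then obtain e where "e > 0" "ball z e \<subseteq> T" using T(1) open_contains_ball by meson
  moreover have "inj_on p T" using T(3) by (metis homeomorphism_apply1 inj_onI)
  ultimately show thesis using that \<open>T \<subseteq> ball 0 1\<close> by (meson inj_on_subset subset_trans)
qed

text \<open>An accumulation point of a fibre in the open disk would contradict local injectivity.\<close>

lemma finite_fibre:
  fixes p :: "complex \<Rightarrow> 'b::topological_space"
  assumes cov: "covering_space (ball 0 1) p \<Omega>" and r: "r < 1"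
  shows "finite {z. cmod z \<le> r \<and> p z = y}"
proof (rule ccontr)
  assume inf: "infinite {z. cmod z \<le> r \<and> p z = y}"
  have "compact (cball (0::complex) r)" by simp
  then obtain z where z: "z \<in> cball 0 r" "z islimpt {z. cmod z \<le> r \<and> p z = y}"
    using inf by (metis (no_types, lifting) compact_eq_Bolzano_Weierstrass mem_Collect_eq mem_cball_0 subsetI)
  obtain e where e: "e > 0" "inj_on p (ball z e)"
    using covering_locally_injective[OF cov, of z] z(1) r by (metis mem_cball_0 order_le_less_trans)
  have "infinite ({z. cmod z \<le> r \<and> p z = y} \<inter> ball z e)"
    using z(2) e(1) islimpt_eq_infinite_ball by blast
  then obtain a b where "a \<in> {z. cmod z \<le> r \<and> p z = y} \<inter> ball z e" "b \<in> {z. cmod z \<le> r \<and> p z = y} \<inter> ball z e" "a \<noteq> b"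
    by (metis (no_types, lifting) finite.simps insertCI is_singletonI' is_singleton_def)
  then show False using e(2) by (auto simp: inj_on_def)
qed

text \<open>The lift of \<open>p\<close> through itself that maps \<open>z\<close> to \<open>w\<close> has the
  lift mapping \<open>w\<close> to \<open>z\<close> as inverse, because the disk is simply connected. The
  omitted point \<open>c\<close> is moved to infinity first, so that the base lies in the plane.\<close>

lemma deck_transitive:
  assumes uc: "universal_covering p \<Omega>" and c: "c \<notin> \<Omega>"
    and zw: "cmod z < 1" "cmod w < 1" "p z = p w"
  obtains g where "g \<in> deck_group p" "g z = w"
proof -
  define S where "S = chart0 ` send_to_infinity c ` \<Omega>"
  define X where "X u = chart0 (send_to_infinity c (p u))" for u
  have uc1: "universal_covering (\<lambda>u. send_to_infinity c (p u)) (send_to_infinity c ` \<Omega>)"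
    by (rule universal_covering_send[OF uc])
  have noInf: "Infty \<notin> send_to_infinity c ` \<Omega>"
    using c by (metis imageE send_eq_Infty_iff)
  then have rng: "send_to_infinity c ` \<Omega> \<subseteq> range Cpx"
    by (metis riemann_sphere.exhaust rangeI subsetI)
  have Cc: "Cpx (chart0 y) = y" if "y \<in> send_to_infinity c ` \<Omega>" for y
    using that rng by auto
  have h: "homeomorphism (send_to_infinity c ` \<Omega>) S chart0 Cpx"
    unfolding S_def using Cc
    by (intro homeomorphismI continuous_Cpx continuous_on_subset[OF continuous_chart0 rng]) auto
  have cov: "covering_space (ball 0 1) X S"
    unfolding X_def using uc1 h
    by (intro covering_space_homeomorphism_compose[where h = chart0]) (auto simp: universal_covering_def)
  have pS: "send_to_infinity c (p u) \<in> send_to_infinity c ` \<Omega>" if "cmod u < 1" for u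
    using uc that covering_space_imp_surjective[of "ball 0 1" p \<Omega>] by (auto simp: universal_covering_def)
  have Xp: "p u = p v" if "X u = X v" "cmod u < 1" "cmod v < 1" for u v
    using that Cc[OF pS[of u]] Cc[OF pS[of v]] unfolding X_def by (metis unsend_send)
  have holX: "X holomorphic_on ball 0 1"
  proof -
    have "X analytic_on {u}" if "cmod u < 1" for u
    proof -
      have "send_to_infinity c (p u) \<noteq> Infty" using pS[OF that] noInf by metis
      then show ?thesis
        using uc1 that unfolding X_def universal_covering_def sphere_holomorphic_on_def by simp
    qed
    then have "X analytic_on ball 0 1" by (meson analytic_on_analytic_at mem_ball_0)
    then show ?thesis by (rule analytic_imp_holomorphic)
  qed
  have contX: "continuous_on (ball 0 1) X" by (rule holomorphic_on_imp_continuous_on[OF holX])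
  have XS: "X \<in> ball 0 1 \<rightarrow> S" using covering_space_imp_surjective[OF cov] by auto
  have lift: "\<exists>g. continuous_on (ball 0 1) g \<and> g \<in> ball 0 1 \<rightarrow> ball 0 1 \<and> g a = b \<and> (\<forall>y\<in>ball 0 1. X (g y) = X y)"
    if ab: "cmod a < 1" "cmod b < 1" "X a = X b" for a b
  proof -
    have "simply_connected (ball (0::complex) 1)" "locally path_connected (ball (0::complex) 1)"
      by (auto intro: convex_imp_simply_connected convex_imp_locally_path_connected)
    then obtain g where "continuous_on (ball 0 1) g" "g \<in> ball 0 1 \<rightarrow> ball 0 1" "g a = b" "\<And>y. y \<in> ball 0 1 \<Longrightarrow> X (g y) = X y"
      using covering_space_lift_strong[OF cov, of b a "ball 0 1" X] ab contX XS by (metis mem_ball_0)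
    then show ?thesis by blast
  qed
  have Xzw: "X z = X w" using zw by (simp add: X_def)
  obtain g where g: "continuous_on (ball 0 1) g" "g \<in> ball 0 1 \<rightarrow> ball 0 1" "g z = w" "\<And>y. y \<in> ball 0 1 \<Longrightarrow> X (g y) = X y"
    using lift[OF zw(1,2) Xzw] by metis
  obtain k where k: "continuous_on (ball 0 1) k" "k \<in> ball 0 1 \<rightarrow> ball 0 1" "k w = z" "\<And>y. y \<in> ball 0 1 \<Longrightarrow> X (k y) = X y"
    using lift[OF zw(2,1) Xzw[symmetric]] by metis
  have uniq: "m y = y"
    if "continuous_on (ball 0 1) m" "m \<in> ball 0 1 \<rightarrow> ball 0 1" "m a = a" "\<And>y. y \<in> ball 0 1 \<Longrightarrow> X y = X (m y)"
      "a \<in> ball 0 1" "y \<in> ball 0 1" for m a y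
    by (rule covering_space_lift_unique[OF cov, of m a "\<lambda>y. y" "ball 0 1" X y])
       (use that contX XS in \<open>auto intro: connected_ball\<close>)
  have kg: "k (g y) = y" if "y \<in> ball 0 1" for y
  proof (rule uniq[of "\<lambda>y. k (g y)" z])
    show "continuous_on (ball 0 1) (\<lambda>y. k (g y))"
      using g(2) by (intro continuous_on_compose2[OF k(1) g(1)]) auto
    show "\<And>y. y \<in> ball 0 1 \<Longrightarrow> X y = X (k (g y))" using g(2,4) k(4) by (metis PiE)
  qed (use g k zw that in auto)
  have gk: "g (k y) = y" if "y \<in> ball 0 1" for y
  proof (rule uniq[of "\<lambda>y. g (k y)" w])
    show "continuous_on (ball 0 1) (\<lambda>y. g (k y))"
      using k(2) by (intro continuous_on_compose2[OF g(1) k(1)]) auto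
    show "\<And>y. y \<in> ball 0 1 \<Longrightarrow> X y = X (g (k y))" using k(2,4) g(4) by (metis PiE)
  qed (use g k zw that in auto)
  have "g analytic_on {y}" if y: "y \<in> ball 0 1" for y
  proof -
    have gy: "cmod (g y) < 1" using g(2) y by auto
    obtain e where e: "e > 0" "ball (g y) e \<subseteq> ball 0 1" "inj_on X (ball (g y) e)"
      using covering_locally_injective[OF cov gy] by metis
    have holXe: "X holomorphic_on ball (g y) e" by (rule holomorphic_on_subset[OF holX e(2)])
    obtain j where j: "j holomorphic_on (X ` ball (g y) e)" "\<And>u. u \<in> ball (g y) e \<Longrightarrow> j (X u) = u"
      using holomorphic_has_inverse[OF holXe open_ball e(3)] by metis
    have "open (ball 0 1 \<inter> g -` ball (g y) e)"
      by (rule continuous_open_preimage[OF g(1)]) auto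
    moreover have "y \<in> ball 0 1 \<inter> g -` ball (g y) e" using y e(1) by auto
    moreover have "g holomorphic_on (ball 0 1 \<inter> g -` ball (g y) e)"
    proof (rule holomorphic_transform)
      show "(\<lambda>u. j (X u)) holomorphic_on (ball 0 1 \<inter> g -` ball (g y) e)"
      proof -
        have 1: "X holomorphic_on ball 0 1 \<inter> g -` ball (g y) e"
          by (rule holomorphic_on_subset[OF holX]) auto
        have 2: "X u \<in> X ` ball (g y) e" if u: "u \<in> ball 0 1 \<inter> g -` ball (g y) e" for u
        proof -
          have "X u = X (g u)" using g(4)[of u] u by simp
          moreover have "g u \<in> ball (g y) e" using u by blast
          ultimately show ?thesis by (rule image_eqI)
        qed
        show ?thesis
          using holomorphic_on_compose_gen[OF 1 j(1) image_subsetI[OF 2]] by (simp only: o_def)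
      qed
      fix u assume u: "u \<in> ball 0 1 \<inter> g -` ball (g y) e"
      then have "j (X (g u)) = g u" by (intro j(2)) auto
      then show "j (X u) = g u" using g(4) u by auto
    qed
    ultimately show ?thesis using analytic_at by blast
  qed
  then have holg: "g holomorphic_on ball 0 1"
    by (meson analytic_imp_holomorphic analytic_on_analytic_at)
  have "bij_betw g (ball 0 1) (ball 0 1)"
    using kg gk g(2) k(2) by (intro bij_betw_byWitness[where f' = k]) auto
  moreover have "p (g y) = p y" if "y \<in> ball 0 1" for y
    using that g(2) g(4)[OF that] by (intro Xp) auto
  ultimately have "g \<in> deck_group p"
    using holg by (simp add: deck_group_def disk_automorphisms_def)
  then show thesis using that g(3) by blast
qed

text \<open>With \<open>w = 1 - cnj \<zeta> z\<close> the distance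
  \<open>|w| = |z - \<zeta>|\<close> is at most \<open>Re w / cos \<alpha>\<close>, and
  \<open>Re w\<close> is comparable to \<open>1 - |z|\<close> up to a term quadratic in \<open>|w|\<close>,
  which is absorbed near \<open>\<zeta>\<close>.\<close>

lemma Stolz_angle_bound:
  assumes \<zeta>: "cmod \<zeta> = 1" and \<alpha>: "0 < \<alpha>" "\<alpha> < pi / 2" and z: "z \<in> stolz_angle \<zeta> \<alpha> \<rho>"
    and near: "cmod (z - \<zeta>) < cos \<alpha>"
  shows "cmod (z - \<zeta>) \<le> 2 / cos \<alpha> * (1 - cmod z)"
proof -
  define w where "w = 1 - cnj \<zeta> * z"
  have c\<zeta>: "cnj \<zeta> * \<zeta> = 1" using \<zeta> complex_norm_square[of \<zeta>] by (simp add: mult.commute)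
  have "cmod w = cmod (cnj \<zeta> * (\<zeta> - z))" by (simp add: w_def right_diff_distrib c\<zeta>)
  then have cw: "cmod w = cmod (z - \<zeta>)" using \<zeta> by (simp add: norm_mult norm_minus_commute)
  have cz: "cmod (cnj \<zeta> * z) = cmod z" using \<zeta> by (simp add: norm_mult)
  have z1: "cmod z < 1" and A: "\<bar>Arg w\<bar> < \<alpha>" using z by (auto simp: stolz_angle_def w_def)
  have ca: "cos \<alpha> > 0" using \<alpha> by (intro cos_gt_zero) auto
  have "cos \<alpha> \<le> cos \<bar>Arg w\<bar>" using A \<alpha> by (intro cos_monotone_0_pi_le) auto
  then have "cmod w * cos \<alpha> \<le> cmod w * cos (Arg w)" by (intro mult_left_mono) auto
  also have "\<dots> = Re w" by (metis Re_rcis rcis_cmod_Arg)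
  finally have Re: "cmod w * cos \<alpha> \<le> Re w" .
  have "(cmod z)\<^sup>2 = (cmod (1 - w))\<^sup>2" using cz by (simp add: w_def)
  also have "\<dots> = 1 - 2 * Re w + (cmod w)\<^sup>2"
    unfolding cmod_power2 by (simp add: power2_eq_square algebra_simps)
  finally have "1 - (cmod z)\<^sup>2 = 2 * Re w - cmod w * cmod w" by (simp add: power2_eq_square)
  moreover have "cmod w * cmod w \<le> cmod w * cos \<alpha>" using near cw by (intro mult_left_mono) auto
  ultimately have "cmod w * cos \<alpha> \<le> 1 - (cmod z)\<^sup>2" using Re by linarith
  also have "\<dots> = (1 - cmod z) * (1 + cmod z)" by algebra
  also have "\<dots> \<le> (1 - cmod z) * 2" using z1 by (intro mult_left_mono) auto
  finally show ?thesis using ca cw by (simp add: field_simps)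
qed

text \<open>The points \<open>|\<gamma> n 0| \<zeta>\<close> of the radius stay within bounded
  pseudo-hyperbolic distance of \<open>\<gamma> n 0\<close>. Deck transformations bring them to a compact
  part of the disk, and a limit point there would be mapped by \<open>p\<close> to the radial limit, which
  does not lie in \<open>\<Omega>\<close>.\<close>

lemma nontangential_no_radial_limit:
  assumes uc: "universal_covering p \<Omega>" and \<Omega>: "open \<Omega>"
    and \<zeta>: "\<zeta> \<in> nontangential_limit_set (deck_group p)"
  shows "\<not> has_radial_limit p \<zeta>"
proof
  assume "has_radial_limit p \<zeta>"
  then obtain l where l: "((\<lambda>r. p (of_real r * \<zeta>)) \<longlongrightarrow> l) (at_left (1::real))"
    by (auto simp: has_radial_limit_def)
  have cov: "covering_space (ball 0 1) p \<Omega>" using uc by (simp add: universal_covering_def)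
  obtain \<gamma> :: "nat \<Rightarrow> complex \<Rightarrow> complex" and \<alpha> \<rho> where \<zeta>1: "cmod \<zeta> = 1" and \<gamma>: "\<And>n. \<gamma> n \<in> deck_group p"
    "(\<lambda>n. \<gamma> n 0) \<longlonglongrightarrow> \<zeta>" and \<alpha>: "0 < \<alpha>" "\<alpha> < pi / 2" and st: "\<And>n. \<gamma> n 0 \<in> stolz_angle \<zeta> \<alpha> \<rho>"
    using \<zeta> by (auto simp: nontangential_limit_set_def)
  have ca: "cos \<alpha> > 0" using \<alpha> by (intro cos_gt_zero) auto
  define C where "C = 2 / cos \<alpha> + 1"
  have C: "C > 1" using ca by (simp add: C_def)
  define z where "z n = \<gamma> n 0" for n
  have z1: "cmod (z n) < 1" for n using st by (auto simp: z_def stolz_angle_def)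
  have zlim: "z \<longlonglongrightarrow> \<zeta>" using \<gamma>(2) by (simp add: z_def[abs_def])
  have "(\<lambda>n. cmod (z n - \<zeta>)) \<longlonglongrightarrow> 0"
    using zlim by (simp add: LIM_zero tendsto_norm_zero)
  then have ev: "\<forall>\<^sub>F n in sequentially. cmod (z n - \<zeta>) < cos \<alpha>"
    using ca by (rule order_tendstoD)
  define k where "k = sqrt (1 - 1 / C\<^sup>2)"
  have C2: "1 / C\<^sup>2 < 1" "1 / C\<^sup>2 > 0" using C by (auto simp: power_gt1)
  have k: "k < 1" "0 \<le> k" using C2 by (auto simp: k_def)
  have rn: "(\<lambda>n. cmod (z n)) \<longlonglongrightarrow> 1" using tendsto_norm[OF zlim] \<zeta>1 by simp
  have close: "phd (of_real (cmod (z n)) * \<zeta>) (z n) \<le> k" if near: "cmod (z n - \<zeta>) < cos \<alpha>" for n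
  proof -
    define r where "r = cmod (z n)"
    have r: "0 \<le> r" "r < 1" using z1 by (auto simp: r_def)
    have b: "cmod (z n - \<zeta>) \<le> 2 / cos \<alpha> * (1 - r)"
      using Stolz_angle_bound[OF \<zeta>1 \<alpha> st[of n]] near unfolding r_def z_def by blast
    have nr: "cmod (of_real r * \<zeta>) = r" using r \<zeta>1 by (simp add: norm_mult)
    have c\<zeta>: "cnj \<zeta> * \<zeta> = 1" using \<zeta>1 complex_norm_square[of \<zeta>] by (simp add: mult.commute)
    have "1 - cnj (z n) * (of_real r * \<zeta>) = cnj (\<zeta> - z n) * \<zeta> + of_real (1 - r) * (cnj (z n) * \<zeta>)"
      using c\<zeta> by (simp add: algebra_simps)
    then have "cmod (1 - cnj (z n) * (of_real r * \<zeta>)) \<le> cmod (cnj (\<zeta> - z n) * \<zeta>) + cmod (of_real (1 - r) * (cnj (z n) * \<zeta>))"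
      by (metis norm_triangle_ineq)
    also have "cmod (cnj (\<zeta> - z n) * \<zeta>) = cmod (z n - \<zeta>)"
      unfolding norm_mult complex_mod_cnj using \<zeta>1 by (simp add: norm_minus_commute)
    also have "cmod (of_real (1 - r) * (cnj (z n) * \<zeta>)) = (1 - r) * r"
      unfolding norm_mult complex_mod_cnj norm_of_real using \<zeta>1 r by (simp add: r_def)
    also have "cmod (z n - \<zeta>) + (1 - r) * r \<le> 2 / cos \<alpha> * (1 - r) + (1 - r) * 1"
      using b r by (intro add_mono mult_left_mono) auto
    also have "\<dots> = C * (1 - r)" by (simp add: C_def algebra_simps)
    finally have den: "cmod (1 - cnj (z n) * (of_real r * \<zeta>)) \<le> C * (1 - r)" .
    have den0: "1 - cnj (z n) * (of_real r * \<zeta>) \<noteq> 0"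
      using z1 nr r by (intro moebius_denom) auto
    have "1 - (phd (of_real r * \<zeta>) (z n))\<^sup>2 = (1 - r\<^sup>2) * (1 - r\<^sup>2) / (cmod (1 - cnj (z n) * (of_real r * \<zeta>)))\<^sup>2"
      using one_minus_phd_sq[of "z n" "of_real r * \<zeta>"] z1[of n] nr r by (simp add: r_def)
    also have "\<dots> \<ge> (1 - r) * (1 - r) / (C * (1 - r))\<^sup>2"
    proof (rule frac_le)
      have "r\<^sup>2 \<le> r" using r by (simp add: power2_eq_square mult_left_le_one_le)
      then show "(1 - r) * (1 - r) \<le> (1 - r\<^sup>2) * (1 - r\<^sup>2)" "0 \<le> (1 - r\<^sup>2) * (1 - r\<^sup>2)" using r by (auto intro!: mult_mono)
      show "(cmod (1 - cnj (z n) * (of_real r * \<zeta>)))\<^sup>2 \<le> (C * (1 - r))\<^sup>2"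
        using den by (intro power_mono) auto
    qed (use den0 in auto)
    also have "(1 - r) * (1 - r) / (C * (1 - r))\<^sup>2 = 1 / C\<^sup>2"
      using r C by (simp add: power_mult_distrib power2_eq_square)
    finally have "(phd (of_real r * \<zeta>) (z n))\<^sup>2 \<le> 1 - 1 / C\<^sup>2" by simp
    then have "phd (of_real r * \<zeta>) (z n) \<le> k" unfolding k_def by (rule real_le_rsqrt)
    then show ?thesis by (simp add: r_def)
  qed
  have "\<exists>w. cmod w < 1 \<and> \<gamma> n w = of_real (cmod (z n)) * \<zeta>" for n
  proof -
    obtain h where "h \<in> deck_group p" "\<And>z. cmod z < 1 \<Longrightarrow> \<gamma> n (h z) = z"
      using deck_inverse[OF \<gamma>(1)] by metis
    moreover have "cmod (of_real (cmod (z n)) * \<zeta>) < 1" using z1 \<zeta>1 by (simp add: norm_mult)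
    ultimately show ?thesis
      using disk_automorphism_norm[OF deck_automorphism] by (intro exI[of _ "h (of_real (cmod (z n)) * \<zeta>)"]) blast
  qed
  then obtain w where w: "\<And>n. cmod (w n) < 1" "\<And>n. \<gamma> n (w n) = of_real (cmod (z n)) * \<zeta>" by metis
  have wk: "cmod (w n) \<le> k" if "cmod (z n - \<zeta>) < cos \<alpha>" for n
    using close[OF that] phd_automorphism[OF deck_automorphism[OF \<gamma>(1)], of "w n" 0 n] w by (simp add: z_def)
  from ev obtain N where N: "\<And>n. n \<ge> N \<Longrightarrow> cmod (z n - \<zeta>) < cos \<alpha>"
    by (auto simp: eventually_sequentially)
  have "\<forall>n. w (n + N) \<in> cball 0 k" using wk N by simp
  moreover have "seq_compact (cball (0::complex) k)" by (simp add: compact_imp_seq_compact)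
  ultimately obtain w0 \<phi> where w0: "w0 \<in> cball 0 k" "strict_mono \<phi>" "((\<lambda>n. w (n + N)) \<circ> \<phi>) \<longlonglongrightarrow> w0"
    using seq_compactE by metis
  have "filterlim (\<lambda>n. cmod (z n)) (at_left 1) sequentially"
    using rn z1 by (simp add: filterlim_at less_imp_neq)
  then have "(\<lambda>n. p (of_real (cmod (z n)) * \<zeta>)) \<longlonglongrightarrow> l"
    by (rule filterlim_compose[OF l])
  moreover have "p (of_real (cmod (z n)) * \<zeta>) = p (w n)" for n
    using deck_invariant[OF \<gamma>(1), of "w n" n] w by simp
  ultimately have "(\<lambda>n. p (w n)) \<longlonglongrightarrow> l" by simp
  then have "(\<lambda>n. p (w (n + N))) \<longlonglongrightarrow> l" by (rule LIMSEQ_ignore_initial_segment)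
  then have "((\<lambda>n. p (w (n + N))) \<circ> \<phi>) \<longlonglongrightarrow> l" by (rule LIMSEQ_subseq_LIMSEQ[OF _ w0(2)])
  moreover have "isCont p w0"
    using covering_space_imp_continuous[OF cov] w0(1) k
    by (auto simp: continuous_on_eq_continuous_at)
  then have "(\<lambda>n. p (((\<lambda>n. w (n + N)) \<circ> \<phi>) n)) \<longlonglongrightarrow> p w0"
    using w0(3) by (rule isCont_tendsto_compose)
  ultimately have "l = p w0"
    using LIMSEQ_unique by (auto simp: o_def)
  moreover have "p w0 \<in> \<Omega>" using covering_space_imp_surjective[OF cov] w0(1) k by auto
  ultimately show False
    using radial_limit_not_in_base[OF cov \<Omega> \<zeta>1 l] by simp
qed

section \<open>Harmonic measure of subsets of the circle\<close>

text \<open>Harmonic measure of the set \<open>cis ` A\<close>, seen from \<open>z\<close>; points outside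
  \<open>{-pi..pi}\<close> are ignored by \<open>circ\<close>.\<close>

definition harmonic_measure :: "real set \<Rightarrow> complex \<Rightarrow> real" where
  "harmonic_measure A z = (LINT t|circ. indicator A t * poisson z t)"

lemma continuous_poisson: "cmod z < 1 \<Longrightarrow> continuous_on S (poisson z)"
  using continuous_on_poisson_gen[of S "\<lambda>_. z" "\<lambda>t. t"] by auto

lemma measurable_poisson [measurable]: "cmod z < 1 \<Longrightarrow> poisson z \<in> borel_measurable borel"
  by (intro borel_measurable_cont continuous_poisson)

lemma poisson_le_2: "cmod z \<le> r \<Longrightarrow> r < 1 \<Longrightarrow> poisson z t \<le> 2 / (1 - r)"
proof -
  assume z: "cmod z \<le> r" "r < 1"
  have "poisson z t \<le> (1 + cmod z) / (1 - cmod z)" using z by (intro poisson_le) auto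
  also have "\<dots> \<le> 2 / (1 - r)" using z by (intro frac_le) auto
  finally show ?thesis .
qed

lemma integrable_harmonic_measure:
  assumes "A \<in> sets borel" "cmod z < 1"
  shows "integrable circ (\<lambda>t. indicator A t * poisson z t)"
  using assms poisson_le_2[of z "cmod z"] poisson_pos[of z]
  by (intro integrable_circ_bounded[of _ "2 / (1 - cmod z)"])
     (auto simp: indicator_def abs_mult less_imp_le)

lemma integrable_indicator_circ:
  "A \<in> sets borel \<Longrightarrow> integrable circ (\<lambda>t. indicator A t * (c :: real))"
  by (intro integrable_circ_bounded[of _ "\<bar>c\<bar>"]) (auto simp: indicator_def)

lemma measurable_indicator_continuous:
  assumes "continuous_on UNIV g" "A \<in> sets borel"
  shows "(\<lambda>x. indicator A (g x) :: real) \<in> borel_measurable borel"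
  using measurable_compose[OF borel_measurable_cont[OF assms(1)] borel_measurable_indicator[OF assms(2)]] .

lemma harmonic_measure_nonneg: "cmod z < 1 \<Longrightarrow> harmonic_measure A z \<ge> 0"
  unfolding harmonic_measure_def using poisson_pos[of z]
  by (intro Bochner_Integration.integral_nonneg) (auto simp: indicator_def less_imp_le)

lemma harmonic_measure_le_1:
  assumes "A \<in> sets borel" "cmod z < 1"
  shows "harmonic_measure A z \<le> 1"
proof -
  have "harmonic_measure A z \<le> (LINT t|circ. poisson z t)"
    unfolding harmonic_measure_def using poisson_pos[of z] assms integrable_poisson[of z "\<lambda>_. 1"]
    by (intro integral_mono integrable_harmonic_measure) (auto simp: indicator_def less_imp_le)
  then show ?thesis using integral_poisson assms by simp
qed

lemma harmonic_measure_ge_measure: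
  assumes "A \<in> sets borel" "cmod z < 1"
  shows "(1 - cmod z) / 2 * measure circ A \<le> harmonic_measure A z"
proof -
  have "(1 - cmod z) / 2 * measure circ A = (LINT t|circ. indicator A t * ((1 - cmod z) / 2))"
    using assms by simp
  also have "\<dots> \<le> harmonic_measure A z"
    unfolding harmonic_measure_def
  proof (intro integral_mono integrable_harmonic_measure assms)
    show "integrable circ (\<lambda>t. indicator A t * ((1 - cmod z) / 2))"
      by (rule integrable_indicator_circ[OF assms(1)])
    fix t
    have "(1 - cmod z) / 2 \<le> (1 - cmod z) / (1 + cmod z)" using assms
      by (intro divide_left_mono) (auto simp: add_pos_nonneg)
    also have "\<dots> \<le> poisson z t" using assms by (intro poisson_ge) auto
    finally show "indicator A t * ((1 - cmod z) / 2) \<le> indicator A t * poisson z t"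
      by (intro mult_left_mono) auto
  qed
  finally show ?thesis .
qed

lemma continuous_on_harmonic_measure:
  assumes A: "A \<in> sets borel"
  shows "continuous_on (ball 0 1) (harmonic_measure A)"
  unfolding continuous_on_sequentially
proof (intro allI ballI impI)
  fix x and a :: complex assume "a \<in> ball 0 1" and "(\<forall>n. x n \<in> ball 0 1) \<and> x \<longlonglongrightarrow> a"
  then have a: "cmod a < 1" and x: "\<And>n. cmod (x n) < 1" "x \<longlonglongrightarrow> a" by auto
  have "compact (insert a (range x))" by (rule compact_sequence_with_limit[OF x(2)])
  then have "\<exists>s\<in>insert a (range x). \<forall>t\<in>insert a (range x). cmod t \<le> cmod s"
    by (intro continuous_attains_sup continuous_intros) auto
  then obtain s where s: "s \<in> insert a (range x)" "\<And>n. cmod (x n) \<le> cmod s" by auto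
  have s1: "cmod s < 1" using s(1) a x by auto
  have "(\<lambda>n. LINT t|circ. indicator A t * poisson (x n) t) \<longlonglongrightarrow> (LINT t|circ. indicator A t * poisson a t)"
  proof (rule integral_dominated_convergence[where w = "\<lambda>_. 2 / (1 - cmod s)"])
    show "AE t in circ. (\<lambda>n. indicator A t * poisson (x n) t) \<longlonglongrightarrow> indicator A t * poisson a t"
      unfolding poisson_def using a cis_minus_nonzero[OF a]
      by (intro AE_I2 tendsto_intros x(2)) auto
    show "AE t in circ. norm (indicator A t * poisson (x n) t) \<le> 2 / (1 - cmod s)" for n
      using poisson_le_2[OF s(2) s1] poisson_pos[OF x(1)] s1
      by (auto simp: indicator_def abs_mult less_imp_le)
  qed (use A a x in auto)
  then show "(harmonic_measure A \<circ> x) \<longlonglongrightarrow> harmonic_measure A a" by (simp add: harmonic_measure_def o_def)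
qed

lemma pair_circ: "pair_sigma_finite circ circ"
  by (intro pair_sigma_finite.intro) (simp_all add: circ.sigma_finite_measure_axioms)

lemma integrable_pair_circ:
  fixes f :: "real \<Rightarrow> real \<Rightarrow> real"
  assumes "(\<lambda>(x, y). f x y) \<in> borel_measurable borel" "\<And>x y. \<bar>f x y\<bar> \<le> B"
  shows "integrable (circ \<Otimes>\<^sub>M circ) (\<lambda>(x, y). f x y)"
proof -
  interpret pair_prob_space circ circ
    by (intro pair_prob_space.intro pair_circ prob_space_circ)
  have "sets (circ \<Otimes>\<^sub>M circ) = sets (borel :: (real \<times> real) measure)"
    by (metis sets_pair_measure_cong sets_circ borel_prod)
  then have "(\<lambda>(x, y). f x y) \<in> borel_measurable (circ \<Otimes>\<^sub>M circ)"
    using assms(1) by (simp cong: measurable_cong_sets)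
  then show ?thesis
    by (intro P.integrable_const_bound[of _ B]) (use assms(2) in auto)
qed

lemma mean_value_poisson:
  assumes "cball z s \<subseteq> ball 0 1" "s > 0"
  shows "(LINT \<theta>|circ. poisson (z + of_real s * cis \<theta>) t) = poisson z t"
proof -
  have sub: "cmod w < 1" if "w \<in> cball z s" for w using assms that by auto
  have in_c: "z + of_real s * cis \<theta> \<in> cball z s" for \<theta>
    using assms by (simp add: dist_norm norm_mult)
  have zin: "z \<in> cball z s" using assms by simp
  have "(LINT \<theta>|circ. Re ((cis t + (z + of_real s * cis \<theta>)) / (cis t - (z + of_real s * cis \<theta>)))) = Re ((cis t + z) / (cis t - z))"
    using cis_minus_nonzero[OF sub] assms
    by (intro mean_value_Re[of z s "\<lambda>w. (cis t + w) / (cis t - w)"] continuous_intros holomorphic_intros) auto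
  then show ?thesis
    using poisson_Re[OF sub[OF in_c]] poisson_Re[OF sub[OF zin]] by simp
qed

lemma harm_on_harmonic_measure:
  assumes A: "A \<in> sets borel"
  shows "harm_on (ball 0 1) (harmonic_measure A)"
  unfolding harm_on_def
proof (intro conjI ballI continuous_on_harmonic_measure A)
  fix z :: complex assume z: "z \<in> ball 0 1"
  show "\<exists>e>0. \<forall>s. 0 < s \<and> s < e \<longrightarrow> cball z s \<subseteq> ball 0 1 \<and> (LINT t|circ. harmonic_measure A (z + of_real s * cis t)) = harmonic_measure A z"
  proof (intro exI[of _ "1 - cmod z"] conjI allI impI)
    fix s assume s: "0 < s \<and> s < 1 - cmod z"
    show sub: "cball z s \<subseteq> ball 0 1"
    proof
      fix w assume "w \<in> cball z s"
      then have "cmod (w - z) \<le> s" by (simp add: dist_norm norm_minus_commute)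
      then have "cmod w \<le> cmod z + s" using norm_triangle_ineq2[of w z] by linarith
      then show "w \<in> ball 0 1" using s by simp
    qed
    have le: "cmod (z + of_real s * cis \<theta>) \<le> cmod z + s" for \<theta>
      using norm_triangle_ineq[of z "of_real s * cis \<theta>"] s by (simp add: norm_mult)
    have lt: "cmod (z + of_real s * cis \<theta>) < 1" for \<theta>
      using s le[of \<theta>] by linarith
    have meas: "(\<lambda>(\<theta>, t). indicator A t * poisson (z + of_real s * cis \<theta>) t) \<in> borel_measurable borel"
    proof -
      have "(\<lambda>x. poisson (z + of_real s * cis (fst x)) (snd x)) \<in> borel_measurable (borel :: (real \<times> real) measure)"
        using lt by (intro borel_measurable_cont continuous_on_poisson_gen continuous_intros) auto
      moreover have "(\<lambda>x. indicator A (snd x) :: real) \<in> borel_measurable (borel :: (real \<times> real) measure)"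
        by (intro measurable_indicator_continuous A continuous_intros)
      ultimately show ?thesis unfolding case_prod_beta by (rule borel_measurable_times[rotated])
    qed
    have int: "integrable (circ \<Otimes>\<^sub>M circ) (\<lambda>(\<theta>, t). indicator A t * poisson (z + of_real s * cis \<theta>) t)"
      using meas
    proof (rule integrable_pair_circ)
      show "\<bar>indicator A t * poisson (z + of_real s * cis \<theta>) t\<bar> \<le> 2 / (1 - (cmod z + s))" for \<theta> t
        using poisson_le_2[OF le] poisson_pos[OF lt] s by (auto simp: indicator_def abs_mult less_imp_le)
    qed
    have "(LINT \<theta>|circ. harmonic_measure A (z + of_real s * cis \<theta>)) = (LINT t|circ. LINT \<theta>|circ. indicator A t * poisson (z + of_real s * cis \<theta>) t)"
      unfolding harmonic_measure_def by (rule pair_sigma_finite.Fubini_integral[OF pair_circ int, symmetric])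
    also have "\<dots> = (LINT t|circ. indicator A t * poisson z t)"
      using mean_value_poisson[OF sub] s by simp
    finally show "(LINT t|circ. harmonic_measure A (z + of_real s * cis t)) = harmonic_measure A z" by (simp add: harmonic_measure_def)
  qed (use z in auto)
qed

lemma poisson_rotate: "poisson (of_real r * cis \<theta>) t = poisson (of_real r * cis t) \<theta>"
proof -
  have "(cmod (cis a - of_real r * cis b))\<^sup>2 = ((cos a)\<^sup>2 + (sin a)\<^sup>2) + r\<^sup>2 * ((cos b)\<^sup>2 + (sin b)\<^sup>2) - 2 * r * (cos a * cos b + sin a * sin b)" for a b
    unfolding cmod_power2 by (simp add: power2_eq_square algebra_simps del: sin_cos_squared_add sin_cos_squared_add2 sin_cos_squared_add3)
  then have "(cmod (cis t - of_real r * cis \<theta>))\<^sup>2 = (cmod (cis \<theta> - of_real r * cis t))\<^sup>2"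
    by (simp add: mult.commute)
  then show ?thesis by (simp add: poisson_def norm_mult)
qed

text \<open>The mean over the complement of \<open>A\<close> of the harmonic measure of \<open>A\<close> on
  the circle of radius \<open>r\<close> equals, by the symmetry of the Poisson kernel, the mean over
  \<open>A\<close> of the harmonic measure of the complement. The latter tends to 0 at every point of
  \<open>A\<close>, as \<open>A\<close> is open.\<close>

lemma harmonic_measure_small_somewhere:
  assumes V: "open V" and A: "A = cis -` V" and pos: "measure circ (- A) > 0" and \<delta>: "\<delta> > 0"
  shows "\<exists>z. cmod z < 1 \<and> harmonic_measure A z < \<delta>"
proof (rule ccontr)
  assume "\<not> ?thesis"
  then have ge: "harmonic_measure A z \<ge> \<delta>" if "cmod z < 1" for z using that by (meson not_less)
  have cis_cont: "continuous_on UNIV cis" by (intro continuous_intros)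
  then have oA: "open A" unfolding A using V open_vimage by blast
  then have Ab [measurable]: "A \<in> sets borel" "- A \<in> sets borel" by auto
  define r where "r n = 1 - 1 / (real n + 2)" for n
  have r: "0 \<le> r n" "r n < 1" for n by (auto simp: r_def divide_simps)
  have rn: "cmod (of_real (r n) * cis t) = r n" for n t using r by (simp add: norm_mult)
  have rlim: "r \<longlonglongrightarrow> 1" unfolding r_def by real_asymp
  have swap: "(LINT \<theta>|circ. indicator (-A) \<theta> * harmonic_measure A (of_real (r n) * cis \<theta>)) =
        (LINT t|circ. indicator A t * harmonic_measure (-A) (of_real (r n) * cis t))" for n
  proof -
    have meas: "(\<lambda>(\<theta>, t). indicator (-A) \<theta> * (indicator A t * poisson (of_real (r n) * cis \<theta>) t)) \<in> borel_measurable borel"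
    proof -
      have "(\<lambda>x. poisson (of_real (r n) * cis (fst x)) (snd x)) \<in> borel_measurable (borel :: (real \<times> real) measure)"
        using rn r by (intro borel_measurable_cont continuous_on_poisson_gen continuous_intros) auto
      moreover have "(\<lambda>x. indicator A (snd x) :: real) \<in> borel_measurable (borel :: (real \<times> real) measure)"
        by (intro measurable_indicator_continuous Ab continuous_intros)
      moreover have "(\<lambda>x. indicator (-A) (fst x) :: real) \<in> borel_measurable (borel :: (real \<times> real) measure)"
        by (intro measurable_indicator_continuous Ab continuous_intros)
      ultimately show ?thesis unfolding case_prod_beta by (intro borel_measurable_times)
    qed
    have int: "integrable (circ \<Otimes>\<^sub>M circ) (\<lambda>(\<theta>, t). indicator (-A) \<theta> * (indicator A t * poisson (of_real (r n) * cis \<theta>) t))"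
      using meas
    proof (rule integrable_pair_circ)
      show "\<bar>indicator (-A) \<theta> * (indicator A t * poisson (of_real (r n) * cis \<theta>) t)\<bar> \<le> 2 / (1 - r n)" for \<theta> t
        using poisson_le_2[of "of_real (r n) * cis \<theta>" "r n" t] poisson_pos[of "of_real (r n) * cis \<theta>" t] r rn
        by (auto simp: indicator_def abs_mult less_imp_le)
    qed
    have "(LINT \<theta>|circ. indicator (-A) \<theta> * harmonic_measure A (of_real (r n) * cis \<theta>)) =
        (LINT \<theta>|circ. LINT t|circ. indicator (-A) \<theta> * (indicator A t * poisson (of_real (r n) * cis \<theta>) t))"
      unfolding harmonic_measure_def by simp
    also have "\<dots> = (LINT t|circ. LINT \<theta>|circ. indicator (-A) \<theta> * (indicator A t * poisson (of_real (r n) * cis \<theta>) t))"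
      by (rule pair_sigma_finite.Fubini_integral[OF pair_circ int, symmetric])
    also have "\<dots> = (LINT t|circ. LINT \<theta>|circ. indicator A t * (indicator (-A) \<theta> * poisson (of_real (r n) * cis t) \<theta>))"
    proof (intro Bochner_Integration.integral_cong refl)
      fix t \<theta>
      show "indicator (-A) \<theta> * (indicator A t * poisson (of_real (r n) * cis \<theta>) t) =
            indicator A t * (indicator (-A) \<theta> * poisson (of_real (r n) * cis t) \<theta>)"
        unfolding poisson_rotate[of "r n" \<theta> t] by (simp only: mult_ac)
    qed
    also have "\<dots> = (LINT t|circ. indicator A t * harmonic_measure (-A) (of_real (r n) * cis t))"
      unfolding harmonic_measure_def by simp
    finally show ?thesis .
  qed
  have contp: "continuous_on UNIV (\<lambda>t. harmonic_measure B (of_real (r n) * cis t))" if "B \<in> sets borel" for B n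
    by (rule continuous_on_compose2[OF continuous_on_harmonic_measure[OF that]]) (use rn r in \<open>auto intro!: continuous_intros\<close>)
  have lower: "\<delta> * measure circ (-A) \<le> (LINT \<theta>|circ. indicator (-A) \<theta> * harmonic_measure A (of_real (r n) * cis \<theta>))" for n
  proof -
    have "\<delta> * measure circ (-A) = (LINT \<theta>|circ. indicator (-A) \<theta> * \<delta>)" by simp
    also have "\<dots> \<le> (LINT \<theta>|circ. indicator (-A) \<theta> * harmonic_measure A (of_real (r n) * cis \<theta>))"
    proof (rule integral_mono)
      show "integrable circ (\<lambda>\<theta>. indicator (-A) \<theta> * harmonic_measure A (of_real (r n) * cis \<theta>))"
        using contp[OF Ab(1), of n, THEN borel_measurable_cont] harmonic_measure_le_1[OF Ab(1)] harmonic_measure_nonneg rn r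
        by (intro integrable_circ_bounded[of _ 1]) (auto simp: indicator_def)
      show "indicator (-A) \<theta> * \<delta> \<le> indicator (-A) \<theta> * harmonic_measure A (of_real (r n) * cis \<theta>)" for \<theta>
        using ge[of "of_real (r n) * cis \<theta>"] rn r by (intro mult_left_mono) auto
    qed (rule integrable_indicator_circ[OF Ab(2)])
    finally show ?thesis .
  qed
  have "(\<lambda>n. LINT t|circ. indicator A t * harmonic_measure (-A) (of_real (r n) * cis t)) \<longlonglongrightarrow> (LINT t|circ. 0)"
  proof (rule integral_dominated_convergence[where w = "\<lambda>_. 1"])
    show "(\<lambda>t. indicator A t * harmonic_measure (-A) (of_real (r n) * cis t)) \<in> borel_measurable circ" for n
      using contp[OF Ab(2), of n, THEN borel_measurable_cont] by simp
    show "AE t in circ. norm (indicator A t * harmonic_measure (-A) (of_real (r n) * cis t)) \<le> 1" for n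
      using harmonic_measure_le_1[OF Ab(2)] harmonic_measure_nonneg rn r by (auto simp: indicator_def)
    have "(\<lambda>n. indicator A t * harmonic_measure (-A) (of_real (r n) * cis t)) \<longlonglongrightarrow> 0" for t
    proof (cases "t \<in> A")
      case True
      then have "cis t \<in> V" using A by auto
      then obtain \<eta> where \<eta>: "\<eta> > 0" "ball (cis t) \<eta> \<subseteq> V" using V open_contains_ball by meson
      have "\<forall>\<^sub>F n in sequentially. r n > 1 - \<eta> / 2"
        using rlim \<eta> by (intro order_tendstoD) auto
      then have ev: "\<forall>\<^sub>F n in sequentially. norm (harmonic_measure (-A) (of_real (r n) * cis t)) \<le> (1 - (r n)\<^sup>2) / (\<eta> / 2)\<^sup>2"
      proof eventually_elim
        case (elim n)
        have "indicator (-A) \<theta> * poisson (of_real (r n) * cis t) \<theta> \<le> (1 - (r n)\<^sup>2) / (\<eta> / 2)\<^sup>2" for \<theta>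
        proof (cases "\<theta> \<in> A")
          case True
          then show ?thesis using r[of n] by (simp add: power_le_one)
        next
          case False
          then have "cmod (cis t - cis \<theta>) \<ge> \<eta>" using \<eta>(2) A by (force simp: dist_norm)
          moreover have "cmod (cis t - of_real (r n) * cis t) = 1 - r n"
          proof -
            have "cis t - of_real (r n) * cis t = of_real (1 - r n) * cis t" by (simp add: algebra_simps)
            then show ?thesis using r[of n] by (simp only: norm_mult norm_of_real norm_cis) simp
          qed
          ultimately have "\<eta> / 2 \<le> cmod (cis \<theta> - of_real (r n) * cis t)"
            using elim norm_triangle_ineq[of "cis t - of_real (r n) * cis t" "of_real (r n) * cis t - cis \<theta>"]
            by (simp add: norm_minus_commute)
          then have "(\<eta> / 2)\<^sup>2 \<le> (cmod (cis \<theta> - of_real (r n) * cis t))\<^sup>2" using \<eta> by (intro power_mono) auto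
          then have "poisson (of_real (r n) * cis t) \<theta> \<le> (1 - (r n)\<^sup>2) / (\<eta> / 2)\<^sup>2"
            unfolding poisson_def rn using r[of n] \<eta> by (intro frac_le) (auto simp: power_le_one)
          then show ?thesis using False by simp
        qed
        then have "harmonic_measure (-A) (of_real (r n) * cis t) \<le> (LINT \<theta>|circ. (1 - (r n)\<^sup>2) / (\<eta> / 2)\<^sup>2)"
          unfolding harmonic_measure_def using rn r by (intro integral_mono integrable_harmonic_measure) auto
        then show ?case using harmonic_measure_nonneg[of "of_real (r n) * cis t" "-A"] rn r by (simp add: circ.prob_space[simplified])
      qed
      have "(\<lambda>n. (1 - (r n)\<^sup>2) / (\<eta> / 2)\<^sup>2) \<longlonglongrightarrow> (1 - 1\<^sup>2) / (\<eta> / 2)\<^sup>2"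
        using \<eta> by (intro tendsto_intros rlim) auto
      then have "(\<lambda>n. (1 - (r n)\<^sup>2) / (\<eta> / 2)\<^sup>2) \<longlonglongrightarrow> 0" by simp
      then have "(\<lambda>n. harmonic_measure (-A) (of_real (r n) * cis t)) \<longlonglongrightarrow> 0"
        by (rule Lim_null_comparison[OF ev])
      then show ?thesis using True by simp
    qed simp
    then show "AE t in circ. (\<lambda>n. indicator A t * harmonic_measure (-A) (of_real (r n) * cis t)) \<longlonglongrightarrow> 0"
      by simp
  qed auto
  then have "(\<lambda>n. LINT \<theta>|circ. indicator (-A) \<theta> * harmonic_measure A (of_real (r n) * cis \<theta>)) \<longlonglongrightarrow> 0"
    by (simp add: swap)
  then have "\<delta> * measure circ (-A) \<le> 0"
    using lower by (intro LIMSEQ_le_const) auto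
  then show False using pos \<delta> by (simp add: mult_le_0_iff)
qed

lemma dist_cis_le: "cmod (cis a - cis b) \<le> \<bar>a - b\<bar>"
proof -
  have "(cmod (cis a - cis b))\<^sup>2 = ((cos a)\<^sup>2 + (sin a)\<^sup>2) + ((cos b)\<^sup>2 + (sin b)\<^sup>2) - 2 * (cos a * cos b + sin a * sin b)"
    unfolding cmod_power2 by (simp add: power2_eq_square algebra_simps del: sin_cos_squared_add sin_cos_squared_add2 sin_cos_squared_add3)
  also have "\<dots> = 2 - 2 * cos (a - b)" by (simp add: cos_diff)
  also have "\<dots> = (2 * \<bar>sin ((a - b) / 2)\<bar>)\<^sup>2"
  proof -
    define h where "h = (a - b) / 2"
    have "a - b = 2 * h" by (simp add: h_def)
    then show ?thesis using cos_double_sin[of h] by (simp add: power_mult_distrib)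
  qed
  finally have "cmod (cis a - cis b) = 2 * \<bar>sin ((a - b) / 2)\<bar>"
    by (rule power2_eq_imp_eq) auto
  also have "\<dots> \<le> 2 * \<bar>(a - b) / 2\<bar>" using abs_sin_x_le_abs_x[of "(a - b) / 2"] by linarith
  finally show ?thesis by simp
qed

text \<open>The Poisson kernel of \<open>r e\<close> is of order \<open>1 / (1 - r)\<close> on an arc of
  length of order \<open>1 - r\<close> around \<open>e\<close>.\<close>

lemma harmonic_measure_shadow_bound:
  assumes A: "A \<in> sets borel" and e: "cmod e = 1" and r: "0 \<le> r" "r < 1"
    and c: "0 < c" "c \<le> 1" and sh: "\<And>t. cmod (cis t - e) < c * (1 - r) \<Longrightarrow> t \<in> A"
  shows "c / (8 * pi) \<le> harmonic_measure A (of_real r * e)"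
proof -
  define \<tau> where "\<tau> = Arg e"
  have "e \<noteq> 0" using e by auto
  then have \<tau>: "- pi < \<tau>" "\<tau> \<le> pi" "e = cis \<tau>"
    using Arg_bounded[of e] e cis_Arg[of e] by (auto simp: \<tau>_def sgn_eq)
  define \<eta> where "\<eta> = c * (1 - r)"
  have "c * (1 - r) \<le> 1 * 1" using r c by (intro mult_mono) auto
  then have \<eta>: "0 < \<eta>" "\<eta> \<le> 1" using r c by (auto simp: \<eta>_def)
  have pi1: "pi > 1" using pi_gt3 by simp
  define J where "J = (if \<tau> \<le> 0 then {\<tau><..<\<tau> + \<eta>} else {\<tau> - \<eta><..<\<tau>})"
  have J: "J \<subseteq> {-pi..pi}" "J \<in> sets borel" "emeasure lborel J = ennreal \<eta>"
    using \<tau> \<eta> pi1 by (auto simp: J_def)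
  have near: "cmod (cis t - e) < \<eta>" if "t \<in> J" for t
    using that dist_cis_le[of t \<tau>] \<tau>(3) by (auto simp: J_def split: if_splits)
  have JA: "J \<subseteq> A" using near sh by (auto simp: \<eta>_def)
  have mJ: "measure circ J = \<eta> / (2 * pi)"
  proof -
    have "J \<inter> {-pi..pi} = J" using J(1) by blast
    then have "emeasure circ J = ennreal (1 / (2 * pi)) * ennreal \<eta>"
      using emeasure_circ[OF J(2)] J(3) by simp
    also have "\<dots> = ennreal (\<eta> / (2 * pi))" using \<eta> by (subst ennreal_mult'[symmetric]) auto
    finally show ?thesis using \<eta> by (simp add: measure_def)
  qed
  have z1: "cmod (of_real r * e) = r" using r e by (simp add: norm_mult)
  have P: "poisson (of_real r * e) t \<ge> 1 / (4 * (1 - r))" if t: "t \<in> J" for t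
  proof -
    have "cmod (cis t - of_real r * e) \<le> cmod (cis t - e) + cmod (e - of_real r * e)"
      using norm_triangle_ineq[of "cis t - e" "e - of_real r * e"] by simp
    also have "cmod (e - of_real r * e) = 1 - r"
    proof -
      have "e - of_real r * e = of_real (1 - r) * e" by (simp add: algebra_simps)
      then show ?thesis using r e by (simp only: norm_mult norm_of_real) simp
    qed
    also have "cmod (cis t - e) \<le> 1 - r"
    proof -
      have "c * (1 - r) \<le> 1 * (1 - r)" using c r by (intro mult_right_mono) auto
      then have "\<eta> \<le> 1 - r" by (simp add: \<eta>_def)
      then show ?thesis by (rule order_trans[OF less_imp_le[OF near[OF t]]])
    qed
    finally have "cmod (cis t - of_real r * e) \<le> 2 * (1 - r)" by simp
    then have "(cmod (cis t - of_real r * e))\<^sup>2 \<le> (2 * (1 - r))\<^sup>2" by (intro power_mono) auto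
    then have "(1 - r) / (2 * (1 - r))\<^sup>2 \<le> (1 - r\<^sup>2) / (cmod (cis t - of_real r * e))\<^sup>2"
      using r cis_minus_nonzero[of "of_real r * e" t] z1
      by (intro frac_le) (auto simp: power_le_one power2_eq_square[of r] mult_left_le_one_le mult_le_one)
    moreover have "d / (2 * d)\<^sup>2 = 1 / (4 * d)" if "d > 0" for d :: real
      using that by (simp add: power2_eq_square)
    from this[of "1 - r"] have "(1 - r) / (2 * (1 - r))\<^sup>2 = 1 / (4 * (1 - r))"
      using r(2) by (simp only: diff_gt_0_iff_gt)
    ultimately show ?thesis unfolding poisson_def z1 by argo
  qed
  have "c / (8 * pi) = measure circ J * (1 / (4 * (1 - r)))"
  proof -
    have "c / (8 * pi) = c * d / (2 * pi) * (1 / (4 * d))" if "d > 0" for d :: real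
      using that by simp
    then show ?thesis unfolding mJ \<eta>_def using r(2) by (simp only: diff_gt_0_iff_gt)
  qed
  also have "\<dots> = (LINT t|circ. indicator J t * (1 / (4 * (1 - r))))" using J(2) by simp
  also have "\<dots> \<le> harmonic_measure A (of_real r * e)"
    unfolding harmonic_measure_def
  proof (intro integral_mono integrable_harmonic_measure A)
    show "integrable circ (\<lambda>t. indicator J t * (1 / (4 * (1 - r))))"
      by (rule integrable_indicator_circ[OF J(2)])
    show "indicator J t * (1 / (4 * (1 - r))) \<le> indicator A t * poisson (of_real r * e) t" for t
      using P[of t] JA poisson_pos[of "of_real r * e" t] z1 r by (auto simp: indicator_def less_imp_le)
  qed (use z1 r in auto)
  finally show ?thesis .
qed

text \<open>On a pseudo-hyperbolic disk of radius \<open>1/2\<close> the numerator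
  \<open>1 - |z|\<^sup>2\<close> and the denominator \<open>|cis t - z|\<^sup>2\<close> vary by bounded
  factors.\<close>

lemma poisson_Harnack:
  assumes z: "cmod z < 1" "cmod b < 1" and d: "phd z b \<le> 1/2"
  shows "poisson b t / 36 \<le> poisson z t"
proof -
  define D where "D = cmod (1 - cnj b * z)"
  define p where "p = 1 - (cmod z)\<^sup>2"
  define q where "q = 1 - (cmod b)\<^sup>2"
  have D0: "D > 0" using moebius_denom[of b z] z by (simp add: D_def)
  have pq: "p > 0" "q > 0" using z by (auto simp: p_def q_def power_less_one_iff abs_square_less_1)
  have zb: "cmod (z - b) \<le> D / 2" using d D0 by (simp add: phd_eq D_def field_simps)
  have "(phd z b)\<^sup>2 \<le> (1/2)\<^sup>2" using d phd_nonneg by (intro power_mono) auto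
  then have "3/4 \<le> 1 - (phd z b)\<^sup>2" by (simp add: power2_eq_square)
  also have "\<dots> = p * q / D\<^sup>2" using one_minus_phd_sq[of b z] z by (simp add: p_def q_def D_def)
  finally have pqD: "3/4 * D\<^sup>2 \<le> p * q" using D0 by (simp add: field_simps)
  have e: "1 - cnj b * z = of_real q - cnj b * (z - b)"
    using complex_norm_square[of b] by (simp add: q_def algebra_simps)
  have "cmod (cnj b * (z - b)) \<le> 1 * (D / 2)"
    unfolding norm_mult using zb z by (intro mult_mono) auto
  moreover have "cmod (of_real q) = q" using pq by simp
  ultimately have Dq: "D \<le> q + D / 2" "q \<le> D + D / 2"
    unfolding D_def[symmetric] using norm_triangle_ineq4[of "of_real q" "cnj b * (z - b)"]
      norm_triangle_ineq2[of "of_real q" "cnj b * (z - b)"] e by (auto simp: D_def)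
  have "p \<ge> q / 4"
  proof -
    have "q / 4 * q \<le> (3/8) * D * q" using Dq pq by (intro mult_right_mono) auto
    also have "\<dots> \<le> (3/8) * D * (2 * D) "
    proof (rule ccontr)
      assume "\<not> ?thesis"
      then show False using Dq D0 mult_left_mono[of q "2 * D" "(3/8) * D"] by linarith
    qed
    also have "\<dots> = 3/4 * D\<^sup>2" by (simp add: power2_eq_square)
    also have "\<dots> \<le> p * q" by (rule pqD)
    finally show ?thesis using pq by simp
  qed
  have b0: "1 - cmod b \<le> cmod (cis t - b)" using norm_triangle_ineq2[of "cis t" b] by simp
  have q2: "q \<le> 2 * (1 - cmod b)"
  proof -
    have "q = (1 - cmod b) * (1 + cmod b)" by (simp add: q_def power2_eq_square algebra_simps)
    also have "\<dots> \<le> (1 - cmod b) * 2" using z by (intro mult_left_mono) auto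
    finally show ?thesis by simp
  qed
  have "cmod (cis t - z) \<le> cmod (cis t - b) + cmod (z - b)"
    using norm_triangle_ineq4[of "cis t - b" "z - b"] by simp
  also have "\<dots> \<le> cmod (cis t - b) + q" using zb Dq D0 by linarith
  also have "\<dots> \<le> 3 * cmod (cis t - b)"
  proof -
    have "2 * (1 - cmod b) \<le> 2 * cmod (cis t - b)" using b0 by simp
    then have "q \<le> 2 * cmod (cis t - b)" by (rule order_trans[OF q2])
    then show ?thesis by simp
  qed
  finally have "(cmod (cis t - z))\<^sup>2 \<le> (3 * cmod (cis t - b))\<^sup>2" by (intro power_mono) auto
  then have "(q / 4) / (3 * cmod (cis t - b))\<^sup>2 \<le> p / (cmod (cis t - z))\<^sup>2"
    using \<open>p \<ge> q / 4\<close> pq cis_minus_nonzero[OF z(1), of t] by (intro frac_le) auto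
  then show ?thesis by (simp add: poisson_def p_def q_def power_mult_distrib)
qed

lemma harmonic_measure_Harnack:
  assumes "A \<in> sets borel" "cmod z < 1" "cmod b < 1" "phd z b \<le> 1/2"
  shows "harmonic_measure A b / 36 \<le> harmonic_measure A z"
proof -
  have "harmonic_measure A b / 36 = (LINT t|circ. indicator A t * poisson b t / 36)" by (simp add: harmonic_measure_def)
  also have "\<dots> \<le> harmonic_measure A z" unfolding harmonic_measure_def
    using assms poisson_Harnack[OF assms(2-4)]
    by (intro integral_mono integrable_harmonic_measure integrable_divide) (auto simp: indicator_def)
  finally show ?thesis .
qed

section \<open>Green sums over an orbit\<close>

text \<open>The Green function of the disk, cut off on the pseudo-hyperbolic disk of radius \<open>1/2\<close>
  around its pole in order to have a finite supremum.\<close>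

definition truncated_Green :: "complex \<Rightarrow> complex \<Rightarrow> real" where
  "truncated_Green b z = - ln (max (1/2) (phd z b))"

lemma phd_boundary: "cmod b < 1 \<Longrightarrow> cmod z = 1 \<Longrightarrow> phd z b = 1"
  using one_minus_phd_sq[of b z] phd_nonneg[of z b] by (simp add: power2_eq_1_iff)

lemma phd_le_1: "cmod b < 1 \<Longrightarrow> cmod z \<le> 1 \<Longrightarrow> phd z b \<le> 1"
  using phd_boundary[of b z] phd_lt_1[of b z] by (cases "cmod z = 1") auto

lemma continuous_on_phd: "cmod b < 1 \<Longrightarrow> continuous_on (cball 0 1) (\<lambda>z. phd z b)"
  unfolding phd_eq using moebius_denom[of b] by (intro continuous_intros) auto

lemma continuous_on_truncated_Green: "cmod b < 1 \<Longrightarrow> continuous_on (cball 0 1) (truncated_Green b)"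
  unfolding truncated_Green_def[abs_def] by (intro continuous_intros continuous_on_phd) auto

lemma truncated_Green_bounds:
  assumes "cmod b < 1" "cmod z \<le> 1"
  shows "0 \<le> truncated_Green b z" "truncated_Green b z \<le> ln 2"
proof -
  show "0 \<le> truncated_Green b z" using phd_le_1[OF assms] by (simp add: truncated_Green_def)
  have "ln (1/2) \<le> ln (max (1/2) (phd z b))" by simp
  then show "truncated_Green b z \<le> ln 2" by (simp add: truncated_Green_def ln_div)
qed

lemma truncated_Green_boundary: "cmod b < 1 \<Longrightarrow> cmod z = 1 \<Longrightarrow> truncated_Green b z = 0"
  by (simp add: truncated_Green_def phd_boundary)

lemma harm_on_cong:
  assumes "harm_on U u" "\<And>z. z \<in> U \<Longrightarrow> v z = u z"
  shows "harm_on U v"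
  unfolding harm_on_def
proof (intro conjI ballI)
  show "continuous_on U v" using assms by (auto simp: harm_on_def cong: continuous_on_cong)
  fix z assume z: "z \<in> U"
  then obtain e where e: "e > 0" "\<And>s. 0 < s \<and> s < e \<Longrightarrow> cball z s \<subseteq> U \<and> (LINT t|circ. u (z + of_real s * cis t)) = u z"
    using assms(1) unfolding harm_on_def by meson
  show "\<exists>e>0. \<forall>s. 0 < s \<and> s < e \<longrightarrow> cball z s \<subseteq> U \<and> (LINT t|circ. v (z + of_real s * cis t)) = v z"
  proof (intro exI[of _ e] conjI allI impI)
    fix s assume s: "0 < s \<and> s < e"
    show sub: "cball z s \<subseteq> U" using e(2)[OF s] by simp
    have "z + of_real s * cis t \<in> U" for t
      using sub s by (auto simp: dist_norm norm_mult subset_iff)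
    then show "(LINT t|circ. v (z + of_real s * cis t)) = v z"
      using e(2)[OF s] assms(2) z by simp
  qed (use e in auto)
qed

lemma harm_on_truncated_Green:
  assumes b: "cmod b < 1" and U: "open U" "U \<subseteq> ball 0 1" "\<And>z. z \<in> U \<Longrightarrow> phd z b > 1/2"
  shows "harm_on U (truncated_Green b)"
proof -
  have "harm_on U (\<lambda>z. ln (cmod (Moebius_function 0 b z)))"
  proof (rule harm_on_ln_norm)
    show "Moebius_function 0 b holomorphic_on U"
      by (rule holomorphic_on_subset[OF Moebius_function_holomorphic[OF b] U(2)])
    show "Moebius_function 0 b z \<noteq> 0" if "z \<in> U" for z
      using U(3)[OF that] by (auto simp: phd_def)
  qed fact
  then have "harm_on U (\<lambda>z. (-1) * ln (phd z b))" unfolding phd_def by (rule harm_on_cmult)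
  then show ?thesis
    by (rule harm_on_cong) (use U(3) in \<open>force simp: truncated_Green_def max_def\<close>)
qed

text \<open>The orbit of 0 under a group of disk automorphisms, with the properties on which the estimates
  rest.\<close>

locale disk_orbit =
  fixes Orb :: "complex set"
  assumes Orb_disk: "b \<in> Orb \<Longrightarrow> cmod b < 1"
    and Orb_0: "0 \<in> Orb"
    and Orb_finite: "r < 1 \<Longrightarrow> finite {b \<in> Orb. cmod b \<le> r}"
    and Orb_homogeneous: "b \<in> Orb \<Longrightarrow> \<exists>g \<in> disk_automorphisms. g 0 = b \<and> g ` Orb = Orb"
begin

definition Green_sum :: "complex set \<Rightarrow> complex \<Rightarrow> real" where
  "Green_sum F z = (\<Sum>b\<in>F. truncated_Green b z)"

lemma Green_sum_nonneg: "F \<subseteq> Orb \<Longrightarrow> cmod z \<le> 1 \<Longrightarrow> Green_sum F z \<ge> 0"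
  unfolding Green_sum_def by (intro sum_nonneg truncated_Green_bounds Orb_disk) auto

lemma Green_sum_le_card: "F \<subseteq> Orb \<Longrightarrow> cmod z \<le> 1 \<Longrightarrow> Green_sum F z \<le> card F * ln 2"
  unfolding Green_sum_def using truncated_Green_bounds(2) Orb_disk by (intro sum_bounded_above) auto

lemma continuous_on_Green_sum: "F \<subseteq> Orb \<Longrightarrow> continuous_on (cball 0 1) (Green_sum F)"
  unfolding Green_sum_def[abs_def] by (intro continuous_intros continuous_on_truncated_Green Orb_disk) auto

lemma compact_Green_sum_ge: "F \<subseteq> Orb \<Longrightarrow> compact {z \<in> cball 0 1. Green_sum F z \<ge> c}"
proof -
  assume F: "F \<subseteq> Orb"
  have "closed (cball 0 1 \<inter> Green_sum F -` {c..})"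
    by (rule continuous_closed_preimage[OF continuous_on_Green_sum[OF F]]) auto
  moreover have "cball 0 1 \<inter> Green_sum F -` {c..} = {z \<in> cball 0 1. Green_sum F z \<ge> c}" by auto
  ultimately have "closed {z \<in> cball 0 1. Green_sum F z \<ge> c}" by simp
  moreover have "bounded {z \<in> cball 0 1. Green_sum F z \<ge> c}"
    by (rule bounded_subset[OF bounded_cball[of 0 1]]) auto
  ultimately show ?thesis by (simp add: compact_eq_bounded_closed)
qed

lemma Green_sum_ge_in_ball: "F \<subseteq> Orb \<Longrightarrow> c > 0 \<Longrightarrow> z \<in> cball 0 1 \<Longrightarrow> Green_sum F z \<ge> c \<Longrightarrow> cmod z < 1"
  unfolding Green_sum_def using truncated_Green_boundary Orb_disk
  by (cases "cmod z = 1") (force simp: subset_iff intro: sum.neutral)+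

text \<open>Off the pseudo-hyperbolic disks around its poles the truncated Green sum is harmonic, and it
  vanishes on the circle.\<close>

lemma Green_sum_le_sup_on_disks:
  assumes F: "finite F" "F \<subseteq> Orb" and A: "A \<ge> 0"
    and le: "\<And>z b. b \<in> F \<Longrightarrow> cmod z < 1 \<Longrightarrow> phd z b \<le> 1/2 \<Longrightarrow> Green_sum F z \<le> A"
    and z: "cmod z < 1"
  shows "Green_sum F z \<le> A"
proof (rule ccontr)
  assume n: "\<not> Green_sum F z \<le> A"
  define U where "U = {w. cmod w < 1 \<and> (\<forall>b\<in>F. phd w b > 1/2)}"
  have "open (ball 0 1 \<inter> (\<lambda>z. phd z b) -` {1/2<..})" if "b \<in> F" for b
    by (rule continuous_open_preimage[OF continuous_on_subset[OF continuous_on_phd]])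
       (use that F Orb_disk in auto)
  then have "open ((\<Inter>b\<in>F. ball 0 1 \<inter> (\<lambda>z. phd z b) -` {1/2<..}) \<inter> ball 0 1)"
    by (intro open_Int[OF open_INT[OF F(1)]] ballI) auto
  moreover have "(\<Inter>b\<in>F. ball 0 1 \<inter> (\<lambda>z. phd z b) -` {1/2<..}) \<inter> ball 0 1 = U"
    unfolding U_def by (intro set_eqI) (simp only: INT_iff Int_iff vimage_eq mem_ball_0 greaterThan_iff mem_Collect_eq, blast)
  ultimately have "open U" by (simp only:)
  have U1: "U \<subseteq> ball 0 1" by (auto simp: U_def)
  have zU: "z \<in> U" using n le z by (force simp: U_def)
  have "harm_on U (\<lambda>z. Green_sum F z + (- A))"
    unfolding Green_sum_def using F Orb_disk \<open>open U\<close> U1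
    by (intro harm_on_add harm_on_sum harm_on_const harm_on_truncated_Green) (auto simp: U_def)
  then have "Green_sum F z + (- A) \<le> 0"
  proof (rule maximum_principle[OF _ U1 _ zU])
    fix \<eta> :: real assume \<eta>: "\<eta> > 0"
    show "\<exists>K. compact K \<and> K \<subseteq> U \<and> (\<forall>z\<in>U - K. Green_sum F z + - A \<le> \<eta>)"
    proof (intro exI[of _ "{z \<in> cball 0 1. Green_sum F z \<ge> A + \<eta>}"] conjI ballI compact_Green_sum_ge F)
      show "{z \<in> cball 0 1. Green_sum F z \<ge> A + \<eta>} \<subseteq> U"
      proof
        fix w assume w: "w \<in> {z \<in> cball 0 1. Green_sum F z \<ge> A + \<eta>}"
        then have w1: "cmod w < 1" using Green_sum_ge_in_ball[OF F(2), of "A + \<eta>" w] A \<eta> by auto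
        then show "w \<in> U" using le[OF _ w1] w \<eta> by (force simp: U_def)
      qed
    qed (use U1 in force)
  qed
  then show False using n by simp
qed

text \<open>Where \<open>h < \<delta>\<close>, the point is far from the orbit and the Green sum is
  harmonic; there the maximum principle compares it with \<open>M h / \<delta>\<close>, which is at least
  as large where \<open>h = \<delta>\<close>.\<close>

lemma Green_sum_le_harmonic:
  assumes F: "finite F" "F \<subseteq> Orb" and M: "\<And>z. cmod z < 1 \<Longrightarrow> Green_sum F z \<le> M"
    and h: "harm_on (ball 0 1) h" "\<And>z. cmod z < 1 \<Longrightarrow> h z \<ge> 0" and \<delta>: "\<delta> > 0"
    and near: "\<And>z b. b \<in> Orb \<Longrightarrow> cmod z < 1 \<Longrightarrow> phd z b \<le> 1/2 \<Longrightarrow> h z \<ge> \<delta>"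
    and z: "cmod z < 1"
  shows "Green_sum F z \<le> M * min 1 (h z / \<delta>)"
proof (cases "h z < \<delta>")
  case False
  then show ?thesis using M[OF z] \<delta> by simp
next
  case True
  have M0: "M \<ge> 0" using M[of 0] Green_sum_nonneg[OF F(2), of 0] by simp
  define U where "U = ball 0 1 \<inter> h -` {..<\<delta>}"
  have conth: "continuous_on (ball 0 1) h" using h by (simp add: harm_on_def)
  then have "open U" unfolding U_def by (intro continuous_open_preimage) auto
  have U1: "U \<subseteq> ball 0 1" by (auto simp: U_def)
  have zU: "z \<in> U" using True z by (simp add: U_def)
  have far: "phd w b > 1/2" if "w \<in> U" "b \<in> Orb" for w b
    using near[OF that(2), of w] that(1) by (force simp: U_def)
  have "harm_on U (\<lambda>z. Green_sum F z + (- (M / \<delta>)) * h z)"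
    unfolding Green_sum_def using F Orb_disk \<open>open U\<close> U1 far
    by (intro harm_on_add harm_on_sum harm_on_cmult harm_on_truncated_Green harm_on_subset[OF h(1)]) auto
  then have "Green_sum F z + (- (M / \<delta>)) * h z \<le> 0"
  proof (rule maximum_principle[OF _ U1 _ zU])
    fix \<eta> :: real assume \<eta>: "\<eta> > 0"
    define K1 where "K1 = {z \<in> cball 0 1. Green_sum F z \<ge> \<eta>}"
    have K1: "compact K1" "K1 \<subseteq> ball 0 1"
      unfolding K1_def using compact_Green_sum_ge[OF F(2)] Green_sum_ge_in_ball[OF F(2) \<eta>] by auto
    have ch: "continuous_on K1 h" by (rule continuous_on_subset[OF conth K1(2)])
    have cT: "continuous_on K1 (Green_sum F)" by (rule continuous_on_subset[OF continuous_on_Green_sum[OF F(2)]]) (auto simp: K1_def)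
    define K where "K = (K1 \<inter> (\<lambda>z. Green_sum F z + (- (M / \<delta>)) * h z) -` {\<eta>..}) \<inter> (K1 \<inter> h -` {..\<delta>})"
    have "closed K" unfolding K_def using K1(1)
      by (intro closed_Int continuous_closed_preimage continuous_intros ch cT) (auto intro: compact_imp_closed)
    moreover have "K \<subseteq> K1" by (auto simp: K_def)
    ultimately have "compact K" using K1(1) by (metis compact_Int_closed inf.absorb_iff2)
    moreover have "K \<subseteq> U"
    proof
      fix w assume w: "w \<in> K"
      then have w1: "cmod w < 1" using K1(2) by (auto simp: K_def)
      have "h w \<noteq> \<delta>"
      proof
        assume "h w = \<delta>"
        then have "Green_sum F w \<ge> \<eta> + M" using w \<delta> by (simp add: K_def)
        then show False using M[OF w1] \<eta> by simp
      qed
      then show "w \<in> U" using w w1 by (auto simp: K_def U_def)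
    qed
    moreover have "Green_sum F w + (- (M / \<delta>)) * h w \<le> \<eta>" if w: "w \<in> U - K" for w
    proof (cases "Green_sum F w \<ge> \<eta>")
      case True
      have "w \<in> K1" using True w U1 by (force simp: K1_def)
      then show ?thesis using w by (auto simp: K_def U_def)
    next
      case False
      have "0 \<le> M / \<delta> * h w" using M0 \<delta> h(2)[of w] w U1 by (intro mult_nonneg_nonneg) auto
      then show ?thesis using False by simp
    qed
    ultimately show "\<exists>K. compact K \<and> K \<subseteq> U \<and> (\<forall>z\<in>U - K. Green_sum F z + - (M / \<delta>) * h z \<le> \<eta>)" by blast
  qed
  then show ?thesis using True \<delta> by (simp add: min_def)
qed

text \<open>Far from its poles the truncated Green sum is the real part of a holomorphic function, a logarithm
  of the finite product of Moebius factors.\<close>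

lemma poisson_Green_sum:
  assumes F: "finite F" "F \<subseteq> Orb" and \<rho>: "0 < \<rho>" "\<rho> < \<rho>2"
    "\<rho>2 \<le> 1" and far: "\<And>z b. b \<in> F \<Longrightarrow> cmod z < \<rho>2 \<Longrightarrow> phd z b > 1/2" and z: "cmod z < \<rho>"
  shows "Green_sum F z = (LINT t|circ. poisson (z / of_real \<rho>) t * Green_sum F (of_real \<rho> * cis t))"
proof -
  define Q where "Q w = (\<Prod>b\<in>F. Moebius_function 0 b w)" for w
  have Qhol: "Q holomorphic_on ball 0 \<rho>2" unfolding Q_def
    using F Orb_disk \<rho> by (intro holomorphic_intros holomorphic_on_subset[OF Moebius_function_holomorphic]) auto
  have M0: "Moebius_function 0 b w \<noteq> 0" if "b \<in> F" "w \<in> ball 0 \<rho>2" for b w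
    using far[OF that(1), of w] that(2) by (auto simp: phd_def)
  then have Q0: "Q w \<noteq> 0" if "w \<in> ball 0 \<rho>2" for w
    using F that by (simp add: Q_def)
  have "contractible (ball (0::complex) \<rho>2)" by (intro convex_imp_contractible convex_ball)
  then obtain f where f: "f holomorphic_on ball 0 \<rho>2" "\<And>w. w \<in> ball 0 \<rho>2 \<Longrightarrow> Q w = exp (f w)"
    using contractible_imp_holomorphic_log[OF Qhol _ Q0] by metis
  have TF: "Green_sum F w = - Re (f w)" if w: "w \<in> ball 0 \<rho>2" for w
  proof -
    have "Green_sum F w = (\<Sum>b\<in>F. - ln (cmod (Moebius_function 0 b w)))"
      unfolding Green_sum_def using far w by (intro sum.cong) (force simp: truncated_Green_def phd_def max_def)+
    also have "\<dots> = - (\<Sum>b\<in>F. ln (cmod (Moebius_function 0 b w)))" by (rule sum_negf)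
    also have "(\<Sum>b\<in>F. ln (cmod (Moebius_function 0 b w))) = ln (\<Prod>b\<in>F. cmod (Moebius_function 0 b w))"
      using M0[OF _ w] F(1) by (subst ln_prod) auto
    also have "(\<Prod>b\<in>F. cmod (Moebius_function 0 b w)) = cmod (Q w)" by (simp add: Q_def prod_norm)
    also have "ln (cmod (Q w)) = Re (f w)" using f(2)[OF w] by simp
    finally show ?thesis .
  qed
  define k where "k u = f (of_real \<rho> * u)" for u
  have sub: "of_real \<rho> * u \<in> ball 0 \<rho>2" if "cmod u \<le> 1" for u
  proof -
    have "\<rho> * cmod u \<le> \<rho> * 1" using that \<rho> by (intro mult_left_mono) auto
    then have "\<rho> * cmod u < \<rho>2" using \<rho> by linarith
    then show ?thesis using \<rho> by (simp add: norm_mult)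
  qed
  have "k (z / of_real \<rho>) = (LINT t|circ. poisson (z / of_real \<rho>) t *\<^sub>R k (cis t))"
  proof (rule poisson_integral)
    show "continuous_on (cball 0 1) k" unfolding k_def
      by (rule continuous_on_compose2[OF holomorphic_on_imp_continuous_on[OF f(1)]])
         (use sub in \<open>auto intro!: continuous_intros\<close>)
    have "(\<lambda>u. complex_of_real \<rho> * u) ` ball 0 1 \<subseteq> ball 0 \<rho>2" using sub by auto
    then have "f \<circ> (\<lambda>u. complex_of_real \<rho> * u) holomorphic_on ball 0 1"
      by (intro holomorphic_on_compose_gen[OF _ f(1)] holomorphic_intros)
    then show "k holomorphic_on ball 0 1" by (simp add: k_def[abs_def] o_def)
    show "cmod (z / of_real \<rho>) < 1" using z \<rho> by (simp add: norm_divide)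
  qed
  then have "Re (f z) = Re (LINT t|circ. poisson (z / of_real \<rho>) t *\<^sub>R k (cis t))"
    using \<rho> by (simp add: k_def)
  also have "\<dots> = (LINT t|circ. Re (poisson (z / of_real \<rho>) t *\<^sub>R k (cis t)))"
  proof (rule integral_Re[symmetric])
    show "integrable circ (\<lambda>t. poisson (z / of_real \<rho>) t *\<^sub>R k (cis t))"
      unfolding k_def using z \<rho>
      by (intro integrable_circ_cont continuous_intros continuous_poisson
            continuous_on_compose2[OF holomorphic_on_imp_continuous_on[OF f(1)]])
         (auto simp: norm_divide norm_mult)
  qed
  also have "\<dots> = (LINT t|circ. - (poisson (z / of_real \<rho>) t * Green_sum F (of_real \<rho> * cis t)))"
    using TF[OF sub] by (simp add: k_def)
  finally show ?thesis using TF[of z] z \<rho> by simp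
qed

text \<open>Let \<open>A\<close> be the supremum of the Green sum. On the disk \<open>|z| \<le> 1/2\<close>
  it is at most the contribution of the finitely many poles near that disk, plus a Poisson average of values
  at most \<open>A min(1, h / \<delta>)\<close>. The average is at most
  \<open>A (1 - \<kappa>)\<close>, since \<open>h < \<delta>\<close> near \<open>z0\<close>. As the
  supremum is approached near the poles and every orbit point can be moved to 0, this bound holds for
  \<open>A\<close> itself, whence \<open>A \<le> N ln 2 / \<kappa>\<close>.\<close>

theorem Green_sum_bounded:
  assumes h: "harm_on (ball 0 1) h" "\<And>z. cmod z < 1 \<Longrightarrow> h z \<ge> 0" and \<delta>: "\<delta> > 0"
    and near: "\<And>z b. b \<in> Orb \<Longrightarrow> cmod z < 1 \<Longrightarrow> phd z b \<le> 1/2 \<Longrightarrow> h z \<ge> \<delta>"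
    and z0: "cmod z0 < 1" "h z0 < \<delta>"
  shows "\<exists>C. \<forall>F z. finite F \<longrightarrow> F \<subseteq> Orb \<longrightarrow> cmod z < 1 \<longrightarrow> Green_sum F z \<le> C"
proof -
  define \<rho> where "\<rho> = cmod z0"
  have \<rho>: "1/2 < \<rho>" "\<rho> < 1"
    using near[OF Orb_0 z0(1)] z0 by (auto simp: \<rho>_def not_le[symmetric])
  define \<rho>2 where "\<rho>2 = (1 + \<rho>) / 2"
  have \<rho>2: "\<rho> < \<rho>2" "\<rho>2 < 1" using \<rho> by (auto simp: \<rho>2_def)
  \<comment> \<open>Poles beyond \<open>\<rho>3\<close> are far, in the pseudo-hyperbolic sense, from the disk of radius \<open>\<rho>2\<close>.\<close>
  define \<rho>3 where "\<rho>3 = 1 - 3/8 * (1 - \<rho>2)\<^sup>2"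
  have \<rho>3: "\<rho>3 < 1" using \<rho>2 by (simp add: \<rho>3_def)
  have far: "phd z b > 1/2" if "cmod z < \<rho>2" "cmod b < 1" "\<rho>3 < cmod b" for z b
  proof (rule ccontr)
    assume "\<not> phd z b > 1/2"
    then have "(phd z b)\<^sup>2 \<le> (1/2)\<^sup>2" using phd_nonneg by (intro power_mono) auto
    then have "3/4 \<le> 1 - (phd z b)\<^sup>2" by (simp add: power2_eq_square)
    also have "\<dots> = (1 - (cmod z)\<^sup>2) * (1 - (cmod b)\<^sup>2) / (cmod (1 - cnj b * z))\<^sup>2"
      using that \<rho>2 by (intro one_minus_phd_sq) auto
    also have "\<dots> \<le> (1 * (2 * (1 - cmod b))) / (1 - \<rho>2)\<^sup>2"
    proof (rule frac_le)
      have "1 - (cmod b)\<^sup>2 = (1 - cmod b) * (1 + cmod b)" by algebra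
      also have "\<dots> \<le> (1 - cmod b) * 2" using that by (intro mult_left_mono) auto
      finally show "(1 - (cmod z)\<^sup>2) * (1 - (cmod b)\<^sup>2) \<le> 1 * (2 * (1 - cmod b))"
        using that \<rho>2 by (intro mult_mono) (auto simp: power_le_one)
      have "cmod b * cmod z \<le> 1 * \<rho>2" using that \<rho> \<rho>2 by (intro mult_mono) auto
      then have "1 - \<rho>2 \<le> 1 - cmod (cnj b * z)" by (simp add: norm_mult)
      also have "\<dots> \<le> cmod (1 - cnj b * z)" using norm_triangle_ineq2[of 1 "cnj b * z"] by simp
      finally show "(1 - \<rho>2)\<^sup>2 \<le> (cmod (1 - cnj b * z))\<^sup>2" using \<rho>2 by (intro power_mono) auto
    qed (use that \<rho>2 in auto)
    finally have "3/4 * (1 - \<rho>2)\<^sup>2 \<le> 2 * (1 - cmod b)" using \<rho>2 by (simp add: pos_le_divide_eq)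
    then show False using that(3) by (simp add: \<rho>3_def)
  qed
  define N where "N = card {b \<in> Orb. cmod b \<le> \<rho>3}"
  define m where "m t = min 1 (h (of_real \<rho> * cis t) / \<delta>)" for t
  have contm: "continuous_on UNIV m"
  proof -
    have "continuous_on (ball 0 1) h" using h by (simp add: harm_on_def)
    then have "continuous_on UNIV (\<lambda>t. h (of_real \<rho> * cis t))"
      by (rule continuous_on_compose2) (use \<rho> in \<open>auto intro!: continuous_intros simp: norm_mult\<close>)
    then show ?thesis unfolding m_def using \<delta> by (intro continuous_intros) auto
  qed
  have m01: "0 \<le> m t" "m t \<le> 1" for t
    unfolding m_def using h(2)[of "of_real \<rho> * cis t"] \<rho> \<delta> by (auto simp: norm_mult)
  define I where "I = (LINT t|circ. 1 - m t)"
  have I0: "I > 0"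
  proof -
    have "I \<ge> 0" unfolding I_def using m01 by (intro Bochner_Integration.integral_nonneg) auto
    moreover have "I \<noteq> 0"
    proof
      assume "I = 0"
      moreover have cont1: "continuous_on UNIV (\<lambda>t. 1 - m t)" by (intro continuous_intros contm)
      ultimately have "integral {-pi..pi} (\<lambda>t. 1 - m t) = 0"
        using integral_circ[OF continuous_on_subset[OF cont1] borel_measurable_cont[OF cont1]] by (simp add: I_def)
      then have all1: "\<forall>t\<in>{-pi..pi}. 1 - m t = 0"
        using m01 by (subst (asm) integral_eq_0_iff) (auto intro: continuous_on_subset[OF cont1])
      have "z0 = of_real \<rho> * cis (Arg z0)" by (metis \<rho>_def rcis_cmod_Arg rcis_def)
      then have "m (Arg z0) < 1" unfolding m_def using z0 \<delta> by (simp add: min_less_iff_disj)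
      then show False using all1 Arg_bounded[of z0] by force
    qed
    ultimately show ?thesis by simp
  qed
  \<comment> \<open>The Poisson kernel of \<open>z / \<rho>\<close> for \<open>|z| \<le> 1/2\<close> is at least the first factor.\<close>
  define \<kappa> where "\<kappa> = (1 - 1 / (2 * \<rho>)) / 2 * I"
  have \<kappa>: "\<kappa> > 0" unfolding \<kappa>_def using I0 \<rho> by (intro mult_pos_pos) (auto simp: field_simps)
  \<comment> \<open>The bound for \<open>z\<close> in the disk around 0, with the near poles \<open>F1\<close> and the far poles \<open>F2\<close> treated apart.\<close>
  have step: "Green_sum F z \<le> N * ln 2 + M * (1 - \<kappa>)"
    if F: "finite F" "F \<subseteq> Orb" and M: "\<And>z. cmod z < 1 \<Longrightarrow> Green_sum F z \<le> M" and z: "cmod z \<le> 1/2" for F M z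
  proof -
    define F1 where "F1 = {b \<in> F. cmod b \<le> \<rho>3}"
    define F2 where "F2 = {b \<in> F. \<rho>3 < cmod b}"
    have F12: "finite F1" "finite F2" "F1 \<subseteq> Orb" "F2 \<subseteq> Orb" "F1 \<inter> F2 = {}" "F = F1 \<union> F2"
      using F by (auto simp: F1_def F2_def)
    have z1: "cmod z < 1" "cmod z < \<rho>" using z \<rho> by auto
    have M0: "M \<ge> 0" using M[of 0] Green_sum_nonneg[OF F(2), of 0] by simp
    have split: "Green_sum F w = Green_sum F1 w + Green_sum F2 w" for w
      unfolding Green_sum_def F12(6) using F12 by (intro sum.union_disjoint) auto
    have "card F1 \<le> N" unfolding N_def F1_def using F by (intro card_mono Orb_finite \<rho>3) auto
    then have "card F1 * ln 2 \<le> N * ln 2" by (intro mult_right_mono) auto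
    then have T1: "Green_sum F1 z \<le> N * ln 2" using Green_sum_le_card[OF F12(3), of z] z1 by linarith
    define w where "w = z / of_real \<rho>"
    have w: "cmod w \<le> 1 / (2 * \<rho>)" "cmod w < 1"
      using z z1 \<rho> by (auto simp: w_def norm_divide field_simps)
    have circ_in: "cmod (of_real \<rho> * cis t) < 1" for t using \<rho> by (simp add: norm_mult)
    have le: "Green_sum F2 (of_real \<rho> * cis t) \<le> M * m t" for t
    proof -
      have "Green_sum F (of_real \<rho> * cis t) \<le> M * min 1 (h (of_real \<rho> * cis t) / \<delta>)"
        by (rule Green_sum_le_harmonic[of F M h \<delta>])
           (fact F h \<delta> circ_in | erule M near; assumption)+
      then show ?thesis
        unfolding m_def using split[of "of_real \<rho> * cis t"]
          Green_sum_nonneg[OF F12(3), of "of_real \<rho> * cis t"] circ_in[of t] by linarith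
    qed
    have contT: "continuous_on UNIV (\<lambda>t. Green_sum F2 (of_real \<rho> * cis t))"
      by (rule continuous_on_compose2[OF continuous_on_Green_sum[OF F12(4)]])
         (use \<rho> in \<open>auto intro!: continuous_intros simp: norm_mult\<close>)
    have contP: "continuous_on UNIV (poisson w)" using w by (intro continuous_poisson)
    have "Green_sum F2 z = (LINT t|circ. poisson w t * Green_sum F2 (of_real \<rho> * cis t))"
      unfolding w_def
    proof (rule poisson_Green_sum[of F2 \<rho> \<rho>2 z, OF F12(2,4)])
      show "phd u b > 1/2" if "b \<in> F2" "cmod u < \<rho>2" for u b
        using far[of u b] that Orb_disk F(2) by (auto simp: F2_def)
    qed (use \<rho> \<rho>2 z1 in auto)
    also have "\<dots> \<le> (LINT t|circ. M * poisson w t - M * (poisson w t * (1 - m t)))"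
    proof (intro integral_mono integrable_circ_cont continuous_intros contT contP contm)
      fix t
      have "poisson w t * Green_sum F2 (of_real \<rho> * cis t) \<le> poisson w t * (M * m t)"
        using le poisson_pos[OF w(2)] by (intro mult_left_mono) (auto simp: less_imp_le)
      then show "poisson w t * Green_sum F2 (of_real \<rho> * cis t) \<le> M * poisson w t - M * (poisson w t * (1 - m t))"
        by (simp add: algebra_simps)
    qed
    also have "\<dots> = M - M * (LINT t|circ. poisson w t * (1 - m t))"
      using integral_poisson[OF w(2)]
      by (subst Bochner_Integration.integral_diff)
         (auto intro!: integrable_circ_cont continuous_intros contP contm)
    also have "\<dots> \<le> M - M * \<kappa>"
    proof -
      have "\<kappa> = (LINT t|circ. (1 - 1 / (2 * \<rho>)) / 2 * (1 - m t))" by (simp add: \<kappa>_def I_def)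
      also have "\<dots> \<le> (LINT t|circ. poisson w t * (1 - m t))"
      proof (intro integral_mono integrable_circ_cont continuous_intros contP contm)
        fix t
        have "(1 - 1 / (2 * \<rho>)) / 2 \<le> (1 - cmod w) / (1 + cmod w)"
          using w \<rho> by (intro frac_le) (auto simp: add_pos_nonneg)
        also have "\<dots> \<le> poisson w t" by (rule poisson_ge[OF w(2)])
        finally show "(1 - 1 / (2 * \<rho>)) / 2 * (1 - m t) \<le> poisson w t * (1 - m t)"
          using m01 by (intro mult_right_mono) auto
      qed
      finally show ?thesis using M0 by (simp add: mult_left_mono)
    qed
    finally show ?thesis using T1 split[of z] by (simp add: algebra_simps)
  qed
  show ?thesis
  proof (intro exI[of _ "N * ln 2 / \<kappa>"] allI impI)
    fix F z assume F: "finite F" "F \<subseteq> Orb" and z: "cmod z < (1::real)"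
    define Z where "Z = {z. cmod z < 1 \<and> (\<exists>b\<in>F. phd z b \<le> 1/2)}"
    show "Green_sum F z \<le> N * ln 2 / \<kappa>"
    proof (cases "F = {}")
      case True
      then show ?thesis using \<kappa> by (simp add: Green_sum_def)
    next
      case False
      then obtain b0 where b0: "b0 \<in> F" by auto
      have "phd b0 b0 = 0" by (simp add: phd_eq)
      then have "b0 \<in> Z" using F Orb_disk b0 by (force simp: Z_def)
      define A where "A = (SUP z\<in>Z. Green_sum F z)"
      have bdd: "bdd_above (Green_sum F ` Z)"
        using Green_sum_le_card[OF F(2)] by (intro bdd_aboveI2[of _ _ "card F * ln 2"]) (auto simp: Z_def)
      have leA: "Green_sum F w \<le> A" if "w \<in> Z" for w
        unfolding A_def by (rule cSUP_upper[OF that bdd])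
      have A0: "A \<ge> 0" using leA[OF \<open>b0 \<in> Z\<close>] Green_sum_nonneg[OF F(2), of b0] \<open>b0 \<in> Z\<close> by (simp add: Z_def)
      have leA': "Green_sum F w \<le> A" if "cmod w < 1" for w
        by (rule Green_sum_le_sup_on_disks[OF F A0 _ that]) (auto intro!: leA simp: Z_def)
      have "Green_sum F w \<le> N * ln 2 + A * (1 - \<kappa>)" if w: "w \<in> Z" for w
      proof -
        obtain b where b: "b \<in> F" "phd w b \<le> 1/2" and w1: "cmod w < 1" using w by (auto simp: Z_def)
        obtain g where g: "g \<in> disk_automorphisms" "g 0 = b" "g ` Orb = Orb"
          using Orb_homogeneous b F by blast
        define G where "G = {c \<in> Orb. g c \<in> F}"
        have inj: "inj_on g (ball 0 1)" using g by (auto simp: disk_automorphisms_def bij_betw_def)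
        have injG: "inj_on g G" by (rule inj_on_subset[OF inj]) (auto simp: G_def Orb_disk)
        have gG: "g ` G = F" using g(3) F by (force simp: G_def)
        have G: "finite G" "G \<subseteq> Orb"
          using finite_imageD[of g G] injG gG F(1) by (auto simp: G_def)
        have TG: "Green_sum F (g u) = Green_sum G u" if "cmod u < 1" for u
        proof -
          have "Green_sum F (g u) = (\<Sum>c\<in>G. truncated_Green (g c) (g u))"
            unfolding Green_sum_def gG[symmetric] by (rule sum.reindex_cong[OF injG refl refl])
          also have "\<dots> = Green_sum G u"
            unfolding Green_sum_def truncated_Green_def using phd_automorphism[OF g(1) that] Orb_disk G
            by (intro sum.cong) auto
          finally show ?thesis .
        qed
        obtain k where k: "k \<in> disk_automorphisms" "\<And>z. cmod z < 1 \<Longrightarrow> g (k z) = z"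
          using disk_automorphism_inverse[OF g(1)] by metis
        define u where "u = k w"
        have u: "cmod u < 1" "g u = w" using k disk_automorphism_norm w1 by (auto simp: u_def)
        have "cmod u \<le> 1/2" using phd_automorphism[OF g(1) u(1), of 0] b(2) u(2) g(2) by simp
        moreover have "Green_sum G v \<le> A" if "cmod v < 1" for v
          using leA'[of "g v"] TG[OF that] disk_automorphism_norm[OF g(1) that] by simp
        ultimately have "Green_sum G u \<le> N * ln 2 + A * (1 - \<kappa>)" by (intro step G) auto
        then show ?thesis using TG[OF u(1)] u(2) by simp
      qed
      then have "A \<le> N * ln 2 + A * (1 - \<kappa>)"
        unfolding A_def using \<open>b0 \<in> Z\<close> by (intro cSUP_least) (auto simp: A_def)
      then have "A * \<kappa> \<le> N * ln 2" by (simp add: algebra_simps)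
      then have "A \<le> N * ln 2 / \<kappa>" using \<kappa> by (simp add: pos_le_divide_eq)
      then show ?thesis using leA'[OF z] by simp
    qed
  qed
qed

text \<open>Twice the truncated Green function at 0 with pole \<open>b\<close> is at least
  \<open>1 - |b|\<close>.\<close>

corollary Blaschke_condition:
  assumes h: "harm_on (ball 0 1) h" "\<And>z. cmod z < 1 \<Longrightarrow> h z \<ge> 0" and \<delta>: "\<delta> > 0"
    and near: "\<And>z b. b \<in> Orb \<Longrightarrow> cmod z < 1 \<Longrightarrow> phd z b \<le> 1/2 \<Longrightarrow> h z \<ge> \<delta>"
    and z0: "cmod z0 < 1" "h z0 < \<delta>"
  shows "(\<lambda>b. 1 - cmod b) summable_on Orb"
proof -
  have "\<exists>C. \<forall>F z. finite F \<longrightarrow> F \<subseteq> Orb \<longrightarrow> cmod z < 1 \<longrightarrow> Green_sum F z \<le> C"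
    by (rule Green_sum_bounded[of h \<delta> z0]) (fact h \<delta> z0 | erule near; assumption)+
  then obtain C where C: "\<And>F z. finite F \<Longrightarrow> F \<subseteq> Orb \<Longrightarrow> cmod z < 1 \<Longrightarrow> Green_sum F z \<le> C"
    by blast
  have ineq: "1 - cmod b \<le> 2 * truncated_Green b 0" if "b \<in> Orb" for b
  proof -
    have p: "phd 0 b = cmod b" using phd_sym[of 0 b] by simp
    have b1: "cmod b < 1" by (rule Orb_disk[OF that])
    show ?thesis
    proof (cases "cmod b \<le> 1/2")
      case True
      have "ln (1/2::real) \<le> 1/2 - 1" by (rule ln_le_minus_one) simp
      then have "- ln (1/2 :: real) \<ge> 1/2" by simp
      moreover have "truncated_Green b 0 = - ln (1/2)" using True by (simp add: truncated_Green_def p max_absorb1)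
      moreover have "cmod b \<ge> 0" by simp
      ultimately show ?thesis by linarith
    next
      case False
      have "ln (cmod b) \<le> cmod b - 1" using False by (intro ln_le_minus_one) auto
      moreover have "truncated_Green b 0 = - ln (cmod b)" using False by (simp add: truncated_Green_def p max_def)
      ultimately show ?thesis using b1 by linarith
    qed
  qed
  show ?thesis
  proof (rule nonneg_bdd_above_summable_on)
    show "0 \<le> 1 - cmod b" if "b \<in> Orb" for b using Orb_disk[OF that] by simp
    show "bdd_above (sum (\<lambda>b. 1 - cmod b) ` {F. F \<subseteq> Orb \<and> finite F})"
    proof (rule bdd_aboveI2)
      fix F assume F: "F \<in> {F. F \<subseteq> Orb \<and> finite F}"
      have "(\<Sum>b\<in>F. 1 - cmod b) \<le> (\<Sum>b\<in>F. 2 * truncated_Green b 0)" using F ineq by (intro sum_mono) auto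
      also have "\<dots> = 2 * Green_sum F 0" by (simp add: Green_sum_def sum_distrib_left)
      also have "\<dots> \<le> 2 * C" using C[of F 0] F by simp
      finally show "(\<Sum>b\<in>F. 1 - cmod b) \<le> 2 * C" .
    qed
  qed
qed

end

section \<open>Groups with a null non-tangential limit set\<close>

lemma Arg_cis_eq: "- pi < t \<Longrightarrow> t \<le> pi \<Longrightarrow> Arg (cis t) = t"
  by (rule cis_Arg_unique) auto

text \<open>A measurable left inverse of \<open>cis\<close>, through which null sets of the circle and of the
  interval correspond.\<close>

lemma borel_measurable_Arg_unit:
  obtains A :: "complex \<Rightarrow> real" where "A \<in> borel_measurable borel" "\<And>t. - pi < t \<Longrightarrow> t \<le> pi \<Longrightarrow> A (cis t) = t"
proof -
  define A where "A z = (if z \<in> - \<real>\<^sub>\<le>\<^sub>0 then Arg z else pi)" for z :: complex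
  have "continuous_on (- \<real>\<^sub>\<le>\<^sub>0) Arg"
    by (intro continuous_at_imp_continuous_on ballI continuous_at_Arg) auto
  then have "A \<in> borel_measurable borel"
    unfolding A_def by (intro borel_measurable_continuous_on_if) (auto simp: open_Compl borel_open)
  moreover have "A (cis t) = t" if "- pi < t" "t \<le> pi" for t
  proof (cases "cis t \<in> \<real>\<^sub>\<le>\<^sub>0")
    case True
    then have "Re (cis t) \<le> 0" "Im (cis t) = 0" by (auto simp: complex_nonpos_Reals_iff)
    then have "cis t = -1"
      using sin_zero_abs_cos_one[of t] by (auto simp: complex_eq_iff)
    then have "cis t = cis pi" by simp
    then have "t = pi" using Arg_cis_eq[OF that] Arg_cis_eq[of pi] pi_gt_zero by simp
    then show ?thesis using True by (simp add: A_def)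
  next
    case False
    then show ?thesis using Arg_cis_eq[OF that] by (simp add: A_def)
  qed
  ultimately show thesis using that by blast
qed

lemma AE_circle:
  "(AE \<zeta> in circle_lebesgue. P \<zeta>) \<longleftrightarrow> (AE t in circ. P (cis t))"
proof -
  let ?I = "restrict_space lborel {-pi<..pi} :: real measure"
  let ?S = "restrict_space borel (sphere (0::complex) 1)"
  have cis_meas: "cis \<in> ?I \<rightarrow>\<^sub>M ?S"
  proof (rule measurable_restrict_space2)
    show "cis \<in> ?I \<rightarrow>\<^sub>M borel"
      by (rule measurable_restrict_space1)
         (simp add: borel_measurable_continuous_onI continuous_on_cis)
  qed auto
  have circ_iff: "(AE t in circ. Q t) \<longleftrightarrow> (AE t in ?I. Q t)" for Q
  proof -
    have "(AE t in ?I. Q t) \<longleftrightarrow> (AE t in lborel. t \<in> {-pi<..pi} \<longrightarrow> Q t)"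
      by (rule AE_restrict_space_iff) simp
    also have "\<dots> \<longleftrightarrow> (AE t in lborel. t \<in> {-pi..pi} \<longrightarrow> Q t)"
    proof
      assume "AE t in lborel. t \<in> {-pi<..pi} \<longrightarrow> Q t"
      moreover have "AE t in lborel. t \<noteq> - pi" by (rule AE_lborel_singleton)
      ultimately show "AE t in lborel. t \<in> {-pi..pi} \<longrightarrow> Q t" by eventually_elim auto
    next
      assume "AE t in lborel. t \<in> {-pi..pi} \<longrightarrow> Q t"
      then show "AE t in lborel. t \<in> {-pi<..pi} \<longrightarrow> Q t" by eventually_elim auto
    qed
    finally show ?thesis by (simp add: AE_circ)
  qed
  have "(AE \<zeta> in circle_lebesgue. P \<zeta>) \<longleftrightarrow> (AE \<zeta> in distr ?I ?S cis. P \<zeta>)"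
    unfolding circle_lebesgue_def by (rule AE_completion_iff)
  also have "\<dots> \<longleftrightarrow> (AE t in ?I. P (cis t))"
  proof
    assume "AE \<zeta> in distr ?I ?S cis. P \<zeta>"
    then show "AE t in ?I. P (cis t)" by (rule AE_distrD[OF cis_meas])
  next
    assume "AE t in ?I. P (cis t)"
    then obtain N where N: "{t \<in> space ?I. \<not> P (cis t)} \<subseteq> N" "emeasure ?I N = 0" "N \<in> sets ?I"
      by (rule AE_E)
    obtain A :: "complex \<Rightarrow> real" where A: "A \<in> borel_measurable borel" "\<And>t. - pi < t \<Longrightarrow> t \<le> pi \<Longrightarrow> A (cis t) = t"
      using borel_measurable_Arg_unit by blast
    have Nb: "N \<in> sets borel" "N \<subseteq> {-pi<..pi}"
      using N(3) by (auto simp: sets_restrict_space)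
    define B where "B = sphere 0 1 \<inter> A -` N"
    have "A -` N \<in> sets borel" using measurable_sets[OF A(1) Nb(1)] by simp
    then have B: "B \<in> sets ?S" unfolding B_def by (auto simp: sets_restrict_space)
    have "cis -` B \<inter> space ?I = N"
      using Nb(2) A(2) by (auto simp: B_def space_restrict_space subset_iff)
    then have "emeasure (distr ?I ?S cis) B = 0"
      using N(2) by (simp add: emeasure_distr[OF cis_meas B])
    then have "B \<in> null_sets (distr ?I ?S cis)" using B by (auto intro: null_setsI)
    then show "AE \<zeta> in distr ?I ?S cis. P \<zeta>"
    proof (rule AE_I')
      show "{\<zeta> \<in> space (distr ?I ?S cis). \<not> P \<zeta>} \<subseteq> B"
      proof
        fix \<zeta> assume "\<zeta> \<in> {\<zeta> \<in> space (distr ?I ?S cis). \<not> P \<zeta>}"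
        then have \<zeta>: "cmod \<zeta> = 1" "\<not> P \<zeta>" by (auto simp: space_restrict_space)
        then have "\<zeta> \<noteq> 0" by auto
        with \<zeta> have c: "cis (Arg \<zeta>) = \<zeta>" "- pi < Arg \<zeta>" "Arg \<zeta> \<le> pi"
          using Arg_bounded[of \<zeta>] cis_Arg[of \<zeta>] by (auto simp: sgn_eq)
        then have "Arg \<zeta> \<in> N" using N(1) \<zeta>(2) by (auto simp: space_restrict_space)
        then show "\<zeta> \<in> B" using A(2)[OF c(2,3)] c(1) \<zeta>(1) by (simp add: B_def)
      qed
    qed
  qed
  finally show ?thesis by (simp add: circ_iff)
qed

lemma null_sets_circle:
  assumes "N \<subseteq> sphere 0 1"
  shows "N \<in> null_sets circle_lebesgue \<longleftrightarrow> (AE \<zeta> in circle_lebesgue. \<zeta> \<notin> N)"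
proof
  assume "N \<in> null_sets circle_lebesgue"
  then show "AE \<zeta> in circle_lebesgue. \<zeta> \<notin> N" by (rule AE_not_in)
next
  assume "AE \<zeta> in circle_lebesgue. \<zeta> \<notin> N"
  then obtain N' where N': "{\<zeta> \<in> space circle_lebesgue. \<not> \<zeta> \<notin> N} \<subseteq> N'" "emeasure circle_lebesgue N' = 0" "N' \<in> sets circle_lebesgue"
    by (rule AE_E)
  have "space circle_lebesgue = sphere 0 1"
    by (simp add: circle_lebesgue_def space_restrict_space)
  then have "N \<subseteq> N'" using N'(1) assms by blast
  moreover have "N' \<in> null_sets circle_lebesgue" using N' by (auto intro: null_setsI)
  ultimately show "N \<in> null_sets circle_lebesgue"
    unfolding circle_lebesgue_def by (rule null_sets_completion_subset)
qed

lemma Arg_less_quarter: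
  assumes "\<bar>Im w\<bar> < Re w"
  shows "\<bar>Arg w\<bar> < pi / 4"
proof -
  have R: "Re w > 0" using assms by linarith
  have "\<bar>Im w / Re w\<bar> < 1" using assms R by (simp add: field_simps)
  then have "- 1 < Im w / Re w" "Im w / Re w < 1" by (simp_all only: abs_less_iff minus_less_iff)
  then have "arctan (- 1) < arctan (Im w / Re w)" "arctan (Im w / Re w) < arctan 1"
    by (simp_all only: arctan_less_iff)
  then show ?thesis using arg_conv_arctan[OF R] by (simp add: arctan_one arctan_minus)
qed

text \<open>On the circle, these are the points that see \<open>b\<close> in a Stolz angle of half-opening
  \<open>pi / 4\<close> and from a distance less than \<open>\<epsilon>\<close>. The condition on real and
  imaginary parts makes openness evident.\<close>

definition shadow :: "real \<Rightarrow> complex \<Rightarrow> complex set" where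
  "shadow \<epsilon> b = {\<zeta>. \<bar>Im (1 - cnj \<zeta> * b)\<bar> < Re (1 - cnj \<zeta> * b) \<and> cmod (b - \<zeta>) < \<epsilon>}"

lemma open_shadow: "open (shadow \<epsilon> b)"
proof -
  have "open {\<zeta>. \<bar>Im (1 - cnj \<zeta> * b)\<bar> < Re (1 - cnj \<zeta> * b)}" "open {\<zeta>. cmod (b - \<zeta>) < \<epsilon>}"
    by (intro open_Collect_less continuous_intros)+
  then show ?thesis unfolding shadow_def Collect_conj_eq by (rule open_Int)
qed

lemma in_shadow:
  assumes e: "cmod e = 1" and r: "0 \<le> r" "r < 1" and \<zeta>: "cmod \<zeta> = 1" "cmod (\<zeta> - e) < 1/4 * (1 - r)"
    and \<epsilon>: "2 * (1 - r) < \<epsilon>"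
  shows "\<zeta> \<in> shadow \<epsilon> (of_real r * e)"
proof -
  have c\<zeta>: "cnj \<zeta> * \<zeta> = 1" using \<zeta>(1) complex_norm_square[of \<zeta>] by (simp add: mult.commute)
  define x where "x = of_real r * (cnj \<zeta> * (\<zeta> - e))"
  have w: "1 - cnj \<zeta> * (of_real r * e) = of_real (1 - r) + x"
    using c\<zeta> by (simp add: x_def algebra_simps)
  have "cmod x = r * cmod (\<zeta> - e)" using r \<zeta> by (simp add: x_def norm_mult)
  also have "\<dots> \<le> 1 * cmod (\<zeta> - e)" using r by (intro mult_right_mono) auto
  finally have x: "cmod x < 1/4 * (1 - r)" using \<zeta>(2) by linarith
  have "\<bar>Im (of_real (1 - r) + x)\<bar> < Re (of_real (1 - r) + x)"
  proof -
    have "\<bar>Im x\<bar> < 1/4 * (1 - r)" "- Re x < 1/4 * (1 - r)"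
      using abs_Im_le_cmod[of x] abs_Re_le_cmod[of x] x by linarith+
    then show ?thesis using r by simp
  qed
  moreover have "cmod (of_real r * e - \<zeta>) < \<epsilon>"
  proof -
    have "of_real r * e - \<zeta> = of_real (r - 1) * e + (e - \<zeta>)" by (simp add: algebra_simps)
    then have "cmod (of_real r * e - \<zeta>) \<le> cmod (of_real (r - 1) * e) + cmod (e - \<zeta>)"
      by (metis norm_triangle_ineq)
    also have "cmod (of_real (r - 1) * e) = 1 - r"
      unfolding norm_mult norm_of_real e using r by simp
    finally show ?thesis using \<zeta>(2) \<epsilon> r by (simp add: norm_minus_commute)
  qed
  ultimately show ?thesis unfolding shadow_def mem_Collect_eq w by blast
qed

lemma orbit_eq_fibre:
  assumes uc: "universal_covering p \<Omega>" and c: "c \<notin> \<Omega>"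
  shows "{g 0 | g. g \<in> deck_group p} = {z. cmod z < 1 \<and> p z = p 0}"
proof safe
  fix g assume g: "g \<in> deck_group p"
  show "cmod (g 0) < 1" using disk_automorphism_norm[OF deck_automorphism[OF g], of 0] by simp
  show "p (g 0) = p 0" using deck_invariant[OF g, of 0] by simp
next
  fix z assume z: "cmod z < 1" "p z = p 0"
  obtain g where "g \<in> deck_group p" "g 0 = z"
    using deck_transitive[OF uc c, of 0 z] z by auto
  then show "\<exists>g. z = g 0 \<and> g \<in> deck_group p" by auto
qed

lemma deck_permutes_fibre:
  assumes g: "g \<in> deck_group p"
  shows "g ` {z. cmod z < 1 \<and> p z = y} = {z. cmod z < 1 \<and> p z = y}"
proof
  show "g ` {z. cmod z < 1 \<and> p z = y} \<subseteq> {z. cmod z < 1 \<and> p z = y}"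
    using deck_invariant[OF g] disk_automorphism_norm[OF deck_automorphism[OF g]] by auto
  obtain h where h: "h \<in> deck_group p" "\<And>z. cmod z < 1 \<Longrightarrow> g (h z) = z"
    using deck_inverse[OF g] by metis
  show "{z. cmod z < 1 \<and> p z = y} \<subseteq> g ` {z. cmod z < 1 \<and> p z = y}"
  proof
    fix z assume z: "z \<in> {z. cmod z < 1 \<and> p z = y}"
    then have "z = g (h z)" "h z \<in> {z. cmod z < 1 \<and> p z = y}"
      using h deck_invariant[OF h(1)] disk_automorphism_norm[OF deck_automorphism[OF h(1)]] by auto
    then show "z \<in> g ` {z. cmod z < 1 \<and> p z = y}" by blast
  qed
qed

text \<open>A point in the shadows, for every \<open>\<epsilon>\<close>, of the orbit is a non-tangential
  limit point. So the union of the shadows for some fixed small \<open>\<epsilon>\<close> misses a set of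
  positive measure, and its harmonic measure is the comparison function for the Green sums.\<close>

theorem null_nontangential_imp_Blaschke:
  assumes uc: "universal_covering p \<Omega>" and c: "c \<notin> \<Omega>"
    and null: "nontangential_limit_set (deck_group p) \<in> null_sets circle_lebesgue"
  shows "(\<lambda>b. 1 - cmod b) summable_on {z. cmod z < 1 \<and> p z = p 0}"
proof -
  define Orb where "Orb = {z. cmod z < 1 \<and> p z = p 0}"
  have cov: "covering_space (ball 0 1) p \<Omega>" using uc by (simp add: universal_covering_def)
  have OrbE: "\<exists>g \<in> deck_group p. g 0 = b" if "b \<in> Orb" for b
  proof -
    have "b \<in> {g 0 | g. g \<in> deck_group p}" unfolding orbit_eq_fibre[OF uc c] using that by (simp add: Orb_def)
    then show ?thesis by blast
  qed
  interpret disk_orbit Orb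
  proof
    show "finite {b \<in> Orb. cmod b \<le> r}" if "r < 1" for r
      by (rule finite_subset[OF _ finite_fibre[OF cov that, of "p 0"]]) (auto simp: Orb_def)
    show "\<exists>g\<in>disk_automorphisms. g 0 = b \<and> g ` Orb = Orb" if b: "b \<in> Orb" for b
    proof -
      obtain g where g: "g \<in> deck_group p" "g 0 = b" using OrbE[OF b] by blast
      show ?thesis
        using g deck_automorphism[OF g(1)] deck_permutes_fibre[OF g(1), of "p 0"]
        by (intro bexI[of _ g]) (auto simp: Orb_def)
    qed
  qed (auto simp: Orb_def)
  define V where "V k = (\<Union>b\<in>Orb. shadow (1 / real (Suc k)) b)" for k
  define A where "A k = cis -` V k" for k
  have openV: "open (V k)" for k unfolding V_def by (intro open_UN ballI open_shadow)
  have openA: "open (A k)" for k unfolding A_def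
    by (rule open_vimage[OF openV]) (intro continuous_intros)
  have Ab: "A k \<in> sets borel" for k using openA by auto
  have limit: "cis t \<in> nontangential_limit_set (deck_group p)" if t: "\<And>k. t \<in> A k" for t
  proof -
    have "\<forall>k. \<exists>g. g \<in> deck_group p \<and> cis t \<in> shadow (1 / real (Suc k)) (g 0)"
    proof
      fix k
      obtain b where b: "b \<in> Orb" "cis t \<in> shadow (1 / real (Suc k)) b"
        using t[of k] by (auto simp: A_def V_def)
      then show "\<exists>g. g \<in> deck_group p \<and> cis t \<in> shadow (1 / real (Suc k)) (g 0)"
        using OrbE[OF b(1)] by blast
    qed
    then obtain g where g: "\<And>k. g k \<in> deck_group p" "\<And>k. cis t \<in> shadow (1 / real (Suc k)) (g k 0)" by metis
    have close: "cmod (g k 0 - cis t) < 1 / real (Suc k)" for k using g(2)[of k] by (simp add: shadow_def)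
    have "(\<lambda>k. 1 / real (Suc k)) \<longlonglongrightarrow> 0" by real_asymp
    then have "(\<lambda>k. g k 0 - cis t) \<longlonglongrightarrow> 0"
      by (rule Lim_null_comparison[rotated]) (use close in \<open>auto intro!: always_eventually less_imp_le\<close>)
    then have lim: "(\<lambda>k. g k 0) \<longlonglongrightarrow> cis t" by (simp add: LIM_zero_iff)
    have "g k 0 \<in> stolz_angle (cis t) (pi/4) 2" for k
    proof -
      have "1 / real (Suc k) < 2" by (simp add: divide_less_eq)
      then show ?thesis
        using g(2)[of k] Arg_less_quarter[of "1 - cnj (cis t) * g k 0"] close[of k]
          disk_automorphism_norm[OF deck_automorphism[OF g(1)], of 0 k]
        by (simp add: stolz_angle_def shadow_def)
    qed
    then show ?thesis
      unfolding nontangential_limit_set_def mem_Collect_eq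
      using g(1) lim pi_gt_zero
      by (intro conjI exI[of _ g] exI[of _ "pi / 4"] exI[of _ 2]) auto
  qed
  have "nontangential_limit_set (deck_group p) \<subseteq> sphere 0 1"
    by (auto simp: nontangential_limit_set_def)
  then have "AE t in circ. cis t \<notin> nontangential_limit_set (deck_group p)"
    using null null_sets_circle[of "nontangential_limit_set (deck_group p)"]
      AE_circle[of "\<lambda>\<zeta>. \<zeta> \<notin> nontangential_limit_set (deck_group p)"] by blast
  then have "AE t in circ. t \<notin> (\<Inter>k. A k)"
    by eventually_elim (use limit in auto)
  then have "measure circ (\<Inter>k. A k) = 0"
    using AE_iff_null_sets[of "\<Inter>k. A k" circ] Ab by (auto simp: measure_def)
  moreover have "decseq A"
  proof (rule decseq_SucI)
    fix k
    have "1 / real (Suc (Suc k)) \<le> 1 / real (Suc k)" by (simp add: frac_le)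
    then show "A (Suc k) \<subseteq> A k"
      unfolding A_def V_def shadow_def by (force intro: less_le_trans)
  qed
  then have "(\<lambda>k. measure circ (A k)) \<longlonglongrightarrow> measure circ (\<Inter>k. A k)"
    using Ab by (intro circ.finite_Lim_measure_decseq) auto
  ultimately have "(\<lambda>k. measure circ (A k)) \<longlonglongrightarrow> 0" by simp
  then have "\<forall>\<^sub>F k in sequentially. measure circ (A k) < 1" by (rule order_tendstoD) simp
  then obtain k where k: "measure circ (A k) < 1" by (auto simp: eventually_sequentially)
  have compl: "measure circ (- A k) > 0"
    using circ.prob_compl[of "A k"] Ab k by (simp add: Compl_eq_Diff_UNIV)
  define \<rho>1 where "\<rho>1 = 1 - 1 / (2 * real (Suc k))"
  have \<rho>1: "0 < \<rho>1" "\<rho>1 < 1" by (auto simp: \<rho>1_def field_simps)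
  show ?thesis
  proof (cases "\<exists>b\<in>Orb. \<rho>1 < cmod b")
    case False
    then have "Orb \<subseteq> {b \<in> Orb. cmod b \<le> \<rho>1}" by auto
    then have "finite Orb" using Orb_finite[OF \<rho>1(2)] finite_subset by blast
    then show ?thesis unfolding Orb_def[symmetric] by (rule summable_on_finite)
  next
    case True
    have big: "1 / (32 * pi) \<le> harmonic_measure (A k) b" if b: "b \<in> Orb" "\<rho>1 < cmod b" for b
    proof -
      define e where "e = b / of_real (cmod b)"
      have nb: "cmod b > 0" using b \<rho>1 by linarith
      then have e: "cmod e = 1" "b = of_real (cmod b) * e" by (auto simp: e_def norm_divide)
      have "1 / x = 2 * (1 / (2 * x))" for x :: real by simp
      define y where "y = 1 / (2 * real (Suc k))"
      have y1: "1 / real (Suc k) = 2 * y" unfolding y_def by fact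
      have y2: "\<rho>1 = 1 - y" by (simp only: \<rho>1_def y_def)
      have "1 - cmod b < y" using b(2) unfolding y2 by simp
      then have "2 * (1 - cmod b) < 1 / real (Suc k)" unfolding y1 by simp
      then have sh: "t \<in> A k" if "cmod (cis t - e) < 1/4 * (1 - cmod b)" for t
        using in_shadow[OF e(1), of "cmod b" "cis t" "1 / real (Suc k)"] that b(1) Orb_disk[OF b(1)] e(2)
        unfolding A_def V_def by auto
      have "(1/4) / (8 * pi) \<le> harmonic_measure (A k) (of_real (cmod b) * e)"
        using Orb_disk[OF b(1)] sh by (intro harmonic_measure_shadow_bound Ab e) auto
      then show ?thesis using e(2) by simp
    qed
    obtain b1 where b1: "b1 \<in> Orb" "\<rho>1 < cmod b1" using True by auto
    define m where "m = measure circ (A k)"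
    have "m > 0"
    proof (rule ccontr)
      assume "\<not> m > 0"
      then have "measure circ (A k) = 0" unfolding m_def by (simp add: order.antisym not_less)
      then have "A k \<in> null_sets circ" using Ab by (intro null_setsI) (auto simp: circ.emeasure_eq_measure)
      then have "AE t in circ. t \<notin> A k" by (rule AE_not_in)
      then have "AE t in circ. indicator (A k) t * poisson b1 t = 0" by eventually_elim auto
      then have "harmonic_measure (A k) b1 = 0"
        unfolding harmonic_measure_def by (subst integral_cong_AE[of _ _ "\<lambda>_. 0"]) (use Ab Orb_disk[OF b1(1)] in auto)
      moreover have "1 / (32 * pi) > 0" by simp
      ultimately show False using big[OF b1] by linarith
    qed
    define \<delta> where "\<delta> = min (1 / (32 * pi)) ((1 - \<rho>1) / 2 * m) / 36"
    have \<delta>: "\<delta> > 0" using \<open>m > 0\<close> \<rho>1 by (simp add: \<delta>_def)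
    have near: "harmonic_measure (A k) z \<ge> \<delta>" if b: "b \<in> Orb" and z: "cmod z < 1" "phd z b \<le> 1/2" for z b
    proof -
      have "min (1 / (32 * pi)) ((1 - \<rho>1) / 2 * m) \<le> harmonic_measure (A k) b"
      proof (cases "\<rho>1 < cmod b")
        case True then show ?thesis using big[OF b] by linarith
      next
        case False
        then have "(1 - \<rho>1) / 2 * m \<le> (1 - cmod b) / 2 * m" using \<open>m > 0\<close> by (intro mult_right_mono) auto
        also have "\<dots> \<le> harmonic_measure (A k) b" unfolding m_def by (rule harmonic_measure_ge_measure[OF Ab Orb_disk[OF b]])
        finally show ?thesis by linarith
      qed
      then have "\<delta> \<le> harmonic_measure (A k) b / 36" by (simp add: \<delta>_def)
      also have "\<dots> \<le> harmonic_measure (A k) z" by (rule harmonic_measure_Harnack[OF Ab z(1) Orb_disk[OF b] z(2)])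
      finally show ?thesis .
    qed
    obtain z0 where z0: "cmod z0 < 1" "harmonic_measure (A k) z0 < \<delta>"
      using harmonic_measure_small_somewhere[OF openV A_def compl \<delta>] by auto
    show ?thesis unfolding Orb_def[symmetric]
      by (rule Blaschke_condition[OF harm_on_harmonic_measure[OF Ab] harmonic_measure_nonneg \<delta> _ z0]) (use near in blast)+
  qed
qed

section \<open>Blaschke products\<close>

text \<open>Normalized to be positive at 0, hence close to 1 when \<open>b\<close> is close to the
  circle.\<close>

definition blaschke_factor :: "complex \<Rightarrow> complex \<Rightarrow> complex" where
  "blaschke_factor b z = (if b = 0 then z else - (cnj b / of_real (cmod b)) * Moebius_function 0 b z)"

lemma norm_blaschke_factor: "cmod (blaschke_factor b z) = phd z b"
  by (simp add: blaschke_factor_def phd_def norm_mult norm_divide Moebius_function_simple)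

lemma holomorphic_blaschke_factor: "cmod b < 1 \<Longrightarrow> blaschke_factor b holomorphic_on ball 0 1"
  unfolding blaschke_factor_def[abs_def]
  by (cases "b = 0") (auto intro!: holomorphic_intros Moebius_function_holomorphic)

lemma blaschke_factor_near_1:
  assumes b: "cmod b < 1" and z: "cmod z < 1"
  shows "cmod (blaschke_factor b z - 1) \<le> 2 * (1 - cmod b) / (1 - cmod z)"
proof (cases "b = 0")
  case True
  have "cmod (z - 1) \<le> 2" using norm_triangle_ineq4[of z 1] z by simp
  also have "\<dots> \<le> 2 / (1 - cmod z)" using z by (simp add: pos_le_divide_eq)
  finally show ?thesis using True by (simp add: blaschke_factor_def)
next
  case False
  define r where "r = cmod b"
  have r: "0 < r" "r < 1" using False b by (auto simp: r_def)
  have den: "1 - cnj b * z \<noteq> 0" using b z by (intro moebius_denom) auto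
  have rr: "cnj b * b = of_real r * of_real r"
    using complex_norm_square[of b] by (simp add: r_def power2_eq_square mult.commute)
  have "blaschke_factor b z - 1 = (- (cnj b * (z - b)) - of_real r * (1 - cnj b * z)) / (of_real r * (1 - cnj b * z))"
    using False den r by (simp add: blaschke_factor_def Moebius_function_simple r_def[symmetric] field_simps)
  also have "- (cnj b * (z - b)) - of_real r * (1 - cnj b * z) = - (of_real (1 - r) * (of_real r + cnj b * z))"
    using rr by (simp add: algebra_simps)
  also have "cmod (- (of_real (1 - r) * (of_real r + cnj b * z)) / (of_real r * (1 - cnj b * z)))
      = (1 - r) * cmod (of_real r + cnj b * z) / (r * cmod (1 - cnj b * z))"
    using r by (simp only: norm_divide norm_mult norm_minus_cancel norm_of_real abs_of_pos abs_of_nonneg diff_ge_0_iff_ge less_imp_le)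
  also have "\<dots> \<le> (1 - r) * (r * 2) / (r * (1 - cmod z))"
  proof (rule frac_le)
    have "cmod (of_real r + cnj b * z) \<le> r + r * cmod z"
      using norm_triangle_ineq[of "of_real r" "cnj b * z"] r by (simp add: norm_mult r_def)
    also have "\<dots> \<le> r * 2" using z r by (simp add: mult_left_le)
    finally show "(1 - r) * cmod (of_real r + cnj b * z) \<le> (1 - r) * (r * 2)"
      using r by (intro mult_left_mono) auto
    have "cmod (cnj b * z) \<le> 1 * cmod z" unfolding norm_mult using b by (intro mult_right_mono) auto
    then have "1 - cmod z \<le> cmod (1 - cnj b * z)" using norm_triangle_ineq2[of 1 "cnj b * z"] by simp
    then show "r * (1 - cmod z) \<le> r * cmod (1 - cnj b * z)" using r by (intro mult_left_mono) auto
  qed (use r z in auto)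
  also have "\<dots> = 2 * (1 - r) / (1 - cmod z)" using r by simp
  finally show ?thesis by (simp add: r_def)
qed

text \<open>The formula for \<open>ln |B|\<close> as a sum over the zeros determines \<open>|B|\<close>; the
  invariance of \<open>|B|\<close> under automorphisms that permute the zeros follows from it.\<close>

theorem Blaschke_product:
  assumes P: "\<And>b. b \<in> P \<Longrightarrow> cmod b < 1" "countable P" and summ: "(\<lambda>b. 1 - cmod b) summable_on P"
  obtains B where "B holomorphic_on ball 0 1" "\<And>z. cmod z < 1 \<Longrightarrow> cmod (B z) \<le> 1"
    "\<And>z. cmod z < 1 \<Longrightarrow> B z = 0 \<longleftrightarrow> z \<in> P"
    "\<And>z. cmod z < 1 \<Longrightarrow> z \<notin> P \<Longrightarrow> ((\<lambda>b. - ln (phd z b)) has_sum (- ln (cmod (B z)))) P"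
proof -
  define N where "N = to_nat_on P ` P"
  define x where "x = inv_into P (to_nat_on P)"
  have bij: "bij_betw (to_nat_on P) P N"
    unfolding N_def using inj_on_to_nat_on[OF P(2)] by (simp add: bij_betw_def)
  have xx: "x (to_nat_on P b) = b" if "b \<in> P" for b
    using that inj_on_to_nat_on[OF P(2)] by (simp add: x_def inv_into_f_f)
  have xP: "x n \<in> P" if "n \<in> N" for n using that xx by (auto simp: N_def)
  have transfer: "(g has_sum s) P \<longleftrightarrow> ((\<lambda>n. if n \<in> N then g (x n) else 0) has_sum s) UNIV" for g :: "complex \<Rightarrow> real" and s
  proof -
    have "((\<lambda>n. if n \<in> N then g (x n) else 0) has_sum s) UNIV \<longleftrightarrow> ((\<lambda>n. g (x n)) has_sum s) N"
      by (rule has_sum_cong_neutral) auto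
    also have "\<dots> \<longleftrightarrow> ((\<lambda>b. g (x (to_nat_on P b))) has_sum s) P"
      by (rule has_sum_reindex_bij_betw[OF bij, symmetric])
    also have "\<dots> \<longleftrightarrow> (g has_sum s) P" by (rule has_sum_cong) (simp add: xx)
    finally show ?thesis by simp
  qed
  define d where "d n = (if n \<in> N then 1 - cmod (x n) else 0)" for n
  have d0: "d n \<ge> 0" for n using P(1)[OF xP] by (simp add: d_def less_imp_le)
  have "d summable_on UNIV" using summ transfer[of "\<lambda>b. 1 - cmod b"] by (auto simp: summable_on_def d_def[abs_def])
  then have sumd: "summable d" using d0 by (simp add: summable_on_UNIV_nonneg_real_iff)
  define f where "f n z = (if n \<in> N then blaschke_factor (x n) z else 1)" for n z
  have holf: "f n holomorphic_on ball 0 1" for n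
    using holomorphic_blaschke_factor[OF P(1)[OF xP], of n]
    by (cases "n \<in> N") (simp_all add: f_def[abs_def])
  have f1: "cmod (f n z - 1) \<le> d n * (2 / (1 - cmod z))" if "cmod z < 1" for n z
    using blaschke_factor_near_1[OF P(1)[OF xP] that, of n] by (simp add: f_def d_def mult.commute)
  have f_le_1: "cmod (f n z) \<le> 1" if "cmod z < 1" for n z
    using phd_le_1[OF P(1)[OF xP], of n z] that by (simp add: f_def norm_blaschke_factor)
  define B where "B z = (\<Prod>n. f n z)" for z
  have hp: "(\<lambda>n. f n z) has_prod B z" if z: "cmod z < 1" for z
  proof -
    have "summable (\<lambda>n. norm (f n z - 1))"
      by (rule summable_comparison_test'[OF summable_mult2[OF sumd, of "2 / (1 - cmod z)"], of 0]) (use f1[OF z] in auto)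
    then have "abs_convergent_prod (\<lambda>n. f n z)" by (simp add: abs_convergent_prod_conv_summable)
    then show ?thesis unfolding B_def
      by (intro convergent_prod_has_prod abs_convergent_prod_imp_convergent_prod)
  qed
  have lim: "(\<lambda>n. \<Prod>k<n. f k z) \<longlonglongrightarrow> B z" if "cmod z < 1" for z
    by (rule has_prod_imp_tendsto'[OF hp[OF that]])
  have "B holomorphic_on ball 0 1"
  proof (rule holomorphic_uniform_sequence[where f = "\<lambda>n z. \<Prod>k<n. f k z"])
    show "(\<lambda>z. \<Prod>k<n. f k z) holomorphic_on ball 0 1" for n
      by (intro holomorphic_intros holf)
    fix z :: complex assume "z \<in> ball 0 1"
    define e where "e = (1 - cmod z) / 2"
    have e: "e > 0" "cmod z + e < 1" using \<open>z \<in> ball 0 1\<close> by (auto simp: e_def field_simps)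
    have sub: "cmod w \<le> cmod z + e" if "w \<in> cball z e" for w
      using that norm_triangle_ineq2[of w z] by (simp add: dist_norm norm_minus_commute)
    have "uniformly_convergent_on (cball z e) (\<lambda>N w. \<Prod>n<N. f n w)"
    proof (rule Infinite_Products.uniformly_convergent_on_prod')
      show "continuous_on (cball z e) (f n)" for n
        by (rule continuous_on_subset[OF holomorphic_on_imp_continuous_on[OF holf]]) (use sub e in force)
      show "uniformly_convergent_on (cball z e) (\<lambda>N w. \<Sum>n<N. norm (f n w - 1))"
      proof (rule Weierstrass_m_test'_ev[where M = "\<lambda>n. d n * (2 / (1 - (cmod z + e)))"])
        have "norm (norm (f n w - 1)) \<le> d n * (2 / (1 - (cmod z + e)))" if w: "w \<in> cball z e" for n w
        proof -
          have "norm (f n w - 1) \<le> d n * (2 / (1 - cmod w))" using sub[OF w] e by (intro f1) auto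
          also have "\<dots> \<le> d n * (2 / (1 - (cmod z + e)))"
            using sub[OF w] e d0 by (intro mult_left_mono divide_left_mono mult_pos_pos) auto
          finally show ?thesis by simp
        qed
        then show "\<forall>\<^sub>F n in sequentially. \<forall>w\<in>cball z e. norm (norm (f n w - 1)) \<le> d n * (2 / (1 - (cmod z + e)))"
          by (intro always_eventually) auto
        show "summable (\<lambda>n. d n * (2 / (1 - (cmod z + e))))" by (intro summable_mult2 sumd)
      qed
    qed auto
    then obtain l where l: "uniform_limit (cball z e) (\<lambda>N w. \<Prod>n<N. f n w) l sequentially"
      by (auto simp: uniformly_convergent_on_def)
    have "l w = B w" if w: "w \<in> cball z e" for w
      using tendsto_uniform_limitI[OF l w] lim[of w] sub[OF w] e LIMSEQ_unique by fastforce
    then have "uniform_limit (cball z e) (\<lambda>N w. \<Prod>n<N. f n w) B sequentially"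
      using l by (subst uniform_limit_cong'[of _ _ _ B l]) auto
    moreover have "cball z e \<subseteq> ball 0 1" using sub e by force
    ultimately show "\<exists>d>0. cball z d \<subseteq> ball 0 1 \<and> uniform_limit (cball z d) (\<lambda>n z. \<Prod>k<n. f k z) B sequentially"
      using e by blast
  qed auto
  moreover have "cmod (B z) \<le> 1" if z: "cmod z < 1" for z
  proof (rule LIMSEQ_le_const2[OF tendsto_norm[OF lim[OF z]]])
    show "\<exists>N. \<forall>n\<ge>N. norm (\<Prod>k<n. f k z) \<le> 1"
      using f_le_1[OF z] by (auto simp: prod_norm[symmetric] intro!: prod_le_1)
  qed
  moreover have zero: "B z = 0 \<longleftrightarrow> z \<in> P" if z: "cmod z < 1" for z
  proof -
    have "B z = 0 \<longleftrightarrow> 0 \<in> range (\<lambda>n. f n z)" by (rule has_prod_eq_0_iff[OF hp[OF z]])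
    also have "\<dots> \<longleftrightarrow> (\<exists>n\<in>N. blaschke_factor (x n) z = 0)" by (force simp: f_def)
    also have "\<dots> \<longleftrightarrow> (\<exists>n\<in>N. z = x n)"
      using norm_blaschke_factor phd_pos[OF P(1)[OF xP] z]
      by (metis less_irrefl norm_eq_zero Moebius_function_eq_zero phd_def)
    also have "\<dots> \<longleftrightarrow> z \<in> P" using xP xx by (auto simp: N_def image_iff) 
    finally show ?thesis .
  qed
  moreover have "((\<lambda>b. - ln (phd z b)) has_sum (- ln (cmod (B z)))) P" if z: "cmod z < 1" "z \<notin> P" for z
  proof -
    have B0: "B z \<noteq> 0" using zero z by simp
    have f0: "f n z \<noteq> 0" for n using has_prod_eq_0_iff[OF hp[OF z(1)]] B0 by auto
    have "(\<lambda>n. - ln (cmod (\<Prod>k<n. f k z))) \<longlonglongrightarrow> - ln (cmod (B z))"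
      using lim[OF z(1)] B0 by (intro tendsto_intros) auto
    moreover have "- ln (cmod (\<Prod>k<n. f k z)) = (\<Sum>k<n. - ln (cmod (f k z)))" for n
      using f0 by (simp add: prod_norm[symmetric] ln_prod sum_negf)
    ultimately have "(\<lambda>n. - ln (cmod (f n z))) sums (- ln (cmod (B z)))" by (simp add: sums_def)
    moreover have nn: "- ln (cmod (f n z)) \<ge> 0" for n using f_le_1[OF z(1)] f0 by simp
    ultimately have "((\<lambda>n. - ln (cmod (f n z))) has_sum (- ln (cmod (B z)))) UNIV"
      by (intro sums_nonneg_imp_has_sum) auto
    moreover have "(\<lambda>n. - ln (cmod (f n z))) = (\<lambda>n. if n \<in> N then - ln (phd z (x n)) else 0)"
      by (auto simp: f_def norm_blaschke_factor)
    ultimately show ?thesis by (simp add: transfer)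
  qed
  ultimately show thesis using that by blast
qed

text \<open>Splitting off the factor of \<open>b0\<close> leaves a Blaschke product that does not vanish at
  \<open>b0\<close>.\<close>

lemma Blaschke_simple_zero:
  assumes P: "\<And>b. b \<in> P \<Longrightarrow> cmod b < 1" "countable P" "(\<lambda>b. 1 - cmod b) summable_on P"
    and B: "B holomorphic_on ball 0 1" "\<And>z. cmod z < 1 \<Longrightarrow> B z = 0 \<longleftrightarrow> z \<in> P"
    "\<And>z. cmod z < 1 \<Longrightarrow> z \<notin> P \<Longrightarrow> ((\<lambda>b. - ln (phd z b)) has_sum (- ln (cmod (B z)))) P"
    and b0: "b0 \<in> P" and e: "e > 0" "ball b0 e \<subseteq> ball 0 1" "ball b0 e \<inter> P \<subseteq> {b0}"
  shows "deriv B b0 \<noteq> 0"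
proof -
  define P' where "P' = P - {b0}"
  obtain B1 where B1: "B1 holomorphic_on ball 0 1"
    "\<And>z. cmod z < 1 \<Longrightarrow> B1 z = 0 \<longleftrightarrow> z \<in> P'"
    "\<And>z. cmod z < 1 \<Longrightarrow> z \<notin> P' \<Longrightarrow> ((\<lambda>b. - ln (phd z b)) has_sum (- ln (cmod (B1 z)))) P'"
  proof (rule Blaschke_product[of P'])
    show "(\<lambda>b. 1 - cmod b) summable_on P'" by (rule summable_on_subset_banach[OF P(3)]) (auto simp: P'_def)
  qed (use P that in \<open>auto simp: P'_def\<close>)
  have b01: "cmod b0 < 1" using P(1) b0 by blast
  have eq: "cmod (B z) = phd z b0 * cmod (B1 z)" if z: "z \<in> ball b0 e" "z \<noteq> b0" for z
  proof -
    have z1: "cmod z < 1" "z \<notin> P" "z \<notin> P'" using z e by (auto simp: P'_def)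
    have "((\<lambda>b. - ln (phd z b)) has_sum (- ln (phd z b0))) {b0}" by (rule has_sum_finiteI) auto
    then have "((\<lambda>b. - ln (phd z b)) has_sum (- ln (phd z b0) + - ln (cmod (B1 z)))) ({b0} \<union> P')"
      by (rule has_sum_Un_disjoint[OF _ B1(3)[OF z1(1,3)]]) (auto simp: P'_def)
    moreover have "{b0} \<union> P' = P" using b0 by (auto simp: P'_def)
    ultimately have "- ln (cmod (B z)) = - ln (phd z b0) + - ln (cmod (B1 z))"
      using B(3)[OF z1(1,2)] has_sum_unique by metis
    moreover have "cmod (B z) > 0" "cmod (B1 z) > 0" "phd z b0 > 0"
      using B(2)[OF z1(1)] B1(2)[OF z1(1)] z1 phd_pos[OF b01 z1(1) z(2)] by auto
    ultimately have "ln (cmod (B z)) = ln (phd z b0 * cmod (B1 z))" by (simp add: ln_mult)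
    then show ?thesis using \<open>cmod (B z) > 0\<close> \<open>cmod (B1 z) > 0\<close> \<open>phd z b0 > 0\<close> by simp
  qed
  have der: "(B has_field_derivative deriv B b0) (at b0)"
    using B(1) b01 by (intro holomorphic_derivI[of B "ball 0 1"]) auto
  then have "((\<lambda>z. (B z - B b0) / (z - b0)) \<longlongrightarrow> deriv B b0) (at b0)"
    by (simp add: has_field_derivative_iff)
  then have "((\<lambda>z. cmod ((B z - B b0) / (z - b0))) \<longlongrightarrow> cmod (deriv B b0)) (at b0)" by (rule tendsto_norm)
  moreover have "\<forall>\<^sub>F z in at b0. cmod ((B z - B b0) / (z - b0)) = cmod (B1 z) / cmod (1 - cnj b0 * z)"
  proof -
    have "\<forall>\<^sub>F z in at b0. z \<in> ball b0 e - {b0}" by (rule eventually_at_in_open) (use e in auto)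
    then show ?thesis
    proof eventually_elim
      case (elim z)
      have "B b0 = 0" using B(2)[OF b01] b0 by simp
      then show ?case using eq[of z] elim by (simp add: norm_divide phd_eq)
    qed
  qed
  ultimately have "((\<lambda>z. cmod (B1 z) / cmod (1 - cnj b0 * z)) \<longlongrightarrow> cmod (deriv B b0)) (at b0)"
    by (rule Lim_transform_eventually)
  moreover have "isCont B1 b0"
    using holomorphic_on_imp_continuous_on[OF B1(1)] b01 by (auto simp: continuous_on_eq_continuous_at)
  then have "((\<lambda>z. cmod (B1 z) / cmod (1 - cnj b0 * z)) \<longlongrightarrow> cmod (B1 b0) / cmod (1 - cnj b0 * b0)) (at b0)"
    using moebius_denom[OF b01, of b0] b01 by (intro tendsto_intros isContD) auto
  ultimately have "cmod (deriv B b0) = cmod (B1 b0) / cmod (1 - cnj b0 * b0)"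
    using tendsto_unique[OF at_neq_bot] by blast
  moreover have "B1 b0 \<noteq> 0" using B1(2)[OF b01] by (simp add: P'_def)
  ultimately show ?thesis using moebius_denom[OF b01, of b0] b01 by auto
qed

section \<open>Coverings as quotients of bounded functions\<close>

lemma countable_fibre:
  fixes p :: "complex \<Rightarrow> 'b::topological_space"
  assumes cov: "covering_space (ball 0 1) p \<Omega>"
  shows "countable {z. cmod z < 1 \<and> p z = y}"
proof (rule countable_subset)
  show "countable (\<Union>n. {z. cmod z \<le> 1 - 1 / real (Suc n) \<and> p z = y})"
    by (rule countable_UN, simp, rule countable_finite, rule finite_fibre[OF cov], simp)
  show "{z. cmod z < 1 \<and> p z = y} \<subseteq> (\<Union>n. {z. cmod z \<le> 1 - 1 / real (Suc n) \<and> p z = y})"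
  proof
    fix z assume z: "z \<in> {z. cmod z < 1 \<and> p z = y}"
    then obtain n where "1 / real (Suc n) < 1 - cmod z"
      using nat_approx_posE[of "1 - cmod z"] by (metis diff_gt_0_iff_gt mem_Collect_eq)
    then have "cmod z \<le> 1 - 1 / real (Suc n)" by linarith
    then show "z \<in> (\<Union>n. {z. cmod z \<le> 1 - 1 / real (Suc n) \<and> p z = y})" using z by blast
  qed
qed

lemma chart1_inj: "x \<noteq> Cpx 0 \<Longrightarrow> y \<noteq> Cpx 0 \<Longrightarrow> chart1 x = chart1 y \<Longrightarrow> x = y"
  by (cases x; cases y) auto

text \<open>At a point over infinity the chart \<open>1/w\<close> turns the covering into an injective
  holomorphic function, whose derivative does not vanish.\<close>

lemma covering_simple_pole:
  assumes uc: "universal_covering p \<Omega>" and b: "cmod b < 1" "p b = Infty"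
  obtains e where "e > 0" "ball b e \<subseteq> ball 0 1" "inj_on p (ball b e)"
    "\<And>z. z \<in> ball b e \<Longrightarrow> p z \<noteq> Cpx 0"
    "(\<lambda>z. chart1 (p z)) holomorphic_on ball b e" "deriv (\<lambda>z. chart1 (p z)) b \<noteq> 0"
proof -
  have cov: "covering_space (ball 0 1) p \<Omega>" and hol: "sphere_holomorphic_on p (ball 0 1)"
    using uc by (auto simp: universal_covering_def)
  obtain e1 where e1: "e1 > 0" "ball b e1 \<subseteq> ball 0 1" "inj_on p (ball b e1)"
    using covering_locally_injective[OF cov b(1)] by metis
  have "open (p -` (-{Cpx 0}) \<inter> ball 0 1)"
    using hol by (auto simp: sphere_holomorphic_on_def continuous_on_open_vimage)
  moreover have "b \<in> p -` (-{Cpx 0}) \<inter> ball 0 1" using b by auto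
  ultimately obtain e2 where e2: "e2 > 0" "ball b e2 \<subseteq> p -` (-{Cpx 0}) \<inter> ball 0 1"
    using open_contains_ball by meson
  define e where "e = min e1 e2"
  have e: "e > 0" "ball b e \<subseteq> ball 0 1" "inj_on p (ball b e)" "\<And>z. z \<in> ball b e \<Longrightarrow> p z \<noteq> Cpx 0"
    using e1 e2 by (auto simp: e_def intro: inj_on_subset)
  have "(\<lambda>z. chart1 (p z)) analytic_on {z}" if "z \<in> ball b e" for z
    using hol e(2,4) that by (auto simp: sphere_holomorphic_on_def)
  then have "(\<lambda>z. chart1 (p z)) analytic_on ball b e" by (meson analytic_on_analytic_at)
  then have h: "(\<lambda>z. chart1 (p z)) holomorphic_on ball b e" by (rule analytic_imp_holomorphic)
  have "inj_on (\<lambda>z. chart1 (p z)) (ball b e)"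
    using e(3,4) chart1_inj by (meson inj_on_def)
  then have "deriv (\<lambda>z. chart1 (p z)) b \<noteq> 0"
    using e(1) by (intro holomorphic_injective_imp_regular[OF h]) auto
  then show thesis using that e h by blast
qed

text \<open>A deck transformation permutes the zeros and preserves pseudo-hyperbolic distances, so it only
  rearranges the series for \<open>ln |B|\<close>.\<close>

lemma Blaschke_deck_invariant:
  assumes P_def: "P = {z. cmod z < 1 \<and> p z = y}" and g: "g \<in> deck_group p"
    and B0: "\<And>z. cmod z < 1 \<Longrightarrow> B z = 0 \<longleftrightarrow> z \<in> P"
    and B: "\<And>z. cmod z < 1 \<Longrightarrow> z \<notin> P \<Longrightarrow> ((\<lambda>b. - ln (phd z b)) has_sum (- ln (cmod (B z)))) P"
    and z: "cmod z < 1" "z \<notin> P"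
  shows "cmod (B (g z)) = cmod (B z)"
proof -
  have gz: "cmod (g z) < 1" "g z \<notin> P"
    using disk_automorphism_norm[OF deck_automorphism[OF g] z(1)] deck_invariant[OF g z(1)] z
    by (auto simp: P_def)
  have "inj_on g P"
    using deck_automorphism[OF g] unfolding disk_automorphisms_def bij_betw_def P_def
    by (auto intro: inj_on_subset)
  then have bij: "bij_betw g P P"
    using deck_permutes_fibre[OF g, of y] by (simp add: bij_betw_def P_def)
  have "((\<lambda>b. - ln (phd (g z) (g b))) has_sum (- ln (cmod (B (g z))))) P"
    using B[OF gz] has_sum_reindex_bij_betw[OF bij, of "\<lambda>b. - ln (phd (g z) b)"] by simp
  moreover have "phd (g z) (g b) = phd z b" if "b \<in> P" for b
    using phd_automorphism[OF deck_automorphism[OF g] z(1)] that by (auto simp: P_def)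
  ultimately have "((\<lambda>b. - ln (phd z b)) has_sum (- ln (cmod (B (g z))))) P"
    by (simp cong: has_sum_cong)
  then have "- ln (cmod (B z)) = - ln (cmod (B (g z)))"
    by (rule has_sum_unique[OF B[OF z]])
  then have "ln (cmod (B (g z))) = ln (cmod (B z))" by simp
  moreover have "cmod (B (g z)) > 0" "cmod (B z) > 0" using B0 gz z by auto
  ultimately show ?thesis by simp
qed

text \<open>A representation of \<open>p\<close> as a quotient of bounded holomorphic functions without common
  zeros.\<close>

definition bounded_quotient :: "(complex \<Rightarrow> riemann_sphere) \<Rightarrow> (complex \<Rightarrow> complex) \<Rightarrow> (complex \<Rightarrow> complex) \<Rightarrow> real \<Rightarrow> bool" where
  "bounded_quotient p H B C \<longleftrightarrow> H holomorphic_on ball 0 1 \<and> B holomorphic_on ball 0 1 \<and>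
     (\<forall>z. cmod z < 1 \<longrightarrow> cmod (H z) \<le> C \<and> cmod (B z) \<le> 1 \<and>
        (p z = Infty \<longrightarrow> B z = 0 \<and> H z \<noteq> 0) \<and>
        (p z \<noteq> Infty \<longrightarrow> B z \<noteq> 0 \<and> p z = Cpx (H z / B z)))"

text \<open>\<open>B\<close> is the Blaschke product of the poles and \<open>H = p B\<close>. Outside the
  image of a disk around one pole \<open>b0\<close>, \<open>p\<close> is bounded. A point over that image is
  moved into the disk by a deck transformation, which preserves \<open>|H| = |p| |B|\<close>.\<close>

theorem quotient_representation:
  assumes uc: "universal_covering p \<Omega>" and \<Omega>: "open \<Omega>" and c: "c \<notin> \<Omega>" and inf: "Infty \<in> \<Omega>"
    and summ: "(\<lambda>b. 1 - cmod b) summable_on {z. cmod z < 1 \<and> p z = Infty}"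
  obtains H B C where "bounded_quotient p H B C"
proof -
  have cov: "covering_space (ball 0 1) p \<Omega>" and hol: "sphere_holomorphic_on p (ball 0 1)"
    using uc by (auto simp: universal_covering_def)
  define P where "P = {z. cmod z < 1 \<and> p z = Infty}"
  have P1: "\<And>b. b \<in> P \<Longrightarrow> cmod b < 1" by (simp add: P_def)
  have cP: "countable P" unfolding P_def by (rule countable_fibre[OF cov])
  have sP: "(\<lambda>b. 1 - cmod b) summable_on P" using summ by (simp add: P_def)
  obtain B where B: "B holomorphic_on ball 0 1" "\<And>z. cmod z < 1 \<Longrightarrow> cmod (B z) \<le> 1"
    and B0: "\<And>z. cmod z < 1 \<Longrightarrow> B z = 0 \<longleftrightarrow> z \<in> P"
    and Bs: "\<And>z. cmod z < 1 \<Longrightarrow> z \<notin> P \<Longrightarrow> ((\<lambda>b. - ln (phd z b)) has_sum (- ln (cmod (B z)))) P"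
    using Blaschke_product[OF P1 cP sP] by blast
  define X where "X z = chart0 (p z)" for z
  define H0 where "H0 z = B z * X z" for z
  define H where "H = remove_sings H0"
  have an0: "H0 analytic_on {z}" if z: "cmod z < 1" "z \<notin> P" for z
  proof -
    have "X analytic_on {z}"
      using hol z unfolding X_def by (auto simp: sphere_holomorphic_on_def P_def)
    moreover have "B analytic_on {z}"
      using B(1) z(1) by (intro holomorphic_on_imp_analytic_at[of B "ball 0 1"]) auto
    ultimately show ?thesis unfolding H0_def by (intro analytic_intros)
  qed
  have Hoff: "H z = H0 z" if "cmod z < 1" "z \<notin> P" for z
    unfolding H_def using an0[OF that] by simp
  \<comment> \<open>Both \<open>B\<close> and \<open>1 / p\<close> have simple zeros at a pole of \<open>p\<close>.\<close>
  have at_pole: "H analytic_on {b} \<and> H b \<noteq> 0" if b: "b \<in> P" for b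
  proof -
    have b1: "cmod b < 1" "p b = Infty" using b by (auto simp: P_def)
    define f where "f z = chart1 (p z)" for z
    obtain e where e: "e > 0" "ball b e \<subseteq> ball 0 1" "inj_on p (ball b e)"
        "\<And>z. z \<in> ball b e \<Longrightarrow> p z \<noteq> Cpx 0" "f holomorphic_on ball b e" "deriv f b \<noteq> 0"
      using covering_simple_pole[OF uc b1] unfolding f_def by metis
    have PB: "ball b e \<inter> P \<subseteq> {b}"
    proof
      fix z assume z: "z \<in> ball b e \<inter> P"
      then have "p z = p b" using b1 by (simp add: P_def)
      then have "z = b" by (rule inj_onD[OF e(3)]) (use z e(1) in auto)
      then show "z \<in> {b}" by simp
    qed
    have dB: "deriv B b \<noteq> 0"
      by (rule Blaschke_simple_zero[OF P1 cP sP B(1) B0 Bs b e(1,2) PB])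
    have "(B has_field_derivative deriv B b) (at b)"
      using B(1) b1 by (intro holomorphic_derivI[of B "ball 0 1"]) auto
    moreover have "B b = 0" using B0 b b1 by simp
    ultimately have l1: "((\<lambda>z. B z / (z - b)) \<longlongrightarrow> deriv B b) (at b)"
      by (simp add: has_field_derivative_iff)
    have "(f has_field_derivative deriv f b) (at b)"
      using e by (intro holomorphic_derivI[of f "ball b e"]) auto
    moreover have "f b = 0" using b1 by (simp add: f_def)
    ultimately have l2: "((\<lambda>z. f z / (z - b)) \<longlongrightarrow> deriv f b) (at b)"
      by (simp add: has_field_derivative_iff)
    have "((\<lambda>z. (B z / (z - b)) / (f z / (z - b))) \<longlongrightarrow> deriv B b / deriv f b) (at b)"
      by (intro tendsto_divide l1 l2 e(6))
    moreover have "\<forall>\<^sub>F z in at b. (B z / (z - b)) / (f z / (z - b)) = H0 z"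
    proof -
      have "\<forall>\<^sub>F z in at b. z \<in> ball b e - {b}" by (rule eventually_at_in_open) (use e in auto)
      then show ?thesis
      proof eventually_elim
        case (elim z)
        then have "p z \<noteq> Infty" using PB e(2) by (auto simp: P_def subset_iff)
        then obtain w where w: "p z = Cpx w" by (cases "p z") auto
        then have "w \<noteq> 0" using e(4)[of z] elim by auto
        then show ?case using w elim by (simp add: f_def H0_def X_def field_simps)
      qed
    qed
    ultimately have lim: "(H0 \<longlongrightarrow> deriv B b / deriv f b) (at b)"
      by (rule Lim_transform_eventually)
    have "H0 analytic_on {w}" if w: "w \<in> ball b e - {b}" for w
    proof (rule an0)
      show "cmod w < 1" using e(2) w by auto
      show "w \<notin> P" using PB w by blast
    qed
    then have "H0 analytic_on ball b e - {b}" by (subst analytic_on_analytic_at) blast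
    then have "isolated_singularity_at H0 b"
      using e(1) by (intro isolated_singularity_at_holomorphic[of H0 "ball b e"]) (auto intro: analytic_imp_holomorphic)
    then have "H analytic_on {b}" unfolding H_def using lim by (rule remove_sings_analytic_at)
    moreover have "H b = deriv B b / deriv f b" unfolding H_def using lim by (rule remove_sings_eqI)
    ultimately show ?thesis using dB e(6) by simp
  qed
  have "H analytic_on {z}" if z: "cmod z < 1" for z
  proof (cases "z \<in> P")
    case False
    then show ?thesis unfolding H_def using remove_sings_analytic_on[OF an0[OF z False]] by simp
  qed (use at_pole in auto)
  then have "H analytic_on ball 0 1" by (subst analytic_on_analytic_at) auto
  then have holH: "H holomorphic_on ball 0 1" by (rule analytic_imp_holomorphic)
  have pH: "p z = Cpx (H z / B z)" if z: "cmod z < 1" "z \<notin> P" for z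
  proof -
    have "p z \<noteq> Infty" using z by (simp add: P_def)
    then have "p z = Cpx (X z)" by (cases "p z") (auto simp: X_def)
    moreover have "B z \<noteq> 0" using B0 z by simp
    ultimately show ?thesis using Hoff[OF z] by (simp add: H0_def)
  qed
  obtain b0 where b0: "cmod b0 < 1" "p b0 = Infty"
    using covering_space_imp_surjective[OF cov] inf by (metis imageE mem_ball_0)
  obtain \<epsilon> where \<epsilon>: "\<epsilon> > 0" "cball b0 \<epsilon> \<subseteq> ball 0 1"
    using open_contains_cball b0(1) by (meson mem_ball_0 open_ball)
  have "compact (H ` cball b0 \<epsilon>)"
    by (intro compact_continuous_image continuous_on_subset[OF holomorphic_on_imp_continuous_on[OF holH] \<epsilon>(2)]) auto
  then obtain C1 where C1: "\<And>z. z \<in> cball b0 \<epsilon> \<Longrightarrow> cmod (H z) \<le> C1"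
    using compact_imp_bounded bounded_iff by (metis imageI)
  obtain T U q where T: "b0 \<in> T" "openin (top_of_set (ball 0 1)) T" "openin (top_of_set \<Omega>) U" "homeomorphism T U p q"
    using covering_space_local_homeomorphism[OF cov, of b0] b0(1) by (metis mem_ball_0)
  define N where "N = T \<inter> ball b0 \<epsilon>"
  have "openin (top_of_set T) N"
    unfolding N_def by (rule openin_open_Int) simp
  then have "openin (top_of_set U) (p ` N)"
    by (rule homeomorphism_imp_open_map[OF T(4)])
  then have "open (p ` N)" using T(3) \<Omega> by (meson openin_open_eq openin_trans)
  moreover have "Infty \<in> p ` N" using b0 T(1) \<epsilon>(1) unfolding N_def by (metis centre_in_ball imageI IntI)
  ultimately have "bounded (- (Cpx -` (p ` N)))"
    by (simp add: open_riemann_sphere_iff compact_imp_bounded)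
  then obtain R where R: "\<And>w. Cpx w \<notin> p ` N \<Longrightarrow> cmod w \<le> R"
    unfolding bounded_iff by auto
  have bd0: "cmod (H z) \<le> max R C1" if z: "cmod z < 1" "z \<notin> P" for z
  proof (cases "p z \<in> p ` N")
    case False
    then have "cmod (H z / B z) \<le> R" using pH[OF z] R by metis
    moreover have "cmod (H z) = cmod (H z / B z) * cmod (B z)"
      using B0[OF z(1)] z(2) by (simp add: norm_divide)
    moreover have "\<dots> \<le> cmod (H z / B z) * 1" using B(2)[OF z(1)] by (intro mult_left_mono) auto
    ultimately show ?thesis by linarith
  next
    case True
    then obtain u where u: "u \<in> ball b0 \<epsilon>" "p u = p z" by (auto simp: N_def)
    have "u \<in> ball 0 1" using u(1) \<epsilon>(2) ball_subset_cball[of b0 \<epsilon>] by blast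
    then have u1: "cmod u < 1" by simp
    have uP: "u \<notin> P" using u z by (auto simp: P_def)
    obtain g where g: "g \<in> deck_group p" "g u = z" using deck_transitive[OF uc c u1 z(1) u(2)] by metis
    have eqB: "cmod (B z) = cmod (B u)"
      using Blaschke_deck_invariant[OF P_def g(1) B0 Bs u1 uP] g(2) by simp
    have "H z / B z = H u / B u" using pH[OF z] pH[OF u1 uP] u(2) by simp
    then have "cmod (H z) = cmod (H u)"
      using eqB B0[OF z(1)] B0[OF u1] z(2) uP by (metis nonzero_eq_divide_eq norm_mult)
    also have "\<dots> \<le> C1" using u(1) by (intro C1) auto
    finally show ?thesis by simp
  qed
  have bd: "cmod (H z) \<le> max R C1" if z: "cmod z < 1" for z
  proof (cases "z \<in> P")
    case True
    have z2: "p z = Infty" using True by (simp add: P_def)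
    obtain e where e: "e > 0" "ball z e \<subseteq> ball 0 1" "inj_on p (ball z e)"
      using covering_locally_injective[OF cov z] by metis
    have "\<forall>\<^sub>F w in at z. w \<in> ball z e - {z}" by (rule eventually_at_in_open) (use e in auto)
    then have "\<forall>\<^sub>F w in at z. cmod (H w) \<le> max R C1"
    proof eventually_elim
      case (elim w)
      have "w \<notin> P"
      proof
        assume "w \<in> P"
        then have "p w = p z" using z2 by (simp add: P_def)
        then have "w = z" by (rule inj_onD[OF e(3)]) (use elim e(1) in auto)
        then show False using elim by simp
      qed
      then show ?case using elim e(2) by (intro bd0) auto
    qed
    moreover have "isCont H z"
      using holomorphic_on_imp_continuous_on[OF holH] z by (auto simp: continuous_on_eq_continuous_at)
    then have "((\<lambda>w. cmod (H w)) \<longlongrightarrow> cmod (H z)) (at z)" by (intro tendsto_norm isContD)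
    ultimately show ?thesis using tendsto_upperbound at_neq_bot by blast
  qed (use bd0 z in auto)
  have P0: "B z = 0 \<and> H z \<noteq> 0" if "cmod z < 1" "p z = Infty" for z
    using that at_pole[of z] B0[of z] by (auto simp: P_def)
  have P1': "B z \<noteq> 0 \<and> p z = Cpx (H z / B z)" if "cmod z < 1" "p z \<noteq> Infty" for z
    using that pH[of z] B0[of z] by (auto simp: P_def)
  show thesis
    by (rule that[of H B "max R C1"], unfold bounded_quotient_def, intro conjI allI impI)
       (use holH B(1) bd B(2) P0 P1' in blast)+
qed

text \<open>Measurability and Fatou's lemma need a sequence of radii in place of
  \<open>r \<rightarrow> 1\<close>.\<close>

definition rseq :: "nat \<Rightarrow> real" where "rseq n = 1 - 1 / (real n + 2)"

lemma rseq: "0 < rseq n" "rseq n < 1"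
  by (auto simp: rseq_def divide_simps)

lemma rseq_at_left: "filterlim rseq (at_left 1) sequentially"
proof -
  have "rseq \<longlonglongrightarrow> 1" unfolding rseq_def by real_asymp
  then show ?thesis using rseq(2) by (simp add: filterlim_at less_imp_neq)
qed

lemma rseq_lim:
  "((\<lambda>r. f (of_real r * cis t)) \<longlongrightarrow> l) (at_left (1::real)) \<Longrightarrow> (\<lambda>n. f (of_real (rseq n) * cis t)) \<longlonglongrightarrow> l"
  by (rule filterlim_compose[OF _ rseq_at_left])

lemma continuous_on_rseq:
  assumes "f holomorphic_on ball 0 1"
  shows "continuous_on UNIV (\<lambda>t. f (of_real (rseq n) * cis t))"
  by (rule continuous_on_compose2[OF holomorphic_on_imp_continuous_on[OF assms]])
     (use rseq[of n] in \<open>auto intro!: continuous_intros simp: norm_mult\<close>)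

text \<open>On each circle the integral equals \<open>ln (K / |Q 0|)\<close> by the mean value property of
  \<open>ln |Q|\<close>; the limit is taken by Fatou's lemma.\<close>

lemma log_integral_zero_free:
  assumes Q: "Q holomorphic_on ball 0 1" "\<And>z. cmod z < 1 \<Longrightarrow> Q z \<noteq> 0" "\<And>z. cmod z < 1 \<Longrightarrow> cmod (Q z) \<le> K"
  shows "(\<integral>\<^sup>+t. liminf (\<lambda>n. ennreal (ln (K / cmod (Q (of_real (rseq n) * cis t))))) \<partial>circ)
      \<le> ennreal (ln (K / cmod (Q 0)))"
proof -
  have in_ball: "cmod (of_real (rseq n) * cis t) < 1" for n t using rseq[of n] by (simp add: norm_mult)
  have Q0: "cmod (Q 0) > 0" using Q(2)[of 0] by simp
  have K: "K > 0" by (rule less_le_trans[OF Q0 Q(3)]) simp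
  have cont: "continuous_on UNIV (\<lambda>t. ln (cmod (Q (of_real (rseq n) * cis t))))" for n
    using Q(2)[OF in_ball] by (intro continuous_intros continuous_on_rseq Q(1)) auto
  have ln_eq: "ln (K / cmod (Q (of_real (rseq n) * cis t))) = ln K - ln (cmod (Q (of_real (rseq n) * cis t)))" for n t
    using K Q(2)[OF in_ball[of n t]] by (simp add: ln_div)
  have each: "(\<integral>\<^sup>+t. ennreal (ln (K / cmod (Q (of_real (rseq n) * cis t)))) \<partial>circ) = ennreal (ln (K / cmod (Q 0)))" for n
  proof -
    have "(\<integral>\<^sup>+t. ennreal (ln (K / cmod (Q (of_real (rseq n) * cis t)))) \<partial>circ)
        = ennreal (LINT t|circ. ln (K / cmod (Q (of_real (rseq n) * cis t))))"
    proof (rule nn_integral_eq_integral)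
      show "integrable circ (\<lambda>t. ln (K / cmod (Q (of_real (rseq n) * cis t))))"
        unfolding ln_eq by (intro integrable_circ_cont continuous_intros cont)
      show "AE t in circ. 0 \<le> ln (K / cmod (Q (of_real (rseq n) * cis t)))"
        using Q(3)[OF in_ball] Q(2)[OF in_ball] by (intro AE_I2 ln_ge_zero) (auto simp: pos_le_divide_eq)
    qed
    also have "(LINT t|circ. ln (K / cmod (Q (of_real (rseq n) * cis t)))) = ln K - (LINT t|circ. ln (cmod (Q (0 + of_real (rseq n) * cis t))))"
      unfolding ln_eq using integrable_circ_cont[OF cont]
      by (subst Bochner_Integration.integral_diff) (auto simp: circ.prob_space[simplified])
    also have "(LINT t|circ. ln (cmod (Q (0 + of_real (rseq n) * cis t)))) = ln (cmod (Q 0))"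
      using Q rseq[of n] by (intro mean_value_ln_norm[of Q 0 1]) auto
    also have "ln K - ln (cmod (Q 0)) = ln (K / cmod (Q 0))" using K Q0 by (simp add: ln_div)
    finally show ?thesis .
  qed
  have "(\<integral>\<^sup>+t. liminf (\<lambda>n. ennreal (ln (K / cmod (Q (of_real (rseq n) * cis t))))) \<partial>circ)
      \<le> liminf (\<lambda>n. \<integral>\<^sup>+t. ennreal (ln (K / cmod (Q (of_real (rseq n) * cis t)))) \<partial>circ)"
    using cont[THEN borel_measurable_cont] unfolding ln_eq by (intro nn_integral_liminf) auto
  also have "\<dots> = ennreal (ln (K / cmod (Q 0)))" unfolding each by (simp add: Liminf_const)
  finally show ?thesis .
qed

lemma liminf_log_top:
  assumes "X \<longlonglongrightarrow> (0::complex)" "\<And>n. X n \<noteq> 0" "K > 0"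
  shows "liminf (\<lambda>n. ennreal (ln (K / cmod (X n)))) = \<infinity>"
proof -
  have "(\<lambda>n. cmod (X n)) \<longlonglongrightarrow> 0" using assms(1) by (rule tendsto_norm_zero)
  then have "filterlim (\<lambda>n. cmod (X n)) (at_right 0) sequentially"
    using assms(2) by (simp add: filterlim_at)
  then have "filterlim (\<lambda>n. inverse (cmod (X n))) at_top sequentially"
    by (rule filterlim_compose[OF filterlim_inverse_at_top_right])
  then have "filterlim (\<lambda>n. K * inverse (cmod (X n))) at_top sequentially"
    using assms(3) by (intro filterlim_tendsto_pos_mult_at_top[OF tendsto_const]) auto
  then have "filterlim (\<lambda>n. ln (K / cmod (X n))) at_top sequentially"
    unfolding divide_inverse by (rule filterlim_compose[OF ln_at_top])
  then have "(\<lambda>n. ennreal (ln (K / cmod (X n)))) \<longlonglongrightarrow> \<infinity>"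
    by (simp add: ennreal_tendsto_top_eq_at_top)
  then show ?thesis by (intro lim_imp_Liminf) auto
qed

lemma radial_limit_nonzero:
  assumes Q: "Q holomorphic_on ball 0 1" "\<And>z. cmod z < 1 \<Longrightarrow> Q z \<noteq> 0" "\<And>z. cmod z < 1 \<Longrightarrow> cmod (Q z) \<le> K"
  shows "AE t in circ. \<not> ((\<lambda>r. Q (of_real r * cis t)) \<longlongrightarrow> 0) (at_left (1::real))"
proof -
  have in_ball: "cmod (of_real (rseq n) * cis t) < 1" for n t using rseq[of n] by (simp add: norm_mult)
  have "cmod (Q 0) > 0" using Q(2)[of 0] by simp
  then have K: "K > 0" by (rule less_le_trans[OF _ Q(3)]) simp
  have meas: "(\<lambda>t. liminf (\<lambda>n. ennreal (ln (K / cmod (Q (of_real (rseq n) * cis t)))))) \<in> borel_measurable circ"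
    using continuous_on_rseq[OF Q(1), THEN borel_measurable_cont] by measurable
  have "(\<integral>\<^sup>+t. liminf (\<lambda>n. ennreal (ln (K / cmod (Q (of_real (rseq n) * cis t))))) \<partial>circ) \<noteq> \<infinity>"
    using log_integral_zero_free[OF Q] by (metis ennreal_neq_top infinity_ennreal_def top.extremum_unique)
  then have "AE t in circ. liminf (\<lambda>n. ennreal (ln (K / cmod (Q (of_real (rseq n) * cis t))))) \<noteq> \<infinity>"
    by (rule nn_integral_PInf_AE[OF meas])
  then show ?thesis
  proof eventually_elim
    case (elim t)
    show ?case
    proof
      assume "((\<lambda>r. Q (of_real r * cis t)) \<longlongrightarrow> 0) (at_left (1::real))"
      then have "(\<lambda>n. Q (of_real (rseq n) * cis t)) \<longlonglongrightarrow> 0" by (rule rseq_lim)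
      then show False
        using liminf_log_top[of "\<lambda>n. Q (of_real (rseq n) * cis t)" K] Q(2)[OF in_ball] K elim by blast
    qed
  qed
qed

section \<open>From the Blaschke condition to radial limits and capacity\<close>

lemma bounded_quotientD:
  assumes "bounded_quotient p H B C"
  shows "H holomorphic_on ball 0 1" "B holomorphic_on ball 0 1"
    "cmod z < 1 \<Longrightarrow> cmod (H z) \<le> C" "cmod z < 1 \<Longrightarrow> cmod (B z) \<le> 1"
    "cmod z < 1 \<Longrightarrow> p z = Infty \<Longrightarrow> B z = 0 \<and> H z \<noteq> 0"
    "cmod z < 1 \<Longrightarrow> p z \<noteq> Infty \<Longrightarrow> B z \<noteq> 0 \<and> p z = Cpx (H z / B z)"
  using assms unfolding bounded_quotient_def by blast+

lemma tendsto_in_closure: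
  assumes "X \<longlonglongrightarrow> (l::'a::topological_space)" "\<And>n. X n \<in> S"
  shows "l \<in> closure S"
proof (rule ccontr)
  assume "l \<notin> closure S"
  then have "\<forall>\<^sub>F n in sequentially. X n \<in> - closure S"
    by (intro topological_tendstoD[OF assms(1)]) auto
  then show False using assms(2) closure_subset[of S] by (auto simp: eventually_sequentially)
qed

text \<open>With \<open>p = H / B\<close> the function \<open>1 / (p - w0)\<close> is
  \<open>B / Q\<close>, where \<open>Q = H - w0 B\<close> is bounded and zero-free. So the limits of
  \<open>B\<close> and \<open>Q\<close> exist, and those of \<open>Q\<close> do not vanish, almost
  everywhere.\<close>

theorem Blaschke_imp_radial_limits:
  assumes uc: "universal_covering p \<Omega>" and \<Omega>: "open \<Omega>" and w0: "Cpx w0 \<notin> \<Omega>" and inf: "Infty \<in> \<Omega>"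
    and summ: "(\<lambda>b. 1 - cmod b) summable_on {z. cmod z < 1 \<and> p z = Infty}"
  shows "AE t in circ. has_radial_limit p (cis t)"
proof -
  have cov: "covering_space (ball 0 1) p \<Omega>" using uc by (simp add: universal_covering_def)
  obtain H B C where HB: "bounded_quotient p H B C"
    using quotient_representation[OF uc \<Omega> w0 inf summ] by blast
  note hol = bounded_quotientD(1,2)[OF HB] and le = bounded_quotientD(3,4)[OF HB]
    and pI = bounded_quotientD(5)[OF HB] and pF = bounded_quotientD(6)[OF HB]
  note H = hol(1) le(1) and B = hol(2) le(2)
  define Q where "Q z = H z - w0 * B z" for z
  have Qhol: "Q holomorphic_on ball 0 1" unfolding Q_def by (intro holomorphic_intros H B)
  have Qbd: "cmod (Q z) \<le> C + cmod w0" if "cmod z < 1" for z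
  proof -
    have "cmod (w0 * B z) \<le> cmod w0 * 1" unfolding norm_mult using B(2)[OF that] by (intro mult_left_mono) auto
    then show ?thesis unfolding Q_def using norm_triangle_ineq4[of "H z" "w0 * B z"] H(2)[OF that] by linarith
  qed
  have pOm: "p z \<in> \<Omega>" if "cmod z < 1" for z
    using covering_space_imp_surjective[OF cov] that by auto
  have Q0: "Q z \<noteq> 0" if z: "cmod z < 1" for z
  proof (cases "p z = Infty")
    case True
    then show ?thesis using pI[OF z] by (simp add: Q_def)
  next
    case False
    then have "B z \<noteq> 0" "p z = Cpx (H z / B z)" using pF[OF z] by auto
    then show ?thesis using pOm[OF z] w0 by (auto simp: Q_def)
  qed
  have send: "send_to_infinity (Cpx w0) (p z) = Cpx (B z / Q z)" if z: "cmod z < 1" for z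
  proof (cases "p z = Infty")
    case True
    then show ?thesis using pI[OF z] by simp
  next
    case False
    then have B0: "B z \<noteq> 0" and pz: "p z = Cpx (H z / B z)" using pF[OF z] by auto
    have ne: "H z / B z \<noteq> w0" using pOm[OF z] w0 pz by auto
    have "1 / (H z / B z - w0) = B z / Q z"
      using B0 by (simp add: Q_def field_simps)
    then show ?thesis using ne pz by simp
  qed
  have "AE t in circ. \<exists>l. ((\<lambda>r. Q (of_real r * cis t)) \<longlongrightarrow> l) (at_left (1::real))"
    by (rule Fatou_radial_limit[OF Qhol Qbd])
  moreover have "AE t in circ. \<exists>l. ((\<lambda>r. B (of_real r * cis t)) \<longlongrightarrow> l) (at_left (1::real))"
    by (rule Fatou_radial_limit[OF B])
  moreover have "AE t in circ. \<not> ((\<lambda>r. Q (of_real r * cis t)) \<longlongrightarrow> 0) (at_left (1::real))"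
    by (rule radial_limit_nonzero[OF Qhol Q0 Qbd])
  ultimately show ?thesis
  proof eventually_elim
    case (elim t)
    then obtain q \<beta> where q: "((\<lambda>r. Q (of_real r * cis t)) \<longlongrightarrow> q) (at_left (1::real))"
      and \<beta>: "((\<lambda>r. B (of_real r * cis t)) \<longlongrightarrow> \<beta>) (at_left (1::real))" by blast
    have "q \<noteq> 0" using q elim by blast
    then have "((\<lambda>r. B (of_real r * cis t) / Q (of_real r * cis t)) \<longlongrightarrow> \<beta> / q) (at_left (1::real))"
      by (intro tendsto_divide q \<beta>)
    then have lim: "((\<lambda>r. Cpx (B (of_real r * cis t) / Q (of_real r * cis t))) \<longlongrightarrow> Cpx (\<beta> / q)) (at_left (1::real))"
      using continuous_Cpx[of UNIV] by (intro isCont_tendsto_compose[of _ Cpx]) (simp add: continuous_on_eq_continuous_at)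
    have "\<forall>\<^sub>F r in at_left (1::real). Cpx (B (of_real r * cis t) / Q (of_real r * cis t)) = send_to_infinity (Cpx w0) (p (of_real r * cis t))"
      unfolding eventually_at_left_field
      by (intro exI[of _ 0] conjI allI impI send[symmetric]) (auto simp: norm_mult)
    then have "((\<lambda>r. send_to_infinity (Cpx w0) (p (of_real r * cis t))) \<longlongrightarrow> Cpx (\<beta> / q)) (at_left (1::real))"
      using lim by (rule Lim_transform_eventually[rotated])
    then have "has_radial_limit (\<lambda>z. send_to_infinity (Cpx w0) (p z)) (cis t)"
      unfolding has_radial_limit_def by blast
    then show ?case by (simp only: has_radial_limit_send)
  qed
qed

text \<open>The integral of the negative part of the kernel may be left out: it only decreases the
  energy.\<close>

lemma log_capacity_pos:
  assumes \<mu>: "prob_space \<mu>" "sets \<mu> = sets borel" "emeasure \<mu> K = 1"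
    and fin: "(\<integral>\<^sup>+ z. (\<integral>\<^sup>+ w. e2ennreal (log_kernel z w) \<partial>\<mu>) \<partial>\<mu>) < \<infinity>"
  shows "log_capacity K > 0"
proof -
  let ?p = "\<integral>\<^sup>+ z. (\<integral>\<^sup>+ w. e2ennreal (log_kernel z w) \<partial>\<mu>) \<partial>\<mu>"
  let ?n = "\<integral>\<^sup>+ z. (\<integral>\<^sup>+ w. e2ennreal (- log_kernel z w) \<partial>\<mu>) \<partial>\<mu>"
  have "robin_constant K \<le> log_energy \<mu>"
    unfolding robin_constant_def using \<mu> by (intro INF_lower) auto
  also have "\<dots> \<le> enn2ereal ?p" unfolding log_energy_def
    by (simp add: ereal_diff_le_self)
  also have "\<dots> < \<infinity>" using fin by (simp add: less_ennreal.rep_eq)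
  finally have "robin_constant K \<noteq> \<infinity>" by auto
  then show ?thesis by (simp add: log_capacity_def)
qed

text \<open>The distribution \<open>\<mu>\<close> of the radial limits \<open>W = H / B\<close> lives on
  \<open>\<partial>\<Omega>\<close>. For \<open>z \<in> \<partial>\<Omega>\<close>,
  \<open>|H - z B| \<le> |W - z|\<close> in the limit, because \<open>|B| \<le> 1\<close>; hence the
  potential of \<open>\<mu>\<close> at \<open>z\<close> is bounded through the logarithmic integral of the
  zero-free function \<open>H - z B\<close>, whose value at 0 is \<open>H 0\<close> for every
  \<open>z\<close>.\<close>

theorem Blaschke_imp_capacity:
  assumes uc: "universal_covering p \<Omega>" and \<Omega>: "open \<Omega>" and w0: "Cpx w0 \<notin> \<Omega>" and p0: "p 0 = Infty"
    and summ: "(\<lambda>b. 1 - cmod b) summable_on {z. cmod z < 1 \<and> p z = Infty}"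
  shows "log_capacity (Cpx -` frontier \<Omega>) > 0"
proof -
  have cov: "covering_space (ball 0 1) p \<Omega>" using uc by (simp add: universal_covering_def)
  have pOm: "p z \<in> \<Omega>" if "cmod z < 1" for z
    using covering_space_imp_surjective[OF cov] that by auto
  have inf: "Infty \<in> \<Omega>" using pOm[of 0] p0 by simp
  have AElim: "AE t in circ. has_radial_limit p (cis t)"
    by (rule Blaschke_imp_radial_limits[OF uc \<Omega> w0 inf summ])
  obtain H B C0 where HB: "bounded_quotient p H B C0"
    using quotient_representation[OF uc \<Omega> w0 inf summ] by blast
  note hol = bounded_quotientD(1,2)[OF HB] and le = bounded_quotientD(3,4)[OF HB]
    and pI = bounded_quotientD(5)[OF HB] and pF = bounded_quotientD(6)[OF HB]
  note H = hol(1) le(1) and B = hol(2) le(2)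
  define K where "K = Cpx -` frontier \<Omega>"
  have "compact (- (Cpx -` \<Omega>))" using \<Omega> inf by (simp add: open_riemann_sphere_iff)
  then obtain R where R: "R > 0" "\<And>w. Cpx w \<notin> \<Omega> \<Longrightarrow> cmod w \<le> R"
    using compact_imp_bounded bounded_pos by (metis ComplI vimage_eq)
  have frO: "frontier \<Omega> \<inter> \<Omega> = {}" using \<Omega> by (auto simp: frontier_def interior_open)
  have Kout: "Cpx w \<notin> \<Omega>" if "w \<in> K" for w using that frO by (auto simp: K_def)
  have "closed (Cpx -` frontier \<Omega>)"
    using continuous_closed_vimage[of "frontier \<Omega>" Cpx] continuous_Cpx[of UNIV]
    by (simp add: continuous_on_eq_continuous_at)
  then have closedK: "closed K" by (simp add: K_def)
  have in_ball: "cmod (of_real (rseq n) * cis t) < 1" for n t using rseq[of n] by (simp add: norm_mult)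
  define Hs where "Hs t = lim (\<lambda>n. H (of_real (rseq n) * cis t))" for t
  define Bs where "Bs t = lim (\<lambda>n. B (of_real (rseq n) * cis t))" for t
  define W where "W t = Hs t / Bs t" for t
  have [measurable]: "Hs \<in> borel_measurable borel" "Bs \<in> borel_measurable borel"
    unfolding Hs_def[abs_def] Bs_def[abs_def]
    by (intro borel_measurable_lim_metric borel_measurable_cont continuous_on_rseq H B)+
  have [measurable]: "W \<in> borel_measurable borel" unfolding W_def[abs_def] by measurable
  define C where "C = max 1 (C0 + R)"
  define Q where "Q w z = H z - w * B z" for w z
  have Q: "Q w holomorphic_on ball 0 1" "\<And>z. cmod z < 1 \<Longrightarrow> Q w z \<noteq> 0" "\<And>z. cmod z < 1 \<Longrightarrow> cmod (Q w z) \<le> C"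
    if w: "Cpx w \<notin> \<Omega>" for w
  proof -
    show "Q w holomorphic_on ball 0 1" unfolding Q_def[abs_def] by (intro holomorphic_intros H B)
    fix z assume z: "cmod z < 1"
    show "Q w z \<noteq> 0"
    proof (cases "p z = Infty")
      case True
      then show ?thesis using pI[OF z] by (simp add: Q_def)
    next
      case False
      then have "B z \<noteq> 0" "p z = Cpx (H z / B z)" using pF[OF z] by auto
      then show ?thesis using pOm[OF z] w by (auto simp: Q_def)
    qed
    have "cmod (w * B z) \<le> R * 1" unfolding norm_mult using B(2)[OF z] R(2)[OF w] R(1) by (intro mult_mono) auto
    then show "cmod (Q w z) \<le> C" unfolding Q_def C_def using norm_triangle_ineq4[of "H z" "w * B z"] H(2)[OF z] by linarith
  qed
  \<comment> \<open>Where \<open>B\<close> has limit 0, \<open>H\<close> would have too, and with it the function \<open>H - w0 B\<close>.\<close>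
  have lims: "AE t in circ. (\<lambda>n. H (of_real (rseq n) * cis t)) \<longlonglongrightarrow> Hs t \<and> (\<lambda>n. B (of_real (rseq n) * cis t)) \<longlonglongrightarrow> Bs t
      \<and> Bs t \<noteq> 0 \<and> W t \<in> K"
  proof -
    have "AE t in circ. \<exists>l. ((\<lambda>r. H (of_real r * cis t)) \<longlongrightarrow> l) (at_left (1::real))"
      by (rule Fatou_radial_limit[OF H])
    moreover have "AE t in circ. \<exists>l. ((\<lambda>r. B (of_real r * cis t)) \<longlongrightarrow> l) (at_left (1::real))"
      by (rule Fatou_radial_limit[OF B])
    moreover have "AE t in circ. \<not> ((\<lambda>r. Q w0 (of_real r * cis t)) \<longlongrightarrow> 0) (at_left (1::real))"
      by (rule radial_limit_nonzero[OF Q[OF w0]])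
    ultimately show ?thesis using AElim
    proof eventually_elim
      case (elim t)
      then obtain h \<beta> where h: "((\<lambda>r. H (of_real r * cis t)) \<longlongrightarrow> h) (at_left (1::real))"
        and \<beta>: "((\<lambda>r. B (of_real r * cis t)) \<longlongrightarrow> \<beta>) (at_left (1::real))" by blast
      have h': "(\<lambda>n. H (of_real (rseq n) * cis t)) \<longlonglongrightarrow> h" by (rule rseq_lim[OF h])
      have \<beta>': "(\<lambda>n. B (of_real (rseq n) * cis t)) \<longlonglongrightarrow> \<beta>" by (rule rseq_lim[OF \<beta>])
      have Hs: "Hs t = h" and Bs: "Bs t = \<beta>" unfolding Hs_def Bs_def using h' \<beta>' by (auto intro: limI)
      obtain l where l: "((\<lambda>r. p (of_real r * cis t)) \<longlongrightarrow> l) (at_left (1::real))"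
        using elim by (auto simp: has_radial_limit_def)
      have lO: "l \<notin> \<Omega>" by (rule radial_limit_not_in_base[OF cov \<Omega> _ l]) simp
      have seq: "(\<lambda>n. p (of_real (rseq n) * cis t)) \<longlonglongrightarrow> l" by (rule rseq_lim[OF l])
      have "l \<in> closure \<Omega>"
        by (rule tendsto_in_closure[OF seq]) (rule pOm[OF in_ball])
      then have lfr: "l \<in> frontier \<Omega>" using lO \<Omega> by (simp add: frontier_def interior_open)
      then have "l \<noteq> Infty" using lO inf by auto
      then obtain w where w: "l = Cpx w" by (cases l) auto
      have ev: "\<forall>\<^sub>F n in sequentially. p (of_real (rseq n) * cis t) \<in> range Cpx"
        using seq by (rule topological_tendstoD) (auto simp: w open_Cpx_image)
      have "((\<lambda>n. chart0 (p (of_real (rseq n) * cis t))) \<longlongrightarrow> chart0 l) sequentially"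
        using continuous_on_tendsto_compose[OF continuous_chart0 seq] ev w by auto
      moreover have "\<forall>\<^sub>F n in sequentially. chart0 (p (of_real (rseq n) * cis t)) * B (of_real (rseq n) * cis t) = H (of_real (rseq n) * cis t)"
        using ev
      proof eventually_elim
        case (elim n)
        then have "p (of_real (rseq n) * cis t) \<noteq> Infty" by auto
        then show ?case using pF[OF in_ball[of n t]] by simp
      qed
      ultimately have "(\<lambda>n. H (of_real (rseq n) * cis t)) \<longlonglongrightarrow> chart0 l * \<beta>"
        by (intro Lim_transform_eventually[OF tendsto_mult[OF _ \<beta>']]) auto
      then have hw: "h = w * \<beta>" using h' LIMSEQ_unique w by force
      have "\<beta> \<noteq> 0"
      proof
        assume "\<beta> = 0"
        then have "((\<lambda>r. Q w0 (of_real r * cis t)) \<longlongrightarrow> 0 - w0 * 0) (at_left (1::real))"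
          unfolding Q_def using h \<beta> hw by (intro tendsto_intros) auto
        then show False using elim by simp
      qed
      then have "W t = w" using hw by (simp add: W_def Hs Bs)
      then show ?case using h' \<beta>' \<open>\<beta> \<noteq> 0\<close> lfr w by (simp add: Hs Bs K_def)
    qed
  qed
  define \<mu> where "\<mu> = distr circ borel W"
  have sets\<mu>: "sets \<mu> = sets borel" by (simp add: \<mu>_def)
  interpret \<mu>: prob_space \<mu>
    unfolding \<mu>_def by (rule prob_space.prob_space_distr[OF prob_space_circ]) simp
  have AEK: "AE w in \<mu>. w \<in> K"
    unfolding \<mu>_def using closedK lims by (subst AE_distr_iff) (auto elim: eventually_mono)
  have \<mu>K: "emeasure \<mu> K = 1"
    using \<mu>.emeasure_eq_1_AE[of K] AEK closedK sets\<mu> by auto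
  have pot: "(\<integral>\<^sup>+ w. e2ennreal (log_kernel z w) \<partial>\<mu>) \<le> ennreal (ln (C / cmod (H 0)))" if z: "z \<in> K" for z
  proof -
    have zO: "Cpx z \<notin> \<Omega>" by (rule Kout[OF z])
    have meas: "(\<lambda>w. e2ennreal (log_kernel z w)) \<in> borel_measurable borel"
      unfolding log_kernel_def by measurable
    have "(\<integral>\<^sup>+ w. e2ennreal (log_kernel z w) \<partial>\<mu>) = (\<integral>\<^sup>+ t. e2ennreal (log_kernel z (W t)) \<partial>circ)"
      unfolding \<mu>_def using meas by (subst nn_integral_distr) auto
    also have "\<dots> \<le> (\<integral>\<^sup>+ t. liminf (\<lambda>n. ennreal (ln (C / cmod (Q z (of_real (rseq n) * cis t))))) \<partial>circ)"
    proof (rule nn_integral_mono_AE)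
      show "AE t in circ. e2ennreal (log_kernel z (W t)) \<le> liminf (\<lambda>n. ennreal (ln (C / cmod (Q z (of_real (rseq n) * cis t)))))"
        using lims
      proof eventually_elim
        case (elim t)
        then have hl: "(\<lambda>n. H (of_real (rseq n) * cis t)) \<longlonglongrightarrow> Hs t" and bl: "(\<lambda>n. B (of_real (rseq n) * cis t)) \<longlonglongrightarrow> Bs t" and b0: "Bs t \<noteq> 0"
          by auto
        have Ql: "(\<lambda>n. Q z (of_real (rseq n) * cis t)) \<longlonglongrightarrow> Hs t - z * Bs t"
          unfolding Q_def by (intro tendsto_intros hl bl)
        show ?case
        proof (cases "W t = z")
          case True
          then have "Hs t - z * Bs t = 0" using b0 by (simp add: W_def field_simps)
          then have "(\<lambda>n. Q z (of_real (rseq n) * cis t)) \<longlonglongrightarrow> 0" using Ql by simp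
          moreover have "C > 0" by (simp add: C_def)
          ultimately have "liminf (\<lambda>n. ennreal (ln (C / cmod (Q z (of_real (rseq n) * cis t))))) = \<infinity>"
            using liminf_log_top[of "\<lambda>n. Q z (of_real (rseq n) * cis t)" C] Q(2)[OF zO in_ball] by blast
          then show ?thesis by simp
        next
          case False
          have QW: "Hs t - z * Bs t = Bs t * (W t - z)" using b0 by (simp add: W_def field_simps)
          have Qn0: "Hs t - z * Bs t \<noteq> 0" using QW b0 False by simp
          have "(\<lambda>n. ennreal (ln (C / cmod (Q z (of_real (rseq n) * cis t))))) \<longlonglongrightarrow> ennreal (ln (C / cmod (Hs t - z * Bs t)))"
            using Qn0 by (intro tendsto_ennrealI tendsto_intros Ql) (auto simp: C_def)
          then have "liminf (\<lambda>n. ennreal (ln (C / cmod (Q z (of_real (rseq n) * cis t))))) = ennreal (ln (C / cmod (Hs t - z * Bs t)))"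
            by (intro lim_imp_Liminf) auto
          moreover have "ln (1 / cmod (z - W t)) \<le> ln (C / cmod (Hs t - z * Bs t))"
          proof -
            have "cmod (Bs t) \<le> 1"
              by (rule LIMSEQ_le_const2[OF tendsto_norm[OF bl]]) (use B(2)[OF in_ball] in auto)
            then have "cmod (Hs t - z * Bs t) \<le> 1 * cmod (W t - z)"
              unfolding QW norm_mult by (intro mult_right_mono) auto
            then have "1 / cmod (z - W t) \<le> C / cmod (Hs t - z * Bs t)"
              using Qn0 by (intro frac_le) (auto simp: C_def norm_minus_commute)
            then show ?thesis using False by (intro ln_mono) auto
          qed
          ultimately show ?thesis
            using False by (simp add: log_kernel_def e2ennreal_ereal ennreal_leI)
        qed
      qed
    qed
    also have "\<dots> \<le> ennreal (ln (C / cmod (Q z 0)))"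
      by (rule log_integral_zero_free[OF Q[OF zO]])
    also have "Q z 0 = H 0" using pI[of 0] p0 by (simp add: Q_def)
    finally show ?thesis .
  qed
  have "(\<integral>\<^sup>+ z. (\<integral>\<^sup>+ w. e2ennreal (log_kernel z w) \<partial>\<mu>) \<partial>\<mu>) \<le> (\<integral>\<^sup>+ z. ennreal (ln (C / cmod (H 0))) \<partial>\<mu>)"
    by (rule nn_integral_mono_AE) (use AEK pot in \<open>auto elim: eventually_mono\<close>)
  also have "\<dots> = ennreal (ln (C / cmod (H 0)))" using \<mu>.emeasure_space_1 by simp
  also have "\<dots> < \<infinity>" by simp
  finally have "log_capacity K > 0"
    by (rule log_capacity_pos[OF \<mu>.prob_space_axioms sets\<mu> \<mu>K])
  then show ?thesis by (simp add: K_def)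
qed

section \<open>Logarithmic potentials\<close>

lemma log_kernel_measurable [measurable]:
  "(\<lambda>(z, w). e2ennreal (log_kernel z w)) \<in> borel_measurable (borel \<Otimes>\<^sub>M borel)"
  unfolding log_kernel_def case_prod_beta by measurable

lemma log_kernel_le_shift:
  assumes "cmod (z' - w) \<le> 3 * cmod (z - w)" "z \<noteq> w"
  shows "e2ennreal (log_kernel z w) \<le> ennreal (ln 3) + e2ennreal (log_kernel z' w)"
proof (cases "z' = w")
  case True
  then show ?thesis by (simp add: log_kernel_def)
next
  case False
  have "1 / cmod (z - w) \<le> 3 * (1 / cmod (z' - w))"
    using assms False by (simp add: field_simps)
  then have "ln (1 / cmod (z - w)) \<le> ln (3 * (1 / cmod (z' - w)))"
    using assms(2) by (intro ln_mono) auto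
  also have "\<dots> = ln 3 + ln (1 / cmod (z' - w))"
    using False by (intro ln_mult_pos) auto
  finally have "ennreal (ln (1 / cmod (z - w))) \<le> ennreal (ln 3 + max 0 (ln (1 / cmod (z' - w))))"
    by (intro ennreal_leI) linarith
  also have "\<dots> = ennreal (ln 3) + ennreal (max 0 (ln (1 / cmod (z' - w))))"
    by (intro ennreal_plus) auto
  also have "ennreal (max 0 (ln (1 / cmod (z' - w)))) = ennreal (ln (1 / cmod (z' - w)))"
    by (simp add: max_def ennreal_neg)
  finally show ?thesis using False assms(2) by (simp add: log_kernel_def e2ennreal_ereal)
qed

text \<open>If the positive part of the energy were infinite, the difference of the two parts would be
  infinite as well, in the arithmetic of extended reals.\<close>

lemma log_capacity_posD:
  assumes "log_capacity K > 0"
  obtains \<mu> where "prob_space \<mu>" "sets \<mu> = sets borel" "emeasure \<mu> K = 1"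
    "(\<integral>\<^sup>+ z. (\<integral>\<^sup>+ w. e2ennreal (log_kernel z w) \<partial>\<mu>) \<partial>\<mu>) < \<infinity>"
proof -
  have "robin_constant K \<noteq> \<infinity>" using assms by (auto simp: log_capacity_def)
  then have "\<exists>\<mu>. prob_space \<mu> \<and> sets \<mu> = sets borel \<and> emeasure \<mu> K = 1 \<and> log_energy \<mu> \<noteq> \<infinity>"
    by (rule contrapos_np) (auto simp: robin_constant_def top_ereal_def[symmetric] intro!: INF_eqI)
  then obtain \<mu> where \<mu>: "prob_space \<mu>" "sets \<mu> = sets borel" "emeasure \<mu> K = 1" "log_energy \<mu> \<noteq> \<infinity>"
    by blast
  moreover have "(\<integral>\<^sup>+ z. (\<integral>\<^sup>+ w. e2ennreal (log_kernel z w) \<partial>\<mu>) \<partial>\<mu>) < \<infinity>"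
  proof (rule ccontr)
    assume "\<not> ?thesis"
    then have "(\<integral>\<^sup>+ z. (\<integral>\<^sup>+ w. e2ennreal (log_kernel z w) \<partial>\<mu>) \<partial>\<mu>) = \<infinity>" by (metis infinity_ennreal_def top.not_eq_extremum)
    then show False using \<mu>(4) by (simp add: log_energy_def)
  qed
  ultimately show thesis using that by blast
qed

text \<open>A measure of finite energy has a potential that is bounded on a set \<open>K1\<close> of positive
  measure; restrict it to \<open>K1\<close> and normalize. Off \<open>K\<close> the bound grows by at most
  \<open>ln 3\<close>: a nearly closest point \<open>z'\<close> of \<open>K1\<close> has at most three times
  the distance of \<open>z\<close> to every point of \<open>K1\<close>.\<close>

lemma bounded_potential_measure:
  assumes K: "compact K" and pos: "log_capacity K > 0"
  obtains \<nu> C where "prob_space \<nu>" "sets \<nu> = sets borel" "AE w in \<nu>. w \<in> K"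
    "\<And>z. z \<notin> K \<Longrightarrow> (\<integral>\<^sup>+ w. e2ennreal (log_kernel z w) \<partial>\<nu>) \<le> ennreal C"
proof -
  obtain \<mu> where \<mu>: "prob_space \<mu>" "sets \<mu> = sets borel" "emeasure \<mu> K = 1"
    and fin: "(\<integral>\<^sup>+ z. (\<integral>\<^sup>+ w. e2ennreal (log_kernel z w) \<partial>\<mu>) \<partial>\<mu>) < \<infinity>"
    using log_capacity_posD[OF pos] by metis
  interpret \<mu>: prob_space \<mu> by fact
  note [measurable_cong] = \<mu>(2)
  define I where "I z = (\<integral>\<^sup>+ w. e2ennreal (log_kernel z w) \<partial>\<mu>)" for z
  have [measurable]: "I \<in> borel_measurable borel"
    unfolding I_def[abs_def] by (rule \<mu>.borel_measurable_nn_integral) measurable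
  have [measurable]: "K \<in> sets borel" using K by (simp add: borel_compact)
  have "AE z in \<mu>. I z \<noteq> \<infinity>"
    using fin unfolding I_def[symmetric] by (intro nn_integral_PInf_AE) auto
  moreover have "AE z in \<mu>. z \<in> K"
    using \<mu>(3) by (intro \<mu>.AE_prob_1) (simp add: \<mu>.emeasure_eq_measure)
  ultimately have AE1: "AE z in \<mu>. z \<in> K \<and> I z \<noteq> \<infinity>" by eventually_elim simp
  have "\<exists>n::nat. emeasure \<mu> {z \<in> K. I z \<le> of_nat n} \<noteq> 0"
  proof (rule ccontr)
    assume "\<not> ?thesis"
    then have "AE z in \<mu>. z \<notin> {z \<in> K. I z \<le> of_nat n}" for n :: nat
      using \<mu>(2) by (intro AE_not_in) (auto simp: null_sets_def)
    then have "AE z in \<mu>. \<forall>n::nat. z \<notin> {z \<in> K. I z \<le> of_nat n}" by (subst AE_all_countable) blast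
    then have "AE z in \<mu>. False" using AE1
    proof eventually_elim
      case (elim z)
      then obtain n :: nat where "I z < of_nat n" using ennreal_Ex_less_of_nat[of "I z"] by (auto simp: less_top)
      then show ?case using elim by (auto dest: less_imp_le)
    qed
    then show False by simp
  qed
  then obtain n :: nat where n: "emeasure \<mu> {z \<in> K. I z \<le> of_nat n} \<noteq> 0" by blast
  define K1 where "K1 = {z \<in> K. I z \<le> of_nat n}"
  have [measurable]: "K1 \<in> sets borel" unfolding K1_def by measurable
  have mK1: "emeasure \<mu> K1 \<noteq> 0" using n by (simp add: K1_def)
  define m where "m = emeasure \<mu> K1"
  have m: "m \<noteq> 0" "m \<noteq> \<infinity>" using mK1 by (auto simp: m_def)
  define \<nu> where "\<nu> = uniform_measure \<mu> K1"
  have s\<nu>: "sets \<nu> = sets borel" using \<mu>(2) by (simp add: \<nu>_def)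
  interpret \<nu>: prob_space \<nu> unfolding \<nu>_def using mK1 by (intro prob_space_uniform_measure) auto
  have AEK1: "AE w in \<nu>. w \<in> K1"
    unfolding \<nu>_def using m by (intro AE_uniform_measureI) (auto simp: \<mu>(2))
  have I\<nu>: "(\<integral>\<^sup>+ w. e2ennreal (log_kernel z w) \<partial>\<nu>) \<le> of_nat n / m" if "z \<in> K1" for z
  proof -
    have [measurable]: "(\<lambda>w. e2ennreal (log_kernel z w)) \<in> borel_measurable borel"
      unfolding log_kernel_def by measurable
    have "(\<integral>\<^sup>+ w. e2ennreal (log_kernel z w) \<partial>\<nu>) = (\<integral>\<^sup>+ w. e2ennreal (log_kernel z w) * indicator K1 w \<partial>\<mu>) / m"
      unfolding \<nu>_def m_def by (rule nn_integral_uniform_measure) (auto simp: \<mu>(2))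
    also have "\<dots> \<le> I z / m"
      unfolding I_def by (intro divide_right_mono_ennreal nn_integral_mono) (auto simp: indicator_def)
    also have "\<dots> \<le> of_nat n / m" using that by (intro divide_right_mono_ennreal) (simp add: K1_def)
    finally show ?thesis .
  qed
  have cn: "of_nat n / m \<noteq> \<infinity>" using m by (simp add: ennreal_divide_eq_top_iff)
  show thesis
  proof (rule that[of \<nu> "ln 3 + enn2real (of_nat n / m)"])
    show "AE w in \<nu>. w \<in> K" using AEK1 by eventually_elim (simp add: K1_def)
    fix z assume z: "z \<notin> K"
    have K1ne: "K1 \<noteq> {}" using mK1 by auto
    have "infdist z K > 0"
      using z K K1ne by (subst infdist_pos_not_in_closed) (auto simp: K1_def compact_imp_closed)
    also have "infdist z K \<le> infdist z K1" using K1ne by (intro infdist_mono) (auto simp: K1_def)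
    finally have d: "infdist z K1 > 0" .
    obtain z' where z': "z' \<in> K1" "dist z z' < 2 * infdist z K1"
    proof (rule ccontr)
      assume "\<not> thesis"
      then have "\<And>x. x \<in> K1 \<Longrightarrow> 2 * infdist z K1 \<le> dist z x" using that not_less by blast
      then have "2 * infdist z K1 \<le> infdist z K1" using K1ne unfolding infdist_notempty[OF K1ne] by (intro cINF_greatest) auto
      then show False using d by simp
    qed
    have "(\<integral>\<^sup>+ w. e2ennreal (log_kernel z w) \<partial>\<nu>) \<le> (\<integral>\<^sup>+ w. ennreal (ln 3) + e2ennreal (log_kernel z' w) \<partial>\<nu>)"
    proof (rule nn_integral_mono_AE)
      show "AE w in \<nu>. e2ennreal (log_kernel z w) \<le> ennreal (ln 3) + e2ennreal (log_kernel z' w)"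
        using AEK1
      proof eventually_elim
        case (elim w)
        have "infdist z K1 \<le> dist z w" by (rule infdist_le) fact
        moreover have "dist z' w \<le> dist z z' + dist z w" by (rule dist_triangle3)
        ultimately have "cmod (z' - w) \<le> 3 * cmod (z - w)" using z'(2) unfolding dist_norm by linarith
        moreover have "z \<noteq> w" using elim z by (auto simp: K1_def)
        ultimately show ?case by (rule log_kernel_le_shift)
      qed
    qed
    also have "\<dots> = ennreal (ln 3) + (\<integral>\<^sup>+ w. e2ennreal (log_kernel z' w) \<partial>\<nu>)"
    proof -
      have "(\<lambda>w. e2ennreal (log_kernel z' w)) \<in> borel_measurable \<nu>"
        unfolding log_kernel_def measurable_cong_sets[OF s\<nu> refl] by measurable
      then show ?thesis using \<nu>.emeasure_space_1 by (subst nn_integral_add) auto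
    qed
    also have "\<dots> \<le> ennreal (ln 3) + of_nat n / m" using I\<nu>[OF z'(1)] by (intro add_left_mono)
    also have "\<dots> = ennreal (ln 3 + enn2real (of_nat n / m))"
      using cn by (subst ennreal_plus) (auto simp: less_top)
    finally show "(\<integral>\<^sup>+ w. e2ennreal (log_kernel z w) \<partial>\<nu>) \<le> ennreal (ln 3 + enn2real (of_nat n / m))" .
  qed (fact s\<nu> \<nu>.prob_space_axioms)+
qed

text \<open>The negative of the usual logarithmic potential. The indicator makes the integrand bounded for
  every \<open>\<zeta>\<close>, not just almost everywhere, as soon as \<open>w\<close> has positive distance
  to \<open>K\<close>.\<close>

definition log_potential :: "complex measure \<Rightarrow> complex set \<Rightarrow> complex \<Rightarrow> real" where
  "log_potential \<nu> K w = (LINT \<zeta>|\<nu>. indicator K \<zeta> * ln (cmod (w - \<zeta>)))"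

lemma log_bounded_compact:
  assumes "compact S" "compact K" "S \<inter> K = {}"
  obtains M where "\<And>w \<zeta>. w \<in> S \<Longrightarrow> \<bar>indicator K \<zeta> * ln (cmod (w - \<zeta>))\<bar> \<le> M"
proof -
  have "continuous_on (S \<times> K) (\<lambda>x. ln (cmod (fst x - snd x)))"
    using assms(3) by (intro continuous_intros) auto
  then have "bounded ((\<lambda>x. ln (cmod (fst x - snd x))) ` (S \<times> K))"
    by (intro compact_imp_bounded compact_continuous_image compact_Times assms)
  then obtain M where M: "M > 0" "\<forall>y\<in>(\<lambda>x. ln (cmod (fst x - snd x))) ` (S \<times> K). norm y \<le> M"
    using bounded_pos by blast
  show thesis
  proof (rule that[of M])
    fix w \<zeta> assume w: "w \<in> S"
    show "\<bar>indicator K \<zeta> * ln (cmod (w - \<zeta>))\<bar> \<le> M"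
    proof (cases "\<zeta> \<in> K")
      case True
      then have "ln (cmod (w - \<zeta>)) \<in> (\<lambda>x. ln (cmod (fst x - snd x))) ` (S \<times> K)"
        using w by (intro image_eqI[of _ _ "(w, \<zeta>)"]) auto
      then show ?thesis using M(2) True by auto
    qed (use M(1) in auto)
  qed
qed

lemma log_integrand_measurable:
  assumes "compact K" "sets \<nu> = sets borel"
  shows "(\<lambda>\<zeta>. indicator K \<zeta> * ln (cmod (w - \<zeta>))) \<in> borel_measurable \<nu>"
proof -
  have [measurable]: "K \<in> sets borel" using assms(1) by (simp add: borel_compact)
  show ?thesis unfolding measurable_cong_sets[OF assms(2) refl] by measurable
qed

lemma log_integrand_integrable:
  assumes K: "compact K" and \<nu>: "prob_space \<nu>" "sets \<nu> = sets borel" and w: "w \<notin> K"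
  shows "integrable \<nu> (\<lambda>\<zeta>. indicator K \<zeta> * ln (cmod (w - \<zeta>)))"
proof -
  interpret prob_space \<nu> by fact
  obtain M where "\<And>x \<zeta>. x \<in> {w} \<Longrightarrow> \<bar>indicator K \<zeta> * ln (cmod (x - \<zeta>))\<bar> \<le> M"
    using log_bounded_compact[of "{w}" K] K w by auto
  then show ?thesis
    by (intro integrable_const_bound[of _ M] log_integrand_measurable K \<nu>(2)) auto
qed

lemma continuous_on_log_potential:
  assumes K: "compact K" and \<nu>: "prob_space \<nu>" "sets \<nu> = sets borel"
  shows "continuous_on (-K) (log_potential \<nu> K)"
proof -
  interpret prob_space \<nu> by fact
  have oK: "open (-K)" using K by (simp add: compact_imp_closed open_Compl)
  have "continuous (at z) (log_potential \<nu> K)" if z: "z \<in> -K" for z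
  proof -
    obtain e where e: "e > 0" "cball z e \<subseteq> -K" using oK z open_contains_cball by blast
    obtain M where M: "\<And>w \<zeta>. w \<in> cball z e \<Longrightarrow> \<bar>indicator K \<zeta> * ln (cmod (w - \<zeta>))\<bar> \<le> M"
    proof -
      have "cball z e \<inter> K = {}" using e(2) by blast
      then show ?thesis using log_bounded_compact[OF compact_cball K] that by blast
    qed
    have "continuous_on (cball z e) (log_potential \<nu> K)"
      unfolding continuous_on_sequentially
    proof (intro allI ballI impI)
      fix x a assume xa: "a \<in> cball z e" "(\<forall>n. x n \<in> cball z e) \<and> x \<longlonglongrightarrow> a"
      show "(log_potential \<nu> K \<circ> x) \<longlonglongrightarrow> log_potential \<nu> K a"
        unfolding comp_def log_potential_def
      proof (rule integral_dominated_convergence[where w = "\<lambda>_. M"])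
        show "AE \<zeta> in \<nu>. (\<lambda>n. indicator K \<zeta> * ln (cmod (x n - \<zeta>))) \<longlonglongrightarrow> indicator K \<zeta> * ln (cmod (a - \<zeta>))"
        proof (rule AE_I2)
          fix \<zeta>
          have "\<zeta> \<in> K \<Longrightarrow> a \<noteq> \<zeta>" using xa(1) e(2) by auto
          then show "(\<lambda>n. indicator K \<zeta> * ln (cmod (x n - \<zeta>))) \<longlonglongrightarrow> indicator K \<zeta> * ln (cmod (a - \<zeta>))"
            using xa(2) by (cases "\<zeta> \<in> K") (auto intro!: tendsto_intros)
        qed
      qed (use M xa in \<open>auto intro!: log_integrand_measurable K \<nu>(2)\<close>)
    qed
    then show ?thesis by (rule continuous_on_interior) (use e(1) in \<open>simp add: interior_cball\<close>)
  qed
  then show ?thesis by (simp add: continuous_on_eq_continuous_at[OF oK])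
qed

text \<open>Fubini and the mean value property of \<open>ln |X - \<zeta>|\<close>.\<close>

lemma harm_on_log_potential:
  assumes K: "compact K" and \<nu>: "prob_space \<nu>" "sets \<nu> = sets borel"
    and X: "X holomorphic_on U" "open U" "\<And>z. z \<in> U \<Longrightarrow> X z \<notin> K"
  shows "harm_on U (\<lambda>z. log_potential \<nu> K (X z))"
  unfolding harm_on_def
proof (intro conjI ballI)
  interpret prob_space \<nu> by fact
  interpret pair_sigma_finite circ \<nu> ..
  have [measurable]: "K \<in> sets borel" using K by (simp add: borel_compact)
  note [measurable_cong] = \<nu>(2)
  have contX: "continuous_on U X" by (rule holomorphic_on_imp_continuous_on[OF X(1)])
  show "continuous_on U (\<lambda>z. log_potential \<nu> K (X z))"
    by (rule continuous_on_compose2[OF continuous_on_log_potential[OF K \<nu>] contX]) (use X(3) in auto)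
  fix z assume "z \<in> U"
  then obtain e where e: "e > 0" "cball z e \<subseteq> U" using X(2) open_contains_cball by blast
  show "\<exists>e>0. \<forall>s. 0 < s \<and> s < e \<longrightarrow> cball z s \<subseteq> U \<and>
      (LINT t|circ. log_potential \<nu> K (X (z + of_real s * cis t))) = log_potential \<nu> K (X z)"
  proof (intro exI[of _ e] conjI allI impI)
    fix s assume s: "0 < s \<and> s < e"
    show "cball z s \<subseteq> U" using s e(2) by (meson less_imp_le order_trans subset_cball)
    have inb: "z + of_real s * cis t \<in> cball z e" for t using s by (simp add: dist_norm norm_mult)
    have inU: "z + of_real s * cis t \<in> U" for t using inb e(2) by blast
    have comp: "compact (X ` cball z e)"
      by (intro compact_continuous_image continuous_on_subset[OF contX e(2)]) auto
    have "X ` cball z e \<inter> K = {}" using X(3) e(2) by blast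
    then obtain M where M: "\<And>w \<zeta>. w \<in> X ` cball z e \<Longrightarrow> \<bar>indicator K \<zeta> * ln (cmod (w - \<zeta>))\<bar> \<le> M"
      using log_bounded_compact[OF comp K] by blast
    have "continuous_on UNIV (\<lambda>t. X (z + of_real s * cis t))"
      by (rule continuous_on_compose2[OF contX]) (intro continuous_intros, use inU in blast)
    then have [measurable]: "(\<lambda>t. X (z + of_real s * cis t)) \<in> borel_measurable borel"
      by (rule borel_measurable_cont)
    have "integrable (circ \<Otimes>\<^sub>M \<nu>) (\<lambda>(t, \<zeta>). indicator K \<zeta> * ln (cmod (X (z + of_real s * cis t) - \<zeta>)))"
    proof -
      interpret pp: pair_prob_space circ \<nu> ..
      show ?thesis
      proof (rule pp.P.integrable_const_bound[of _ M])
        show "AE x in circ \<Otimes>\<^sub>M \<nu>. norm (case x of (t, \<zeta>) \<Rightarrow> indicator K \<zeta> * ln (cmod (X (z + of_real s * cis t) - \<zeta>))) \<le> M"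
          using M inb by (intro AE_I2) (auto split: prod.split)
      qed measurable
    qed
    then have "(LINT t|circ. LINT \<zeta>|\<nu>. indicator K \<zeta> * ln (cmod (X (z + of_real s * cis t) - \<zeta>)))
        = (LINT \<zeta>|\<nu>. LINT t|circ. indicator K \<zeta> * ln (cmod (X (z + of_real s * cis t) - \<zeta>)))"
      by (rule Fubini_integral[symmetric])
    also have "\<dots> = (LINT \<zeta>|\<nu>. indicator K \<zeta> * ln (cmod (X z - \<zeta>)))"
    proof (rule Bochner_Integration.integral_cong[OF refl])
      fix \<zeta>
      show "(LINT t|circ. indicator K \<zeta> * ln (cmod (X (z + of_real s * cis t) - \<zeta>))) = indicator K \<zeta> * ln (cmod (X z - \<zeta>))"
      proof (cases "\<zeta> \<in> K")
        case True
        have "(LINT t|circ. ln (cmod (X (z + of_real s * cis t) - \<zeta>))) = ln (cmod (X z - \<zeta>))"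
        proof (rule mean_value_ln_norm[of "\<lambda>w. X w - \<zeta>" z e s])
          show "(\<lambda>w. X w - \<zeta>) holomorphic_on ball z e"
            using e(2) ball_subset_cball[of z e] by (intro holomorphic_intros holomorphic_on_subset[OF X(1)]) blast
          show "X w - \<zeta> \<noteq> 0" if "w \<in> ball z e" for w
          proof -
            have "w \<in> U" using that e(2) ball_subset_cball[of z e] by blast
            then show ?thesis using X(3)[of w] True by auto
          qed
        qed (use s in auto)
        then show ?thesis using True by simp
      qed simp
    qed
    finally show "(LINT t|circ. log_potential \<nu> K (X (z + of_real s * cis t))) = log_potential \<nu> K (X z)"
      by (simp add: log_potential_def)
  qed (use e in auto)
qed

lemma log_potential_lower_bound:
  assumes K: "compact K" and \<nu>: "prob_space \<nu>" "sets \<nu> = sets borel" and w: "w \<notin> K"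
    and bd: "(\<integral>\<^sup>+ \<zeta>. e2ennreal (log_kernel w \<zeta>) \<partial>\<nu>) \<le> ennreal C" and C: "C \<ge> 0"
  shows "- C \<le> log_potential \<nu> K w"
proof -
  interpret prob_space \<nu> by fact
  let ?f = "\<lambda>\<zeta>. indicator K \<zeta> * ln (cmod (w - \<zeta>))"
  have int: "integrable \<nu> ?f" by (rule log_integrand_integrable[OF K \<nu> w])
  have "ennreal (LINT \<zeta>|\<nu>. max 0 (- ?f \<zeta>)) = (\<integral>\<^sup>+ \<zeta>. ennreal (max 0 (- ?f \<zeta>)) \<partial>\<nu>)"
    using int by (intro nn_integral_eq_integral[symmetric]) auto
  also have "\<dots> \<le> (\<integral>\<^sup>+ \<zeta>. e2ennreal (log_kernel w \<zeta>) \<partial>\<nu>)"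
  proof (intro nn_integral_mono)
    fix \<zeta>
    show "ennreal (max 0 (- ?f \<zeta>)) \<le> e2ennreal (log_kernel w \<zeta>)"
    proof (cases "\<zeta> \<in> K")
      case True
      then have "w \<noteq> \<zeta>" using w by auto
      then show ?thesis using True by (simp add: log_kernel_def e2ennreal_ereal ln_div max_def ennreal_neg)
    qed simp
  qed
  also note bd
  finally have "(LINT \<zeta>|\<nu>. max 0 (- ?f \<zeta>)) \<le> C" using C by simp
  moreover have "(LINT \<zeta>|\<nu>. - ?f \<zeta>) \<le> (LINT \<zeta>|\<nu>. max 0 (- ?f \<zeta>))"
    using int by (intro integral_mono) auto
  ultimately show ?thesis using int by (simp add: log_potential_def)
qed

lemma log_potential_growth:
  assumes K: "compact K" and \<nu>: "prob_space \<nu>" "sets \<nu> = sets borel" and AEK: "AE \<zeta> in \<nu>. \<zeta> \<in> K"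
    and R: "\<And>\<zeta>. \<zeta> \<in> K \<Longrightarrow> cmod \<zeta> \<le> R" "R > 0" and w: "cmod w \<ge> 2 * R"
  shows "ln (cmod w) - ln 2 \<le> log_potential \<nu> K w"
proof -
  interpret prob_space \<nu> by fact
  have wK: "w \<notin> K" using R w by force
  have "(LINT \<zeta>|\<nu>. ln (cmod w) - ln 2) \<le> (LINT \<zeta>|\<nu>. indicator K \<zeta> * ln (cmod (w - \<zeta>)))"
  proof (rule integral_mono_AE)
    show "AE \<zeta> in \<nu>. ln (cmod w) - ln 2 \<le> indicator K \<zeta> * ln (cmod (w - \<zeta>))"
      using AEK
    proof eventually_elim
      case (elim \<zeta>)
      have "cmod w / 2 \<le> cmod (w - \<zeta>)"
        using norm_triangle_ineq2[of w \<zeta>] R(1)[OF elim] w by linarith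
      moreover have "cmod w > 0" using w R(2) by linarith
      ultimately have "ln (cmod w / 2) \<le> ln (cmod (w - \<zeta>))" by (intro ln_mono) auto
      then show ?case using elim \<open>cmod w > 0\<close> by (simp add: ln_div)
    qed
  qed (use log_integrand_integrable[OF K \<nu> wK] in auto)
  then show ?thesis by (simp add: log_potential_def prob_space)
qed

section \<open>From capacity to the Blaschke condition\<close>

lemma compact_in_unit_ball:
  assumes "compact (S :: complex set)" "S \<subseteq> ball 0 1"
  obtains r where "r < 1" "S \<subseteq> cball 0 r"
proof (cases "S = {}")
  case False
  then obtain x where x: "x \<in> S" "\<And>y. y \<in> S \<Longrightarrow> cmod y \<le> cmod x"
    using continuous_attains_sup[OF assms(1), of cmod] by (auto intro: continuous_intros)
  show thesis by (rule that[of "cmod x"]) (use x assms(2) in auto)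
qed (use that[of 0] in auto)

text \<open>From \<open>- ln x \<ge> 1 - x \<ge> (1 - x\<^sup>2) / 2\<close> and the formula for
  \<open>1 - d(z, b)\<^sup>2\<close>.\<close>

lemma one_minus_le_green:
  assumes "cmod b < 1" "cmod z < 1" "z \<noteq> b"
  shows "1 - cmod b \<le> 8 / (1 - (cmod z)\<^sup>2) * (- ln (phd z b))"
proof -
  have z2: "0 < 1 - (cmod z)\<^sup>2" using assms(2) by (simp add: power_less_one_iff abs_square_less_1)
  have ph: "0 < phd z b" "phd z b < 1" using phd_pos[OF assms] phd_lt_1[OF assms(1,2)] by auto
  have "cmod (1 - cnj b * z) \<le> 1 + cmod (cnj b * z)" using norm_triangle_ineq4[of 1 "cnj b * z"] by simp
  also have "\<dots> \<le> 2" using assms mult_le_one[of "cmod b" "cmod z"] by (simp add: norm_mult)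
  finally have "(cmod (1 - cnj b * z))\<^sup>2 \<le> 2\<^sup>2" by (intro power_mono) auto
  then have den: "(cmod (1 - cnj b * z))\<^sup>2 \<le> 4" by simp
  have dpos: "0 < (cmod (1 - cnj b * z))\<^sup>2" using moebius_denom[of b z] assms by auto
  have "1 - cmod b \<le> 1 - (cmod b)\<^sup>2"
    using assms(1) mult_left_mono[of "cmod b" 1 "cmod b"] by (simp add: power2_eq_square)
  then have "(1 - (cmod z)\<^sup>2) * (1 - cmod b) / 4 \<le> (1 - (cmod z)\<^sup>2) * (1 - (cmod b)\<^sup>2) / (cmod (1 - cnj b * z))\<^sup>2"
    using z2 den dpos assms(1) by (intro frac_le mult_left_mono mult_nonneg_nonneg) auto
  also have "\<dots> = 1 - (phd z b)\<^sup>2" using one_minus_phd_sq[of b z] assms by simp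
  also have "\<dots> = (1 - phd z b) * (1 + phd z b)" by (simp add: power2_eq_square algebra_simps)
  also have "\<dots> \<le> (1 - phd z b) * 2" using ph by (intro mult_left_mono) auto
  also have "1 - phd z b \<le> - ln (phd z b)" using ln_le_minus_one[OF ph(1)] by simp
  finally have "(1 - (cmod z)\<^sup>2) * (1 - cmod b) \<le> 8 * (- ln (phd z b))" by simp
  then show ?thesis using z2 by (simp add: field_simps)
qed

lemma Green_sum_small_near_circle:
  assumes F: "finite F" "\<And>b. b \<in> F \<Longrightarrow> cmod b < 1" and \<eta>: "\<eta> > 0"
  obtains r where "r < 1" "\<And>z. r < cmod z \<Longrightarrow> cmod z < 1 \<Longrightarrow> (\<Sum>b\<in>F. - ln (phd z b)) \<le> \<eta>"
proof -
  define \<delta> where "\<delta> = exp (- (\<eta> / (card F + 1)))"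
  have \<delta>: "0 < \<delta>" "\<delta> < 1" using \<eta> by (auto simp: \<delta>_def)
  define S where "S = (\<Union>b\<in>F. {z \<in> cball 0 1. phd z b \<le> \<delta>})"
  have "compact {z \<in> cball 0 1. phd z b \<le> \<delta>}" if "b \<in> F" for b
  proof -
    have "{z \<in> cball 0 1. phd z b \<le> \<delta>} = cball 0 1 \<inter> (\<lambda>z. phd z b) -` {..\<delta>}" by auto
    moreover have "closed (cball 0 1 \<inter> (\<lambda>z. phd z b) -` {..\<delta>})"
      by (rule continuous_closed_preimage[OF continuous_on_phd[OF F(2)[OF that]]]) auto
    ultimately show ?thesis by (simp add: compact_eq_bounded_closed bounded_Int)
  qed
  then have "compact S" unfolding S_def using F(1) by (intro compact_UN) auto
  moreover have "S \<subseteq> ball 0 1"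
  proof
    fix z assume "z \<in> S"
    then obtain b where b: "b \<in> F" "cmod z \<le> 1" "phd z b \<le> \<delta>" by (auto simp: S_def)
    have "cmod z \<noteq> 1" using phd_boundary[OF F(2)[OF b(1)]] b(3) \<delta>(2) by force
    then show "z \<in> ball 0 1" using b(2) by simp
  qed
  ultimately obtain r where r: "r < 1" "S \<subseteq> cball 0 r" using compact_in_unit_ball by blast
  show thesis
  proof (rule that[OF r(1)])
    fix z assume z: "r < cmod z" "cmod z < 1"
    have zS: "z \<notin> S" using r(2) z(1) by auto
    have "- ln (phd z b) \<le> \<eta> / (card F + 1)" if b: "b \<in> F" for b
    proof -
      have "\<delta> < phd z b" using zS b z(2) by (auto simp: S_def not_le)
      then have "ln \<delta> < ln (phd z b)" using \<delta>(1) by simp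
      then show ?thesis by (simp add: \<delta>_def)
    qed
    then have "(\<Sum>b\<in>F. - ln (phd z b)) \<le> (\<Sum>b\<in>F. \<eta> / (card F + 1))" by (rule sum_mono)
    also have "\<dots> \<le> \<eta>" using \<eta> by (simp add: field_simps)
    finally show "(\<Sum>b\<in>F. - ln (phd z b)) \<le> \<eta>" .
  qed
qed

lemma Green_sum_near_point:
  assumes F: "finite F" "\<And>b. b \<in> F \<Longrightarrow> cmod b < 1" and b: "cmod b < 1"
  obtains D where "\<forall>\<^sub>F z in at b. (\<Sum>b'\<in>F. - ln (phd z b')) \<le> D - ln (cmod (z - b))"
proof -
  define D where "D = (\<Sum>b'\<in>F-{b}. - ln (phd b b')) + 1"
  have "((\<lambda>z. \<Sum>b'\<in>F-{b}. - ln (phd z b')) \<longlongrightarrow> (\<Sum>b'\<in>F-{b}. - ln (phd b b'))) (at b)"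
  proof (intro tendsto_sum tendsto_minus tendsto_ln)
    fix b' assume b': "b' \<in> F - {b}"
    have "continuous_on (ball 0 1) (\<lambda>z. phd z b')"
      by (rule continuous_on_subset[OF continuous_on_phd]) (use F b' in auto)
    then have "isCont (\<lambda>z. phd z b') b" using b by (auto simp: continuous_on_eq_continuous_at)
    then show "((\<lambda>z. phd z b') \<longlongrightarrow> phd b b') (at b)" by (rule isContD)
    show "phd b b' \<noteq> 0" using phd_pos[of b' b] F b' b by force
  qed
  then have "\<forall>\<^sub>F z in at b. (\<Sum>b'\<in>F-{b}. - ln (phd z b')) < D"
    by (rule order_tendstoD) (simp add: D_def)
  moreover have "\<forall>\<^sub>F z in at b. z \<in> ball 0 1 - {b}" by (rule eventually_at_in_open) (use b in auto)
  ultimately have "\<forall>\<^sub>F z in at b. (\<Sum>b'\<in>F. - ln (phd z b')) \<le> D + ln 2 - ln (cmod (z - b))"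
  proof eventually_elim
    case (elim z)
    have z: "cmod z < 1" "z \<noteq> b" using elim by auto
    have zb: "cmod (z - b) > 0" using z by simp
    have *: "ln (cmod (z - b)) \<le> ln 2 + ln (phd z b)" if "b \<in> F"
    proof -
      have "cmod (1 - cnj b * z) \<le> 1 + cmod (cnj b * z)" using norm_triangle_ineq4[of 1 "cnj b * z"] by simp
      also have "\<dots> \<le> 2" using b z mult_le_one[of "cmod b" "cmod z"] by (simp add: norm_mult)
      finally have "ln (cmod (1 - cnj b * z)) \<le> ln 2" using moebius_denom[of b z] b z by (intro ln_mono) auto
      moreover have "ln (phd z b) = ln (cmod (z - b)) - ln (cmod (1 - cnj b * z))"
        using moebius_denom[of b z] b z by (simp add: phd_eq ln_div)
      ultimately show ?thesis by simp
    qed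
    have **: "ln (cmod (z - b)) \<le> ln 2"
      using norm_triangle_ineq4[of z b] b z zb by (intro ln_mono) auto
    show ?case
    proof (cases "b \<in> F")
      case True
      then have "(\<Sum>b'\<in>F. - ln (phd z b')) = - ln (phd z b) + (\<Sum>b'\<in>F-{b}. - ln (phd z b'))"
        using F(1) by (rule sum.remove[rotated])
      then show ?thesis using elim(1) *[OF True] by linarith
    next
      case False
      then have "F - {b} = F" by simp
      then show ?thesis using elim(1) ** by simp
    qed
  qed
  then show thesis by (rule that)
qed

text \<open>Let \<open>h\<close> be the composition of the logarithmic potential with \<open>p\<close>, and
  \<open>G\<close> the Green sum over a finite set of poles. At each pole \<open>-h\<close> tends to
  \<open>-\<infinity>\<close> like \<open>ln |z - b|\<close> while \<open>G\<close> grows at most like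
  \<open>- ln |z - b|\<close>; so for \<open>k < 1\<close> the function \<open>k G - h - C\<close>
  tends to \<open>-\<infinity>\<close> at the poles, and it is at most 0 at the circle. The maximum principle
  gives \<open>k G \<le> h + C\<close>, and \<open>k \<rightarrow> 1\<close> bounds the Green sums at a
  point \<open>z0\<close> independently of the finite set.\<close>

theorem capacity_imp_Blaschke:
  assumes uc: "universal_covering p \<Omega>" and \<Omega>: "open \<Omega>" and inf: "Infty \<in> \<Omega>"
    and cap: "log_capacity (Cpx -` frontier \<Omega>) > 0"
  shows "(\<lambda>b. 1 - cmod b) summable_on {z. cmod z < 1 \<and> p z = Infty}"
proof -
  have cov: "covering_space (ball 0 1) p \<Omega>" and hol: "sphere_holomorphic_on p (ball 0 1)"
    using uc by (auto simp: universal_covering_def)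
  have pOm: "p z \<in> \<Omega>" if "cmod z < 1" for z
    using covering_space_imp_surjective[OF cov] that by auto
  define K where "K = Cpx -` frontier \<Omega>"
  have "closed (Cpx -` frontier \<Omega>)"
    using continuous_closed_vimage[of "frontier \<Omega>" Cpx] continuous_Cpx[of UNIV]
    by (simp add: continuous_on_eq_continuous_at)
  then have closedK: "closed K" by (simp add: K_def)
  have frO: "frontier \<Omega> \<inter> \<Omega> = {}" using \<Omega> by (auto simp: frontier_def interior_open)
  have "compact (- (Cpx -` \<Omega>))" using \<Omega> inf by (simp add: open_riemann_sphere_iff)
  moreover have "K = - (Cpx -` \<Omega>) \<inter> K" using frO by (auto simp: K_def)
  ultimately have K: "compact K" using closedK by (metis compact_Int_closed)
  then obtain R where R: "R > 0" "\<And>\<zeta>. \<zeta> \<in> K \<Longrightarrow> cmod \<zeta> \<le> R"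
    using compact_imp_bounded bounded_pos by metis
  obtain \<nu> C0 where \<nu>: "prob_space \<nu>" "sets \<nu> = sets borel" and AEK: "AE w in \<nu>. w \<in> K"
    and C0: "\<And>z. z \<notin> K \<Longrightarrow> (\<integral>\<^sup>+ w. e2ennreal (log_kernel z w) \<partial>\<nu>) \<le> ennreal C0"
    using bounded_potential_measure[OF K] cap unfolding K_def by blast
  define C where "C = max 0 C0"
  have C: "(\<integral>\<^sup>+ w. e2ennreal (log_kernel z w) \<partial>\<nu>) \<le> ennreal C" if "z \<notin> K" for z
    by (rule order_trans[OF C0[OF that]]) (simp add: C_def ennreal_leI)
  define P where "P = {z. cmod z < 1 \<and> p z = Infty}"
  define X where "X z = chart0 (p z)" for z
  define U where "U = ball 0 1 - P"
  have "open (ball 0 1 \<inter> p -` range Cpx)"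
    by (rule continuous_open_preimage) (use hol in \<open>auto simp: sphere_holomorphic_on_def open_Cpx_image\<close>)
  moreover have "ball 0 1 \<inter> p -` range Cpx = U"
  proof (rule set_eqI)
    fix z show "z \<in> ball 0 1 \<inter> p -` range Cpx \<longleftrightarrow> z \<in> U"
      by (cases "p z") (auto simp: U_def P_def)
  qed
  ultimately have oU: "open U" by simp
  have U1: "U \<subseteq> ball 0 1" by (auto simp: U_def)
  have pX: "p z = Cpx (X z)" if "z \<in> U" for z
    using that by (cases "p z") (auto simp: U_def P_def X_def)
  have XK: "X z \<notin> K" if "z \<in> U" for z
    using pOm[of z] pX[OF that] that frO by (auto simp: U_def K_def)
  have "X analytic_on {z}" if "z \<in> U" for z
  proof -
    have "p z \<noteq> Infty" "z \<in> ball 0 1" using that by (auto simp: U_def P_def)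
    then show ?thesis using hol unfolding X_def sphere_holomorphic_on_def by blast
  qed
  then have "X analytic_on U" by (subst analytic_on_analytic_at) blast
  then have Xhol: "X holomorphic_on U" by (rule analytic_imp_holomorphic)
  define h where "h z = log_potential \<nu> K (X z)" for z
  have harm_h: "harm_on U h"
    unfolding h_def[abs_def] by (rule harm_on_log_potential[OF K \<nu> Xhol oU XK])
  have h_ge: "- C \<le> h z" if "z \<in> U" for z
    unfolding h_def by (rule log_potential_lower_bound[OF K \<nu> XK[OF that] C[OF XK[OF that]]]) (simp add: C_def)
  have near_pole: "\<exists>A. \<forall>\<^sub>F z in at b. z \<in> U \<longrightarrow> - h z \<le> A + ln (cmod (z - b))" if b: "b \<in> P" for b
  proof -
    have b1: "cmod b < 1" "p b = Infty" using b by (auto simp: P_def)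
    define f where "f z = chart1 (p z)" for z
    obtain e where e: "e > 0" "ball b e \<subseteq> ball 0 1" "inj_on p (ball b e)"
        "\<And>z. z \<in> ball b e \<Longrightarrow> p z \<noteq> Cpx 0" "f holomorphic_on ball b e" "deriv f b \<noteq> 0"
      using covering_simple_pole[OF uc b1] unfolding f_def by metis
    define A where "A = cmod (deriv f b) + 1"
    have A: "A > 0" by (simp add: A_def add_nonneg_pos)
    have fb: "f b = 0" using b1 by (simp add: f_def)
    have der: "(f has_field_derivative deriv f b) (at b)"
      using e by (intro holomorphic_derivI[of f "ball b e"]) auto
    then have "((\<lambda>z. f z / (z - b)) \<longlongrightarrow> deriv f b) (at b)"
      using fb by (simp add: has_field_derivative_iff)
    then have "((\<lambda>z. cmod (f z / (z - b))) \<longlongrightarrow> cmod (deriv f b)) (at b)" by (rule tendsto_norm)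
    then have ev1: "\<forall>\<^sub>F z in at b. cmod (f z / (z - b)) < A"
      by (rule order_tendstoD) (simp add: A_def)
    have "isCont f b" using der by (rule DERIV_isCont)
    then have "((\<lambda>z. cmod (f z)) \<longlongrightarrow> cmod (f b)) (at b)" by (intro tendsto_norm isContD)
    then have ev2: "\<forall>\<^sub>F z in at b. cmod (f z) < 1 / (2 * R)"
      by (rule order_tendstoD) (use fb R(1) in simp)
    have "\<forall>\<^sub>F z in at b. z \<in> ball b e - {b}" by (rule eventually_at_in_open) (use e in auto)
    then have "\<forall>\<^sub>F z in at b. z \<in> U \<longrightarrow> - h z \<le> ln 2 + ln A + ln (cmod (z - b))"
      using ev1 ev2
    proof eventually_elim
      case (elim z)
      show ?case
      proof
        assume zU: "z \<in> U"
        have fX: "f z = inverse (X z)" using pX[OF zU] by (simp add: f_def)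
        have le: "cmod (f z) \<le> A * cmod (z - b)" using elim by (simp add: norm_divide field_simps)
        show "- h z \<le> ln 2 + ln A + ln (cmod (z - b))"
        proof -
          have False: "X z \<noteq> 0" using e(4)[of z] pX[OF zU] elim(1) by auto
          then have f0: "cmod (f z) > 0" using fX by simp
          have "cmod (X z) \<ge> 2 * R" 
            using elim(3) False R(1) unfolding fX norm_inverse by (simp add: field_simps)
          then have "ln (cmod (X z)) - ln 2 \<le> h z"
            unfolding h_def by (intro log_potential_growth[OF K \<nu> AEK R(2,1)])
          moreover have "ln (cmod (f z)) = - ln (cmod (X z))" unfolding fX norm_inverse using False by (simp add: ln_inverse)
          moreover have "ln (cmod (f z)) \<le> ln (A * cmod (z - b))" using le f0 by (intro ln_mono) auto
          moreover have "ln (A * cmod (z - b)) = ln A + ln (cmod (z - b))"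
            using A elim(1) by (intro ln_mult_pos) auto
          ultimately show ?thesis by linarith
        qed
      qed
    qed
    then show ?thesis by blast
  qed
  have bound: "(\<Sum>b\<in>F. - ln (phd z0 b)) \<le> h z0 + C" if F: "finite F" "F \<subseteq> P" and z0: "z0 \<in> U" for F z0
  proof (rule field_le_mult_one_interval)
    fix k :: real assume k: "0 < k" "k < 1"
    have F1: "cmod b < 1" if "b \<in> F" for b using that F by (auto simp: P_def)
    define G where "G z = (\<Sum>b\<in>F. - ln (phd z b))" for z
    define v where "v z = (- 1) * h z + (k * G z + (- C))" for z
    have "harm_on U (\<lambda>z. - 1 * ln (phd z b))" if b: "b \<in> F" for b
      unfolding phd_def
    proof (intro harm_on_cmult harm_on_ln_norm oU)
      show "Moebius_function 0 b holomorphic_on U"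
        by (rule holomorphic_on_subset[OF Moebius_function_holomorphic[OF F1[OF b]] U1])
      show "Moebius_function 0 b z \<noteq> 0" if "z \<in> U" for z
      proof -
        have "z \<noteq> b" "cmod z < 1" using that b F by (auto simp: U_def)
        then show ?thesis using phd_pos[OF F1[OF b], of z] by (auto simp: phd_def)
      qed
    qed
    then have "harm_on U (\<lambda>z. \<Sum>b\<in>F. - 1 * ln (phd z b))" by (rule harm_on_sum[OF oU])
    then have "harm_on U G" unfolding G_def[abs_def] by simp
    then have harm_v: "harm_on U v"
      unfolding v_def[abs_def] using harm_h oU by (intro harm_on_add harm_on_cmult harm_on_const)
    have G0: "0 \<le> G z" if "z \<in> U" for z
      unfolding G_def
    proof (rule sum_nonneg)
      fix b assume b: "b \<in> F"
      have "z \<noteq> b" "cmod z < 1" using that b F by (auto simp: U_def)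
      then show "0 \<le> - ln (phd z b)" using phd_pos[OF F1[OF b], of z] phd_lt_1[OF F1[OF b], of z] by simp
    qed
    have pole: "\<exists>\<delta>>0. \<forall>z\<in>ball b \<delta> \<inter> U. v z \<le> 0" if b: "b \<in> P" for b
    proof -
      have b1: "cmod b < 1" using b by (simp add: P_def)
      obtain A where A: "\<forall>\<^sub>F z in at b. z \<in> U \<longrightarrow> - h z \<le> A + ln (cmod (z - b))" using near_pole[OF b] by blast
      obtain D where D: "\<forall>\<^sub>F z in at b. G z \<le> D - ln (cmod (z - b))"
        using Green_sum_near_point[OF F(1) F1 b1] unfolding G_def by blast
      define q where "q = - (A + k * D) / (1 - k)"
      have "\<forall>\<^sub>F z in at b. dist z b < exp q"
        unfolding eventually_at by (intro exI[of _ "exp q"]) auto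
      then have "\<forall>\<^sub>F z in at b. z \<in> U \<longrightarrow> v z \<le> 0"
        using A D
      proof eventually_elim
        case (elim z)
        show ?case
        proof
          assume zU: "z \<in> U"
          then have "cmod (z - b) > 0" using b by (auto simp: U_def)
          then have "ln (cmod (z - b)) \<le> ln (exp q)"
            using elim(1) unfolding dist_norm by (intro ln_mono) auto
          then have "(1 - k) * ln (cmod (z - b)) \<le> (1 - k) * q" using k by (intro mult_left_mono) auto
          also have "\<dots> = - (A + k * D)" using k by (simp add: q_def)
          finally have 1: "ln (cmod (z - b)) - k * ln (cmod (z - b)) \<le> - A - k * D" by (simp add: algebra_simps)
          have "k * G z \<le> k * (D - ln (cmod (z - b)))" using elim(3) k by (intro mult_left_mono) auto
          then have 2: "k * G z \<le> k * D - k * ln (cmod (z - b))" by (simp add: algebra_simps)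
          have 3: "- h z \<le> A + ln (cmod (z - b))" using elim(2) zU by blast
          have "0 \<le> C" by (simp add: C_def)
          then show "v z \<le> 0" unfolding v_def using 1 2 3 by simp
        qed
      qed
      then obtain d where "d > 0" "\<And>z. z \<noteq> b \<Longrightarrow> dist z b < d \<Longrightarrow> z \<in> U \<Longrightarrow> v z \<le> 0"
        unfolding eventually_at by blast
      moreover have "b \<notin> U" using b by (simp add: U_def)
      ultimately show ?thesis by (intro exI[of _ d]) (metis IntD1 IntD2 dist_commute mem_ball)
    qed
    obtain \<delta> where \<delta>: "\<And>b. b \<in> P \<Longrightarrow> \<delta> b > 0" "\<And>b z. b \<in> P \<Longrightarrow> z \<in> ball b (\<delta> b) \<inter> U \<Longrightarrow> v z \<le> 0"
      using pole by metis
    have "v z0 \<le> 0"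
    proof (rule maximum_principle[OF harm_v U1 _ z0])
      fix \<eta> :: real assume \<eta>: "\<eta> > 0"
      obtain r where r: "r < 1" "\<And>z. r < cmod z \<Longrightarrow> cmod z < 1 \<Longrightarrow> G z \<le> \<eta>"
        using Green_sum_small_near_circle[OF F(1) F1 \<eta>] unfolding G_def by blast
      define L where "L = cball 0 r - (\<Union>b\<in>P. ball b (\<delta> b))"
      have "compact L" unfolding L_def by (intro compact_diff) auto
      moreover have "L \<subseteq> U"
      proof
        fix z assume z: "z \<in> L"
        then have "z \<notin> P" using \<delta>(1)[of z] unfolding L_def by force
        then show "z \<in> U" using z r(1) by (auto simp: L_def U_def)
      qed
      moreover have "v z \<le> \<eta>" if z: "z \<in> U - L" for z
      proof (cases "cmod z \<le> r")
        case True
        then obtain b where "b \<in> P" "z \<in> ball b (\<delta> b)" using z by (auto simp: L_def)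
        then have "v z \<le> 0" using \<delta>(2)[of b z] z by blast
        then show ?thesis using \<eta> by simp
      next
        case False
        then have "G z \<le> \<eta>" using z U1 by (intro r(2)) auto
        moreover have "k * G z \<le> 1 * G z" using k G0[of z] z by (intro mult_right_mono) auto
        ultimately show ?thesis unfolding v_def using h_ge[of z] z by simp
      qed
      ultimately show "\<exists>K. compact K \<and> K \<subseteq> U \<and> (\<forall>z\<in>U - K. v z \<le> \<eta>)" by blast
    qed
    then show "k * (\<Sum>b\<in>F. - ln (phd z0 b)) \<le> h z0 + C" by (simp add: v_def G_def)
  qed
  obtain z0 where z0: "z0 \<in> U"
  proof (cases "p 0 = Infty")
    case True
    obtain e where e: "e > 0" "ball 0 e \<subseteq> ball (0::complex) 1" "inj_on p (ball 0 e)"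
      using covering_locally_injective[OF cov, of 0] by auto
    have mem: "complex_of_real (e / 2) \<in> ball 0 e" using e(1) by simp
    have "p (complex_of_real (e / 2)) \<noteq> p 0"
      using inj_onD[OF e(3), of "complex_of_real (e / 2)" 0] mem e(1) by auto
    then have "complex_of_real (e / 2) \<notin> P" using True by (simp add: P_def)
    then show thesis using that mem e(2) unfolding U_def by blast
  qed (use that[of 0] in \<open>simp add: U_def P_def\<close>)
  have z01: "cmod z0 < 1" using z0 U1 by auto
  define c where "c = 8 / (1 - (cmod z0)\<^sup>2)"
  have "0 < 1 - (cmod z0)\<^sup>2" using z01 by (simp add: power_less_one_iff abs_square_less_1)
  then have c: "c \<ge> 0" by (simp add: c_def)
  show ?thesis
    unfolding P_def[symmetric]
  proof (rule nonneg_bdd_above_summable_on)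
    show "0 \<le> 1 - cmod b" if "b \<in> P" for b using that by (simp add: P_def)
    show "bdd_above (sum (\<lambda>b. 1 - cmod b) ` {F. F \<subseteq> P \<and> finite F})"
    proof (rule bdd_aboveI2)
      fix F assume F: "F \<in> {F. F \<subseteq> P \<and> finite F}"
      have "(\<Sum>b\<in>F. 1 - cmod b) \<le> (\<Sum>b\<in>F. c * (- ln (phd z0 b)))"
        unfolding c_def using F z0 z01 by (intro sum_mono one_minus_le_green) (auto simp: P_def U_def)
      also have "\<dots> = c * (\<Sum>b\<in>F. - ln (phd z0 b))" by (simp add: sum_distrib_left)
      also have "\<dots> \<le> c * (h z0 + C)" using F c by (intro mult_left_mono bound z0) auto
      finally show "(\<Sum>b\<in>F. 1 - cmod b) \<le> c * (h z0 + C)" .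
    qed
  qed
qed

text \<open>If infinity is an exterior point of \<open>\<Omega>\<close>, then \<open>p\<close> is a bounded
  function and Fatou's theorem applies directly.\<close>

theorem capacity_imp_radial_limits:
  assumes uc: "universal_covering p \<Omega>" and \<Omega>: "open \<Omega>" and w0: "Cpx w0 \<notin> \<Omega>" and inf: "Infty \<notin> frontier \<Omega>"
    and cap: "log_capacity (Cpx -` frontier \<Omega>) > 0"
  shows "AE t in circ. has_radial_limit p (cis t)"
proof (cases "Infty \<in> \<Omega>")
  case True
  then show ?thesis
    by (intro Blaschke_imp_radial_limits[OF uc \<Omega> w0] capacity_imp_Blaschke[OF uc \<Omega>] cap)
next
  case False
  have cov: "covering_space (ball 0 1) p \<Omega>" and hol: "sphere_holomorphic_on p (ball 0 1)"
    using uc by (auto simp: universal_covering_def)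
  have pOm: "p z \<in> \<Omega>" if "cmod z < 1" for z
    using covering_space_imp_surjective[OF cov] that by auto
  have "Infty \<notin> closure \<Omega>" using inf False \<Omega> by (simp add: frontier_def interior_open)
  moreover have "open (- closure \<Omega>)" by auto
  ultimately have "compact (- (Cpx -` (- closure \<Omega>)))"
    using open_riemann_sphere_iff[of "- closure \<Omega>"] by blast
  then have "bounded (- (Cpx -` (- closure \<Omega>)))" by (rule compact_imp_bounded)
  then obtain M where "\<And>w. w \<in> - (Cpx -` (- closure \<Omega>)) \<Longrightarrow> cmod w \<le> M"
    unfolding bounded_iff by blast
  then have M: "\<And>w. Cpx w \<in> closure \<Omega> \<Longrightarrow> cmod w \<le> M" by simp
  define X where "X z = chart0 (p z)" for z
  have pX: "p z = Cpx (X z)" if "cmod z < 1" for z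
    using pOm[OF that] False by (cases "p z") (auto simp: X_def)
  have "X analytic_on {z}" if "cmod z < 1" for z
  proof -
    have "p z \<noteq> Infty" "z \<in> ball 0 1" using pOm[OF that] that False by auto
    then show ?thesis using hol unfolding X_def sphere_holomorphic_on_def by blast
  qed
  then have "X analytic_on ball 0 1" by (subst analytic_on_analytic_at) auto
  then have Xhol: "X holomorphic_on ball 0 1" by (rule analytic_imp_holomorphic)
  have Xbd: "cmod (X z) \<le> M" if "cmod z < 1" for z
    using M[of "X z"] pOm[OF that] pX[OF that] closure_subset[of \<Omega>] by auto
  have "AE t in circ. \<exists>l. ((\<lambda>r. X (of_real r * cis t)) \<longlongrightarrow> l) (at_left (1::real))"
    by (rule Fatou_radial_limit[OF Xhol Xbd])
  then show ?thesis
  proof eventually_elim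
    case (elim t)
    then obtain l where "((\<lambda>r. X (of_real r * cis t)) \<longlongrightarrow> l) (at_left (1::real))" by blast
    then have lim: "((\<lambda>r. Cpx (X (of_real r * cis t))) \<longlongrightarrow> Cpx l) (at_left (1::real))"
      using continuous_Cpx[of UNIV] by (intro isCont_tendsto_compose[of _ Cpx]) (simp add: continuous_on_eq_continuous_at)
    have "\<forall>\<^sub>F r in at_left (1::real). Cpx (X (of_real r * cis t)) = p (of_real r * cis t)"
      unfolding eventually_at_left_field
      by (intro exI[of _ 0] conjI allI impI pX[symmetric]) (auto simp: norm_mult)
    then have "((\<lambda>r. p (of_real r * cis t)) \<longlongrightarrow> Cpx l) (at_left (1::real))"
      using lim by (rule Lim_transform_eventually[rotated])
    then show ?case unfolding has_radial_limit_def by blast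
  qed
qed

section \<open>The equivalence\<close>

theorem corollaryB:
  fixes \<Omega> :: "riemann_sphere set" and p :: "complex \<Rightarrow> riemann_sphere"
  assumes "hyperbolic_domain \<Omega>" and "universal_covering p \<Omega>"
  shows "(nontangential_limit_set (deck_group p) \<in> null_sets circle_lebesgue
            \<longleftrightarrow> positive_log_capacity (frontier \<Omega>)) \<and>
         (positive_log_capacity (frontier \<Omega>)
            \<longleftrightarrow> (AE \<zeta> in circle_lebesgue. has_radial_limit p \<zeta>))"
proof -
  note uc = assms(2)
  have \<Omega>: "open \<Omega>" and three: "\<exists>a b c. a \<notin> \<Omega> \<and> b \<notin> \<Omega> \<and> c \<notin> \<Omega> \<and> a \<noteq> b \<and> a \<noteq> c \<and> b \<noteq> c"
    using assms(1) by (auto simp: hyperbolic_domain_def)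
  have cov: "covering_space (ball 0 1) p \<Omega>" using uc by (simp add: universal_covering_def)
  \<comment> \<open>Of two omitted points at least one is not moved to infinity.\<close>
  have omitted: "\<exists>w. Cpx w \<notin> send_to_infinity a ` \<Omega>" for a
  proof -
    obtain c where c: "c \<notin> \<Omega>" "c \<noteq> a" using three by metis
    then have "send_to_infinity a c \<noteq> Infty" by simp
    then obtain w where w: "send_to_infinity a c = Cpx w" by (cases "send_to_infinity a c") auto
    have "send_to_infinity a c \<notin> send_to_infinity a ` \<Omega>"
      using c(1) by (simp add: inj_image_mem_iff[OF inj_send])
    then show ?thesis using w by auto
  qed
  have bc: "AE \<zeta> in circle_lebesgue. has_radial_limit p \<zeta>" if pos: "positive_log_capacity (frontier \<Omega>)"
  proof -
    obtain a where a: "a \<notin> frontier \<Omega>" "log_capacity (Cpx -` (send_to_infinity a ` frontier \<Omega>)) > 0"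
      using pos unfolding positive_log_capacity_def by blast
    obtain w where w: "Cpx w \<notin> send_to_infinity a ` \<Omega>" using omitted by blast
    have "Infty \<notin> send_to_infinity a ` frontier \<Omega>"
      using a(1) inj_image_mem_iff[OF inj_send, of a a "frontier \<Omega>"] by simp
    then have "AE t in circ. has_radial_limit (\<lambda>z. send_to_infinity a (p z)) (cis t)"
      using a(2) unfolding frontier_send_image[symmetric]
      by (intro capacity_imp_radial_limits[OF universal_covering_send[OF uc] open_send_image[OF \<Omega>] w])
    then show ?thesis unfolding has_radial_limit_send AE_circle .
  qed
  have ca: "nontangential_limit_set (deck_group p) \<in> null_sets circle_lebesgue"
    if "AE \<zeta> in circle_lebesgue. has_radial_limit p \<zeta>"
  proof -
    have "nontangential_limit_set (deck_group p) \<subseteq> sphere 0 1"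
      by (auto simp: nontangential_limit_set_def)
    moreover have "AE \<zeta> in circle_lebesgue. \<zeta> \<notin> nontangential_limit_set (deck_group p)"
      using that by eventually_elim (use nontangential_no_radial_limit[OF uc \<Omega>] in blast)
    ultimately show ?thesis by (simp only: null_sets_circle)
  qed
  have ab: "positive_log_capacity (frontier \<Omega>)"
    if null: "nontangential_limit_set (deck_group p) \<in> null_sets circle_lebesgue"
  proof -
    obtain c where c: "c \<notin> \<Omega>" using three by blast
    obtain w where w: "Cpx w \<notin> send_to_infinity (p 0) ` \<Omega>" using omitted by blast
    have "p 0 \<in> \<Omega>" using covering_space_imp_surjective[OF cov] by force
    then have fr: "p 0 \<notin> frontier \<Omega>" using \<Omega> by (simp add: frontier_def interior_open)
    have "(\<lambda>b. 1 - cmod b) summable_on {z. cmod z < 1 \<and> send_to_infinity (p 0) (p z) = Infty}"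
      using null_nontangential_imp_Blaschke[OF uc c null] by simp
    then have "log_capacity (Cpx -` frontier (send_to_infinity (p 0) ` \<Omega>)) > 0"
      by (intro Blaschke_imp_capacity[OF universal_covering_send[OF uc] open_send_image[OF \<Omega>] w]) simp_all
    then show ?thesis
      using fr unfolding positive_log_capacity_def frontier_send_image by blast
  qed
  show ?thesis using ab bc ca by blast
qed

end
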